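(* Assume $d\ge2$ is an integer, $\ell>0$, and $1<r<r^*(d,\ell)$ if $\ell<d$, respectively $r^*(d,\ell)<r<r_+(d,\ell)$ if $\ell>d$. Consider the autonomous system $\Delta w'=-\Delta_1$, $\Delta\sigma'=-\Delta_2$ and the points $P_2,P_4,P_6$ defined in the context. Then: (1) (Solutions near the origin) There exists a unique trajectory of the system which connects $P_6$ to $P_2$. It corresponds to the unique (up to scaling) local spherically symmetric solution of the stationary self-similar Euler system which is $\mathcal C^\infty$ on the interval $|Z|\in[0,Z_2)$, with $0$ corresponding to $P_6$ and $Z_2$ to $P_2$. (2) (Solutions near infinity) There exists a one-parameter family of trajectories connecting $P_2$ to $P_4$. These curves correspond to spherically symmetric solutions of the stationary self-similar Euler system which are $\mathcal C^\infty$ on the interval $|Z|\in(Z_2,\infty)$, with $\infty$ corresponding to $P_4$. (3) (Connection at $P_2$) In both cases $P_2$ is reached in finite time, i.e. $0<Z_2<\infty$, and the solutions constructed in (1) and (2) can be glued continuously to each other.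
   Context: $r^*(d,\ell)=\frac{d+\ell}{\ell+\sqrt d}$, $r_+(d,\ell)=1+\frac{d-1}{(1+\sqrt\ell)^2}$, $\gamma=1+2/\ell$, $w_e=\ell(r-1)/d$. The stationary self-similar Euler system is $\ell(r-1)\hat\rho+Z\cdot\nabla\hat\rho+\nabla\cdot(\hat\rho\,\hat u)=0$, $(r-1)\hat u+(Z\cdot\nabla)\hat u+\hat u\cdot\nabla\hat u+\nabla(\hat\rho^{\,\gamma-1})=0$, $Z\in\mathbb R^d$, $\hat\rho>0$. For spherically symmetric $(\hat\rho,\hat u)$ ($\hat\rho$ depending on $|Z|$ only, $\hat u$ radial) the Emden transform $\hat\rho(Z)^{\frac{\gamma-1}{2}}=\sqrt{\ell/2}\,|Z|\sigma(x)$, $\hat u(Z)=-Z\,w(x)$, $|Z|=e^x$, maps it to $\Delta w'=-\Delta_1$, $\Delta\sigma'=-\Delta_2$ ($'=d/dx$) with $\Delta=(w-1)^2-\sigma^2$, $\Delta_1=w(w-1)(w-r)-d(w-w_e)\sigma^2$, $\Delta_2=\frac{\sigma}{\ell}\left[(\ell+d-1)w^2-(\ell+d+\ell r-r)w+\ell r-\ell\sigma^2\right]$. Trajectories are considered in $\sigma>0$. Points are written $(\sigma,w)$: $P_4=(0,0)$ (corresponding to $x\to+\infty$); $P_6$ is the point $\sigma=+\infty$, $w=w_e$ (corresponding to $x\to-\infty$, i.e. $Z=0$); $P_2=(1-w_-,w_-)$ with $w_-=\frac{1}{2(d-1)}\left(d-1+(\ell-1)(r-1)-\sqrt J\right)$,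 $J=(1-\ell)^2(r-1)^2-2(d-1)(\ell+1)(r-1)+(d-1)^2$. Scaling means the invariance $x\mapsto x+x_0$ of the autonomous system. *)

theory Defs
  imports "HOL-Analysis.Analysis"
begin

section \<open>Parameters\<close>

text \<open>The dimension \<open>d\<close> enters the formulas as a real number.\<close>

definition r_star :: "real \<Rightarrow> real \<Rightarrow> real" where
  "r_star d l = (d + l) / (l + sqrt d)"

definition r_plus :: "real \<Rightarrow> real \<Rightarrow> real" where
  "r_plus d l = 1 + (d - 1) / (1 + sqrt l)\<^sup>2"

definition gam :: "real \<Rightarrow> real" where
  "gam l = 1 + 2 / l"

definition w_e :: "real \<Rightarrow> real \<Rightarrow> real \<Rightarrow> real" where
  "w_e d l r = l * (r - 1) / d"

section \<open>The autonomous system\<close>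

definition Delta :: "real \<Rightarrow> real \<Rightarrow> real" where
  "Delta s w = (w - 1)\<^sup>2 - s\<^sup>2"

definition Delta1 :: "real \<Rightarrow> real \<Rightarrow> real \<Rightarrow> real \<Rightarrow> real \<Rightarrow> real" where
  "Delta1 d l r s w = w * (w - 1) * (w - r) - d * (w - w_e d l r) * s\<^sup>2"

definition Delta2 :: "real \<Rightarrow> real \<Rightarrow> real \<Rightarrow> real \<Rightarrow> real \<Rightarrow> real" where
  "Delta2 d l r s w =
     s / l * ((l + d - 1) * w\<^sup>2 - (l + d + l * r - r) * w + l * r - l * s\<^sup>2)"

text \<open>
  A trajectory is a solution on an open, possibly unbounded, interval \<open>(a,b)\<close> along which
  \<open>\<sigma> > 0\<close> and the system is regular, i.e. \<open>\<Delta> \<noteq> 0\<close>. Sonic points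
  such as \<open>P\<^sub>2\<close> are thus only reached as limits at the end points.
\<close>

definition trajectory ::
  "real \<Rightarrow> real \<Rightarrow> real \<Rightarrow> ereal \<Rightarrow> ereal \<Rightarrow> (real \<Rightarrow> real) \<Rightarrow> (real \<Rightarrow> real) \<Rightarrow> bool" where
  "trajectory d l r a b \<sigma> w \<longleftrightarrow> a < b \<and>
     (\<forall>x\<in>einterval a b. \<sigma> x > 0 \<and> Delta (\<sigma> x) (w x) \<noteq> 0 \<and>
        (\<exists>\<sigma>' w'. (\<sigma> has_real_derivative \<sigma>') (at x) \<and> (w has_real_derivative w') (at x) \<and>
           Delta (\<sigma> x) (w x) * w' = - Delta1 d l r (\<sigma> x) (w x) \<and>
           Delta (\<sigma> x) (w x) * \<sigma>' = - Delta2 d l r (\<sigma> x) (w x)))"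

definition J_disc :: "real \<Rightarrow> real \<Rightarrow> real \<Rightarrow> real" where
  "J_disc d l r =
     (1 - l)\<^sup>2 * (r - 1)\<^sup>2 - 2 * (d - 1) * (l + 1) * (r - 1) + (d - 1)\<^sup>2"

definition w_minus :: "real \<Rightarrow> real \<Rightarrow> real \<Rightarrow> real" where
  "w_minus d l r = (d - 1 + (l - 1) * (r - 1) - sqrt (J_disc d l r)) / (2 * (d - 1))"

text \<open>Points of the phase plane are written \<open>(\<sigma>, w)\<close>.\<close>

definition P2 :: "real \<Rightarrow> real \<Rightarrow> real \<Rightarrow> real \<times> real" where
  "P2 d l r = (1 - w_minus d l r, w_minus d l r)"

definition P4 :: "real \<times> real" where
  "P4 = (0, 0)"

text \<open>
  \<open>P\<^sub>6\<close> is reached at \<open>x = -\<infinity>\<close> and \<open>P\<^sub>4\<close> at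
  \<open>x = +\<infinity>\<close>; the end point at \<open>P\<^sub>2\<close> may a priori be infinite.
\<close>

definition connects_P6_P2 ::
  "real \<Rightarrow> real \<Rightarrow> real \<Rightarrow> ereal \<Rightarrow> (real \<Rightarrow> real) \<Rightarrow> (real \<Rightarrow> real) \<Rightarrow> bool" where
  "connects_P6_P2 d l r b \<sigma> w \<longleftrightarrow>
     trajectory d l r (-\<infinity>) b \<sigma> w \<and>
     filterlim \<sigma> at_top at_bot \<and> (w \<longlongrightarrow> w_e d l r) at_bot \<and>
     (((\<lambda>x. (\<sigma> x, w x)) \<circ> real_of_ereal) \<longlongrightarrow> P2 d l r) (at_left b)"

definition connects_P2_P4 ::
  "real \<Rightarrow> real \<Rightarrow> real \<Rightarrow> ereal \<Rightarrow> (real \<Rightarrow> real) \<Rightarrow> (real \<Rightarrow> real) \<Rightarrow> bool" where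
  "connects_P2_P4 d l r a \<sigma> w \<longleftrightarrow>
     trajectory d l r a \<infinity> \<sigma> w \<and>
     (((\<lambda>x. (\<sigma> x, w x)) \<circ> real_of_ereal) \<longlongrightarrow> P2 d l r) (at_right a) \<and>
     ((\<lambda>x. (\<sigma> x, w x)) \<longlongrightarrow> P4) at_top"

section \<open>The stationary self-similar Euler system\<close>

text \<open>
  Continuous differentiability of order \<open>k\<close> and smoothness, intended for open sets:
  all iterated partial derivatives exist and are continuous.
\<close>

primrec Ck_on :: "nat \<Rightarrow> ('a::euclidean_space \<Rightarrow> 'b::real_normed_vector) \<Rightarrow> 'a set \<Rightarrow> bool" where
  "Ck_on 0 f S \<longleftrightarrow> continuous_on S f"
| "Ck_on (Suc k) f S \<longleftrightarrow> (\<forall>x\<in>S. f differentiable (at x)) \<and>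
     (\<forall>b\<in>Basis. Ck_on k (\<lambda>x. frechet_derivative f (at x) b) S)"

definition Cinf_on :: "('a::euclidean_space \<Rightarrow> 'b::real_normed_vector) \<Rightarrow> 'a set \<Rightarrow> bool" where
  "Cinf_on f S \<longleftrightarrow> (\<forall>k. Ck_on k f S)"

definition grad :: "(real^'n \<Rightarrow> real) \<Rightarrow> real^'n \<Rightarrow> real^'n" where
  "grad f Z = (\<chi> i. frechet_derivative f (at Z) (axis i 1))"

definition diverg :: "(real^'n \<Rightarrow> real^'n) \<Rightarrow> real^'n \<Rightarrow> real" where
  "diverg v Z = (\<Sum>i\<in>UNIV. frechet_derivative v (at Z) (axis i 1) $ i)"

text \<open>
  For vector fields \<open>v, u\<close> the value of \<open>(v \<cdot> \<nabla>) u\<close> at \<open>Z\<close> is the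
  derivative of \<open>u\<close> at \<open>Z\<close> applied to \<open>v Z\<close>.
\<close>

definition euler_solution_on ::
  "real \<Rightarrow> real \<Rightarrow> (real^'n) set \<Rightarrow> (real^'n \<Rightarrow> real) \<Rightarrow> (real^'n \<Rightarrow> real^'n) \<Rightarrow> bool" where
  "euler_solution_on l r S \<rho> u \<longleftrightarrow> (\<forall>Z\<in>S. \<rho> Z > 0 \<and>
     l * (r - 1) * \<rho> Z + Z \<bullet> grad \<rho> Z + diverg (\<lambda>Y. \<rho> Y *\<^sub>R u Y) Z = 0 \<and>
     (r - 1) *\<^sub>R u Z + frechet_derivative u (at Z) Z + frechet_derivative u (at Z) (u Z)
       + grad (\<lambda>Y. \<rho> Y powr (gam l - 1)) Z = 0)"

definition spherically_symmetric_on ::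
  "(real^'n) set \<Rightarrow> (real^'n \<Rightarrow> real) \<Rightarrow> (real^'n \<Rightarrow> real^'n) \<Rightarrow> bool" where
  "spherically_symmetric_on S \<rho> u \<longleftrightarrow>
     (\<exists>f g. \<forall>Z\<in>S. \<rho> Z = f (norm Z) \<and> u Z = g (norm Z) *\<^sub>R Z)"

definition smooth_radial_euler_on ::
  "real \<Rightarrow> real \<Rightarrow> (real^'n) set \<Rightarrow> (real^'n \<Rightarrow> real) \<Rightarrow> (real^'n \<Rightarrow> real^'n) \<Rightarrow> bool" where
  "smooth_radial_euler_on l r S \<rho> u \<longleftrightarrow>
     spherically_symmetric_on S \<rho> u \<and> Cinf_on \<rho> S \<and> Cinf_on u S \<and> euler_solution_on l r S \<rho> u"

text \<open>The Emden transform, to be used away from \<open>Z = 0\<close>.\<close>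

definition emden_on ::
  "real \<Rightarrow> (real^'n) set \<Rightarrow> (real^'n \<Rightarrow> real) \<Rightarrow> (real^'n \<Rightarrow> real^'n) \<Rightarrow>
   (real \<Rightarrow> real) \<Rightarrow> (real \<Rightarrow> real) \<Rightarrow> bool" where
  "emden_on l S \<rho> u \<sigma> w \<longleftrightarrow> (\<forall>Z\<in>S.
     \<rho> Z powr ((gam l - 1) / 2) = sqrt (l / 2) * norm Z * \<sigma> (ln (norm Z)) \<and>
     u Z = - (w (ln (norm Z)) *\<^sub>R Z))"

text \<open>
  A smooth spherically symmetric solution on \<open>|Z| < R\<close> whose Emden transform runs from
  \<open>P\<^sub>6\<close> (at \<open>|Z| = 0\<close>) to \<open>P\<^sub>2\<close> (at \<open>|Z| = R\<close>).
\<close>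

definition inner_solution ::
  "real \<Rightarrow> real \<Rightarrow> real \<Rightarrow> (real^'n \<Rightarrow> real) \<Rightarrow> (real^'n \<Rightarrow> real^'n) \<Rightarrow> bool" where
  "inner_solution l r R \<rho> u \<longleftrightarrow> R > 0 \<and> smooth_radial_euler_on l r (ball 0 R) \<rho> u \<and>
     (\<exists>\<sigma> w. connects_P6_P2 (real CARD('n)) l r (ereal (ln R)) \<sigma> w \<and>
            emden_on l (ball 0 R - {0}) \<rho> u \<sigma> w)"

text \<open>
  Under the Emden transform the translation \<open>x \<mapsto> x + ln \<lambda>\<close> acts on
  \<open>(\<rho>, u)\<close> as follows (note \<open>(gam l - 1) / 2 = 1 / l\<close>).
\<close>

definition scale_density :: "real \<Rightarrow> real \<Rightarrow> (real^'n \<Rightarrow> real) \<Rightarrow> real^'n \<Rightarrow> real" where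
  "scale_density l lam \<rho> Z = lam powr (- l) * \<rho> (lam *\<^sub>R Z)"

definition scale_velocity :: "real \<Rightarrow> (real^'n \<Rightarrow> real^'n) \<Rightarrow> real^'n \<Rightarrow> real^'n" where
  "scale_velocity lam u Z = (1 / lam) *\<^sub>R u (lam *\<^sub>R Z)"

end

theory Submission
  imports Defs
begin

text \<open>
  Everything rests on two polynomials. On the sonic line \<open>\<sigma> = 1 - w\<close> the fields are
  \<open>\<Delta>\<^sub>1 = (1-w) Q\<close> and \<open>\<Delta>\<^sub>2 = (1-w) Q / l\<close> with one quadratic \<open>Q\<close>, whose smaller root is \<open>w\<^sub>-\<close>; and
  \<open>\<Delta>\<^sub>2\<close> vanishes where \<open>l \<sigma>\<^sup>2 = N\<close>, \<open>N = Q + l (1-w)\<^sup>2\<close>. Eliminating \<open>\<sigma>\<^sup>2\<close> between the two nullclines gives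
  \<open>l w (w-1) (w-r) - d (w-w\<^sub>e) N = Q (l r - (l+d) w)\<close> (\<open>nullclines_cubic\<close>). The conditions on \<open>r\<close> ensure that
  \<open>w\<^sub>-\<close> lies to the left of the zero \<open>l r / (l+d)\<close> (\<open>wm_lt_third\<close>). Hence to the left of \<open>w\<^sub>-\<close> the two
  nullclines are ordered in one way, slightly to the right of it in the other, and \<open>P\<^sub>2\<close> is the only
  equilibrium nearby. All curves are constructed in a desingularised time, in which the right-hand
  sides are polynomials and only limits at infinite time remain to be determined.
  
  The curve from \<open>P\<^sub>6\<close>. In terms of \<open>\<tau> = 1 / (y \<sigma>\<^sup>2)\<close> and a time \<open>y\<close> that is \<open>0\<close> at \<open>P\<^sub>6\<close>, the point \<open>P\<^sub>6\<close> is a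
  regular singular point; the regular solution exists and is smooth across \<open>y = 0\<close>
  (\<open>clipped_system_exists\<close>, \<open>inner_curve\<close>). It stays between the nullclines because \<open>\<Delta>\<^sub>1\<close> and \<open>- \<Delta>\<^sub>2\<close>,
  suitably normalised, satisfy a cooperative system and cannot both be positive at \<open>w\<^sub>-\<close>
  (\<open>region_invariant\<close>); being monotone it converges to \<open>P\<^sub>2\<close> (\<open>region_limit\<close>). Smoothness in \<open>y\<close> becomes
  smoothness in \<open>\<bar>Z\<bar>\<^sup>2\<close>, that is, of the flow at the origin (\<open>inner_trajectory\<close>). For uniqueness,
  \<open>m = e\<^sup>x \<sigma>\<close> has a positive limit at \<open>P\<^sub>6\<close> on every trajectory (\<open>mass_limit\<close>), a translation of \<open>x\<close> makes two
  such limits equal, and then a Gronwall estimate from \<open>x = - \<infinity>\<close> makes the solutions equal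
  (\<open>local_uniqueness_P6\<close>, \<open>inner_unique\<close>). A smooth radial Euler flow near the origin provides a
  solution with the same asymptotics (\<open>euler_to_weak\<close>), so that it falls under the same uniqueness.
  
  The curves to \<open>P\<^sub>4\<close>. Through each point of the arc of \<open>\<Delta>\<^sub>1 = 0\<close> immediately to the right of \<open>P\<^sub>2\<close> there is
  an orbit. Backwards it is trapped between the nullclines, by the same cooperative argument, and ends
  at \<open>P\<^sub>2\<close> (\<open>out_region_invariant\<close>, \<open>out_region_limit\<close>); forwards a Lyapunov function drives it to \<open>P\<^sub>4\<close>
  (\<open>fwd_region_limit\<close>). Different points of the arc give disjoint orbits, and the dependence on the
  point is continuous (\<open>outer_family\<close>).
  
  Finite time. At \<open>P\<^sub>2\<close> the linearisation of \<open>(\<Delta>\<^sub>2, \<Delta>\<^sub>1)\<close> has negative trace and positive determinant,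
  and \<open>\<Delta>\<close> vanishes to first order; so along a trajectory approaching \<open>P\<^sub>2\<close> the distance to it, in a suitable norm, decreases
  at least at a constant rate in \<open>x\<close> (\<open>no_slow_approach\<close>). This applies to every trajectory ending or starting at \<open>P\<^sub>2\<close>,
  and gluing becomes a translation of \<open>x\<close> that makes the two end points coincide.
  
  Finally the radial Euler equations are equivalent to two scalar equations in \<open>y = \<bar>Z\<bar>\<^sup>2\<close>
  (\<open>radial_euler_iff\<close>), which are equivalent to the autonomous system off the sonic line.
\<close>

section \<open>Functions of class C^k\<close>

lemma Ck_on_cong:
  assumes "open S" "\<And>x. x \<in> S \<Longrightarrow> f x = g x" "Ck_on k f S"
  shows "Ck_on k g S"
  using assms(2,3)
proof (induction k arbitrary: f g)
  case 0
  then show ?case using continuous_on_cong[of S S f g] by simp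
next
  case (Suc k)
  have der: "(g has_derivative frechet_derivative f (at x)) (at x)" if "x \<in> S" for x
    using Suc.prems that assms(1)
    by (intro has_derivative_transform_within_open[of f "frechet_derivative f (at x)" x UNIV S g])
       (auto simp: frechet_derivative_works)
  show ?case
    unfolding Ck_on.simps
  proof (intro conjI ballI)
    fix x assume "x \<in> S"
    then show "g differentiable at x" using der differentiable_def by blast
  next
    fix b :: 'a assume b: "b \<in> Basis"
    show "Ck_on k (\<lambda>x. frechet_derivative g (at x) b) S"
    proof (rule Suc.IH)
      show "frechet_derivative f (at x) b = frechet_derivative g (at x) b" if "x \<in> S" for x
        using frechet_derivative_at[OF der[OF that]] by simp
    qed (use Suc.prems b in simp)
  qed
qed

lemma Ck_on_SucI:
  assumes "open S" "\<And>x. x \<in> S \<Longrightarrow> (f has_derivative f' x) (at x)"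
    "\<And>b. b \<in> Basis \<Longrightarrow> Ck_on k (\<lambda>x. f' x b) S"
  shows "Ck_on (Suc k) f S"
  unfolding Ck_on.simps
proof (intro conjI ballI)
  fix x assume "x \<in> S"
  then show "f differentiable at x" using assms(2) differentiable_def by blast
next
  fix b :: 'a assume b: "b \<in> Basis"
  show "Ck_on k (\<lambda>x. frechet_derivative f (at x) b) S"
    using assms(2) frechet_derivative_at
    by (intro Ck_on_cong[OF assms(1) _ assms(3)[OF b]]) fastforce
qed

lemma Ck_on_imp_continuous: "Ck_on k f S \<Longrightarrow> continuous_on S f"
proof (cases k)
  case (Suc j)
  moreover assume "Ck_on k f S"
  ultimately have "f differentiable (at x)" if "x \<in> S" for x using that by simp
  then show ?thesis
    by (meson continuous_at_imp_continuous_on differentiable_imp_continuous_within)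
qed simp

lemma Ck_on_lower: "Ck_on (Suc k) f S \<Longrightarrow> Ck_on k f S"
proof (induction k arbitrary: f)
  case 0
  then show ?case using Ck_on_imp_continuous by (metis Ck_on.simps(1))
next
  case (Suc k)
  then show ?case by (metis Ck_on.simps(2))
qed

lemma Ck_on_subset: "Ck_on k f S \<Longrightarrow> T \<subseteq> S \<Longrightarrow> Ck_on k f T"
  by (induction k arbitrary: f) (auto intro: continuous_on_subset)

lemma Ck_on_SucD:
  assumes "Ck_on (Suc k) f S" "x \<in> S"
  shows "(f has_derivative frechet_derivative f (at x)) (at x)"
  using assms frechet_derivative_works by auto

lemma Ck_on_const: "open S \<Longrightarrow> Ck_on k (\<lambda>x. c) S"
  by (induction k arbitrary: c) simp_all

lemma Ck_on_linear:
  assumes "open S" "bounded_linear f"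
  shows "Ck_on k f S"
proof (cases k)
  case 0
  then show ?thesis using assms linear_continuous_on by auto
next
  case (Suc j)
  show ?thesis unfolding Suc
    by (rule Ck_on_SucI[where f' = "\<lambda>x. f"])
       (use assms bounded_linear_imp_has_derivative Ck_on_const in auto)
qed

lemma Ck_on_add:
  assumes "open S" "Ck_on k f S" "Ck_on k g S"
  shows "Ck_on k (\<lambda>x. f x + g x) S"
  using assms(2,3)
proof (induction k arbitrary: f g)
  case 0
  then show ?case by (auto intro: continuous_intros)
next
  case (Suc k)
  show ?case
    using Suc.prems
    by (intro Ck_on_SucI[OF assms(1) has_derivative_add[OF Ck_on_SucD Ck_on_SucD] Suc.IH]) auto
qed

lemma Ck_on_scaleR:
  fixes f :: "'a::euclidean_space \<Rightarrow> real"
  assumes "open S" "Ck_on k f S" "Ck_on k g S"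
  shows "Ck_on k (\<lambda>x. f x *\<^sub>R g x) S"
  using assms(2,3)
proof (induction k arbitrary: f g)
  case 0
  then show ?case by (auto intro: continuous_intros)
next
  case (Suc k)
  show ?case
  proof (intro Ck_on_SucI[OF assms(1) has_derivative_scaleR[OF Ck_on_SucD Ck_on_SucD]])
    fix b :: 'a assume "b \<in> Basis"
    then show "Ck_on k (\<lambda>x. f x *\<^sub>R frechet_derivative g (at x) b +
        frechet_derivative f (at x) b *\<^sub>R g x) S"
      using Suc.prems Ck_on_lower[OF Suc.prems(1)] Ck_on_lower[OF Suc.prems(2)]
      by (intro Ck_on_add[OF assms(1)] Suc.IH) auto
  qed (use Suc.prems in auto)
qed

lemma Ck_on_mult:
  fixes f g :: "'a::euclidean_space \<Rightarrow> real"
  assumes "open S" "Ck_on k f S" "Ck_on k g S"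
  shows "Ck_on k (\<lambda>x. f x * g x) S"
  using Ck_on_scaleR[OF assms] by simp

lemma Ck_on_minus:
  fixes f :: "'a::euclidean_space \<Rightarrow> real"
  assumes "open S" "Ck_on k f S"
  shows "Ck_on k (\<lambda>x. - f x) S"
  using Ck_on_mult[OF assms(1) Ck_on_const[OF assms(1), of k "-1"] assms(2)] by simp

lemma Ck_on_diff:
  fixes f g :: "'a::euclidean_space \<Rightarrow> real"
  assumes "open S" "Ck_on k f S" "Ck_on k g S"
  shows "Ck_on k (\<lambda>x. f x - g x) S"
  using Ck_on_add[OF assms(1,2) Ck_on_minus[OF assms(1,3)]] by simp

lemma Ck_on_power:
  fixes f :: "'a::euclidean_space \<Rightarrow> real"
  assumes "open S" "Ck_on k f S"
  shows "Ck_on k (\<lambda>x. f x ^ n) S"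
  by (induction n) (auto intro!: Ck_on_const Ck_on_mult assms)

lemma Ck_on_compose:
  fixes f :: "'a::euclidean_space \<Rightarrow> real" and \<phi> :: "real \<Rightarrow> real"
  assumes "open S" "f ` S \<subseteq> U" "Ck_on k f S" "Ck_on k \<phi> U"
  shows "Ck_on k (\<lambda>x. \<phi> (f x)) S"
  using assms(3,4)
proof (induction k arbitrary: \<phi>)
  case 0
  then show ?case using assms(2) by (auto intro: continuous_on_compose2)
next
  case (Suc k)
  have fU: "f x \<in> U" if "x \<in> S" for x using assms(2) that by blast
  have "linear (frechet_derivative \<phi> (at (f x)))" if "x \<in> S" for x
    using Ck_on_SucD[OF Suc.prems(2) fU[OF that]] has_derivative_linear by blast
  then have lin: "frechet_derivative \<phi> (at (f x)) c = c * frechet_derivative \<phi> (at (f x)) 1"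
    if "x \<in> S" for x c
    using that linear_scale[of "frechet_derivative \<phi> (at (f x))" c 1] by simp
  show ?case
  proof (intro Ck_on_SucI[OF assms(1)])
    show "((\<lambda>x. \<phi> (f x)) has_derivative
       (\<lambda>h. frechet_derivative f (at x) h * frechet_derivative \<phi> (at (f x)) 1)) (at x)"
      if "x \<in> S" for x
      using has_derivative_compose[OF Ck_on_SucD[OF Suc.prems(1) that] Ck_on_SucD[OF Suc.prems(2) fU[OF that]]]
      by (simp add: lin[OF that, symmetric])
    fix b :: 'a assume b: "b \<in> Basis"
    have "Ck_on k (\<lambda>x. frechet_derivative \<phi> (at (f x)) 1) S"
      using Suc.prems Ck_on_lower[OF Suc.prems(1)]
      by (intro Suc.IH[of "\<lambda>y. frechet_derivative \<phi> (at y) 1"]) auto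
    then show "Ck_on k (\<lambda>x. frechet_derivative f (at x) b * frechet_derivative \<phi> (at (f x)) 1) S"
      using Suc.prems b by (intro Ck_on_mult[OF assms(1)]) auto
  qed
qed

lemma Ck_on_realI:
  fixes f :: "real \<Rightarrow> real"
  assumes "open S" "\<And>x. x \<in> S \<Longrightarrow> (f has_real_derivative f' x) (at x)" "Ck_on k f' S"
  shows "Ck_on (Suc k) f S"
proof (rule Ck_on_SucI[OF assms(1), where f' = "\<lambda>x h. f' x * h"])
  show "(f has_derivative (\<lambda>h. f' x * h)) (at x)" if "x \<in> S" for x
    using assms(2)[OF that] by (simp add: has_field_derivative_def)
  show "Ck_on k (\<lambda>x. f' x * b) S" if "b \<in> Basis" for b :: real
    using assms(3) that by simp
qed

lemma Ck_on_real_deriv: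
  fixes f :: "real \<Rightarrow> real"
  assumes "open S" "\<And>x. x \<in> S \<Longrightarrow> (f has_real_derivative f' x) (at x)" "Ck_on (Suc k) f S"
  shows "Ck_on k f' S"
proof -
  have "Ck_on k (\<lambda>x. frechet_derivative f (at x) 1) S" using assms(3) by simp
  moreover have "frechet_derivative f (at x) 1 = f' x" if "x \<in> S" for x
    using frechet_derivative_at[OF assms(2)[OF that, unfolded has_field_derivative_def], symmetric]
    by simp
  ultimately show ?thesis
    by (rule Ck_on_cong[OF assms(1), rotated])
qed

lemma Ck_on_recip: "Ck_on k (\<lambda>x::real. inverse x) (- {0})"
proof (induction k)
  case 0
  then show ?case by (auto intro!: continuous_intros)
next
  case (Suc k)
  show ?case
    by (intro Ck_on_realI[where f' = "\<lambda>x. - (inverse x * inverse x)"] Ck_on_minus Ck_on_mult Suc.IH)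
       (auto intro!: derivative_eq_intros simp: power2_eq_square)
qed

lemma Ck_on_divide:
  fixes f g :: "'a::euclidean_space \<Rightarrow> real"
  assumes "open S" "Ck_on k f S" "Ck_on k g S" "\<And>x. x \<in> S \<Longrightarrow> g x \<noteq> 0"
  shows "Ck_on k (\<lambda>x. f x / g x) S"
proof -
  have "Ck_on k (\<lambda>x. inverse (g x)) S"
    by (rule Ck_on_compose[OF assms(1) _ assms(3) Ck_on_recip]) (use assms(4) in auto)
  then show ?thesis unfolding divide_inverse by (intro Ck_on_mult assms)
qed

lemma Ck_on_powr: "Ck_on k (\<lambda>x::real. x powr a) {0<..}"
proof (induction k arbitrary: a)
  case 0
  then show ?case by (auto intro!: continuous_intros)
next
  case (Suc k)
  show ?case
    by (intro Ck_on_realI[where f' = "\<lambda>x. a * x powr (a - 1)"] Ck_on_mult Suc.IH Ck_on_const)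
       (auto intro!: derivative_eq_intros)
qed

lemma Ck_on_ln: "Ck_on k (\<lambda>x::real. ln x) {0<..}"
proof (cases k)
  case 0
  then show ?thesis by (auto intro!: continuous_intros)
next
  case (Suc j)
  show ?thesis unfolding Suc
    by (intro Ck_on_realI[where f' = "\<lambda>x. inverse x"] Ck_on_subset[OF Ck_on_recip])
       (auto intro!: derivative_eq_intros simp: divide_inverse)
qed

lemma Ck_on_exp: "Ck_on k (\<lambda>x::real. exp x) UNIV"
proof (induction k)
  case 0
  then show ?case by (auto intro!: continuous_intros)
next
  case (Suc k)
  show ?case by (intro Ck_on_realI[where f' = exp] Suc.IH) (auto intro!: derivative_eq_intros)
qed

lemma Ck_on_inner_self: "open S \<Longrightarrow> Ck_on k (\<lambda>x. x \<bullet> x) S"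
proof (cases k)
  case 0
  then show ?thesis by (auto intro!: continuous_intros)
next
  case (Suc j)
  assume "open S"
  then show ?thesis unfolding Suc
    by (intro Ck_on_SucI[where f' = "\<lambda>x h. x \<bullet> h + h \<bullet> x"] Ck_on_add Ck_on_linear)
       (auto intro!: derivative_eq_intros bounded_linear_inner_left bounded_linear_inner_right)
qed

text \<open>
  The derivative of an inverse function is the reciprocal of the original derivative, evaluated at
  the inverse function itself; smoothness therefore bootstraps.
\<close>

lemma Ck_on_inverse_function:
  fixes f G :: "real \<Rightarrow> real"
  assumes "open S" "open T" "\<And>x. x \<in> T \<Longrightarrow> G x \<in> S"
    and G: "\<And>x. x \<in> T \<Longrightarrow> (G has_real_derivative 1 / f' (G x)) (at x)"
    and f': "\<And>k. Ck_on k f' S" "\<And>y. y \<in> S \<Longrightarrow> f' y \<noteq> 0"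
  shows "Ck_on k G T"
proof (induction k)
  case 0
  then show ?case
    using G by (auto intro!: continuous_at_imp_continuous_on DERIV_isCont)
next
  case (Suc k)
  have "Ck_on k (\<lambda>y. 1 / f' y) S"
    by (intro Ck_on_divide Ck_on_const assms)
  then show ?case
    by (intro Ck_on_realI[OF \<open>open T\<close> G] Ck_on_compose[OF \<open>open T\<close> _ Suc.IH]) (use assms in auto)
qed

lemma Ck_on_1_imp_lipschitz:
  fixes f :: "'a::euclidean_space \<Rightarrow> real"
  assumes f: "Ck_on (Suc 0) f S" and C: "compact C" "convex C" "C \<subseteq> S"
  obtains L where "L \<ge> 0" "\<And>x y. x \<in> C \<Longrightarrow> y \<in> C \<Longrightarrow> \<bar>f x - f y\<bar> \<le> L * norm (x - y)"
proof -
  have "\<exists>B. \<forall>x\<in>C. \<bar>frechet_derivative f (at x) b\<bar> \<le> B" if "b \<in> Basis" for b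
  proof -
    have "continuous_on C (\<lambda>x. frechet_derivative f (at x) b)"
      using f that C(3) by (auto intro: continuous_on_subset)
    then have "bounded ((\<lambda>x. frechet_derivative f (at x) b) ` C)"
      using C(1) compact_continuous_image compact_imp_bounded by blast
    then show ?thesis by (auto simp: bounded_iff)
  qed
  then obtain B where B: "\<And>b x. b \<in> Basis \<Longrightarrow> x \<in> C \<Longrightarrow> \<bar>frechet_derivative f (at x) b\<bar> \<le> B b"
    by metis
  define L where "L = \<bar>\<Sum>b\<in>Basis. B b\<bar>"
  show ?thesis
  proof
    show "L \<ge> 0" by (simp add: L_def)
    fix x y assume xy: "x \<in> C" "y \<in> C"
    have der: "(f has_derivative frechet_derivative f (at x)) (at x)" if "x \<in> C" for x
      using Ck_on_SucD[OF f] C(3) that by blast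
    have on: "onorm (frechet_derivative f (at x)) \<le> L" if x: "x \<in> C" for x
    proof (rule onorm_bound)
      show "L \<ge> 0" by (simp add: L_def)
      fix h
      have lin: "linear (frechet_derivative f (at x))" using der[OF x] has_derivative_linear by blast
      have "frechet_derivative f (at x) h = frechet_derivative f (at x) (\<Sum>b\<in>Basis. (h \<bullet> b) *\<^sub>R b)"
        by (simp add: euclidean_representation)
      also have "\<dots> = (\<Sum>b\<in>Basis. (h \<bullet> b) * frechet_derivative f (at x) b)"
        using lin by (simp add: linear_sum linear_scale)
      finally have "\<bar>frechet_derivative f (at x) h\<bar> \<le> (\<Sum>b\<in>Basis. \<bar>(h \<bullet> b) * frechet_derivative f (at x) b\<bar>)"
        by (metis sum_abs)
      also have "\<dots> \<le> (\<Sum>b\<in>Basis. norm h * B b)"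
        by (intro sum_mono) (auto simp: abs_mult Basis_le_norm B x intro!: mult_mono)
      also have "\<dots> \<le> L * norm h"
        by (simp add: L_def sum_distrib_left[symmetric] mult.commute[of _ "norm h"] mult_left_mono)
      finally show "norm (frechet_derivative f (at x) h) \<le> L * norm h" by simp
    qed
    have "norm (f x - f y) \<le> L * norm (x - y)"
      by (rule differentiable_bound[OF C(2) _ on xy])
         (use der in \<open>auto intro: has_derivative_at_withinI\<close>)
    then show "\<bar>f x - f y\<bar> \<le> L * norm (x - y)" by simp
  qed
qed

section \<open>Weighted averages of a function over rays through the origin\<close>

text \<open>
  In the application \<open>n\<close> is the dimension \<open>d\<close>; the weight \<open>\<theta>\<^sup>d\<^sup>/\<^sup>2\<close> comes from the damping term
  \<open>- d (w - w\<^sub>e)\<close> of the system at \<open>P\<^sub>6\<close>.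
\<close>

definition ray_mean :: "nat \<Rightarrow> (real \<Rightarrow> real) \<Rightarrow> real \<Rightarrow> real" where
  "ray_mean n H y = integral {0..1} (\<lambda>\<theta>. sqrt \<theta> ^ n * H (\<theta> * y))"

lemma ray_in:
  fixes I :: "real set"
  assumes "convex I" "0 \<in> I" "y \<in> I" "\<theta> \<in> {0..1}"
  shows "\<theta> * y \<in> I"
  using convexD_alt[OF assms(1,2,3), of \<theta>] assms(4) by simp

lemma continuous_on_ray_mean:
  assumes "convex I" "0 \<in> I" "continuous_on I H"
  shows "continuous_on I (ray_mean n H)"
proof -
  have "continuous_on (I \<times> cbox 0 1) (\<lambda>(y, \<theta>). sqrt \<theta> ^ n * H (\<theta> * y))"
    unfolding split_beta
    by (intro continuous_intros continuous_on_compose2[OF assms(3)]) (use ray_in[OF assms(1,2)] in auto)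
  from integral_continuous_on_param[OF this] show ?thesis
    unfolding ray_mean_def[abs_def] by simp
qed

text \<open>
  Differentiating under the integral sign replaces \<open>n\<close> by \<open>n + 2\<close> and \<open>H\<close> by its derivative, so the
  smoothness of \<open>H\<close> is inherited order by order.
\<close>

lemma Ck_on_ray_mean:
  assumes I: "open I" "convex I" "0 \<in> I" and "Ck_on k H I"
  shows "Ck_on k (ray_mean n H) I"
  using assms(4)
proof (induction k arbitrary: n H)
  case 0
  then show ?case using continuous_on_ray_mean I by simp
next
  case (Suc k)
  define H' where "H' x = frechet_derivative H (at x) 1" for x
  have H': "(H has_real_derivative H' x) (at x)" if "x \<in> I" for x
  proof -
    have der: "(H has_derivative frechet_derivative H (at x)) (at x)"
      by (rule Ck_on_SucD[OF Suc.prems that])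
    have "frechet_derivative H (at x) c = H' x * c" for c
      using linear_scale[OF has_derivative_linear[OF der], of c 1] by (simp add: H'_def mult.commute)
    then have "frechet_derivative H (at x) = (*) (H' x)" by (rule ext)
    with der show ?thesis unfolding has_field_derivative_def by metis
  qed
  have CkH': "Ck_on k H' I" using Suc.prems by (simp add: H'_def[abs_def])
  note [continuous_intros] = continuous_on_compose2[OF Ck_on_imp_continuous[OF CkH']]
    continuous_on_compose2[OF Ck_on_imp_continuous[OF Suc.prems]]
  have "(ray_mean n H has_real_derivative ray_mean (n + 2) H' y) (at y)" if y: "y \<in> I" for y
  proof -
    have "((\<lambda>y. integral (cbox 0 1) (\<lambda>\<theta>. sqrt \<theta> ^ n * H (\<theta> * y))) has_field_derivative
       integral (cbox 0 1) (\<lambda>\<theta>. sqrt \<theta> ^ n * (H' (\<theta> * y) * \<theta>))) (at y within I)"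
    proof (rule leibniz_rule_field_derivative[OF _ _ _ y I(2)])
      fix x t :: real assume xt: "x \<in> I" "t \<in> cbox 0 1"
      have "((\<lambda>x. H (t * x)) has_real_derivative H' (t * x) * t) (at x)"
        using DERIV_chain'[of "\<lambda>x. t * x" t x UNIV H, OF _ H'] ray_in[OF I(2,3) xt(1)] xt(2)
        by (auto intro!: derivative_eq_intros)
      from DERIV_cmult[OF this, of "sqrt t ^ n"]
      show "((\<lambda>x. sqrt t ^ n * H (t * x)) has_real_derivative sqrt t ^ n * (H' (t * x) * t)) (at x within I)"
        by (rule has_field_derivative_at_within)
    next
      fix x assume "x \<in> I"
      then show "(\<lambda>\<theta>. sqrt \<theta> ^ n * H (\<theta> * x)) integrable_on cbox 0 1"
        by (intro integrable_continuous continuous_intros) (use ray_in[OF I(2,3)] in auto)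
    next
      show "continuous_on (I \<times> cbox 0 1) (\<lambda>(x, t). sqrt t ^ n * (H' (t * x) * t))"
        unfolding split_beta by (intro continuous_intros) (use ray_in[OF I(2,3)] in auto)
    qed
    moreover have "integral (cbox 0 1) (\<lambda>\<theta>. sqrt \<theta> ^ n * (H' (\<theta> * y) * \<theta>)) = ray_mean (n + 2) H' y"
      unfolding ray_mean_def cbox_interval
      by (intro integral_cong) (simp add: power_add)
    ultimately show ?thesis
      unfolding ray_mean_def[abs_def] using at_within_open[OF y I(1)] by simp
  qed
  from Ck_on_realI[OF I(1) this Suc.IH[OF CkH']] show ?case .
qed

text \<open>
  The function \<open>B y = y * ray_mean n H y\<close> is the solution of the singular equation
  \<open>y B' = y H - (n/2) B\<close> that is regular at the origin: away from the origin
  \<open>\<bar>y\<bar>\<^sup>n\<^sup>/\<^sup>2 B\<close> is a primitive of \<open>\<bar>y\<bar>\<^sup>n\<^sup>/\<^sup>2 H\<close>.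
\<close>

lemma DERIV_mult_ray_mean_pos:
  assumes H: "continuous_on UNIV H" and y: "y > 0"
  shows "((\<lambda>y. y * ray_mean n H y) has_real_derivative H y - real n / 2 * ray_mean n H y) (at y)"
proof -
  define P where "P y = integral {0..y} (\<lambda>\<eta>. sqrt \<eta> ^ n * H \<eta>)" for y
  have cont: "continuous_on A (\<lambda>\<eta>. sqrt \<eta> ^ n * H \<eta>)" for A
    by (intro continuous_intros continuous_on_subset[OF H]) auto
  have eq: "ray_mean n H x = P x * x powr (- real n / 2 - 1)" if x: "x > 0" for x
  proof -
    have im: "(\<lambda>z. z / x) ` {0..x} = {0..1}"
      using x by (auto simp: image_iff field_simps intro!: bexI[of _ "_ * x"])
    have sq: "sqrt x ^ n = x powr (real n / 2)"
      using x by (simp add: powr_half_sqrt[symmetric] powr_realpow[symmetric] powr_powr)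
    have "integral {0..1} (\<lambda>\<theta>. sqrt (x * \<theta>) ^ n * H (x * \<theta>)) = (1 / x) * P x"
      using integral_stretch_real[of x 0 x "\<lambda>\<eta>. sqrt \<eta> ^ n * H \<eta>"] x
      by (simp add: im P_def)
    also have "(\<lambda>\<theta>. sqrt (x * \<theta>) ^ n * H (x * \<theta>)) = (\<lambda>\<theta>. sqrt x ^ n * (sqrt \<theta> ^ n * H (\<theta> * x)))"
      by (simp add: real_sqrt_mult power_mult_distrib mult_ac)
    finally have "sqrt x ^ n * ray_mean n H x = P x / x"
      by (simp add: ray_mean_def)
    then have e1: "P x = x * (x powr (real n / 2) * ray_mean n H x)"
      using x by (simp add: sq field_simps)
    have e2: "x powr (- real n / 2 - 1) = 1 / (x powr (real n / 2) * x)"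
      using x powr_minus_divide[of x "real n / 2"] by (simp add: powr_diff)
    show ?thesis
      unfolding e1 e2 using x by simp
  qed
  have dP: "(P has_real_derivative sqrt y ^ n * H y) (at y)"
  proof -
    have "((\<lambda>x. integral {0..x} (\<lambda>\<eta>. sqrt \<eta> ^ n * H \<eta>)) has_real_derivative sqrt y ^ n * H y)
        (at y within {0..y + 1})"
      by (rule integral_has_real_derivative[OF cont]) (use y in auto)
    moreover have "at y within {0..y + 1} = at y"
      by (rule at_within_interior) (use y in auto)
    ultimately show ?thesis by (simp add: P_def[abs_def])
  qed
  have sq: "sqrt y ^ n = y powr (real n / 2)"
    using y by (simp add: powr_half_sqrt[symmetric] powr_realpow[symmetric] powr_powr)
  have "((\<lambda>x. P x * x powr (- real n / 2)) has_real_derivative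
      sqrt y ^ n * H y * y powr (- real n / 2) + P y * ((- real n / 2) * y powr (- real n / 2 - 1))) (at y)"
    using y by (auto intro!: derivative_eq_intros dP)
  also have "sqrt y ^ n * H y * y powr (- real n / 2) + P y * ((- real n / 2) * y powr (- real n / 2 - 1))
    = H y - real n / 2 * ray_mean n H y"
    unfolding eq[OF y] sq using y by (simp add: powr_minus field_simps)
  finally have D: "((\<lambda>x. P x * x powr (- real n / 2)) has_real_derivative
      H y - real n / 2 * ray_mean n H y) (at y)" .
  show ?thesis
  proof (rule has_field_derivative_transform_within_open[OF D])
    show "P x * x powr (- real n / 2) = x * ray_mean n H x" if "x \<in> {0<..}" for x
      using that eq[of x] by (simp add: powr_diff)
  qed (use y in auto)
qed

text \<open>
  For constant \<open>H\<close> the average is constant in \<open>y\<close>, and its differential equation at \<open>y = 1\<close> is a linear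
  equation for its value.
\<close>

lemma ray_mean_const: "ray_mean n (\<lambda>_. c) y = 2 * c / (2 + real n)"
proof -
  define m where "m = integral {0..1::real} (\<lambda>\<theta>. sqrt \<theta> ^ n)"
  have r: "ray_mean n (\<lambda>_. c) y = m * c" for c y
    by (simp add: ray_mean_def m_def)
  have "((\<lambda>y. y * ray_mean n (\<lambda>_. 1) y) has_real_derivative 1 - real n / 2 * ray_mean n (\<lambda>_. 1) 1) (at 1)"
    by (rule DERIV_mult_ray_mean_pos) auto
  moreover have "((\<lambda>y. y * ray_mean n (\<lambda>_. 1) y) has_real_derivative m) (at 1)"
    unfolding r by (auto intro!: derivative_eq_intros)
  ultimately have "m = 1 - real n / 2 * m"
    using DERIV_unique r by fastforce
  then have "m = 2 / (2 + real n)" by (simp add: field_simps)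
  then show ?thesis by (simp add: r)
qed

lemma DERIV_mult_ray_mean:
  assumes H: "continuous_on UNIV H"
  shows "((\<lambda>y. y * ray_mean n H y) has_real_derivative H y - real n / 2 * ray_mean n H y) (at y)"
proof -
  consider "y > 0" | "y < 0" | "y = 0" by linarith
  then show ?thesis
  proof cases
    case 1
    then show ?thesis by (rule DERIV_mult_ray_mean_pos[OF H])
  next
    case 2
    define G where "G x = H (- x)" for x
    have G: "continuous_on UNIV G"
      unfolding G_def by (intro continuous_on_compose2[OF H] continuous_intros) auto
    have GH: "ray_mean n G (- x) = ray_mean n H x" for x by (simp add: ray_mean_def G_def)
    have "((\<lambda>y. y * ray_mean n G y) has_real_derivative G (- y) - real n / 2 * ray_mean n G (- y)) (at (- y))"
      by (rule DERIV_mult_ray_mean_pos[OF G]) (use 2 in auto)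
    from DERIV_chain'[OF DERIV_minus[OF DERIV_ident] this]
    have "((\<lambda>x. - x * ray_mean n G (- x)) has_real_derivative
        - (G (- y) - real n / 2 * ray_mean n G (- y))) (at y)"
      by simp
    from DERIV_minus[OF this] show ?thesis unfolding GH by (simp add: G_def)
  next
    \<comment> \<open>at the origin only the value of \<open>H\<close> there matters, and both sides are \<open>2 H 0 / (2 + n)\<close>\<close>
    case 3
    have "continuous_on UNIV (ray_mean n H)"
      by (rule continuous_on_ray_mean[OF _ _ H]) auto
    then have "ray_mean n H \<midarrow>0\<rightarrow> ray_mean n H 0"
      by (simp add: continuous_on_eq_continuous_at isCont_def)
    then have "(\<lambda>h. ((0 + h) * ray_mean n H (0 + h) - 0 * ray_mean n H 0) / h) \<midarrow>0\<rightarrow> ray_mean n H 0"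
      by (rule Lim_transform_eventually) (auto simp: eventually_at_filter)
    then have "((\<lambda>y. y * ray_mean n H y) has_real_derivative ray_mean n H 0) (at 0)"
      by (simp add: DERIV_def)
    moreover have "ray_mean n H 0 = ray_mean n (\<lambda>_. H 0) 0"
      by (simp add: ray_mean_def)
    then have "ray_mean n H 0 = 2 * H 0 / (2 + real n)" by (simp add: ray_mean_const)
    then have "ray_mean n H 0 = H 0 - real n / 2 * ray_mean n H 0" by (simp add: field_simps)
    ultimately show ?thesis using 3 by simp
  qed
qed

section \<open>Global existence for clipped planar systems\<close>

text \<open>
  A Picard iteration in the weighted space of functions \<open>v\<close> for which
  \<open>exp (- c \<bar>y\<bar>) (v y - v\<^sub>0)\<close> is bounded: for \<open>c = 2 L\<close> the integral operator is a contraction on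
  the whole line at once, so that no continuation argument is needed. The kernel \<open>K\<close> covers regular
  equations (\<open>K \<theta> z = z\<close>) as well as the regular solution of a singular equation.
\<close>

lemma picard_on_line:
  fixes F :: "'a::euclidean_space \<Rightarrow> 'a" and K :: "real \<Rightarrow> 'a \<Rightarrow> 'a"
  assumes L: "L > 0" "\<And>z z'. norm (F z - F z') \<le> L * norm (z - z')"
    and M: "\<And>z. norm (F z) \<le> M"
    and K: "continuous_on ({0..1} \<times> UNIV) (\<lambda>(\<theta>, z). K \<theta> z)"
      "\<And>\<theta> z z'. \<theta> \<in> {0..1} \<Longrightarrow> norm (K \<theta> z - K \<theta> z') \<le> norm (z - z')"
      "\<And>\<theta>. K \<theta> 0 = 0"
  obtains v where "continuous_on UNIV v"
    "\<And>y. v y = v0 + y *\<^sub>R integral {0..1} (\<lambda>\<theta>. K \<theta> (F (v (\<theta> * y))))"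
proof -
  define c where "c = 2 * L"
  have c: "c > 0" using L by (simp add: c_def)
  have M0: "M \<ge> 0" using M[of 0] norm_ge_zero order_trans by blast
  define V where "V u y = v0 + exp (c * \<bar>y\<bar>) *\<^sub>R u y" for u :: "real \<Rightarrow> 'a" and y
  define J where "J u y = integral {0..1} (\<lambda>\<theta>. K \<theta> (F (V u (\<theta> * y))))" for u y
  define P where "P u y = exp (- (c * \<bar>y\<bar>)) *\<^sub>R (y *\<^sub>R J u y)" for u y
  have contF: "continuous_on UNIV F"
  proof (rule lipschitz_on_continuous_on[where L = L])
    show "L-lipschitz_on UNIV F"
      using L by (intro lipschitz_onI) (auto simp: dist_norm)
  qed
  note [continuous_intros] = continuous_on_compose2[OF contF]
  have contK: "continuous_on A (\<lambda>x. K (f x) (g x))"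
    if "continuous_on A f" "continuous_on A g" "f ` A \<subseteq> {0..1}" for A :: "'b::topological_space set" and f g
    using continuous_on_compose2[OF K(1), of A "\<lambda>x. (f x, g x)"] that
    by (auto intro!: continuous_intros)
  have contV: "continuous_on UNIV (V u)" if "continuous_on UNIV u" for u
    unfolding V_def[abs_def] using that by (intro continuous_intros)
  have cont2: "continuous_on (UNIV \<times> cbox 0 1) (\<lambda>(y, \<theta>). K \<theta> (F (V u (\<theta> * y))))"
    if "continuous_on UNIV u" for u
    unfolding split_beta
    by (intro contK continuous_intros continuous_on_compose2[OF contV[OF that]]) auto
  have cont1: "continuous_on {0..1} (\<lambda>\<theta>. K \<theta> (F (V u (\<theta> * y))))"
    if "continuous_on UNIV u" for u y
    by (intro contK continuous_intros continuous_on_compose2[OF contV[OF that]]) auto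
  have int1: "(\<lambda>\<theta>. K \<theta> (F (V u (\<theta> * y)))) integrable_on {0..1}"
    if "continuous_on UNIV u" for u y
    using cont1[OF that] by (rule integrable_continuous_real)
  have contJ: "continuous_on UNIV (J u)" if "continuous_on UNIV u" for u
    using integral_continuous_on_param[OF cont2[OF that]] unfolding J_def[abs_def] by simp
  have boundJ: "norm (J u y) \<le> M" if "continuous_on UNIV u" for u y
  proof -
    have "norm (J u y) \<le> integral {0..1::real} (\<lambda>_. M)"
      unfolding J_def
    proof (rule integral_norm_bound_integral[OF int1[OF that]])
      fix \<theta> :: real assume "\<theta> \<in> {0..1}"
      then show "norm (K \<theta> (F (V u (\<theta> * y)))) \<le> M"
        using K(2)[of \<theta> "F (V u (\<theta> * y))" 0] K(3)[of \<theta>] M order_trans by fastforce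
    qed auto
    then show ?thesis by simp
  qed
  have P_in: "P u \<in> bcontfun" if "continuous_on UNIV u" for u
  proof -
    have "norm (P u y) \<le> M / c" for y
    proof -
      have "exp (- (c * \<bar>y\<bar>)) * \<bar>y\<bar> \<le> 1 / c"
      proof -
        have "c * \<bar>y\<bar> \<le> exp (c * \<bar>y\<bar>)"
          using exp_ge_add_one_self[of "c * \<bar>y\<bar>"] by linarith
        then show ?thesis using c by (simp add: exp_minus field_simps)
      qed
      then have "(exp (- (c * \<bar>y\<bar>)) * \<bar>y\<bar>) * norm (J u y) \<le> (1 / c) * M"
        using boundJ[OF that] c by (intro mult_mono) auto
      then show ?thesis by (simp add: P_def abs_mult mult_ac)
    qed
    then have "bounded (range (P u))" by (auto simp: bounded_iff)
    moreover have "continuous_on UNIV (P u)"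
      unfolding P_def[abs_def] by (intro continuous_intros contJ that)
    ultimately show ?thesis by (simp add: bcontfun_def)
  qed
  define \<Phi> where "\<Phi> u = Bcontfun (P (apply_bcontfun u))" for u
  have app: "apply_bcontfun (\<Phi> u) = P (apply_bcontfun u)" for u
    unfolding \<Phi>_def by (rule Bcontfun_inverse[OF P_in]) auto
  have contr: "dist (\<Phi> u1) (\<Phi> u2) \<le> 1 / 2 * dist u1 u2" for u1 u2
  proof (rule dist_bound)
    fix y
    let ?D = "dist u1 u2"
    have c1: "continuous_on UNIV (apply_bcontfun u1)" "continuous_on UNIV (apply_bcontfun u2)" by auto
    have ints: "((\<lambda>\<theta>. L * (exp (c * (\<theta> * \<bar>y\<bar>)) * \<bar>y\<bar>) * ?D) has_integral
        (L * (exp (c * \<bar>y\<bar>) / c) * ?D - L * (1 / c) * ?D)) {0..1}"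
    proof -
      have "((\<lambda>\<theta>. L * (exp (c * (\<theta> * \<bar>y\<bar>)) * \<bar>y\<bar>) * ?D) has_integral
        (L * (exp (c * (1 * \<bar>y\<bar>)) / c) * ?D - L * (exp (c * (0 * \<bar>y\<bar>)) / c) * ?D)) {0..1}"
        by (rule fundamental_theorem_of_calculus)
           (use c in \<open>auto simp: has_real_derivative_iff_has_vector_derivative[symmetric]
             intro!: derivative_eq_intros\<close>)
      then show ?thesis by simp
    qed
    have "norm (y *\<^sub>R (J u1 y - J u2 y)) =
        norm (integral {0..1} (\<lambda>\<theta>. y *\<^sub>R (K \<theta> (F (V u1 (\<theta> * y))) - K \<theta> (F (V u2 (\<theta> * y))))))"
      unfolding J_def using int1[OF c1(1)] int1[OF c1(2)]
      by (simp add: Henstock_Kurzweil_Integration.integral_diff)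
    also have "\<dots> \<le> integral {0..1} (\<lambda>\<theta>. L * (exp (c * (\<theta> * \<bar>y\<bar>)) * \<bar>y\<bar>) * ?D)"
    proof (rule integral_norm_bound_integral)
      show "(\<lambda>\<theta>. y *\<^sub>R (K \<theta> (F (V u1 (\<theta> * y))) - K \<theta> (F (V u2 (\<theta> * y))))) integrable_on {0..1}"
        by (intro integrable_cmul integrable_diff int1 c1)
      show "(\<lambda>\<theta>. L * (exp (c * (\<theta> * \<bar>y\<bar>)) * \<bar>y\<bar>) * ?D) integrable_on {0..1}"
        using ints by blast
      fix \<theta> :: real assume \<theta>: "\<theta> \<in> {0..1}"
      have "norm (K \<theta> (F (V u1 (\<theta> * y))) - K \<theta> (F (V u2 (\<theta> * y)))) \<le> L * norm (V u1 (\<theta> * y) - V u2 (\<theta> * y))"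
        using K(2)[OF \<theta>] L(2) order_trans by blast
      also have "norm (V u1 (\<theta> * y) - V u2 (\<theta> * y)) = exp (c * (\<theta> * \<bar>y\<bar>)) * dist (u1 (\<theta> * y)) (u2 (\<theta> * y))"
        using \<theta> by (simp add: V_def dist_norm scaleR_diff_right[symmetric] abs_mult)
      also have "\<dots> \<le> exp (c * (\<theta> * \<bar>y\<bar>)) * ?D"
        by (intro mult_left_mono dist_bounded) auto
      finally have *: "norm (K \<theta> (F (V u1 (\<theta> * y))) - K \<theta> (F (V u2 (\<theta> * y)))) \<le> L * (exp (c * (\<theta> * \<bar>y\<bar>)) * ?D)"
        using L(1) by simp
      show "norm (y *\<^sub>R (K \<theta> (F (V u1 (\<theta> * y))) - K \<theta> (F (V u2 (\<theta> * y)))))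
          \<le> L * (exp (c * (\<theta> * \<bar>y\<bar>)) * \<bar>y\<bar>) * ?D"
        using mult_left_mono[OF *, of "\<bar>y\<bar>"] by (simp add: mult_ac)
    qed
    also have "\<dots> = (exp (c * \<bar>y\<bar>) - 1) * (?D / 2)"
      using integral_unique[OF ints] L(1) by (simp add: c_def field_simps)
    also have "\<dots> \<le> exp (c * \<bar>y\<bar>) * (?D / 2)"
      by (intro mult_right_mono) auto
    finally have "exp (- (c * \<bar>y\<bar>)) * norm (y *\<^sub>R (J u1 y - J u2 y)) \<le> exp (- (c * \<bar>y\<bar>)) * (exp (c * \<bar>y\<bar>) * (?D / 2))"
      by (intro mult_left_mono) auto
    also have "\<dots> = ?D / 2" by (simp add: exp_minus)
    finally show "dist (\<Phi> u1 y) (\<Phi> u2 y) \<le> 1 / 2 * ?D"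
      by (simp add: app P_def dist_norm scaleR_diff_right[symmetric] abs_mult mult_ac)
  qed
  obtain u where u: "\<Phi> u = u"
    using banach_fix_type[of "1/2" \<Phi>] contr by auto
  show ?thesis
  proof
    show "continuous_on UNIV (V u)" by (rule contV) auto
    fix y
    have "apply_bcontfun u y = P u y" using u app by metis
    then have "exp (c * \<bar>y\<bar>) *\<^sub>R u y = y *\<^sub>R J u y"
      by (simp add: P_def exp_minus)
    then show "V u y = v0 + y *\<^sub>R integral {0..1} (\<lambda>\<theta>. K \<theta> (F (V u (\<theta> * y))))"
      by (simp add: V_def[of u y] J_def)
  qed
qed

text \<open>
  Clipping the arguments to \<open>[-K, K]\<close> turns a locally Lipschitz field into a bounded, globally Lipschitz
  one without changing it on the square, where all curves of interest turn out to stay.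
\<close>

definition clip :: "real \<Rightarrow> real \<Rightarrow> real" where
  "clip K x = max (- K) (min K x)"

lemma clip_id: "\<bar>x\<bar> \<le> K \<Longrightarrow> clip K x = x"
  by (auto simp: clip_def)

lemma clip_lipschitz: "\<bar>clip K x - clip K y\<bar> \<le> \<bar>x - y\<bar>"
  by (auto simp: clip_def max_def min_def)

lemma clip_range: "K \<ge> 0 \<Longrightarrow> clip K x \<in> {-K..K}"
  by (auto simp: clip_def)

lemma continuous_clip [continuous_intros]:
  "continuous_on A f \<Longrightarrow> continuous_on A (\<lambda>x. clip K (f x))"
  unfolding clip_def by (intro continuous_intros)

lemma clipped_bounds:
  fixes P :: "real \<times> real \<Rightarrow> real"
  assumes "Ck_on (Suc 0) P UNIV" "K \<ge> 0"
  obtains L M where "L \<ge> 0"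
    "\<And>x y x' y'. \<bar>P (clip K x, clip K y) - P (clip K x', clip K y')\<bar> \<le> L * (\<bar>x - x'\<bar> + \<bar>y - y'\<bar>)"
    "\<And>x y. \<bar>P (clip K x, clip K y)\<bar> \<le> M"
proof -
  let ?C = "{-K..K} \<times> {-K..K}"
  have C: "compact ?C" "convex ?C" by (auto intro: compact_Times convex_Times)
  obtain L where L: "L \<ge> 0" "\<And>x y. x \<in> ?C \<Longrightarrow> y \<in> ?C \<Longrightarrow> \<bar>P x - P y\<bar> \<le> L * norm (x - y)"
    using Ck_on_1_imp_lipschitz[OF assms(1) C] by blast
  have "continuous_on ?C P" using Ck_on_imp_continuous[OF assms(1)] continuous_on_subset by blast
  then have "bounded (P ` ?C)" using C compact_continuous_image compact_imp_bounded by blast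
  then obtain M where M: "\<And>z. z \<in> ?C \<Longrightarrow> \<bar>P z\<bar> \<le> M" by (auto simp: bounded_iff)
  show ?thesis
  proof
    show "L \<ge> 0" by fact
    fix x y x' y'
    have in1: "(clip K a, clip K b) \<in> ?C" for a b using clip_range[OF assms(2)] by simp
    have "\<bar>P (clip K x, clip K y) - P (clip K x', clip K y')\<bar> \<le> L * norm ((clip K x, clip K y) - (clip K x', clip K y'))"
      by (rule L(2)[OF in1 in1])
    also have "\<dots> \<le> L * (\<bar>clip K x - clip K x'\<bar> + \<bar>clip K y - clip K y'\<bar>)"
      using norm_Pair_le[of "clip K x - clip K x'" "clip K y - clip K y'"] L(1)
      by (intro mult_left_mono) auto
    also have "\<dots> \<le> L * (\<bar>x - x'\<bar> + \<bar>y - y'\<bar>)"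
      using L(1) by (intro mult_left_mono add_mono clip_lipschitz)
    finally show "\<bar>P (clip K x, clip K y) - P (clip K x', clip K y')\<bar> \<le> L * (\<bar>x - x'\<bar> + \<bar>y - y'\<bar>)" .
    show "\<bar>P (clip K x, clip K y)\<bar> \<le> M" by (rule M[OF in1])
  qed
qed

text \<open>
  The third component is driven by the first two without acting on them. It carries a quadrature
  along the curve, such as the physical time as a function of the desingularised one.
\<close>

definition clipped_field ::
  "real \<Rightarrow> (real \<times> real \<Rightarrow> real) \<Rightarrow> (real \<times> real \<Rightarrow> real) \<Rightarrow> (real \<times> real \<Rightarrow> real) \<Rightarrow>
   real \<times> real \<times> real \<Rightarrow> real \<times> real \<times> real" where
  "clipped_field K F1 F2 F3 = (\<lambda>(x, y, z).
     (F1 (clip K x, clip K y), F2 (clip K x, clip K y), F3 (clip K x, clip K y)))"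

lemma norm_triple_le: "norm (a, b, c) \<le> \<bar>a\<bar> + \<bar>b\<bar> + \<bar>c\<bar>" for a b c :: real
  using norm_Pair_le[of a "(b, c)"] norm_Pair_le[of b c] by simp

lemma clipped_field_bounds:
  assumes "Ck_on (Suc 0) F1 UNIV" "Ck_on (Suc 0) F2 UNIV" "Ck_on (Suc 0) F3 UNIV" "K \<ge> 0"
  obtains L M where "L > 0"
    "\<And>z z'. norm (clipped_field K F1 F2 F3 z - clipped_field K F1 F2 F3 z') \<le> L * norm (z - z')"
    "\<And>z. norm (clipped_field K F1 F2 F3 z) \<le> M"
proof -
  obtain L1 M1 where 1: "L1 \<ge> 0"
    "\<And>x y x' y'. \<bar>F1 (clip K x, clip K y) - F1 (clip K x', clip K y')\<bar> \<le> L1 * (\<bar>x - x'\<bar> + \<bar>y - y'\<bar>)"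
    "\<And>x y. \<bar>F1 (clip K x, clip K y)\<bar> \<le> M1" using clipped_bounds[OF assms(1,4)] by blast
  obtain L2 M2 where 2: "L2 \<ge> 0"
    "\<And>x y x' y'. \<bar>F2 (clip K x, clip K y) - F2 (clip K x', clip K y')\<bar> \<le> L2 * (\<bar>x - x'\<bar> + \<bar>y - y'\<bar>)"
    "\<And>x y. \<bar>F2 (clip K x, clip K y)\<bar> \<le> M2" using clipped_bounds[OF assms(2,4)] by blast
  obtain L3 M3 where 3: "L3 \<ge> 0"
    "\<And>x y x' y'. \<bar>F3 (clip K x, clip K y) - F3 (clip K x', clip K y')\<bar> \<le> L3 * (\<bar>x - x'\<bar> + \<bar>y - y'\<bar>)"
    "\<And>x y. \<bar>F3 (clip K x, clip K y)\<bar> \<le> M3" using clipped_bounds[OF assms(3,4)] by blast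
  show ?thesis
  proof
    show "2 * (L1 + L2 + L3) + 1 > 0" using 1(1) 2(1) 3(1) by simp
    fix u u' :: "real \<times> real \<times> real"
    obtain x y z x' y' z' where u: "u = (x, y, z)" "u' = (x', y', z')" by (metis surj_pair)
    have n: "\<bar>x - x'\<bar> \<le> norm (u - u')" "\<bar>y - y'\<bar> \<le> norm (u - u')"
      using norm_fst_le[of "x - x'" "(y - y', z - z')"] norm_snd_le[of "(y - y', z - z')" "x - x'"]
        norm_fst_le[of "y - y'" "z - z'"] by (auto simp: u)
    have "norm (clipped_field K F1 F2 F3 u - clipped_field K F1 F2 F3 u')
       \<le> L1 * (\<bar>x - x'\<bar> + \<bar>y - y'\<bar>) + L2 * (\<bar>x - x'\<bar> + \<bar>y - y'\<bar>) + L3 * (\<bar>x - x'\<bar> + \<bar>y - y'\<bar>)"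
      unfolding clipped_field_def u
      using 1(2)[of x y x' y'] 2(2)[of x y x' y'] 3(2)[of x y x' y']
      by (auto intro!: order_trans[OF norm_triple_le])
    also have "\<dots> = (L1 + L2 + L3) * (\<bar>x - x'\<bar> + \<bar>y - y'\<bar>)" by (simp add: algebra_simps)
    also have "\<dots> \<le> (L1 + L2 + L3) * (norm (u - u') + norm (u - u'))"
      using n 1(1) 2(1) 3(1) by (intro mult_left_mono add_mono) auto
    also have "\<dots> \<le> (2 * (L1 + L2 + L3) + 1) * norm (u - u')" by (simp add: algebra_simps)
    finally show "norm (clipped_field K F1 F2 F3 u - clipped_field K F1 F2 F3 u')
      \<le> (2 * (L1 + L2 + L3) + 1) * norm (u - u')" .
    show "norm (clipped_field K F1 F2 F3 u) \<le> M1 + M2 + M3"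
      unfolding clipped_field_def u using 1(3)[of x y] 2(3)[of x y] 3(3)[of x y]
      by (auto intro!: order_trans[OF norm_triple_le])
  qed
qed

text \<open>
  For \<open>n = 0\<close> this is the autonomous system with the clipped field. For \<open>n > 0\<close> the first
  equation is replaced by the singular one, \<open>y f' = - (n/2) (f - f 0) + y F\<^sub>1\<close>.
\<close>

definition clipped_solution ::
  "real \<Rightarrow> (real \<times> real \<Rightarrow> real) \<Rightarrow> (real \<times> real \<Rightarrow> real) \<Rightarrow> (real \<times> real \<Rightarrow> real) \<Rightarrow> nat \<Rightarrow>
   (real \<Rightarrow> real) \<Rightarrow> (real \<Rightarrow> real) \<Rightarrow> (real \<Rightarrow> real) \<Rightarrow> bool" where
  "clipped_solution K F1 F2 F3 n f g h \<longleftrightarrow>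
    continuous_on UNIV f \<and> continuous_on UNIV g \<and>
    (\<forall>y. f y = f 0 + y * ray_mean n (\<lambda>y. F1 (clip K (f y), clip K (g y))) y) \<and>
    (\<forall>y. (f has_real_derivative F1 (clip K (f y), clip K (g y))
        - real n / 2 * ray_mean n (\<lambda>y. F1 (clip K (f y), clip K (g y))) y) (at y)) \<and>
    (\<forall>y. (g has_real_derivative F2 (clip K (f y), clip K (g y))) (at y)) \<and>
    (\<forall>y. (h has_real_derivative F3 (clip K (f y), clip K (g y))) (at y))"

text \<open>
  With a kernel that multiplies the first component by \<open>sqrt \<theta> ^ n\<close>, the fixed point of the Picard
  operator has first component \<open>f 0 + y * ray_mean n F\<^sub>1\<close>, the regular solution of the singular equation.
\<close>

lemma clipped_system_exists:
  assumes "Ck_on (Suc 0) F1 UNIV" "Ck_on (Suc 0) F2 UNIV" "Ck_on (Suc 0) F3 UNIV" "K \<ge> 0"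
  obtains f g h where "clipped_solution K F1 F2 F3 n f g h" "f 0 = f0" "g 0 = g0" "h 0 = h0"
proof -
  define F where "F = clipped_field K F1 F2 F3"
  define Ker :: "real \<Rightarrow> real \<times> real \<times> real \<Rightarrow> real \<times> real \<times> real"
    where "Ker \<theta> z = (sqrt \<theta> ^ n * fst z, snd z)" for \<theta> z
  obtain L M where LM: "L > 0" "\<And>z z'. norm (F z - F z') \<le> L * norm (z - z')" "\<And>z. norm (F z) \<le> M"
    unfolding F_def using clipped_field_bounds[OF assms] by metis
  have K1: "continuous_on ({0..1} \<times> UNIV) (\<lambda>(\<theta>, z). Ker \<theta> z)"
    unfolding split_beta Ker_def by (intro continuous_intros)
  have K2: "norm (Ker \<theta> z - Ker \<theta> z') \<le> norm (z - z')" if "\<theta> \<in> {0..1}" for \<theta> z z'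
  proof -
    have "sqrt \<theta> ^ n \<le> 1" using that by (intro power_le_one) auto
    then have "\<bar>sqrt \<theta> ^ n * (fst z - fst z')\<bar> \<le> \<bar>fst z - fst z'\<bar>"
      using that by (auto simp: abs_mult intro!: mult_left_le_one_le)
    then have "norm (sqrt \<theta> ^ n * (fst z - fst z'), snd z - snd z') \<le> norm (fst z - fst z', snd z - snd z')"
      unfolding norm_Pair by (intro real_sqrt_le_mono add_mono power_mono) auto
    also have "(fst z - fst z', snd z - snd z') = z - z'" by (simp add: prod_eq_iff)
    also have "(sqrt \<theta> ^ n * (fst z - fst z'), snd z - snd z') = Ker \<theta> z - Ker \<theta> z'"
      by (simp add: Ker_def right_diff_distrib)
    finally show ?thesis .
  qed
  have K3: "Ker \<theta> 0 = 0" for \<theta> by (simp add: Ker_def zero_prod_def)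
  obtain v where v: "continuous_on UNIV v"
    "\<And>y. v y = (f0, g0, h0) + y *\<^sub>R integral {0..1} (\<lambda>\<theta>. Ker \<theta> (F (v (\<theta> * y))))"
    using picard_on_line[OF LM K1 K2 K3, of "(f0, g0, h0)"] by blast
  define f g h where "f y = fst (v y)" and "g y = fst (snd (v y))" and "h y = snd (snd (v y))" for y
  have contF: "continuous_on UNIV F"
    using LM by (intro lipschitz_on_continuous_on[where L = L] lipschitz_onI) (auto simp: dist_norm)
  have int: "(\<lambda>\<theta>. Ker \<theta> (F (v (\<theta> * y)))) integrable_on {0..1}" for y
    unfolding Ker_def
    by (intro integrable_continuous_real continuous_intros continuous_on_compose2[OF contF]
        continuous_on_compose2[OF v(1)]) auto
  have cfg: "continuous_on UNIV f" "continuous_on UNIV g"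
    unfolding f_def g_def by (intro continuous_intros v(1))+
  let ?H = "\<lambda>P y. P (clip K (f y), clip K (g y))"
  have contH: "continuous_on UNIV (?H P)" if "Ck_on (Suc 0) P UNIV" for P :: "real \<times> real \<Rightarrow> real"
    by (intro continuous_on_compose2[OF Ck_on_imp_continuous[OF that]] continuous_intros cfg) auto
  have Fv: "F (v y) = (?H F1 y, ?H F2 y, ?H F3 y)" for y
    by (simp add: F_def clipped_field_def f_def g_def split_beta)
  have cmp: "bl (integral {0..1} (\<lambda>\<theta>. Ker \<theta> (F (v (\<theta> * y))))) =
      integral {0..1} (\<lambda>\<theta>. bl (Ker \<theta> (F (v (\<theta> * y)))))" if "bounded_linear bl" for bl :: "_ \<Rightarrow> real" and y
    using integral_linear[OF int that] by (simp add: o_def)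
  have fe: "f y = f0 + y * ray_mean n (?H F1) y" for y
    using arg_cong[OF v(2)[of y], of fst] cmp[OF bounded_linear_fst, of y]
    by (simp add: f_def[of y] ray_mean_def Ker_def Fv)
  have ge: "g y = g0 + y * ray_mean 0 (?H F2) y" for y
    using arg_cong[OF v(2)[of y], of "\<lambda>z. fst (snd z)"] cmp[OF bounded_linear_fst_comp[OF bounded_linear_snd], of y]
    by (simp add: g_def[of y] ray_mean_def Ker_def Fv)
  have he: "h y = h0 + y * ray_mean 0 (?H F3) y" for y
    using arg_cong[OF v(2)[of y], of "\<lambda>z. snd (snd z)"] cmp[OF bounded_linear_snd_comp[OF bounded_linear_snd], of y]
    by (simp add: h_def[of y] ray_mean_def Ker_def Fv)
  have der: "((\<lambda>y. e0 + y * ray_mean m (?H P) y) has_real_derivative ?H P y - real m / 2 * ray_mean m (?H P) y) (at y)"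
    if "Ck_on (Suc 0) P UNIV" for P :: "real \<times> real \<Rightarrow> real" and m e0 y
    using DERIV_add[OF DERIV_const DERIV_mult_ray_mean[OF contH[OF that]], of e0 m y] by simp
  have init: "f 0 = f0" "g 0 = g0" "h 0 = h0" using fe[of 0] ge[of 0] he[of 0] by auto
  have "clipped_solution K F1 F2 F3 n f g h"
    unfolding clipped_solution_def
  proof (intro conjI allI cfg)
    fix y
    show "f y = f 0 + y * ray_mean n (?H F1) y" unfolding init by (rule fe)
    show "(f has_real_derivative ?H F1 y - real n / 2 * ray_mean n (?H F1) y) (at y)"
      using der[OF assms(1), of f0 n y] unfolding fe[symmetric] .
    show "(g has_real_derivative ?H F2 y) (at y)"
      using der[OF assms(2), of g0 0 y] unfolding ge[symmetric] by simp
    show "(h has_real_derivative ?H F3 y) (at y)"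
      using der[OF assms(3), of h0 0 y] unfolding he[symmetric] by simp
  qed
  then show ?thesis using init by (rule that)
qed

section \<open>Comparison, limits and changes of time\<close>

text \<open>
  Gronwall's inequality: \<open>N t exp (- C t)\<close> is monotone.
\<close>

lemma growth_upper:
  fixes N :: "real \<Rightarrow> real"
  assumes "a \<le> b" "continuous_on {a..b} N"
    "\<And>t. a < t \<Longrightarrow> t < b \<Longrightarrow> (N has_real_derivative N' t) (at t)"
    "\<And>t. a < t \<Longrightarrow> t < b \<Longrightarrow> N' t \<le> C * N t"
  shows "N b \<le> N a * exp (C * (b - a))"
proof -
  have "N b * exp (- (C * b)) \<le> N a * exp (- (C * a))"
  proof (rule DERIV_nonpos_imp_decreasing_open[OF assms(1), where f = "\<lambda>t. N t * exp (- (C * t))"])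
    fix t assume t: "a < t" "t < b"
    have "((\<lambda>t. N t * exp (- (C * t))) has_real_derivative (N' t - C * N t) * exp (- (C * t))) (at t)"
      by (auto intro!: derivative_eq_intros assms(3)[OF t] simp: algebra_simps)
    moreover have "(N' t - C * N t) * exp (- (C * t)) \<le> 0"
      using assms(4)[OF t] by (intro mult_nonpos_nonneg) auto
    ultimately show "\<exists>y. ((\<lambda>t. N t * exp (- (C * t))) has_real_derivative y) (at t) \<and> y \<le> 0" by blast
  qed (intro continuous_intros assms(2))
  then have "N b * exp (- (C * b)) * exp (C * b) \<le> N a * exp (- (C * a)) * exp (C * b)"
    by (rule mult_right_mono) auto
  then show ?thesis
    by (simp add: mult.assoc exp_add[symmetric] right_diff_distrib)
qed

lemma growth_lower:
  fixes N :: "real \<Rightarrow> real"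
  assumes "a \<le> b" "continuous_on {a..b} N"
    "\<And>t. a < t \<Longrightarrow> t < b \<Longrightarrow> (N has_real_derivative N' t) (at t)"
    "\<And>t. a < t \<Longrightarrow> t < b \<Longrightarrow> N' t \<ge> - C * N t"
  shows "N b \<ge> N a * exp (- C * (b - a))"
proof -
  have "- N b \<le> - N a * exp (- C * (b - a))"
  proof (rule growth_upper[OF assms(1), where N' = "\<lambda>t. - N' t"])
    show "continuous_on {a..b} (\<lambda>t. - N t)" by (intro continuous_intros assms(2))
    show "((\<lambda>t. - N t) has_real_derivative - N' t) (at t)" if "a < t" "t < b" for t
      by (intro DERIV_minus assms(3) that)
    show "- N' t \<le> - C * - N t" if "a < t" "t < b" for t
      using assms(4)[OF that] by simp
  qed
  then show ?thesis by simp
qed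

text \<open>
  Dependence on initial values in both directions of time, by the Gronwall inequality for
  \<open>\<bar>v\<^sub>1 - v\<^sub>2\<bar>\<^sup>2\<close>.
\<close>

lemma dist_growth:
  fixes v1 v2 :: "real \<Rightarrow> 'a::real_inner"
  assumes "a \<le> b" "continuous_on {a..b} v1" "continuous_on {a..b} v2"
    "\<And>t. a < t \<Longrightarrow> t < b \<Longrightarrow> (v1 has_vector_derivative F1 t) (at t)"
    "\<And>t. a < t \<Longrightarrow> t < b \<Longrightarrow> (v2 has_vector_derivative F2 t) (at t)"
    "\<And>t. a < t \<Longrightarrow> t < b \<Longrightarrow> norm (F1 t - F2 t) \<le> L * norm (v1 t - v2 t)"
  shows "norm (v1 b - v2 b) \<le> exp (L * (b - a)) * norm (v1 a - v2 a)"
    and "norm (v1 a - v2 a) \<le> exp (L * (b - a)) * norm (v1 b - v2 b)"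
proof -
  define N where "N t = (v1 t - v2 t) \<bullet> (v1 t - v2 t)" for t
  have Nn: "N t = (norm (v1 t - v2 t))\<^sup>2" for t by (simp add: N_def power2_norm_eq_inner)
  have cont: "continuous_on {a..b} N" unfolding N_def by (intro continuous_intros assms)
  have der: "(N has_real_derivative 2 * ((v1 t - v2 t) \<bullet> (F1 t - F2 t))) (at t)" if "a < t" "t < b" for t
  proof -
    have "((\<lambda>t. v1 t - v2 t) has_vector_derivative F1 t - F2 t) (at t)"
      by (intro has_vector_derivative_diff assms that)
    from has_derivative_inner[OF this[unfolded has_vector_derivative_def] this[unfolded has_vector_derivative_def]]
    show ?thesis
      unfolding N_def[abs_def] has_field_derivative_def
      by (rule has_derivative_eq_rhs) (auto simp: inner_commute algebra_simps)
  qed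
  have bnd: "\<bar>2 * ((v1 t - v2 t) \<bullet> (F1 t - F2 t))\<bar> \<le> 2 * L * N t" if "a < t" "t < b" for t
  proof -
    have "\<bar>(v1 t - v2 t) \<bullet> (F1 t - F2 t)\<bar> \<le> norm (v1 t - v2 t) * norm (F1 t - F2 t)"
      by (rule Cauchy_Schwarz_ineq2)
    also have "\<dots> \<le> norm (v1 t - v2 t) * (L * norm (v1 t - v2 t))"
      by (intro mult_left_mono assms(6) that) auto
    finally show ?thesis by (simp add: Nn power2_eq_square abs_mult mult_ac)
  qed
  have sq: "x \<le> exp (L * (b - a)) * y" if "x\<^sup>2 \<le> y\<^sup>2 * exp (2 * L * (b - a))" "y \<ge> 0" for x y :: real
  proof (rule power2_le_imp_le)
    have "exp (2 * L * (b - a)) = (exp (L * (b - a)))\<^sup>2"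
      by (simp add: power2_eq_square exp_add[symmetric])
    then show "x\<^sup>2 \<le> (exp (L * (b - a)) * y)\<^sup>2" using that by (simp add: power_mult_distrib mult_ac)
  qed (use that in auto)
  have "N b \<le> N a * exp (2 * L * (b - a))"
    by (rule growth_upper[OF assms(1) cont der]) (use bnd in \<open>auto simp: abs_le_iff\<close>)
  then show "norm (v1 b - v2 b) \<le> exp (L * (b - a)) * norm (v1 a - v2 a)"
    unfolding Nn by (intro sq) auto
  have "N b \<ge> N a * exp (- (2 * L) * (b - a))"
  proof (rule growth_lower[OF assms(1) cont der])
    show "- (2 * L) * N t \<le> 2 * ((v1 t - v2 t) \<bullet> (F1 t - F2 t))" if "a < t" "t < b" for t
      using bnd[OF that] by (simp add: abs_le_iff)
  qed auto
  then have "N b * exp (2 * L * (b - a)) \<ge> N a * exp (- (2 * L) * (b - a)) * exp (2 * L * (b - a))"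
    by (rule mult_right_mono) auto
  then have "N a \<le> N b * exp (2 * L * (b - a))"
    by (simp add: mult.assoc exp_add[symmetric])
  then show "norm (v1 a - v2 a) \<le> exp (L * (b - a)) * norm (v1 b - v2 b)"
    unfolding Nn by (intro sq) auto
qed

text \<open>
  Consider the first zero of \<open>m\<close>. With \<open>m\<close> the minimum of the functions that are positive in a region,
  this reduces invariance of the region to excluding a first exit.
\<close>

lemma stays_positive:
  fixes m :: "real \<Rightarrow> real"
  assumes "continuous_on {a..b} m" "m a > 0"
    "\<And>c. a < c \<Longrightarrow> c \<le> b \<Longrightarrow> (\<And>x. a \<le> x \<Longrightarrow> x < c \<Longrightarrow> m x > 0) \<Longrightarrow> m c > 0"
    and x: "x \<in> {a..b}"
  shows "m x > 0"
proof (rule ccontr)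
  assume neg: "\<not> m x > 0"
  define S where "S = {x \<in> {a..b}. m x \<le> 0}"
  have "closed ({a..b} \<inter> m -` {..0})"
    by (rule continuous_closed_preimage[OF assms(1)]) auto
  also have "{a..b} \<inter> m -` {..0} = S" by (auto simp: S_def)
  finally have "compact ({a..b} \<inter> S)" by (intro compact_Int_closed compact_Icc)
  also have "{a..b} \<inter> S = S" by (auto simp: S_def)
  finally have cS: "compact S" .
  have ne: "S \<noteq> {}" using neg x by (auto simp: S_def)
  obtain c where c: "c \<in> S" "\<And>y. y \<in> S \<Longrightarrow> c \<le> y"
    using compact_attains_inf[OF cS ne] by blast
  have "c > a" using c(1) assms(2) by (cases "c = a") (auto simp: S_def)
  moreover have "c \<le> b" using c(1) by (auto simp: S_def)
  moreover have "m y > 0" if "a \<le> y" "y < c" for y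
    using c(2)[of y] that \<open>c \<le> b\<close> by (force simp: S_def)
  ultimately have "m c > 0" by (rule assms(3))
  with c(1) show False by (auto simp: S_def)
qed

lemma mono_bounded_tendsto_at_top:
  fixes f :: "real \<Rightarrow> real"
  assumes "\<And>x y. a \<le> x \<Longrightarrow> x \<le> y \<Longrightarrow> f x \<le> f y" "\<And>x. a \<le> x \<Longrightarrow> f x \<le> B"
  obtains L where "(f \<longlongrightarrow> L) at_top" "\<And>x. a \<le> x \<Longrightarrow> f x \<le> L" "L \<le> B"
proof -
  define L where "L = Sup (f ` {a..})"
  have bdd: "bdd_above (f ` {a..})" using assms(2) by (auto simp: bdd_above_def)
  have up: "f x \<le> L" if "a \<le> x" for x
    unfolding L_def by (rule cSup_upper[OF _ bdd]) (use that in auto)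
  have "(f \<longlongrightarrow> L) at_top"
  proof (rule order_tendstoI)
    fix y assume "y < L"
    then obtain x where x: "a \<le> x" "y < f x"
      unfolding L_def using less_cSup_iff[OF _ bdd] by auto
    have "eventually (\<lambda>z. z \<ge> x) at_top" by (rule eventually_ge_at_top)
    then show "eventually (\<lambda>z. y < f z) at_top"
      by eventually_elim (use assms(1)[OF x(1)] x(2) in force)
  next
    fix y assume "L < y"
    have "eventually (\<lambda>z. z \<ge> a) at_top" by (rule eventually_ge_at_top)
    then show "eventually (\<lambda>z. f z < y) at_top"
      by eventually_elim (use up \<open>L < y\<close> in force)
  qed
  moreover have "L \<le> B" unfolding L_def using assms(2) by (intro cSup_least) auto
  ultimately show ?thesis using that up by blast
qed

lemma mono_bounded_tendsto_at_bot:
  fixes f :: "real \<Rightarrow> real"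
  assumes "\<And>x y. x \<le> y \<Longrightarrow> y \<le> a \<Longrightarrow> f x \<le> f y" "\<And>x. x \<le> a \<Longrightarrow> B \<le> f x"
  obtains L where "(f \<longlongrightarrow> L) at_bot" "B \<le> L"
proof -
  obtain L where L: "((\<lambda>x. - f (- x)) \<longlongrightarrow> L) at_top" "L \<le> - B"
    by (rule mono_bounded_tendsto_at_top[of "- a" "\<lambda>x. - f (- x)" "- B"]) (use assms in auto)
  from tendsto_minus[OF L(1)] have "((\<lambda>x. f (- x)) \<longlongrightarrow> - L) at_top" by simp
  then have "(f \<longlongrightarrow> - L) at_bot" by (simp add: filterlim_at_bot_mirror)
  then show ?thesis using that L(2) by simp
qed

text \<open>
  By the mean value theorem \<open>f (x + 1) - f x\<close> is a value of \<open>f'\<close> beyond \<open>x\<close>. It follows that a convergent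
  solution of an autonomous system converges to an equilibrium.
\<close>

lemma derivative_limit_zero:
  fixes f :: "real \<Rightarrow> real"
  assumes "\<And>x. x \<ge> a \<Longrightarrow> (f has_real_derivative f' x) (at x)"
    and f: "(f \<longlongrightarrow> L) at_top" and f': "(f' \<longlongrightarrow> M) at_top"
  shows "M = 0"
proof -
  have "\<exists>z>x. z < x + 1 \<and> f (x + 1) - f x = f' z" if "x \<ge> a" for x
    using MVT2[of x "x + 1" f f'] assms(1) that by force
  then obtain z where z: "\<And>x. x \<ge> a \<Longrightarrow> z x > x \<and> f (x + 1) - f x = f' (z x)" by metis
  have "filterlim z at_top at_top"
    by (rule filterlim_at_top_mono[OF filterlim_ident])
       (use z in \<open>auto intro!: eventually_at_top_linorderI[of a] less_imp_le\<close>)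
  from filterlim_compose[OF f' this] have "((\<lambda>x. f' (z x)) \<longlongrightarrow> M) at_top" .
  moreover have "((\<lambda>x. f (x + 1) - f x) \<longlongrightarrow> L - L) at_top"
    by (intro tendsto_diff f filterlim_compose[OF f])
       (auto intro: filterlim_tendsto_add_at_top filterlim_at_top_mono[OF filterlim_ident])
  then have "((\<lambda>x. f (x + 1) - f x) \<longlongrightarrow> 0) at_top" by simp
  then have "((\<lambda>x. f' (z x)) \<longlongrightarrow> 0) at_top"
  proof (rule Lim_transform_eventually)
    show "eventually (\<lambda>x. f (x + 1) - f x = f' (z x)) at_top"
      using z by (intro eventually_at_top_linorderI[of a]) blast
  qed
  ultimately show ?thesis using tendsto_unique[OF trivial_limit_at_top_linorder] by blast
qed

text \<open>
  \<open>X\<close> is a physical time as a function of a desingularised one, and \<open>G\<close> its inverse. The range \<open>(a, b)\<close> of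
  \<open>X\<close> need not be the whole line: an end point of a trajectory at finite physical time corresponds
  to infinite desingularised time.
\<close>

definition inverse_clock ::
  "(real \<Rightarrow> real) \<Rightarrow> (real \<Rightarrow> real) \<Rightarrow> ereal \<Rightarrow> ereal \<Rightarrow> (real \<Rightarrow> real) \<Rightarrow> bool" where
  "inverse_clock X X' a b G \<longleftrightarrow> a < b \<and> (\<forall>t. X t \<in> einterval a b \<and> G (X t) = t) \<and>
     (\<forall>x\<in>einterval a b. X (G x) = x \<and> (G has_real_derivative 1 / X' (G x)) (at x)) \<and>
     filterlim (G \<circ> real_of_ereal) at_top (at_left b) \<and>
     filterlim (G \<circ> real_of_ereal) at_bot (at_right a) \<and>
     (filterlim X at_bot at_bot \<longrightarrow> a = - \<infinity>) \<and> (filterlim X at_top at_top \<longrightarrow> b = \<infinity>)"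

lemma inverse_clockD:
  assumes "inverse_clock X X' a b G"
  shows "a < b" "\<And>t. X t \<in> einterval a b" "\<And>t. G (X t) = t"
    "\<And>x. x \<in> einterval a b \<Longrightarrow> X (G x) = x"
    "\<And>x. x \<in> einterval a b \<Longrightarrow> (G has_real_derivative 1 / X' (G x)) (at x)"
    "filterlim (G \<circ> real_of_ereal) at_top (at_left b)"
    "filterlim (G \<circ> real_of_ereal) at_bot (at_right a)"
    "filterlim X at_bot at_bot \<Longrightarrow> a = - \<infinity>" "filterlim X at_top at_top \<Longrightarrow> b = \<infinity>"
  using assms unfolding inverse_clock_def by blast+

lemma inverse_clock_exists:
  fixes X X' :: "real \<Rightarrow> real"
  assumes der: "\<And>t. (X has_real_derivative X' t) (at t)" and pos: "\<And>t. X' t > 0"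
  obtains a b G where "inverse_clock X X' a b G"
proof -
  define a b where "a = (INF t. ereal (X t))" and "b = (SUP t. ereal (X t))"
  have mono: "X s < X t" if "s < t" for s t
    using DERIV_pos_imp_increasing[OF that] der pos by blast
  have inj: "s = t" if "X s = X t" for s t
    using mono[of s t] mono[of t s] that by (cases s t rule: linorder_cases) auto
  have cont: "isCont X t" for t using der DERIV_isCont by blast
  have le: "a \<le> X t" "ereal (X t) \<le> b" for t unfolding a_def b_def by (auto intro: INF_lower SUP_upper)
  have lt: "a < X t" "ereal (X t) < b" for t
    using le(1)[of "t - 1"] le(2)[of "t + 1"] mono[of "t - 1" t] mono[of t "t + 1"]
    by (metis diff_add_cancel ereal_less_eq(3) le_less_trans less_add_one less_ereal.simps(1) less_le_trans le)+
  have rng: "X t \<in> einterval a b" for t using lt by (simp add: einterval_iff)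
  have surj: "\<exists>t. X t = x" if "x \<in> einterval a b" for x
  proof -
    have "a < ereal x" "ereal x < b" using that by (auto simp: einterval_iff)
    then obtain s t where st: "X s < x" "x < X t"
      unfolding a_def b_def by (auto simp: INF_less_iff less_SUP_iff)
    then have "s < t" using mono[of t s] by (cases s t rule: linorder_cases) auto
    then show ?thesis using IVT[of X s x t] st cont by auto
  qed
  define G where "G = inv X"
  have XG: "X (G x) = x" if "x \<in> einterval a b" for x
    unfolding G_def using surj[OF that] by (metis f_inv_into_f rangeI)
  have GX: "G (X t) = t" for t unfolding G_def using inj by (simp add: inj_on_def)
  have contG: "isCont G x" if "x \<in> einterval a b" for x
  proof -
    have "isCont G (X (G x))"
      by (rule isCont_inverse_function[where d = 1 and f = X]) (use cont GX in auto)
    then show ?thesis using XG that by simp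
  qed
  have derG: "(G has_real_derivative 1 / X' (G x)) (at x)" if x: "x \<in> einterval a b" for x
  proof -
    obtain e where e: "e > 0" "ball x e \<subseteq> einterval a b"
      using open_einterval x open_contains_ball by blast
    have "(G has_real_derivative inverse (X' (G x))) (at x)"
      by (rule DERIV_inverse_function[where a = "x - e" and b = "x + e", OF der _ _ _ _ contG[OF x]])
         (use pos[of "G x"] e XG in \<open>auto simp: subset_iff dist_real_def\<close>)
    then show ?thesis by (simp add: divide_inverse)
  qed
  have top: "filterlim (G \<circ> real_of_ereal) at_top (at_left b)"
    unfolding filterlim_at_top
  proof
    fix K
    have "eventually (\<lambda>e. e \<in> {ereal (X K)<..<b}) (at_left b)"
      using eventually_at_left_real lt(2) by (metis (full_types) eventually_at_left greaterThanLessThan_iff)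
    then show "eventually (\<lambda>e. K \<le> (G \<circ> real_of_ereal) e) (at_left b)"
    proof eventually_elim
      case (elim e)
      then obtain x where x: "e = ereal x" by (cases e) auto
      then have xi: "x \<in> einterval a b" using elim lt(1)[of K] less_trans[of a "ereal (X K)" "ereal x"] by (auto simp: einterval_iff)
      have "\<not> G x < K" using mono[of "G x" K] XG[OF xi] elim x by auto
      then show ?case using x by simp
    qed
  qed
  have bot: "filterlim (G \<circ> real_of_ereal) at_bot (at_right a)"
    unfolding filterlim_at_bot
  proof
    fix K
    have "eventually (\<lambda>e. e \<in> {a<..<ereal (X K)}) (at_right a)"
      using lt(1) by (metis (full_types) eventually_at_right greaterThanLessThan_iff)
    then show "eventually (\<lambda>e. (G \<circ> real_of_ereal) e \<le> K) (at_right a)"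
    proof eventually_elim
      case (elim e)
      then obtain x where x: "e = ereal x" by (cases e) auto
      then have xi: "x \<in> einterval a b" using elim lt(2)[of K] less_trans[of "ereal x" "ereal (X K)" b] by (auto simp: einterval_iff)
      have "\<not> G x > K" using mono[of K "G x"] XG[OF xi] elim x by auto
      then show ?case using x by simp
    qed
  qed
  have ab: "a < b" using lt[of 0] less_trans by blast
  have am: "a = - \<infinity>" if "filterlim X at_bot at_bot"
  proof (rule ereal_bot)
    fix B
    from that have "eventually (\<lambda>t. X t \<le> B) at_bot" by (simp add: filterlim_at_bot)
    then obtain t where "X t \<le> B" by (metis eventually_at_bot_linorder order_refl)
    then show "a \<le> ereal B" using le(1)[of t] by (metis ereal_less_eq(3) order_trans)
  qed
  have bp: "b = \<infinity>" if "filterlim X at_top at_top"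
  proof (rule ereal_top)
    fix B
    from that have "eventually (\<lambda>t. X t \<ge> B) at_top" by (simp add: filterlim_at_top)
    then obtain t where "X t \<ge> B" by (metis eventually_at_top_linorder order_refl)
    then show "ereal B \<le> b" using le(2)[of t] by (metis ereal_less_eq(3) order_trans)
  qed
  have "inverse_clock X X' a b G"
    unfolding inverse_clock_def using ab rng GX XG derG top bot am bp by blast
  then show ?thesis by (rule that)
qed

section \<open>Algebra of the phase plane\<close>

text \<open>
  On the sonic line \<open>\<sigma> = 1 - w\<close> the fields \<open>\<Delta>\<^sub>1\<close> and \<open>\<Delta>\<^sub>2\<close> are \<open>(1 - w) Q w\<close> and \<open>(1 - w) Q w / l\<close> for this
  quadratic polynomial \<open>Q\<close>.
\<close>

definition sonic_poly :: "real \<Rightarrow> real \<Rightarrow> real \<Rightarrow> real \<Rightarrow> real" where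
  "sonic_poly d l r w = (d - 1) * w\<^sup>2 - (d - 1 + (l - 1) * (r - 1)) * w + l * (r - 1)"

text \<open>
  The nullcline \<open>\<Delta>\<^sub>2 = 0\<close> is the curve \<open>l \<sigma>\<^sup>2 = null2 w\<close>.
\<close>

definition null2 :: "real \<Rightarrow> real \<Rightarrow> real \<Rightarrow> real \<Rightarrow> real" where
  "null2 d l r w = (l + d - 1) * w\<^sup>2 - (l + d + l * r - r) * w + l * r"

definition null2' :: "real \<Rightarrow> real \<Rightarrow> real \<Rightarrow> real \<Rightarrow> real" where
  "null2' d l r w = 2 * (l + d - 1) * w - (l + d + l * r - r)"

lemma null2_sonic: "null2 d l r w = sonic_poly d l r w + l * (1 - w)\<^sup>2"
  by (simp add: null2_def sonic_poly_def power2_eq_square algebra_simps)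

lemma DERIV_null2 [derivative_intros]:
  "(f has_real_derivative f') (at x) \<Longrightarrow>
   ((\<lambda>x. null2 d l r (f x)) has_real_derivative null2' d l r (f x) * f') (at x)"
  unfolding null2_def null2'_def
  by (auto intro!: derivative_eq_intros simp: algebra_simps)

lemma Delta2_null2: "l \<noteq> 0 \<Longrightarrow> Delta2 d l r s w = s / l * (null2 d l r w - l * s\<^sup>2)"
  by (simp add: Delta2_def null2_def)

locale phase_plane =
  fixes d l r :: real
  assumes d2: "d \<ge> 2" and l0: "l > 0"
    and range: "(l < d \<and> 1 < r \<and> r < r_star d l) \<or> (l > d \<and> r_star d l < r \<and> r < r_plus d l)"
begin

abbreviation "we \<equiv> w_e d l r"
abbreviation "wm \<equiv> w_minus d l r"
abbreviation "Q \<equiv> sonic_poly d l r"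
abbreviation "N2 \<equiv> null2 d l r"

text \<open>
  Common zeros of \<open>\<Delta>\<^sub>1\<close> and \<open>\<Delta>\<^sub>2\<close> with \<open>\<sigma> > 0\<close> have \<open>w\<close> at a root of \<open>Q\<close> or at \<open>w_third\<close>. Below \<open>w_bar\<close> both factors on the
  right of the elimination identity have a known sign, and \<open>null2\<close> is decreasing.
\<close>

definition "w_vertex = (d - 1 + (l - 1) * (r - 1)) / (2 * (d - 1))"
definition "w_third = l * r / (l + d)"
definition "w_bar = min w_vertex w_third"

lemma sqrt_facts: "sqrt l > 0" "(sqrt l)\<^sup>2 = l" "sqrt d > 1" "(sqrt d)\<^sup>2 = d"
  using d2 l0 by (auto simp: real_less_rsqrt)

lemma r_star_minus_1: "r_star d l - 1 = (d - sqrt d) / (l + sqrt d)"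
proof -
  have "l + sqrt d \<noteq> 0" using l0 sqrt_facts(3) by linarith
  then show ?thesis by (simp add: r_star_def divide_simps)
qed

lemma r_gt_1: "r > 1"
proof -
  have "sqrt d < d" using sqrt_facts(3,4) d2 by (metis less_1_mult mult.right_neutral mult_less_cancel_left_pos
        power2_eq_square zero_less_one less_trans)
  then have "r_star d l > 1" using r_star_minus_1 l0 sqrt_facts(3)
    by (smt (verit) divide_pos_pos)
  then show ?thesis using range by auto
qed

text \<open>
  The inequality \<open>r_star \<le> r_plus\<close> amounts to \<open>(sqrt l - sqrt d)\<^sup>2 \<ge> 0\<close>, so that \<open>r < r_plus\<close> in both
  parameter ranges.
\<close>

lemma below_r_plus: "(r - 1) * (1 + sqrt l)\<^sup>2 < d - 1"
proof -
  define a b where "a = sqrt l" and "b = sqrt d"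
  have ab: "a > 0" "a\<^sup>2 = l" "b > 1" "b\<^sup>2 = d" using sqrt_facts by (auto simp: a_def b_def)
  have pos: "(1 + a)\<^sup>2 > 0" using ab by auto
  from range show ?thesis
  proof
    assume "l < d \<and> 1 < r \<and> r < r_star d l"
    then have "r - 1 < (b\<^sup>2 - b) / (a\<^sup>2 + b)" using r_star_minus_1 ab by (simp add: b_def)
    then have "(r - 1) * (1 + a)\<^sup>2 < (b\<^sup>2 - b) / (a\<^sup>2 + b) * (1 + a)\<^sup>2"
      using pos by (rule mult_strict_right_mono)
    also have "\<dots> \<le> b\<^sup>2 - 1"
    proof -
      have "(b - 1) * (b * (1 + a)\<^sup>2) \<le> (b - 1) * ((b + 1) * (a\<^sup>2 + b))"
      proof (rule mult_left_mono)
        have "(b + 1) * (a\<^sup>2 + b) - b * (1 + a)\<^sup>2 = (a - b)\<^sup>2"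
          by (simp add: power2_eq_square algebra_simps)
        then show "b * (1 + a)\<^sup>2 \<le> (b + 1) * (a\<^sup>2 + b)"
          using zero_le_power2[of "a - b"] by linarith
      qed (use ab in auto)
      then have "(b\<^sup>2 - b) * (1 + a)\<^sup>2 \<le> (b\<^sup>2 - 1) * (a\<^sup>2 + b)"
        by (simp add: power2_eq_square algebra_simps)
      moreover have "a\<^sup>2 + b > 0" using ab(3) zero_le_power2[of a] by linarith
      ultimately show ?thesis by (simp add: divide_le_eq)
    qed
    finally show ?thesis using ab by (simp add: a_def)
  next
    assume "l > d \<and> r_star d l < r \<and> r < r_plus d l"
    then have "r - 1 < (d - 1) / (1 + a)\<^sup>2" by (simp add: r_plus_def a_def)
    then show ?thesis using pos by (simp add: less_divide_eq a_def)
  qed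
qed

text \<open>Linear consequences of \<open>r < r_plus\<close>, each a comparison of a coefficient with \<open>(1 + sqrt l)\<^sup>2\<close>.\<close>

lemma coeff_bound:
  assumes "c \<le> (1 + sqrt l)\<^sup>2"
  shows "(r - 1) * c < d - 1"
  using mult_left_mono[OF assms, of "r - 1"] r_gt_1 below_r_plus by linarith

lemma one_plus_sqrt_l: "(1 + sqrt l)\<^sup>2 = 1 + 2 * sqrt l + l"
  using sqrt_facts by (simp add: power2_sum)

lemma coeff_plus: "(l + 1) * (r - 1) < d - 1"
  using coeff_bound[of "l + 1"] sqrt_facts by (simp add: one_plus_sqrt_l mult.commute)

lemma coeff_minus: "(l - 1) * (r - 1) < d - 1"
  using coeff_bound[of "l - 1"] sqrt_facts by (simp add: one_plus_sqrt_l mult.commute)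

lemma we_pos: "we > 0"
  using d2 l0 r_gt_1 by (simp add: w_e_def)

lemma d_we: "d * we = l * (r - 1)"
  using d2 by (simp add: w_e_def)

lemma we_lt_vertex: "we < w_vertex"
proof -
  have "(r - 1) * ((l * (d - 2) + d) / d) < d - 1"
  proof (rule coeff_bound)
    have "l * (d - 2) + d \<le> d * (1 + 2 * sqrt l + l)" using d2 l0 sqrt_facts by (simp add: algebra_simps)
    then show "(l * (d - 2) + d) / d \<le> (1 + sqrt l)\<^sup>2"
      using d2 by (simp add: one_plus_sqrt_l divide_le_eq mult.commute)
  qed
  then have "(r - 1) * (l * (d - 2) + d) < (d - 1) * d" using d2 by (simp add: divide_less_eq)
  moreover have "we * (2 * (d - 1)) * d = 2 * (d - 1) * (l * (r - 1))"
    unfolding d_we[symmetric] by simp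
  ultimately have "we * (2 * (d - 1)) * d < (d - 1 + (l - 1) * (r - 1)) * d"
    by (simp add: algebra_simps)
  then have "we * (2 * (d - 1)) < d - 1 + (l - 1) * (r - 1)" using d2 by simp
  then show ?thesis using d2 by (simp add: w_vertex_def less_divide_eq)
qed

lemma vertex_lt_1: "w_vertex < 1"
  using coeff_minus d2 by (simp add: w_vertex_def divide_less_eq)

lemma J_pos: "J_disc d l r > 0"
proof -
  let ?q = "r - 1"
  define a where "a = sqrt l"
  have l: "l = a\<^sup>2" using l0 by (simp add: a_def)
  have "J_disc d l r = (?q * (1 + a)\<^sup>2 - (d - 1)) * (?q * (1 - a)\<^sup>2 - (d - 1))"
    unfolding J_disc_def l by (simp add: power2_eq_square algebra_simps)
  moreover have "?q * (1 + a)\<^sup>2 - (d - 1) < 0" using below_r_plus by (simp add: a_def)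
  moreover have "?q * (1 - a)\<^sup>2 - (d - 1) < 0"
    using coeff_bound[of "(1 - a)\<^sup>2"] sqrt_facts(1) by (simp add: a_def power2_eq_square algebra_simps)
  ultimately show ?thesis by (simp add: mult_neg_neg)
qed

lemma wm_eq: "wm = w_vertex - sqrt (J_disc d l r) / (2 * (d - 1))"
  using d2 by (simp add: w_minus_def w_vertex_def diff_divide_distrib)

lemma wm_lt_vertex: "wm < w_vertex"
  using J_pos d2 by (simp add: wm_eq)

lemma Q_factor: "Q w = (d - 1) * (w - wm) * (w + wm - 2 * w_vertex)"
proof -
  define k where "k = sqrt (J_disc d l r) / (2 * (d - 1))"
  have v: "2 * (d - 1) * w_vertex = d - 1 + (l - 1) * (r - 1)" using d2 by (simp add: w_vertex_def)
  have k: "4 * (d - 1)\<^sup>2 * k\<^sup>2 = (2 * (d - 1) * w_vertex)\<^sup>2 - 4 * (d - 1) * l * (r - 1)"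
  proof -
    have "4 * (d - 1)\<^sup>2 * k\<^sup>2 = J_disc d l r"
    proof -
      have "2 * (d - 1) * k = sqrt (J_disc d l r)" using d2 by (simp add: k_def)
      then have "(2 * (d - 1) * k)\<^sup>2 = J_disc d l r" using J_pos by simp
      then show ?thesis by (simp add: power2_eq_square algebra_simps)
    qed
    also have "\<dots> = (d - 1 + (l - 1) * (r - 1))\<^sup>2 - 4 * (d - 1) * l * (r - 1)"
      unfolding J_disc_def by (simp add: power2_eq_square algebra_simps)
    finally show ?thesis unfolding v .
  qed
  have "4 * (d - 1) * Q w = 4 * (d - 1)\<^sup>2 * w\<^sup>2 - 4 * (d - 1) * (2 * (d - 1) * w_vertex) * w + 4 * (d - 1) * l * (r - 1)"
    unfolding sonic_poly_def v by (simp add: power2_eq_square algebra_simps)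
  also have "\<dots> = 4 * (d - 1)\<^sup>2 * w\<^sup>2 - 8 * (d - 1)\<^sup>2 * w_vertex * w + ((2 * (d - 1) * w_vertex)\<^sup>2 - 4 * (d - 1)\<^sup>2 * k\<^sup>2)"
    using k by (simp add: power2_eq_square algebra_simps)
  also have "\<dots> = 4 * (d - 1) * ((d - 1) * (w - wm) * (w + wm - 2 * w_vertex))"
    unfolding wm_eq k_def[symmetric] by (simp add: power2_eq_square algebra_simps)
  finally show ?thesis using d2 by simp
qed

lemma Q_pos: "w < wm \<Longrightarrow> Q w > 0"
  unfolding Q_factor using wm_lt_vertex d2 by (intro mult_neg_neg mult_pos_neg) auto

lemma Q_neg: "wm < w \<Longrightarrow> w \<le> w_vertex \<Longrightarrow> Q w < 0"
  unfolding Q_factor using wm_lt_vertex d2 by (intro mult_pos_neg mult_pos_pos) auto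

lemma Q_wm: "Q wm = 0"
  by (simp add: Q_factor)

lemma Q_we: "Q we > 0"
proof -
  have e: "(l - 1) * (r - 1) = d * we - (r - 1)" using d_we by (simp add: algebra_simps)
  have "Q we = we * (r - we)"
    unfolding sonic_poly_def e d_we[symmetric] by (simp add: power2_eq_square algebra_simps)
  then show ?thesis using we_pos we_lt_vertex vertex_lt_1 r_gt_1 by simp
qed

lemma we_lt_wm: "we < wm"
proof (rule ccontr)
  assume "\<not> we < wm"
  then have "wm \<le> we" by simp
  then have "Q we \<le> 0"
    using Q_neg[of we] Q_wm we_lt_vertex by (cases "wm = we") auto
  then show False using Q_we by simp
qed

lemma wm_pos: "wm > 0" and wm_lt_1: "wm < 1" and we_lt_1: "we < 1"
  using we_pos we_lt_wm wm_lt_vertex vertex_lt_1 by linarith+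

text \<open>
  The linear factor of the elimination identity vanishes only beyond \<open>P\<^sub>2\<close>. For \<open>l < d\<close> this is the condition
  \<open>r < r_star\<close>: up to a positive factor \<open>Q w_third\<close> is
  \<open>(r (l + sqrt d) - (l + d)) (r (sqrt d - l) + (l + d))\<close>, whose first factor changes sign at
  \<open>r_star\<close>. For \<open>l > d\<close> its zero is even beyond the vertex of \<open>Q\<close>.
\<close>

lemma wm_lt_third: "wm < w_third"
  using range
proof
  assume A: "l < d \<and> 1 < r \<and> r < r_star d l"
  define b where "b = sqrt d"
  have b: "b > 1" "d = b\<^sup>2" using sqrt_facts by (auto simp: b_def)
  have bl: "l + b > 0" using b l0 by simp
  have n0: "l + d > 0" using l0 d2 by simp
  have f1: "r * (l + b) - (l + d) < 0"
    using A bl by (simp add: r_star_def b_def[symmetric] less_divide_eq add.commute)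
  have f2: "r * (b - l) + (l + d) > 0"
  proof (cases "l \<le> b")
    case True
    then have "r * (b - l) \<ge> 0" using r_gt_1 by simp
    then show ?thesis using n0 by linarith
  next
    case False
    have "r * (l - b) \<le> r * (l + b)" using r_gt_1 b by (intro mult_left_mono) auto
    then show ?thesis using f1 by (simp add: algebra_simps)
  qed
  have "Q w_third * (l + d)\<^sup>2 = (d - 1) * (l * r)\<^sup>2
      - (d - 1 + (l - 1) * (r - 1)) * (l * r) * (l + d) + l * (r - 1) * (l + d)\<^sup>2"
  proof -
    have t: "w_third * (l + d) = l * r" using n0 by (simp add: w_third_def)
    have "Q w_third * (l + d)\<^sup>2 = (d - 1) * (w_third * (l + d))\<^sup>2
      - (d - 1 + (l - 1) * (r - 1)) * (w_third * (l + d)) * (l + d) + l * (r - 1) * (l + d)\<^sup>2"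
      by (simp add: sonic_poly_def power2_eq_square algebra_simps)
    then show ?thesis unfolding t .
  qed
  also have "\<dots> = l * ((r * (l + b) - (l + d)) * (r * (b - l) + (l + d)))"
    unfolding b(2) by (simp add: power2_eq_square algebra_simps)
  also have "\<dots> < 0" using l0 f1 f2 by (intro mult_pos_neg mult_neg_pos) auto
  finally have "Q w_third < 0" using n0 by (simp add: mult_less_0_iff)
  then show ?thesis
    using Q_pos[of w_third] Q_wm by (cases "w_third" wm rule: linorder_cases) auto
next
  assume A: "l > d \<and> r_star d l < r \<and> r < r_plus d l"
  have n0: "l + d > 0" using l0 d2 by simp
  have "(l - d) * ((l + 1) * (r - 1)) < (l - d) * (d - 1)"
    using A coeff_plus by (intro mult_strict_left_mono) auto
  then have "(d - 1 + (l - 1) * (r - 1)) * (l + d) < l * r * (2 * (d - 1))"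
    by (simp add: algebra_simps)
  then have "w_vertex < w_third"
    unfolding w_vertex_def w_third_def using n0 d2 by (simp add: frac_less_eq divide_simps)
  then show ?thesis using wm_lt_vertex by simp
qed

lemma wm_lt_bar: "wm < w_bar"
  using wm_lt_vertex wm_lt_third by (simp add: w_bar_def)

lemma bar_lt_1: "w_bar < 1"
  using vertex_lt_1 by (simp add: w_bar_def)

lemma third_pos: "w < w_bar \<Longrightarrow> l * r - (l + d) * w > 0"
  using l0 d2 by (simp add: w_bar_def w_third_def less_divide_eq mult.commute)

lemma null2'_neg: assumes "w \<le> w_bar" shows "null2' d l r w < 0"
proof -
  have "l * ((l - 1) * (r - 1)) < l * (d - 1)" using coeff_minus l0 by simp
  then have "2 * (l + d - 1) * w_vertex < l + d + l * r - r"
    unfolding w_vertex_def using d2 by (simp add: field_simps)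
  moreover have "2 * (l + d - 1) * w \<le> 2 * (l + d - 1) * w_vertex"
    using assms l0 d2 by (intro mult_left_mono) (auto simp: w_bar_def)
  ultimately show ?thesis by (simp add: null2'_def)
qed

lemma null2_antimono:
  assumes "w1 \<le> w2" "w2 \<le> w_bar"
  shows "N2 w2 \<le> N2 w1"
proof (rule DERIV_nonpos_imp_nonincreasing[OF assms(1)])
  fix x assume "w1 \<le> x" "x \<le> w2"
  then have "null2' d l r x \<le> 0" using null2'_neg[of x] assms(2) by simp
  then show "\<exists>y. (N2 has_real_derivative y) (at x) \<and> y \<le> 0"
    using DERIV_null2[OF DERIV_ident] by force
qed

text \<open>
  Elimination of \<open>\<sigma>\<^sup>2\<close> between \<open>\<Delta>\<^sub>1 = 0\<close> and \<open>\<Delta>\<^sub>2 = 0\<close>. The sign of the right-hand side decides which of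
  the two nullclines is above the other.
\<close>

lemma nullclines_cubic:
  "l * (w * (w - 1) * (w - r)) - d * (w - we) * N2 w = Q w * (l * r - (l + d) * w)"
proof -
  have "d * (w - we) = d * w - l * (r - 1)" using d_we by (simp add: right_diff_distrib)
  then show ?thesis
    by (simp add: null2_def sonic_poly_def power2_eq_square algebra_simps)
qed

lemma cubic_pos: "0 < w \<Longrightarrow> w < 1 \<Longrightarrow> w * (w - 1) * (w - r) > 0"
  using r_gt_1 by (intro mult_neg_neg mult_pos_neg) auto

lemma Delta1_at_P2: "Delta1 d l r (1 - wm) wm = 0"
  and Delta2_at_P2: "Delta2 d l r (1 - wm) wm = 0"
proof -
  have "Delta1 d l r (1 - w) w = (1 - w) * Q w" for w
  proof -
    have "d * (w - we) = d * w - l * (r - 1)" using d_we by (simp add: right_diff_distrib)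
    then show ?thesis
      by (simp add: Delta1_def sonic_poly_def power2_eq_square algebra_simps)
  qed
  then show "Delta1 d l r (1 - wm) wm = 0" by (simp add: Q_wm)
  show "Delta2 d l r (1 - wm) wm = 0"
    using l0 by (simp add: Delta2_null2 null2_sonic Q_wm)
qed

text \<open>
  The elimination identity leaves only the zeros of \<open>Q\<close> and of the linear factor, and below \<open>w_bar\<close> the
  only one of them is \<open>w\<^sub>-\<close>.
\<close>

lemma equilibrium_is_P2:
  assumes "Delta1 d l r s w = 0" "Delta2 d l r s w = 0" "s > 0" "we < w" "w < w_bar"
  shows "w = wm" "s = 1 - wm"
proof -
  have s2: "l * s\<^sup>2 = N2 w" using assms(2,3) l0 by (simp add: Delta2_null2)
  have "l * (w * (w - 1) * (w - r)) - d * (w - we) * N2 w = l * Delta1 d l r s w"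
    by (simp add: s2[symmetric] Delta1_def algebra_simps)
  then have "Q w * (l * r - (l + d) * w) = 0" using assms(1) nullclines_cubic[of w] by simp
  then have "Q w = 0" using third_pos[OF assms(5)] by simp
  then show w: "w = wm"
    using Q_pos[of w] Q_neg[of w] assms(5) by (cases w wm rule: linorder_cases) (auto simp: w_bar_def)
  then have "s\<^sup>2 = (1 - wm)\<^sup>2" using s2 l0 by (simp add: null2_sonic Q_wm)
  then show "s = 1 - wm" using assms(3) wm_lt_1 by (simp add: power2_eq_iff_nonneg)
qed

end

lemmas Ck_intros = Ck_on_add Ck_on_diff Ck_on_minus Ck_on_mult Ck_on_power Ck_on_const Ck_on_divide
  Ck_on_linear[OF _ bounded_linear_fst] Ck_on_linear[OF _ bounded_linear_snd]
  Ck_on_linear[OF _ bounded_linear_ident] open_UNIV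

section \<open>The curve leaving P6\<close>

definition cubic :: "real \<Rightarrow> real \<Rightarrow> real" where
  "cubic r w = w * (w - 1) * (w - r)"

definition cubic' :: "real \<Rightarrow> real \<Rightarrow> real" where
  "cubic' r w = (2 * w - 1) * (w - r) + w * (w - 1)"

lemma DERIV_cubic [derivative_intros]:
  "(f has_real_derivative f') (at x) \<Longrightarrow>
   ((\<lambda>x. cubic r (f x)) has_real_derivative cubic' r (f x) * f') (at x)"
  unfolding cubic_def cubic'_def
  by (auto intro!: derivative_eq_intros simp: algebra_simps)

lemma continuous_cubic [continuous_intros]:
  "continuous_on A f \<Longrightarrow> continuous_on A (\<lambda>x. cubic r (f x))"
  unfolding cubic_def by (intro continuous_intros)

lemma continuous_null2 [continuous_intros]:
  "continuous_on A f \<Longrightarrow> continuous_on A (\<lambda>x. null2 d l r (f x))"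
  unfolding null2_def by (intro continuous_intros)

lemma tendsto_cubic [tendsto_intros]:
  "(f \<longlongrightarrow> a) F \<Longrightarrow> ((\<lambda>x. cubic r (f x)) \<longlongrightarrow> cubic r a) F"
  unfolding cubic_def by (intro tendsto_intros)

lemma tendsto_null2 [tendsto_intros]:
  "(f \<longlongrightarrow> a) F \<Longrightarrow> ((\<lambda>x. null2 d l r (f x)) \<longlongrightarrow> null2 d l r a) F"
  unfolding null2_def by (intro tendsto_intros)

lemma Ck_on_cubic: "open S \<Longrightarrow> Ck_on k f S \<Longrightarrow> Ck_on k (\<lambda>x. cubic r (f x)) S"
  unfolding cubic_def by (intro Ck_intros) auto

lemma Ck_on_null2: "open S \<Longrightarrow> Ck_on k f S \<Longrightarrow> Ck_on k (\<lambda>x. null2 d l r (f x)) S"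
  unfolding null2_def by (intro Ck_intros) auto

context phase_plane
begin

text \<open>
  With \<open>1/\<sigma>\<^sup>2 = y \<tau>\<close> and the time \<open>y\<close> defined by \<open>dx/dy = (1 - y \<tau> (1-w)\<^sup>2) / (2 y)\<close> the system has
  polynomial right-hand sides in \<open>(w, \<tau>)\<close>, and \<open>P\<^sub>6\<close> is the regular singular point \<open>y = 0\<close>. Up to
  positive factors, \<open>A\<close> and \<open>B\<close> below are \<open>\<Delta>\<^sub>1\<close> and \<open>-\<Delta>\<^sub>2\<close>. They satisfy a cooperative linear
  system, in which the derivative of each is a bounded multiple of itself plus a nonnegative multiple
  of the other, so both stay positive; and by the elimination identity they cannot both be positive
  at \<open>w = w\<^sub>-\<close>, which confines the curve to \<open>w < w\<^sub>-\<close>.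
\<close>

definition "A_in y \<tau> w = y * \<tau> * cubic r w - d * (w - we)"
definition "B_in y \<tau> w = l - y * \<tau> * N2 w"

lemma AB_imp_ne_wm:
  assumes "A_in y \<tau> w > 0" "B_in y \<tau> w > 0" "y * \<tau> > 0" "w > we"
  shows "w \<noteq> wm"
proof
  assume w: "w = wm"
  let ?t = "y * \<tau>"
  have "d * (w - we) * (?t * N2 w) \<le> d * (w - we) * l"
    using assms(2,4) d2 by (intro mult_left_mono) (auto simp: B_in_def)
  also have "\<dots> < l * (?t * cubic r w)"
    using assms(1) l0 by (simp add: A_in_def mult.commute)
  finally have "0 < ?t * (l * cubic r w - d * (w - we) * N2 w)"
    by (simp add: algebra_simps)
  also have "l * cubic r w - d * (w - we) * N2 w = 0"
    using nullclines_cubic[of w] Q_wm w by (simp add: cubic_def)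
  finally show False by simp
qed

lemma N2_pos: "w \<le> wm \<Longrightarrow> N2 w > 0"
  using Q_pos[of w] Q_wm wm_lt_1 l0 unfolding null2_sonic
  by (cases "w = wm") (auto intro!: add_pos_nonneg)

lemma N2_le: "we \<le> w \<Longrightarrow> w \<le> wm \<Longrightarrow> N2 w \<le> N2 we"
  using null2_antimono[of we w] wm_lt_bar by simp

lemma cubic'_bound: "0 \<le> w \<Longrightarrow> w \<le> 1 \<Longrightarrow> \<bar>cubic' r w\<bar> \<le> r + 1"
proof -
  assume w: "0 \<le> w" "w \<le> 1"
  have "\<bar>(2 * w - 1) * (w - r)\<bar> \<le> 1 * r"
    unfolding abs_mult using w r_gt_1 by (intro mult_mono) auto
  moreover have "\<bar>w * (w - 1)\<bar> \<le> 1 * 1"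
    unfolding abs_mult using w by (intro mult_mono) auto
  ultimately show ?thesis unfolding cubic'_def by (simp add: abs_le_iff)
qed

text \<open>
  The bounds on \<open>\<tau>\<close> and \<open>w\<close> place the region inside the square on which the clipped equations coincide
  with the true ones.
\<close>

definition "in_region y \<tau> w \<longleftrightarrow>
  A_in y \<tau> w > 0 \<and> B_in y \<tau> w > 0 \<and> 0 < \<tau> \<and> \<tau> < 2 \<and> we < w \<and> w < wm"

text \<open>
  At a first exit \<open>A\<close>, \<open>B\<close> and \<open>\<tau>\<close> are positive by the Gronwall inequality; \<open>\<tau>\<close> has decreased and \<open>w\<close> has
  increased, so the exit could only be through \<open>w = w\<^sub>-\<close>, where \<open>A\<close> and \<open>B\<close> are not both positive.
  A solution of the clipped system is known to satisfy the true equations only inside the region.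
\<close>

lemma region_invariant:
  fixes f g f' g' :: "real \<Rightarrow> real"
  assumes y0: "y0 > 0" "in_region y0 (g y0) (f y0)"
    and f: "\<And>y. (f has_real_derivative f' y) (at y)" and g: "\<And>y. (g has_real_derivative g' y) (at y)"
    and f': "\<And>y. y > 0 \<Longrightarrow> in_region y (g y) (f y) \<Longrightarrow> f' y = A_in y (g y) (f y) / (2 * y)"
    and g': "\<And>y. y > 0 \<Longrightarrow> in_region y (g y) (f y) \<Longrightarrow> g' y = - (g y)\<^sup>2 * N2 (f y) / l"
    and y: "y \<ge> y0"
  shows "in_region y (g y) (f y)"
proof -
  define A where "A y = A_in y (g y) (f y)" for y
  define B where "B y = B_in y (g y) (f y)" for y
  define m where "m y = min (min (min (A y) (B y)) (min (g y) (2 - g y))) (min (f y - we) (wm - f y))" for y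
  have m: "m y > 0 \<longleftrightarrow> in_region y (g y) (f y)" for y
    by (auto simp: m_def A_def B_def in_region_def)
  have cont: "continuous_on S f" "continuous_on S g" for S
    using f g by (auto intro!: continuous_at_imp_continuous_on DERIV_isCont)
  have contAB: "continuous_on S A" "continuous_on S B" for S
    unfolding A_def A_in_def B_def B_in_def by (intro continuous_intros cont)+
  have contm: "continuous_on S m" for S
    unfolding m_def by (intro continuous_intros cont contAB)
  have "m y > 0"
  proof (rule stays_positive[OF contm])
    show "m y0 > 0" using y0 m by blast
    show "y \<in> {y0..y}" using y by simp
  next
    fix c assume c: "y0 < c" and "\<And>x. y0 \<le> x \<Longrightarrow> x < c \<Longrightarrow> m x > 0"
    then have reg: "in_region x (g x) (f x)" if "y0 \<le> x" "x < c" for x using that m by blast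
    have r: "A x > 0" "B x > 0" "0 < g x" "g x < 2" "we < f x" "f x < wm" "x > 0"
        "0 < f x" "f x < 1" "N2 (f x) > 0" "N2 (f x) \<le> N2 we" "cubic r (f x) > 0"
        "null2' d l r (f x) < 0" if "y0 \<le> x" "x < c" for x
      using reg[OF that] that y0(1) we_pos wm_lt_1 wm_lt_bar N2_pos[of "f x"] N2_le[of "f x"]
        cubic_pos[of "f x"] null2'_neg[of "f x"]
      by (auto simp: in_region_def A_def B_def cubic_def)
    have fx: "f' x = A x / (2 * x)" and gx: "g' x = - (g x)\<^sup>2 * N2 (f x) / l"
      if "y0 \<le> x" "x < c" for x
      using f'[OF r(7) reg] g'[OF r(7) reg] that by (auto simp: A_def)
    define A' where "A' x = g x * B x / l * cubic r (f x) - (d - x * g x * cubic' r (f x)) / (2 * x) * A x" for x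
    define B' where "B' x = - (g x * N2 (f x) / l) * B x - (g x / 2 * null2' d l r (f x)) * A x" for x
    have dA: "(A has_real_derivative A' x) (at x)" if "y0 \<le> x" "x < c" for x
    proof -
      have "(A has_real_derivative (g x + g' x * x) * cubic r (f x) + x * g x * (cubic' r (f x) * f' x) - d * f' x) (at x)"
        unfolding A_def[abs_def] A_in_def by (auto intro!: derivative_eq_intros f g simp: algebra_simps)
      moreover have e: "g x + g' x * x = g x * B x / l"
        unfolding gx[OF that] B_def B_in_def using l0 by (simp add: field_simps power2_eq_square)
      have "(g x + g' x * x) * cubic r (f x) + x * g x * (cubic' r (f x) * f' x) - d * f' x = A' x"
        unfolding A'_def e fx[OF that] using r(7)[OF that]
        by (simp add: diff_divide_distrib algebra_simps)
      ultimately show ?thesis by (rule DERIV_cong)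
    qed
    have dB: "(B has_real_derivative B' x) (at x)" if "y0 \<le> x" "x < c" for x
    proof -
      have "(B has_real_derivative - ((g x + g' x * x) * N2 (f x) + x * g x * (null2' d l r (f x) * f' x))) (at x)"
        unfolding B_def[abs_def] B_in_def by (auto intro!: derivative_eq_intros f g simp: algebra_simps)
      moreover have e: "g x + g' x * x = g x * B x / l"
        unfolding gx[OF that] B_def B_in_def using l0 by (simp add: field_simps power2_eq_square)
      have "- ((g x + g' x * x) * N2 (f x) + x * g x * (null2' d l r (f x) * f' x)) = B' x"
        unfolding B'_def e fx[OF that] using r(7)[OF that] by (simp add: algebra_simps)
      ultimately show ?thesis by (rule DERIV_cong)
    qed
    have Ac: "A c > 0"
    proof -
      define M where "M = r + 1 + d / (2 * y0)"
      have "A c \<ge> A y0 * exp (- M * (c - y0))"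
      proof (rule growth_lower[OF _ contAB(1)])
        fix x assume x: "y0 < x" "x < c"
        then show "(A has_real_derivative A' x) (at x)" using dA by simp
        note rx = r[of x, OF less_imp_le[OF x(1)] x(2)]
        have "(d - x * g x * cubic' r (f x)) / (2 * x) = d / (2 * x) + g x / 2 * (- cubic' r (f x))"
          using rx by (simp add: field_simps)
        also have "\<dots> \<le> d / (2 * y0) + (r + 1)"
        proof (rule add_mono)
          show "d / (2 * x) \<le> d / (2 * y0)" using x y0 d2 by (intro divide_left_mono) auto
          have "g x / 2 * (- cubic' r (f x)) \<le> g x / 2 * (r + 1)"
            using rx cubic'_bound[of "f x"] by (intro mult_left_mono) auto
          also have "\<dots> \<le> 1 * (r + 1)" using rx r_gt_1 by (intro mult_right_mono) auto
          finally show "g x / 2 * (- cubic' r (f x)) \<le> r + 1" by simp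
        qed
        finally have "(d - x * g x * cubic' r (f x)) / (2 * x) * A x \<le> M * A x"
          using rx(1) by (intro mult_right_mono) (auto simp: M_def)
        moreover have "g x * B x / l * cubic r (f x) \<ge> 0"
          using rx l0 by simp
        ultimately show "A' x \<ge> - M * A x" by (simp add: A'_def)
      qed (use c in auto)
      moreover have "A y0 > 0" using r[of y0] c by simp
      ultimately show ?thesis by (meson exp_gt_zero less_le_trans mult_pos_pos)
    qed
    have gM: "g x * N2 (f x) / l \<le> 2 * N2 we / l" if "y0 \<le> x" "x < c" for x
      using r[OF that] l0 by (intro divide_right_mono mult_mono) auto
    have Bc: "B c > 0"
    proof -
      have "B c \<ge> B y0 * exp (- (2 * N2 we / l) * (c - y0))"
      proof (rule growth_lower[OF _ contAB(2)])
        fix x assume x: "y0 < x" "x < c"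
        then show "(B has_real_derivative B' x) (at x)" using dB by simp
        note rx = r[of x, OF less_imp_le[OF x(1)] x(2)]
        have "g x * N2 (f x) / l * B x \<le> 2 * N2 we / l * B x"
          using gM x rx by (intro mult_right_mono) auto
        moreover have "(g x / 2 * null2' d l r (f x)) * A x \<le> 0"
          using rx by (intro mult_nonpos_nonneg mult_nonneg_nonpos) auto
        ultimately show "B' x \<ge> - (2 * N2 we / l) * B x" by (simp add: B'_def)
      qed (use c in auto)
      moreover have "B y0 > 0" using r[of y0] c by simp
      ultimately show ?thesis by (meson exp_gt_zero less_le_trans mult_pos_pos)
    qed
    have gc: "g c > 0"
    proof -
      have "g c \<ge> g y0 * exp (- (2 * N2 we / l) * (c - y0))"
      proof (rule growth_lower[OF _ cont(2) g])
        fix x assume x: "y0 < x" "x < c"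
        note rx = r[of x, OF less_imp_le[OF x(1)] x(2)]
        have "g x * N2 (f x) / l * g x \<le> 2 * N2 we / l * g x"
          using gM x rx by (intro mult_right_mono) auto
        then show "g' x \<ge> - (2 * N2 we / l) * g x"
          using gx x by (simp add: power2_eq_square mult_ac)
      qed (use c in auto)
      moreover have "g y0 > 0" using r[of y0] c by simp
      ultimately show ?thesis by (meson exp_gt_zero less_le_trans mult_pos_pos)
    qed
    have g2: "g c \<le> g y0"
    proof (rule DERIV_nonpos_imp_decreasing_open[OF less_imp_le[OF c]])
      fix x assume "y0 < x" "x < c"
      then show "\<exists>y. (g has_real_derivative y) (at x) \<and> y \<le> 0"
        using g[of x] gx[of x] r(10)[of x] l0 by (intro exI[of _ "g' x"]) simp
    qed (rule cont)
    have f2: "f y0 \<le> f c"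
    proof (rule DERIV_nonneg_imp_increasing_open[OF less_imp_le[OF c]])
      fix x assume "y0 < x" "x < c"
      then show "\<exists>y. (f has_real_derivative y) (at x) \<and> y \<ge> 0"
        using f[of x] fx[of x] r(1,7)[of x] by (intro exI[of _ "f' x"]) simp
    qed (rule cont)
    have "f c \<le> wm"
    proof (rule tendsto_upperbound)
      show "(f \<longlongrightarrow> f c) (at_left c)"
        using DERIV_isCont[OF f[of c]] by (simp add: isCont_def filterlim_at_split)
      show "eventually (\<lambda>x. f x \<le> wm) (at_left c)"
        using r(6) c by (auto simp: eventually_at_left less_imp_le intro!: exI[of _ y0])
    qed auto
    moreover have "f c \<noteq> wm"
      using AB_imp_ne_wm[of c "g c" "f c"] Ac Bc gc c y0(1) f2 r(5)[of y0] by (simp add: A_def B_def)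
    ultimately have "f c < wm" by simp
    then show "m c > 0"
      unfolding m in_region_def using Ac Bc gc g2 f2 r[of y0] c by (auto simp: A_def B_def)
  qed
  then show ?thesis by (simp add: m)
qed

text \<open>
  Inside the region \<open>w\<close> and \<open>1/\<sigma>\<^sup>2 = y \<tau>\<close> increase and are bounded, so they converge, necessarily to
  an equilibrium.
\<close>

lemma region_limit:
  fixes f g :: "real \<Rightarrow> real"
  assumes y0: "y0 > 0" and reg: "\<And>y. y \<ge> y0 \<Longrightarrow> in_region y (g y) (f y)"
    and f: "\<And>y. y \<ge> y0 \<Longrightarrow> (f has_real_derivative A_in y (g y) (f y) / (2 * y)) (at y)"
    and g: "\<And>y. y \<ge> y0 \<Longrightarrow> (g has_real_derivative - (g y)\<^sup>2 * N2 (f y) / l) (at y)"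
  shows "(f \<longlongrightarrow> wm) at_top" "((\<lambda>y. y * g y) \<longlongrightarrow> 1 / (1 - wm)\<^sup>2) at_top"
proof -
  define t where "t y = y * g y" for y
  have r: "A_in y (g y) (f y) > 0" "B_in y (g y) (f y) > 0" "0 < g y" "we < f y" "f y < wm" "y > 0"
    if "y \<ge> y0" for y
    using reg[OF that] that y0 by (auto simp: in_region_def)
  have t: "(t has_real_derivative g y * B_in y (g y) (f y) / l) (at y)" if "y \<ge> y0" for y
  proof -
    have "(t has_real_derivative y * (- (g y)\<^sup>2 * N2 (f y) / l) + 1 * g y) (at y)"
      unfolding t_def by (rule DERIV_cong, rule DERIV_mult[OF DERIV_ident g[OF that]]) simp
    moreover have "y * (- (g y)\<^sup>2 * N2 (f y) / l) + 1 * g y = g y * B_in y (g y) (f y) / l"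
      unfolding B_in_def using l0 by (simp add: field_simps power2_eq_square)
    ultimately show ?thesis by simp
  qed
  have mf: "f x \<le> f y" if "y0 \<le> x" "x \<le> y" for x y
  proof (rule DERIV_nonneg_imp_nondecreasing[OF that(2)])
    fix z assume "x \<le> z" "z \<le> y"
    then show "\<exists>D. (f has_real_derivative D) (at z) \<and> 0 \<le> D"
      using f[of z] r(1,6)[of z] that by (intro exI[of _ "A_in z (g z) (f z) / (2 * z)"]) auto
  qed
  have mt: "t x \<le> t y" if "y0 \<le> x" "x \<le> y" for x y
  proof (rule DERIV_nonneg_imp_nondecreasing[OF that(2)])
    fix z assume "x \<le> z" "z \<le> y"
    then show "\<exists>D. (t has_real_derivative D) (at z) \<and> 0 \<le> D"
      using t[of z] r(2,3)[of z] that l0 by (intro exI[of _ "g z * B_in z (g z) (f z) / l"]) auto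
  qed
  obtain winf where winf: "(f \<longlongrightarrow> winf) at_top" "\<And>x. y0 \<le> x \<Longrightarrow> f x \<le> winf" "winf \<le> wm"
    using mono_bounded_tendsto_at_top[of y0 f wm] mf r(5) less_imp_le by metis
  have tb: "t y \<le> l / N2 wm" if "y \<ge> y0" for y
  proof -
    have "t y * N2 wm \<le> t y * N2 (f y)"
      using r[OF that] null2_antimono[of "f y" wm] wm_lt_bar by (intro mult_left_mono) (auto simp: t_def)
    also have "\<dots> \<le> l" using r(2)[OF that] by (simp add: B_in_def t_def)
    finally show ?thesis using N2_pos[of wm] by (simp add: le_divide_eq)
  qed
  obtain tinf where tinf: "(t \<longlongrightarrow> tinf) at_top" "\<And>x. y0 \<le> x \<Longrightarrow> t x \<le> tinf"
    using mono_bounded_tendsto_at_top[of y0 t "l / N2 wm"] mt tb by metis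
  have pos: "tinf > 0" "winf > we"
    using tinf(2)[of y0] winf(2)[of y0] r(3,4)[of y0] y0 by (auto simp: t_def intro: less_le_trans[OF mult_pos_pos])
  define E where "E s = exp (2 * s)" for s :: real
  have Etop: "filterlim E at_top at_top"
    unfolding E_def
    by (intro filterlim_compose[OF exp_at_top] filterlim_tendsto_pos_mult_at_top[OF tendsto_const _ filterlim_ident]) auto
  have E: "E s \<ge> y0" if "s \<ge> ln y0 / 2" for s
  proof -
    have "exp (ln y0) \<le> exp (2 * s)" using that by simp
    then show ?thesis using y0 by (simp add: E_def)
  qed
  have dE: "(E has_real_derivative 2 * E s) (at s)" for s
    unfolding E_def[abs_def] by (auto intro!: derivative_eq_intros)
  have limf: "((\<lambda>s. f (E s)) \<longlongrightarrow> winf) at_top" and limt: "((\<lambda>s. t (E s)) \<longlongrightarrow> tinf) at_top"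
    by (intro filterlim_compose[OF winf(1) Etop] filterlim_compose[OF tinf(1) Etop])+
  have Elim: "tinf * cubic r winf - d * (winf - we) = 0"
  proof (rule derivative_limit_zero[OF _ limf])
    show "((\<lambda>s. t (E s) * cubic r (f (E s)) - d * (f (E s) - we)) \<longlongrightarrow>
        tinf * cubic r winf - d * (winf - we)) at_top"
      by (intro tendsto_intros limf limt)
    fix s assume "s \<ge> ln y0 / 2"
    then have y: "E s \<ge> y0" by (rule E)
    show "((\<lambda>s. f (E s)) has_real_derivative t (E s) * cubic r (f (E s)) - d * (f (E s) - we)) (at s)"
      by (rule DERIV_cong[OF DERIV_chain2[OF f[OF y] dE]]) (use r(6)[OF y] in \<open>simp add: A_in_def t_def\<close>)
  qed
  have Tlim: "2 * tinf * (l - tinf * N2 winf) / l = 0"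
  proof (rule derivative_limit_zero[OF _ limt])
    show "((\<lambda>s. 2 * t (E s) * (l - t (E s) * N2 (f (E s))) / l) \<longlongrightarrow>
        2 * tinf * (l - tinf * N2 winf) / l) at_top"
      by (intro tendsto_intros limf limt) (use l0 in auto)
    fix s assume "s \<ge> ln y0 / 2"
    then have y: "E s \<ge> y0" by (rule E)
    show "((\<lambda>s. t (E s)) has_real_derivative 2 * t (E s) * (l - t (E s) * N2 (f (E s))) / l) (at s)"
      by (rule DERIV_cong[OF DERIV_chain2[OF t[OF y] dE]]) (use r(6)[OF y] in \<open>simp add: B_in_def t_def\<close>)
  qed
  define s where "s = 1 / sqrt tinf"
  have s: "s > 0" "s\<^sup>2 = 1 / tinf" using pos by (auto simp: s_def power_divide)
  have "tinf * Delta1 d l r s winf = tinf * cubic r winf - d * (winf - we)"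
    using pos by (simp add: Delta1_def s(2) cubic_def algebra_simps)
  then have D1: "Delta1 d l r s winf = 0" using Elim pos by simp
  have "l - tinf * N2 winf = 0" using Tlim pos l0 by simp
  then have D2: "Delta2 d l r s winf = 0"
    using l0 pos by (simp add: Delta2_null2 s(2) field_simps)
  have eq: "winf = wm" "s = 1 - wm"
    using equilibrium_is_P2[OF D1 D2 s(1) pos(2)] winf(3) wm_lt_bar by auto
  have "tinf = 1 / (1 - wm)\<^sup>2" using s(2) pos unfolding eq(2) by simp
  then show "(f \<longlongrightarrow> wm) at_top" "((\<lambda>y. y * g y) \<longlongrightarrow> 1 / (1 - wm)\<^sup>2) at_top"
    using winf(1) tinf(1) eq(1) by (auto simp: t_def[abs_def])
qed

text \<open>
  The clipped equations are solved on the whole line. Near the origin \<open>A\<close> is \<open>2 y w'\<close> with \<open>w' 0 > 0\<close>, so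
  the solution enters the region and from then on solves the true equations. Smoothness follows
  by bootstrapping, across \<open>y = 0\<close> through the smoothness of ray averages. \<open>I\<close> is the quadrature
  in the clock \<open>x = (ln y - I) / 2\<close>.
\<close>

lemma inner_curve:
  assumes n: "d = real n"
  obtains e :: real and w \<tau> I w' :: "real \<Rightarrow> real" where
    "\<And>y. (w has_real_derivative w' y) (at y)"
    "\<And>k. Ck_on k w {-e<..}" "\<And>k. Ck_on k \<tau> {-e<..}" "\<And>k. Ck_on k I {-e<..}"
    "e > 0" "w 0 = we" "\<tau> 0 = 1" "I 0 = 0"
    "\<And>y. y > -e \<Longrightarrow> \<tau> y > 0"
    "\<And>y. y > 0 \<Longrightarrow> in_region y (\<tau> y) (w y)"
    "\<And>y. y > 0 \<Longrightarrow> w' y = A_in y (\<tau> y) (w y) / (2 * y)"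
    "\<And>y. y > -e \<Longrightarrow> (\<tau> has_real_derivative - (\<tau> y)\<^sup>2 * N2 (w y) / l) (at y)"
    "\<And>y. y > -e \<Longrightarrow> (I has_real_derivative \<tau> y * (1 - w y)\<^sup>2) (at y)"
    "(w \<longlongrightarrow> wm) at_top" "((\<lambda>y. y * \<tau> y) \<longlongrightarrow> 1 / (1 - wm)\<^sup>2) at_top"
proof -
  define F1 :: "real \<times> real \<Rightarrow> real" where "F1 z = 1 / 2 * (snd z * cubic r (fst z))" for z
  define F2 :: "real \<times> real \<Rightarrow> real" where "F2 z = - (snd z)\<^sup>2 * N2 (fst z) / l" for z
  define F3 :: "real \<times> real \<Rightarrow> real" where "F3 z = snd z * (1 - fst z)\<^sup>2" for z
  have C: "Ck_on k F1 UNIV" "Ck_on k F2 UNIV" "Ck_on k F3 UNIV" for k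
    unfolding F1_def F2_def F3_def using l0 by (intro Ck_intros Ck_on_cubic Ck_on_null2; simp)+
  obtain f g h where sol: "clipped_solution 2 F1 F2 F3 n f g h"
    and init: "f 0 = we" "g 0 = 1" "h 0 = 0"
    using clipped_system_exists[OF C zero_le_numeral] by metis
  have cont: "continuous_on UNIV f" "continuous_on UNIV g"
    using sol unfolding clipped_solution_def by blast+
  define H where "H y = F1 (clip 2 (f y), clip 2 (g y))" for y
  define f' where "f' y = H y - real n / 2 * ray_mean n H y" for y
  define g' where "g' y = F2 (clip 2 (f y), clip 2 (g y))" for y
  have df': "(f has_real_derivative f' y) (at y)" and dg': "(g has_real_derivative g' y) (at y)"
    and dh: "(h has_real_derivative F3 (clip 2 (f y), clip 2 (g y))) (at y)"
    and fint: "f y = we + y * ray_mean n H y" for y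
    using sol unfolding clipped_solution_def init(1) f'_def g'_def H_def[abs_def] by blast+
  have contH: "continuous_on UNIV H"
    unfolding H_def by (intro continuous_on_compose2[OF Ck_on_imp_continuous[OF C(1)[of 0]]] continuous_intros cont) auto
  have contm: "continuous_on UNIV (ray_mean n H)"
    by (rule continuous_on_ray_mean[OF _ _ contH]) auto
  have contf': "continuous_on UNIV f'"
    unfolding f'_def by (intro continuous_intros contH contm)
  have free: "clip 2 (f y) = f y" "clip 2 (g y) = g y" if "0 < f y" "f y < 1" "0 < g y" "g y < 2" for y
    using that by (auto intro!: clip_id)
  have yf': "2 * y * f' y = A_in y (g y) (f y)" if "0 < f y" "f y < 1" "0 < g y" "g y < 2" for y
  proof -
    have "2 * y * f' y = 2 * y * H y - d * (y * ray_mean n H y)"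
      by (simp add: f'_def n algebra_simps)
    also have "y * ray_mean n H y = f y - we" using fint[of y] by simp
    finally show ?thesis using free[OF that] by (simp add: A_in_def H_def F1_def)
  qed
  have f'0: "f' 0 > 0"
  proof -
    have "ray_mean n H 0 = ray_mean n (\<lambda>_. H 0) 0" by (simp add: ray_mean_def)
    then have "f' 0 = H 0 * (2 / (2 + d))" using d2 by (simp add: f'_def ray_mean_const n field_simps)
    moreover have "H 0 > 0"
      using free[of 0] we_pos we_lt_1 cubic_pos[of we] by (simp add: H_def F1_def init cubic_def)
    ultimately show ?thesis using d2 by simp
  qed
  \<comment> \<open>All conditions defining the region, except those that degenerate at the origin, hold near it.\<close>
  define m where "m y = min (min (min (f y) (wm - f y)) (min (g y) (2 - g y))) (min (f' y) (B_in y (g y) (f y)))" for y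
  have "continuous_on UNIV m"
    unfolding m_def B_in_def by (intro continuous_intros cont contf')
  moreover have "m 0 > 0"
    using init we_pos we_lt_wm f'0 l0 by (simp add: m_def B_in_def)
  then have "isCont m 0" using calculation by (simp add: continuous_on_eq_continuous_at)
  then have "(m \<longlongrightarrow> m 0) (at 0)" by (simp add: isCont_def)
  from order_tendstoD(1)[OF this \<open>m 0 > 0\<close>] obtain e where e: "e > 0"
    "\<And>y. y \<noteq> 0 \<Longrightarrow> \<bar>y\<bar> < e \<Longrightarrow> m y > 0"
    unfolding eventually_at dist_real_def by auto
  have e: "e > 0" "\<And>y. \<bar>y\<bar> < e \<Longrightarrow> m y > 0"
    using e \<open>m 0 > 0\<close> by (metis, metis)
  have near: "0 < f y" "f y < wm" "f y < 1" "0 < g y" "g y < 2" "f' y > 0" "B_in y (g y) (f y) > 0" if "\<bar>y\<bar> < e" for y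
    using e(2)[OF that] wm_lt_1 by (auto simp: m_def)
  have reg0: "in_region y (g y) (f y)" if y: "0 < y" "y < e" for y
  proof -
    note ny = near[of y]
    have "f 0 < f y"
    proof (rule DERIV_pos_imp_increasing[OF y(1)])
      fix x assume "0 \<le> x" "x \<le> y"
      then show "\<exists>D. (f has_real_derivative D) (at x) \<and> D > 0" using df'[of x] near(6)[of x] y by auto
    qed
    moreover have "A_in y (g y) (f y) > 0" using yf'[of y] ny y by (metis abs_of_pos mult_pos_pos zero_less_numeral)
    ultimately show ?thesis using ny y init by (auto simp: in_region_def)
  qed
  have unf: "f' y = A_in y (g y) (f y) / (2 * y)" "g' y = - (g y)\<^sup>2 * N2 (f y) / l"
    if "y > 0" "in_region y (g y) (f y)" for y
  proof -
    have b: "0 < f y" "f y < 1" "0 < g y" "g y < 2"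
      using that we_pos wm_lt_1 by (auto simp: in_region_def)
    show "f' y = A_in y (g y) (f y) / (2 * y)" using yf'[OF b] that(1) by (simp add: field_simps)
    show "g' y = - (g y)\<^sup>2 * N2 (f y) / l" using free[OF b] by (simp add: g'_def F2_def)
  qed
  have reg: "in_region y (g y) (f y)" if y: "y > 0" for y
  proof (cases "y < e")
    case False
    then show ?thesis
      using region_invariant[OF _ reg0 df' dg' unf, of "e / 2" y] e(1) by auto
  qed (use reg0 y in auto)
  have b: "0 < f y" "f y < 1" "0 < g y" "g y < 2" if "y > -e" for y
    using near[of y] reg[of y] that we_pos wm_lt_1 by (cases "y > 0"; force simp: in_region_def)+
  have J: "open {-e<..}" "convex {-e<..}" "0 \<in> {-e<..}" using e by auto
  have dgJ: "(g has_real_derivative - (g y)\<^sup>2 * N2 (f y) / l) (at y)" if "y > -e" for y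
    using dg'[of y] free[OF b[OF that]] by (simp add: g'_def F2_def)
  have dhJ: "(h has_real_derivative g y * (1 - f y)\<^sup>2) (at y)" if "y > -e" for y
    using dh[of y] free[OF b[OF that]] by (simp add: F3_def)
  have Ckfg: "Ck_on k f {-e<..} \<and> Ck_on k g {-e<..}" for k
  proof (induction k)
    case 0
    then show ?case using cont continuous_on_subset by auto
  next
    case (Suc k)
    have "Ck_on k (\<lambda>y. 1 / 2 * (g y * cubic r (f y))) {-e<..}"
      using Suc J(1) by (intro Ck_intros Ck_on_cubic) auto
    then have "Ck_on k H {-e<..}"
      by (rule Ck_on_cong[OF J(1), rotated]) (use free b in \<open>auto simp: H_def F1_def\<close>)
    then have "Ck_on k f' {-e<..}"
      unfolding f'_def using J by (intro Ck_intros Ck_on_ray_mean) auto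
    then have "Ck_on (Suc k) f {-e<..}"
      by (intro Ck_on_realI[OF J(1) df'])
    moreover have "Ck_on k (\<lambda>y. - (g y)\<^sup>2 * N2 (f y) / l) {-e<..}"
      using Suc J(1) l0 by (intro Ck_intros Ck_on_null2) auto
    then have "Ck_on (Suc k) g {-e<..}"
      by (intro Ck_on_realI[OF J(1) dgJ]) auto
    ultimately show ?case ..
  qed
  have Ckh: "Ck_on k h {-e<..}" for k
  proof -
    have "Ck_on k (\<lambda>y. g y * (1 - f y)\<^sup>2) {-e<..}"
      using Ckfg J(1) by (intro Ck_intros) auto
    then have "Ck_on (Suc k) h {-e<..}" by (intro Ck_on_realI[OF J(1) dhJ]) auto
    then show ?thesis by (rule Ck_on_lower)
  qed
  have lim: "(f \<longlongrightarrow> wm) at_top" "((\<lambda>y. y * g y) \<longlongrightarrow> 1 / (1 - wm)\<^sup>2) at_top"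
  proof -
    have 1: "(f has_real_derivative A_in y (g y) (f y) / (2 * y)) (at y)" if "y \<ge> 1" for y
      using df'[of y] unf(1)[of y] reg[of y] that by simp
    have 2: "(g has_real_derivative - (g y)\<^sup>2 * N2 (f y) / l) (at y)" if "y \<ge> 1" for y
      using dgJ[of y] that e(1) by simp
    have 3: "in_region y (g y) (f y)" if "y \<ge> 1" for y using reg that by simp
    show "(f \<longlongrightarrow> wm) at_top" "((\<lambda>y. y * g y) \<longlongrightarrow> 1 / (1 - wm)\<^sup>2) at_top"
      using region_limit[OF zero_less_one 3 1 2] by auto
  qed
  have unf': "f' y = A_in y (g y) (f y) / (2 * y)" if "y > 0" for y
    using unf(1) reg that by blast
  show ?thesis
    by (rule that[OF df' conjunct1[OF Ckfg] conjunct2[OF Ckfg] Ckh e(1) init b(3) reg unf' dgJ dhJ lim])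
qed

end

lemma filterlim_at_right_MInf_iff:
  "filterlim (f \<circ> real_of_ereal) F (at_right (- \<infinity>)) \<longleftrightarrow> filterlim f F at_bot"
  by (simp add: at_right_MInf filterlim_filtermap o_def)

lemma filterlim_at_left_PInf_iff:
  "filterlim (f \<circ> real_of_ereal) F (at_left \<infinity>) \<longleftrightarrow> filterlim f F at_top"
  by (simp add: at_left_PInf filterlim_filtermap o_def)

lemma DERIV_recip_sqrt:
  assumes u: "(u has_real_derivative u') (at x)" and pos: "u x > 0"
  shows "((\<lambda>x. 1 / sqrt (u x)) has_real_derivative - (u' / (2 * u x)) * (1 / sqrt (u x))) (at x)"
proof -
  have e: "sqrt (u x) * sqrt (u x) = u x" using pos by simp
  have "((\<lambda>x. sqrt (u x)) has_real_derivative inverse (sqrt (u x)) / 2 * u') (at x)"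
    by (rule DERIV_chain2[OF DERIV_real_sqrt[OF pos] u])
  moreover have "sqrt (u x) \<noteq> 0" using pos by simp
  ultimately have "((\<lambda>x. 1 / sqrt (u x)) has_real_derivative
      (0 * sqrt (u x) - 1 * (inverse (sqrt (u x)) / 2 * u')) / (sqrt (u x) * sqrt (u x))) (at x)"
    by (rule DERIV_divide[OF DERIV_const])
  moreover have "(0 * sqrt (u x) - 1 * (inverse (sqrt (u x)) / 2 * u')) / (sqrt (u x) * sqrt (u x))
      = - (u' / (2 * u x)) * (1 / sqrt (u x))"
  proof -
    have "(0 * R - 1 * (inverse R / 2 * v)) / U = - (v / (2 * U)) * (1 / R)" for R U v :: real
      by (simp add: inverse_eq_divide)
    from this[of "sqrt (u x)" u' "u x"] show ?thesis unfolding e .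
  qed
  ultimately show ?thesis by (rule DERIV_cong)
qed

context phase_plane
begin

text \<open>
  Here \<open>l (1-w)\<^sup>2 < N2 w < l \<sigma>\<^sup>2\<close>, because \<open>Q > 0\<close> to the left of \<open>w\<^sub>-\<close> and \<open>B > 0\<close>.
\<close>

lemma region_subsonic:
  assumes "in_region y \<tau> w" "y > 0"
  shows "y * \<tau> * (1 - w)\<^sup>2 < 1"
proof -
  have t: "y * \<tau> > 0" using assms by (simp add: in_region_def)
  have "l * (y * \<tau> * (1 - w)\<^sup>2) = y * \<tau> * (l * (1 - w)\<^sup>2)" by simp
  also have "\<dots> \<le> y * \<tau> * N2 w"
    using Q_pos[of w] assms t by (intro mult_left_mono) (auto simp: null2_sonic in_region_def)
  also have "\<dots> < l * 1" using assms by (simp add: in_region_def B_in_def)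
  finally show ?thesis using l0 by (simp only: mult_less_cancel_left_pos)
qed

text \<open>
  The desingularised curve, run by the clock \<open>x\<close>, is a trajectory from \<open>P\<^sub>6\<close> to \<open>P\<^sub>2\<close>. As functions of \<open>Y = e\<^sup>2\<^sup>x = \<bar>Z\<bar>\<^sup>2\<close>, both \<open>T = Y \<sigma>\<^sup>2\<close> and \<open>w\<close>
  extend smoothly across \<open>Y = 0\<close>; this is what makes the Euler solution smooth at the origin.
\<close>

lemma inner_trajectory:
  assumes n: "d = real n"
  obtains b :: ereal and \<sigma> w T om :: "real \<Rightarrow> real" and J :: "real set" where
    "connects_P6_P2 d l r b \<sigma> w"
    "open J" "0 \<in> J" "\<And>k. Ck_on k T J" "\<And>k. Ck_on k om J" "\<And>Y. Y \<in> J \<Longrightarrow> T Y > 0"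
    "T 0 = 1" "om 0 = we"
    "\<And>x. ereal x < b \<Longrightarrow> exp (2 * x) \<in> J \<and> T (exp (2 * x)) = exp (2 * x) * (\<sigma> x)\<^sup>2 \<and> om (exp (2 * x)) = w x"
    "\<And>x. ereal x < b \<Longrightarrow> Delta (\<sigma> x) (w x) < 0"
proof -
  obtain e :: real and w \<tau> I w' :: "real \<Rightarrow> real" where
    dw: "\<And>y. (w has_real_derivative w' y) (at y)"
    and Ck: "\<And>k. Ck_on k w {-e<..}" "\<And>k. Ck_on k \<tau> {-e<..}" "\<And>k. Ck_on k I {-e<..}"
    and e: "e > 0" and init: "w 0 = we" "\<tau> 0 = 1" "I 0 = 0"
    and tau: "\<And>y. y > -e \<Longrightarrow> \<tau> y > 0"
    and reg: "\<And>y. y > 0 \<Longrightarrow> in_region y (\<tau> y) (w y)"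
    and w': "\<And>y. y > 0 \<Longrightarrow> w' y = A_in y (\<tau> y) (w y) / (2 * y)"
    and dtau: "\<And>y. y > -e \<Longrightarrow> (\<tau> has_real_derivative - (\<tau> y)\<^sup>2 * N2 (w y) / l) (at y)"
    and dI: "\<And>y. y > -e \<Longrightarrow> (I has_real_derivative \<tau> y * (1 - w y)\<^sup>2) (at y)"
    and lim: "(w \<longlongrightarrow> wm) at_top" "((\<lambda>y. y * \<tau> y) \<longlongrightarrow> 1 / (1 - wm)\<^sup>2) at_top"
    by (rule inner_curve[OF n], rule that)
  define t where "t y = y * \<tau> y" for y
  define D where "D y = 1 - t y * (1 - w y)\<^sup>2" for y
  have D: "D y > 0" if "y > -e" for y
  proof (cases "y > 0")
    case True
    then show ?thesis using region_subsonic[OF reg] by (simp add: D_def t_def)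
  next
    case False
    then have "t y * (1 - w y)\<^sup>2 \<le> 0"
      using tau[OF that] by (intro mult_nonpos_nonneg) (auto simp: t_def mult_nonpos_nonneg)
    then show ?thesis by (simp add: D_def)
  qed
  define E where "E s = exp (2 * s)" for s :: real
  have E: "E s > 0" "E s > -e" for s using e by (auto simp: E_def intro: less_trans[of _ 0])
  have dE: "(E has_real_derivative 2 * E s) (at s)" for s
    unfolding E_def[abs_def] by (auto intro!: derivative_eq_intros)
  \<comment> \<open>the physical variable \<open>x\<close> as a function of the desingularised time \<open>s = ln y / 2\<close>\<close>
  define X where "X s = s - I (E s) / 2" for s
  have dX: "(X has_real_derivative D (E s)) (at s)" for s
    unfolding X_def[abs_def]
    by (auto intro!: derivative_eq_intros DERIV_chain2[OF dI[OF E(2)] dE] simp: D_def t_def)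
  obtain a b G where "inverse_clock X (\<lambda>s. D (E s)) a b G"
    using inverse_clock_exists[OF dX D[OF E(2)]] by blast
  note tc = inverse_clockD[OF this]
  have I0: "I y \<ge> 0" if "y \<ge> 0" for y
  proof -
    have "I 0 \<le> I y"
    proof (rule DERIV_nonneg_imp_nondecreasing[OF that])
      fix x assume "0 \<le> x" "x \<le> y"
      then have "x > -e" using e by simp
      then show "\<exists>D. (I has_real_derivative D) (at x) \<and> 0 \<le> D" using dI[of x] tau[of x] by (auto intro!: exI)
    qed
    then show ?thesis using init by simp
  qed
  have "filterlim X at_bot at_bot"
    by (rule filterlim_at_bot_mono[OF filterlim_ident])
       (use I0[OF less_imp_le[OF E(1)]] in \<open>simp add: X_def\<close>)
  then have a: "a = - \<infinity>" by (rule tc(8))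
  have ein: "x \<in> einterval a b \<longleftrightarrow> ereal x < b" for x by (simp add: a einterval_iff)
  define sg where "sg x = 1 / sqrt (t (E (G x)))" for x
  define wx where "wx x = w (E (G x))" for x
  have tpos: "t (E s) > 0" for s using reg[OF E(1)[of s]] E(1)[of s] by (simp add: t_def in_region_def)
  have sq: "(sg x)\<^sup>2 = 1 / t (E (G x))" "sg x > 0" for x
    using tpos[of "G x"] by (auto simp: sg_def power_divide)
  have Dl: "Delta (sg x) (wx x) = - D (E (G x)) / t (E (G x))" for x
    using tpos[of "G x"] by (simp add: Delta_def sq D_def wx_def field_simps power2_commute)
  have dt: "((\<lambda>s. t (E s)) has_real_derivative 2 * t (E s) * B_in (E s) (\<tau> (E s)) (w (E s)) / l) (at s)" for s
  proof -
    have "(t has_real_derivative E s * (- (\<tau> (E s))\<^sup>2 * N2 (w (E s)) / l) + 1 * \<tau> (E s)) (at (E s))"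
      unfolding t_def by (rule DERIV_cong, rule DERIV_mult[OF DERIV_ident dtau[OF E(2)]]) simp
    from DERIV_chain2[OF this dE] show ?thesis
      by (rule DERIV_cong) (use l0 in \<open>simp add: B_in_def t_def field_simps power2_eq_square\<close>)
  qed
  have "trajectory d l r a b sg wx"
    unfolding trajectory_def
  proof (intro conjI ballI tc(1) sq(2))
    fix x assume x: "x \<in> einterval a b"
    let ?s = "G x"
    let ?y = "E ?s"
    have Dy: "D ?y > 0" by (rule D[OF E(2)])
    show "Delta (sg x) (wx x) \<noteq> 0" using Dl Dy tpos[of ?s] by simp
    define s' where "s' = - (B_in ?y (\<tau> ?y) (w ?y) / (l * D ?y)) * sg x"
    define v' where "v' = A_in ?y (\<tau> ?y) (w ?y) / D ?y"
    have "(wx has_real_derivative v') (at x)"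
      unfolding wx_def[abs_def]
      by (rule DERIV_cong[OF DERIV_chain2[OF dw DERIV_chain2[OF dE tc(5)[OF x]]]])
         (use E(1)[of ?s] Dy in \<open>simp add: w' v'_def\<close>)
    moreover have "(sg has_real_derivative s') (at x)"
    proof -
      have "((\<lambda>x. t (E (G x))) has_real_derivative
          2 * t ?y * B_in ?y (\<tau> ?y) (w ?y) / l * (1 / D ?y)) (at x)"
        by (rule DERIV_chain2[OF dt tc(5)[OF x]])
      from DERIV_recip_sqrt[OF this tpos[of ?s]] show ?thesis
        unfolding sg_def[abs_def] s'_def
        by (rule DERIV_cong) (use tpos[of ?s] l0 Dy in \<open>simp add: sg_def\<close>)
    qed
    moreover have "Delta (sg x) (wx x) * v' = - Delta1 d l r (sg x) (wx x)"
      using tpos[of ?s] Dy unfolding Dl v'_def Delta1_def sq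
      by (simp add: A_in_def t_def[symmetric] wx_def cubic_def field_simps)
    moreover have "Delta (sg x) (wx x) * s' = - Delta2 d l r (sg x) (wx x)"
      using tpos[of ?s] Dy l0 unfolding Dl s'_def Delta2_null2[OF less_imp_neq[OF l0, symmetric]] sq
      by (simp add: B_in_def t_def[symmetric] wx_def field_simps)
    ultimately show "\<exists>\<sigma>' w'. (sg has_real_derivative \<sigma>') (at x) \<and> (wx has_real_derivative w') (at x) \<and>
        Delta (sg x) (wx x) * w' = - Delta1 d l r (sg x) (wx x) \<and>
        Delta (sg x) (wx x) * \<sigma>' = - Delta2 d l r (sg x) (wx x)" by blast
  qed
  moreover have Gbot: "filterlim G at_bot at_bot"
    using tc(7) unfolding a filterlim_at_right_MInf_iff .
  have Ebot: "((\<lambda>x. E (G x)) \<longlongrightarrow> 0) at_bot"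
    unfolding E_def
    by (intro filterlim_compose[OF exp_at_bot] filterlim_tendsto_pos_mult_at_bot[OF tendsto_const _ Gbot]) auto
  have cw: "isCont w y" for y using dw DERIV_isCont by blast
  have ct: "isCont \<tau> 0" using dtau[of 0] e DERIV_isCont by auto
  have "(wx \<longlongrightarrow> we) at_bot"
    unfolding wx_def using isCont_tendsto_compose[OF cw Ebot] init by simp
  moreover have "filterlim sg at_top at_bot"
  proof -
    have "((\<lambda>x. sqrt (E (G x) * \<tau> (E (G x)))) \<longlongrightarrow> sqrt (0 * \<tau> 0)) at_bot"
      by (intro tendsto_intros Ebot isCont_tendsto_compose[OF ct Ebot])
    then have "((\<lambda>x. sqrt (t (E (G x)))) \<longlongrightarrow> 0) at_bot" by (simp add: t_def)
    moreover have "eventually (\<lambda>x. 0 < sqrt (t (E (G x)))) at_bot" using tpos by simp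
    ultimately show ?thesis
      unfolding sg_def divide_inverse mult_1 by (rule filterlim_inverse_at_top)
  qed
  moreover have "(((\<lambda>x. (sg x, wx x)) \<circ> real_of_ereal) \<longlongrightarrow> P2 d l r) (at_left b)"
  proof -
    have Et: "filterlim (\<lambda>z. E ((G \<circ> real_of_ereal) z)) at_top (at_left b)"
      unfolding E_def
      by (intro filterlim_compose[OF exp_at_top] filterlim_tendsto_pos_mult_at_top[OF tendsto_const _ tc(6)]) auto
    have "((\<lambda>z. 1 / sqrt (t (E ((G \<circ> real_of_ereal) z)))) \<longlongrightarrow> 1 / sqrt (1 / (1 - wm)\<^sup>2)) (at_left b)"
      unfolding t_def using wm_lt_1
      by (intro tendsto_intros filterlim_compose[OF lim(2) Et]) auto
    moreover have "1 / sqrt (1 / (1 - wm)\<^sup>2) = 1 - wm"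
      using wm_lt_1 by (simp add: real_sqrt_divide)
    ultimately show ?thesis
      unfolding P2_def o_def sg_def wx_def
      using filterlim_compose[OF lim(1) Et] by (intro tendsto_Pair) (simp_all add: o_def)
  qed
  ultimately have conn: "connects_P6_P2 d l r b sg wx"
    unfolding connects_P6_P2_def a by simp

  \<comment> \<open>\<open>Y\<close> as a smooth increasing function of \<open>y\<close> on a neighbourhood of \<open>[0, \<infinity>)\<close>, and its inverse\<close>
  define Yf where "Yf y = y * exp (- I y)" for y
  define Yf' where "Yf' y = exp (- I y) * D y" for y
  have dY: "(Yf has_real_derivative Yf' y) (at y)" if "y > -e" for y
    unfolding Yf_def[abs_def] Yf'_def
    by (auto intro!: derivative_eq_intros dI[OF that] simp: D_def t_def algebra_simps)
  define V where "V v = exp v - e" for v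
  have V: "V v > -e" for v by (simp add: V_def)
  have dV: "(V has_real_derivative exp v) (at v)" for v
    unfolding V_def[abs_def] by (auto intro!: derivative_eq_intros)
  have dX2: "((\<lambda>v. Yf (V v)) has_real_derivative Yf' (V v) * exp v) (at v)" for v
    by (rule DERIV_chain2[OF dY[OF V] dV])
  have pos2: "Yf' (V v) * exp v > 0" for v using D[OF V] by (simp add: Yf'_def)
  obtain a2 b2 G2 where ic2: "inverse_clock (\<lambda>v. Yf (V v)) (\<lambda>v. Yf' (V v) * exp v) a2 b2 G2"
    using inverse_clock_exists[OF dX2 pos2] by blast
  note tc2 = inverse_clockD(2-5)[OF ic2]
  define J where "J = einterval a2 b2"
  define inv where "inv Y = V (G2 Y)" for Y
  have J: "open J" by (simp add: J_def)
  have VJ: "\<exists>v. V v = y" if "y > -e" for y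
    using that by (intro exI[of _ "ln (y + e)"]) (simp add: V_def)
  have YJ: "Yf y \<in> J" "inv (Yf y) = y" if "y > -e" for y
    using VJ[OF that] tc2(1,2) by (auto simp: J_def inv_def)
  have inv: "inv Y > -e" "Yf (inv Y) = Y" if "Y \<in> J" for Y
    using V tc2(3) that by (auto simp: inv_def J_def)
  have dinv: "(inv has_real_derivative 1 / Yf' (inv Y)) (at Y)" if "Y \<in> J" for Y
    unfolding inv_def[abs_def]
    by (rule DERIV_cong[OF DERIV_chain2[OF dV tc2(4)]]) (use that in \<open>auto simp: J_def\<close>)
  have S: "open {-e<..}" by simp
  have CkE: "Ck_on k (\<lambda>y. exp (- I y)) {-e<..}" for k
    by (rule Ck_on_compose[OF S _ Ck_on_minus[OF S Ck(3)] Ck_on_exp]) auto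
  have CkY': "Ck_on k Yf' {-e<..}" for k
    unfolding Yf'_def D_def t_def using Ck S by (intro Ck_intros CkE) auto
  have Y'pos: "Yf' y \<noteq> 0" if "y \<in> {-e<..}" for y
    using D[of y] that by (simp add: Yf'_def)
  have Ckinv: "Ck_on k inv J" for k
    by (rule Ck_on_inverse_function[OF S J _ dinv CkY' Y'pos]) (use inv in auto)
  have CkTy: "Ck_on k (\<lambda>y. exp (- I y) / \<tau> y) {-e<..}" for k
    using Ck S CkE tau by (intro Ck_intros) (auto simp: less_imp_neq[symmetric])
  define T where "T Y = exp (- I (inv Y)) / \<tau> (inv Y)" for Y
  define om where "om Y = w (inv Y)" for Y
  have 0: "0 \<in> J" "inv 0 = 0" using YJ[of 0] e by (auto simp: Yf_def)
  have phys: "exp (2 * x) \<in> J \<and> T (exp (2 * x)) = exp (2 * x) * (sg x)\<^sup>2 \<and> om (exp (2 * x)) = wx x"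
    if "ereal x < b" for x
  proof -
    have x: "x \<in> einterval a b" using that ein by simp
    let ?y = "E (G x)"
    have "exp (2 * x) = exp (2 * X (G x))" using tc(4)[OF x] by simp
    also have "2 * X (G x) = 2 * G x + - I ?y" by (simp add: X_def)
    also have "exp (2 * G x + - I ?y) = Yf ?y" by (simp only: exp_add Yf_def E_def)
    finally have Y: "exp (2 * x) = Yf ?y" .
    have "T (Yf ?y) = Yf ?y * (sg x)\<^sup>2"
      using YJ(2)[OF E(2)[of "G x"]] E(1)[of "G x"] by (simp add: T_def sq Yf_def t_def)
    then show ?thesis
      unfolding Y using YJ[OF E(2)[of "G x"]] by (simp add: om_def wx_def)
  qed
  show ?thesis
  proof (rule that[OF conn J 0(1)])
    show "Ck_on k T J" for k
      unfolding T_def by (rule Ck_on_compose[OF J _ Ckinv CkTy]) (use inv in auto)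
    show "Ck_on k om J" for k
      unfolding om_def by (rule Ck_on_compose[OF J _ Ckinv Ck(1)]) (use inv in auto)
    show "T Y > 0" if "Y \<in> J" for Y using tau[OF inv(1)[OF that]] by (simp add: T_def)
    show "T 0 = 1" "om 0 = we" using init 0 by (auto simp: T_def om_def)
    show "Delta (sg x) (wx x) < 0" if "ereal x < b" for x
      using Dl[of x] D[OF E(2)] tpos[of "G x"] by (simp add: divide_neg_pos)
  qed (use phys in blast)
qed

end

section \<open>P2 is reached in finite time\<close>

text \<open>
  For a real \<open>2\<times>2\<close> matrix \<open>A\<close> with trace \<open>t\<close> and determinant \<open>D\<close>, the quadratic form
  \<open>D \<bar>\<xi>\<bar>\<^sup>2 + \<bar>adj(A) \<xi>\<bar>\<^sup>2\<close> has derivative \<open>2 t D \<bar>\<xi>\<bar>\<^sup>2\<close> along \<open>\<xi>' = A \<xi>\<close>, because \<open>A + adj(A) = t\<close> and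
  \<open>adj(A) A = D\<close>. It is a Lyapunov function whenever \<open>t < 0 < D\<close>. Along \<open>E \<xi>' = A \<xi> + o(\<bar>\<xi>\<bar>)\<close> with
  \<open>E = O(\<bar>\<xi>\<bar>)\<close> its square root therefore decreases at least at a constant rate.
\<close>

lemma no_slow_approach_linear:
  fixes a11 a12 a21 a22 C :: real and u v u' v' E :: "real \<Rightarrow> real"
  assumes tr: "a11 + a22 < 0" and det: "a11 * a22 - a12 * a21 > 0" and C: "C > 0"
    and du: "\<And>x. x \<ge> x0 \<Longrightarrow> (u has_real_derivative u' x) (at x)"
    and dv: "\<And>x. x \<ge> x0 \<Longrightarrow> (v has_real_derivative v' x) (at x)"
    and E: "\<And>x. x \<ge> x0 \<Longrightarrow> 0 < E x \<and> E x \<le> C * norm (u x, v x)"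
    and lin: "\<And>\<epsilon>. \<epsilon> > 0 \<Longrightarrow> eventually (\<lambda>x.
        \<bar>E x * u' x - (a11 * u x + a12 * v x)\<bar> \<le> \<epsilon> * norm (u x, v x) \<and>
        \<bar>E x * v' x - (a21 * u x + a22 * v x)\<bar> \<le> \<epsilon> * norm (u x, v x)) at_top"
  shows False
proof -
  define t D where "t = a11 + a22" and "D = a11 * a22 - a12 * a21"
  have t: "t < 0" and D: "D > 0" using tr det by (auto simp: t_def D_def)
  define bf where "bf p q p' q' = 2 * D * (p * p' + q * q') + 2 * ((a22 * p - a12 * q) * (a22 * p' - a12 * q'))
      + 2 * ((a11 * q - a21 * p) * (a11 * q' - a21 * p'))" for p q p' q'
  define K where "K = 4 * D + 2 * (\<bar>a22\<bar> + \<bar>a12\<bar>) * (\<bar>a22\<bar> + \<bar>a12\<bar>) + 2 * (\<bar>a11\<bar> + \<bar>a21\<bar>) * (\<bar>a11\<bar> + \<bar>a21\<bar>)"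
  have K: "K > 0" using D by (simp add: K_def add_pos_nonneg)
  have bf_lin: "bf p q (a11 * p + a12 * q) (a21 * p + a22 * q) = 2 * t * D * (p\<^sup>2 + q\<^sup>2)" for p q
    unfolding bf_def t_def D_def by (simp add: power2_eq_square algebra_simps)
  have bf_bound: "\<bar>bf p q p' q'\<bar> \<le> K * n * m" if "\<bar>p\<bar> \<le> n" "\<bar>q\<bar> \<le> n" "\<bar>p'\<bar> \<le> m" "\<bar>q'\<bar> \<le> m" for p q p' q' n m
  proof -
    have n: "n \<ge> 0" "m \<ge> 0" using that by auto
    have l: "\<bar>\<alpha> * p1 - \<beta> * q1\<bar> \<le> (\<bar>\<alpha>\<bar> + \<bar>\<beta>\<bar>) * k" if "\<bar>p1\<bar> \<le> k" "\<bar>q1\<bar> \<le> k" for \<alpha> \<beta> p1 q1 k :: real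
    proof -
      have "\<bar>\<alpha> * p1 - \<beta> * q1\<bar> \<le> \<bar>\<alpha>\<bar> * \<bar>p1\<bar> + \<bar>\<beta>\<bar> * \<bar>q1\<bar>" by (metis abs_mult abs_triangle_ineq4)
      also have "\<dots> \<le> \<bar>\<alpha>\<bar> * k + \<bar>\<beta>\<bar> * k" using that by (intro add_mono mult_left_mono) auto
      finally show ?thesis by (simp add: algebra_simps)
    qed
    have "\<bar>p * p' + q * q'\<bar> \<le> n * m + n * m"
      using that by (intro order_trans[OF abs_triangle_ineq] add_mono) (auto simp: abs_mult intro!: mult_mono)
    then have 1: "\<bar>2 * D * (p * p' + q * q')\<bar> \<le> 2 * D * (n * m + n * m)"
      using D by (simp add: abs_mult)
    have 2: "\<bar>2 * ((a22 * p - a12 * q) * (a22 * p' - a12 * q'))\<bar> \<le> 2 * (((\<bar>a22\<bar> + \<bar>a12\<bar>) * n) * ((\<bar>a22\<bar> + \<bar>a12\<bar>) * m))"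
      using mult_mono[OF l[of p n q a22 a12] l[of p' m q' a22 a12]] that n by (simp add: abs_mult mult_ac)
    have 3: "\<bar>2 * ((a11 * q - a21 * p) * (a11 * q' - a21 * p'))\<bar> \<le> 2 * (((\<bar>a11\<bar> + \<bar>a21\<bar>) * n) * ((\<bar>a11\<bar> + \<bar>a21\<bar>) * m))"
      using mult_mono[OF l[of q n p a11 a21] l[of q' m p' a11 a21]] that n by (simp add: abs_mult mult_ac)
    have "\<bar>bf p q p' q'\<bar> \<le> 2 * D * (n * m + n * m) + 2 * (((\<bar>a22\<bar> + \<bar>a12\<bar>) * n) * ((\<bar>a22\<bar> + \<bar>a12\<bar>) * m))
        + 2 * (((\<bar>a11\<bar> + \<bar>a21\<bar>) * n) * ((\<bar>a11\<bar> + \<bar>a21\<bar>) * m))"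
      unfolding bf_def by (intro order_trans[OF abs_triangle_ineq] add_mono 1 2 3)
    also have "\<dots> = K * n * m" unfolding K_def by algebra
    finally show ?thesis .
  qed
  define N where "N x = norm (u x, v x)" for x
  have N2: "(N x)\<^sup>2 = (u x)\<^sup>2 + (v x)\<^sup>2" for x by (simp add: N_def norm_Pair)
  have uN: "\<bar>u x\<bar> \<le> N x" "\<bar>v x\<bar> \<le> N x" for x
    unfolding N_def using norm_fst_le[of "u x" "v x"] norm_snd_le[of "v x" "u x"] by auto
  have Npos: "N x > 0" if "x \<ge> x0" for x
    using E[OF that] C by (metis N_def less_le_trans zero_less_mult_pos)
  define Vf where "Vf x = bf (u x) (v x) (u x) (v x) / 2" for x
  have Vf_low: "Vf x \<ge> D * (N x)\<^sup>2" for x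
  proof -
    have "Vf x = D * (N x)\<^sup>2 + ((a22 * u x - a12 * v x)\<^sup>2 + (a11 * v x - a21 * u x)\<^sup>2)"
      unfolding Vf_def bf_def N2 by (simp add: power2_eq_square field_simps)
    then show ?thesis by simp
  qed
  have Vf_up: "Vf x \<le> K * (N x)\<^sup>2" for x
    using bf_bound[OF uN uN, of x x] K zero_le_power2[of "N x"] unfolding Vf_def power2_eq_square
    by (simp add: abs_le_iff mult.assoc)
  have Vf_pos: "Vf x > 0" if "x \<ge> x0" for x
    using Vf_low[of x] Npos[OF that] D by (meson less_le_trans mult_pos_pos zero_less_power)
  have dV: "(Vf has_real_derivative bf (u x) (v x) (u' x) (v' x)) (at x)" if "x \<ge> x0" for x
    unfolding Vf_def[abs_def] bf_def
    by (auto intro!: derivative_eq_intros du[OF that] dv[OF that] simp: field_simps)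
  define \<epsilon> where "\<epsilon> = - t * D / K"
  have eps: "\<epsilon> > 0" using t D K by (simp add: \<epsilon>_def divide_neg_pos mult_neg_pos)
  from lin[OF eps] obtain x1 where x1: "\<And>x. x \<ge> x1 \<Longrightarrow>
      \<bar>E x * u' x - (a11 * u x + a12 * v x)\<bar> \<le> \<epsilon> * N x \<and> \<bar>E x * v' x - (a21 * u x + a22 * v x)\<bar> \<le> \<epsilon> * N x"
    unfolding eventually_at_top_linorder N_def by blast
  define x2 where "x2 = max x0 x1"
  define c where "c = - t * D / (2 * C * sqrt K)"
  have c: "c > 0" using t D K C by (simp add: c_def divide_neg_pos mult_neg_pos)
  have rate: "((\<lambda>x. sqrt (Vf x)) has_real_derivative bf (u x) (v x) (u' x) (v' x) / (2 * sqrt (Vf x))) (at x)"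
    "bf (u x) (v x) (u' x) (v' x) / (2 * sqrt (Vf x)) \<le> - c" if "x \<ge> x2" for x
  proof -
    have x: "x \<ge> x0" "x \<ge> x1" using that by (auto simp: x2_def)
    show "((\<lambda>x. sqrt (Vf x)) has_real_derivative bf (u x) (v x) (u' x) (v' x) / (2 * sqrt (Vf x))) (at x)"
      by (rule DERIV_cong[OF DERIV_chain2[OF DERIV_real_sqrt[OF Vf_pos[OF x(1)]] dV[OF x(1)]]])
         (simp add: field_simps)
    define \<beta> where "\<beta> = bf (u x) (v x) (u' x) (v' x)"
    have "E x * \<beta> = bf (u x) (v x) (a11 * u x + a12 * v x) (a21 * u x + a22 * v x)
        + bf (u x) (v x) (E x * u' x - (a11 * u x + a12 * v x)) (E x * v' x - (a21 * u x + a22 * v x))"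
      unfolding \<beta>_def bf_def by (simp add: algebra_simps)
    also have "\<dots> \<le> 2 * t * D * (N x)\<^sup>2 + K * N x * (\<epsilon> * N x)"
      unfolding bf_lin N2[symmetric]
      using bf_bound[OF uN[of x], of _ "\<epsilon> * N x"] x1[OF x(2)] by (intro add_left_mono) (auto simp: abs_le_iff)
    also have "\<dots> = t * D * (N x)\<^sup>2" using K by (simp add: \<epsilon>_def power2_eq_square field_simps)
    finally have b: "E x * \<beta> \<le> t * D * (N x)\<^sup>2" .
    have neg: "t * D * (N x)\<^sup>2 < 0" using t D Npos[OF x(1)] by (simp add: mult_neg_pos)
    have Ex: "E x > 0" "E x \<le> C * N x" using E[OF x(1)] by (auto simp: N_def)
    have bneg: "\<beta> < 0" using b neg Ex by (smt (verit) mult_nonneg_nonneg)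
    have "C * N x * \<beta> \<le> E x * \<beta>" using Ex bneg by (intro mult_right_mono_neg) auto
    with b have "N x * (C * \<beta>) \<le> N x * (t * D * N x)" by (simp add: power2_eq_square mult_ac)
    then have b2: "C * \<beta> \<le> t * D * N x" using Npos[OF x(1)] by simp
    have sq: "sqrt (Vf x) \<le> sqrt K * N x"
      using real_sqrt_le_mono[OF Vf_up[of x]] Npos[OF x(1)] by (simp add: real_sqrt_mult)
    have "t * D * sqrt (Vf x) \<ge> t * D * (sqrt K * N x)"
      using sq t D by (intro mult_left_mono_neg) (auto simp: mult_nonpos_nonneg)
    moreover have "sqrt K * (C * \<beta>) \<le> sqrt K * (t * D * N x)"
      using K by (intro mult_left_mono b2) auto
    moreover have "sqrt K * (t * D * N x) = t * D * (sqrt K * N x)" by simp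
    ultimately have "sqrt K * (C * \<beta>) \<le> t * D * sqrt (Vf x)" by linarith
    then show "bf (u x) (v x) (u' x) (v' x) / (2 * sqrt (Vf x)) \<le> - c"
      unfolding \<beta>_def[symmetric] c_def using K C Vf_pos[OF x(1)]
      by (simp add: divide_le_eq field_simps)
  qed
  define X where "X = x2 + (sqrt (Vf x2) + 1) / c"
  have Vx2: "sqrt (Vf x2) \<ge> 0" using Vf_pos[of x2] by (simp add: x2_def)
  have "X \<ge> x2" using c Vx2 by (simp add: X_def)
  then have "sqrt (Vf X) + c * X \<le> sqrt (Vf x2) + c * x2"
  proof (rule DERIV_nonpos_imp_nonincreasing)
    fix x assume "x2 \<le> x" "x \<le> X"
    show "\<exists>y. ((\<lambda>x. sqrt (Vf x) + c * x) has_real_derivative y) (at x) \<and> y \<le> 0"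
      using DERIV_add[OF rate(1)[OF \<open>x2 \<le> x\<close>] DERIV_cmult[OF DERIV_ident, of c]] rate(2)[OF \<open>x2 \<le> x\<close>]
      by (intro exI[of _ "bf (u x) (v x) (u' x) (v' x) / (2 * sqrt (Vf x)) + c"]) simp
  qed
  moreover have "c * X = c * x2 + sqrt (Vf x2) + 1" using c by (simp add: X_def field_simps)
  moreover have "sqrt (Vf X) \<ge> 0" using Vf_pos[of X] \<open>X \<ge> x2\<close> by (simp add: x2_def)
  ultimately show False by linarith
qed

lemma first_order_error:
  fixes F :: "real \<times> real \<Rightarrow> real"
  assumes F: "(F has_derivative (\<lambda>h. a * fst h + b * snd h)) (at (p, q))" and F0: "F (p, q) = 0"
    and lim: "(u \<longlongrightarrow> p) at_top" "(v \<longlongrightarrow> q) at_top" and "\<epsilon> > 0"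
  shows "eventually (\<lambda>x. \<bar>F (u x, v x) - (a * (u x - p) + b * (v x - q))\<bar> \<le> \<epsilon> * norm (u x - p, v x - q)) (at_top :: real filter)"
proof -
  obtain \<delta> where \<delta>: "\<delta> > 0" "\<And>y. norm (y - (p, q)) < \<delta> \<Longrightarrow>
      norm (F y - F (p, q) - (a * fst (y - (p, q)) + b * snd (y - (p, q)))) \<le> \<epsilon> * norm (y - (p, q))"
    using F \<open>\<epsilon> > 0\<close> unfolding has_derivative_at_alt by blast
  have "((\<lambda>x. (u x, v x)) \<longlongrightarrow> (p, q)) at_top" by (intro tendsto_Pair lim)
  then have "eventually (\<lambda>x. norm ((u x, v x) - (p, q)) < \<delta>) at_top"
    using \<delta>(1) unfolding tendsto_iff dist_norm by blast
  then show ?thesis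
  proof eventually_elim
    case (elim x)
    from \<delta>(2)[OF elim] show ?case by (simp add: F0)
  qed
qed

context phase_plane
begin

text \<open>
  The linearisation of \<open>(\<Delta>\<^sub>2, \<Delta>\<^sub>1)\<close> at \<open>P\<^sub>2\<close> in the coordinates \<open>(\<sigma>, w)\<close>.
\<close>

definition "a11 = - 2 * (1 - wm)\<^sup>2"
definition "a12 = (1 - wm) / l * null2' d l r wm"
definition "a21 = - 2 * d * (wm - we) * (1 - wm)"
definition "a22 = cubic' r wm - d * (1 - wm)\<^sup>2"

lemma trace_neg: "a11 + a22 < 0"
proof -
  have "a22 = (1 - wm) * (r - d - 2 * wm + l * (r - 1)) - Q wm"
    unfolding a22_def cubic'_def sonic_poly_def by (simp add: power2_eq_square algebra_simps)
  then have "a11 + a22 = - ((1 - wm) * (d + 1 - (l + 1) * (r - 1)))"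
    unfolding a11_def Q_wm by (simp add: power2_eq_square algebra_simps)
  moreover have "(1 - wm) * (d + 1 - (l + 1) * (r - 1)) > 0"
    using wm_lt_1 coeff_plus by (intro mult_pos_pos) auto
  ultimately show ?thesis by simp
qed

text \<open>
  Differentiating the elimination identity at \<open>w\<^sub>-\<close> expresses the determinant by
  \<open>Q' (w\<^sub>-) < 0\<close> and \<open>w_third - w\<^sub>- > 0\<close>.
\<close>

lemma det_pos: "a11 * a22 - a12 * a21 > 0"
proof -
  define Q' where "Q' = 2 * (d - 1) * wm - (d - 1 + (l - 1) * (r - 1))"
  have Q': "Q' < 0" using wm_lt_vertex d2 by (simp add: Q'_def w_vertex_def less_divide_eq mult.commute)
  have N2: "N2 wm = l * (1 - wm)\<^sup>2" by (simp add: null2_sonic Q_wm)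
  have e: "d * (w - we) = d * w - l * (r - 1)" for w using d_we by (simp add: right_diff_distrib)
  have "l * cubic' r wm - d * N2 wm - d * (wm - we) * null2' d l r wm
      = Q' * (l * r - (l + d) * wm) - (l + d) * Q wm"
    unfolding e unfolding cubic'_def null2_def null2'_def Q'_def sonic_poly_def
    by (simp add: power2_eq_square algebra_simps)
  then have k: "l * a22 - d * (wm - we) * null2' d l r wm = Q' * (l * r - (l + d) * wm)"
    by (simp add: a22_def N2 Q_wm algebra_simps)
  have "a11 * a22 - a12 * a21 = - (2 * (1 - wm)\<^sup>2 / l) * (l * a22 - d * (wm - we) * null2' d l r wm)"
    unfolding a11_def a12_def a21_def using l0 by (simp add: field_simps power2_eq_square)
  also have "\<dots> > 0"
    unfolding k using Q' third_pos[OF wm_lt_bar] l0 wm_lt_1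
    by (intro mult_neg_neg mult_neg_pos) auto
  finally show ?thesis .
qed

lemma deriv_Delta2_P2:
  "((\<lambda>z. Delta2 d l r (fst z) (snd z)) has_derivative (\<lambda>h. a11 * fst h + a12 * snd h)) (at (1 - wm, wm))"
proof -
  have N2: "N2 wm = l * (1 - wm)\<^sup>2" by (simp add: null2_sonic Q_wm)
  have eq: "(\<lambda>z. Delta2 d l r (fst z) (snd z)) =
     (\<lambda>z. fst z * ((l + d - 1) * (snd z)\<^sup>2 - (l + d + l * r - r) * snd z + l * r - l * (fst z)\<^sup>2) * (1 / l))"
    by (simp add: Delta2_def)
  have "((\<lambda>z. Delta2 d l r (fst z) (snd z)) has_derivative
     (\<lambda>h. (fst h * (N2 wm - l * (1 - wm)\<^sup>2) + (1 - wm) * (null2' d l r wm * snd h - 2 * l * (1 - wm) * fst h)) * (1 / l)))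
     (at (1 - wm, wm))"
    unfolding eq
    by (rule has_derivative_eq_rhs, (rule derivative_intros)+)
       (simp add: fun_eq_iff null2_def null2'_def algebra_simps)
  then show ?thesis
    by (rule has_derivative_eq_rhs)
       (use l0 in \<open>simp add: N2 a11_def a12_def fun_eq_iff field_simps power2_eq_square\<close>)
qed

lemma deriv_Delta1_P2:
  "((\<lambda>z. Delta1 d l r (fst z) (snd z)) has_derivative (\<lambda>h. a21 * fst h + a22 * snd h)) (at (1 - wm, wm))"
proof -
  have eq: "(\<lambda>z. Delta1 d l r (fst z) (snd z)) =
     (\<lambda>z. snd z * (snd z - 1) * (snd z - r) - d * (snd z - we) * (fst z)\<^sup>2)"
    by (simp add: Delta1_def)
  show ?thesis
    unfolding eq
    by (rule has_derivative_eq_rhs, (rule derivative_intros)+)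
       (simp add: fun_eq_iff a21_def a22_def cubic'_def algebra_simps power2_eq_square)
qed

text \<open>
  No solution of \<open>\<bar>\<Delta>\<bar> (\<sigma>', w') = (\<Delta>\<^sub>2, \<Delta>\<^sub>1)\<close> takes infinite time to reach \<open>P\<^sub>2\<close>. The
  trajectories arriving at \<open>P\<^sub>2\<close> with \<open>\<Delta> < 0\<close> are of this form, and so are those leaving
  \<open>P\<^sub>2\<close> with \<open>\<Delta> > 0\<close> after reversal of \<open>x\<close>.
\<close>

lemma no_slow_approach:
  assumes d: "\<And>x. x \<ge> x0 \<Longrightarrow> (\<sigma> has_real_derivative \<sigma>' x) (at x)"
    "\<And>x. x \<ge> x0 \<Longrightarrow> (w has_real_derivative w' x) (at x)"
    and D: "\<And>x. x \<ge> x0 \<Longrightarrow> Delta (\<sigma> x) (w x) \<noteq> 0"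
    and eq: "\<And>x. x \<ge> x0 \<Longrightarrow> \<bar>Delta (\<sigma> x) (w x)\<bar> * \<sigma>' x = Delta2 d l r (\<sigma> x) (w x)"
      "\<And>x. x \<ge> x0 \<Longrightarrow> \<bar>Delta (\<sigma> x) (w x)\<bar> * w' x = Delta1 d l r (\<sigma> x) (w x)"
    and lim: "((\<lambda>x. (\<sigma> x, w x)) \<longlongrightarrow> P2 d l r) at_top"
  shows False
proof -
  have l1: "(\<sigma> \<longlongrightarrow> 1 - wm) at_top" and l2: "(w \<longlongrightarrow> wm) at_top"
    using tendsto_fst[OF lim] tendsto_snd[OF lim] by (auto simp: P2_def)
  define u v where "u x = \<sigma> x - (1 - wm)" and "v x = w x - wm" for x
  have lu: "(u \<longlongrightarrow> 0) at_top" and lv: "(v \<longlongrightarrow> 0) at_top"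
    using tendsto_diff[OF l1 tendsto_const, of "1 - wm"] tendsto_diff[OF l2 tendsto_const, of wm]
    by (auto simp: u_def[abs_def] v_def[abs_def])
  have "eventually (\<lambda>x. \<bar>u x\<bar> < 1 \<and> \<bar>v x\<bar> < 1) at_top"
    using tendstoD[OF lu, of 1] tendstoD[OF lv, of 1] by (auto simp: dist_real_def elim: eventually_elim2)
  then obtain x1 where x1: "\<And>x. x \<ge> x1 \<Longrightarrow> \<bar>u x\<bar> < 1 \<and> \<bar>v x\<bar> < 1"
    unfolding eventually_at_top_linorder by blast
  define x2 where "x2 = max x0 x1"
  have bnd: "0 < \<bar>Delta (\<sigma> x) (w x)\<bar> \<and> \<bar>Delta (\<sigma> x) (w x)\<bar> \<le> 8 * norm (u x, v x)" if "x \<ge> x2" for x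
  proof
    have x: "x \<ge> x0" "x \<ge> x1" using that by (auto simp: x2_def)
    show "0 < \<bar>Delta (\<sigma> x) (w x)\<bar>" using D[OF x(1)] by simp
    have uv: "\<bar>u x\<bar> \<le> norm (u x, v x)" "\<bar>v x\<bar> \<le> norm (u x, v x)"
      using norm_fst_le[of "u x" "v x"] norm_snd_le[of "v x" "u x"] by auto
    have "Delta (\<sigma> x) (w x) = (u x + v x) * (v x - u x - 2 * (1 - wm))"
      by (simp add: Delta_def u_def v_def power2_eq_square algebra_simps)
    also have "\<bar>\<dots>\<bar> \<le> (2 * norm (u x, v x)) * 4"
      unfolding abs_mult using uv x1[OF x(2)] wm_pos wm_lt_1 by (intro mult_mono) auto
    finally show "\<bar>Delta (\<sigma> x) (w x)\<bar> \<le> 8 * norm (u x, v x)" by simp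
  qed
  show False
  proof (rule no_slow_approach_linear[OF trace_neg det_pos _ _ _ bnd])
    show "(u has_real_derivative \<sigma>' x) (at x)" if "x \<ge> x2" for x
      unfolding u_def[abs_def] using d(1)[of x] that by (auto intro!: derivative_eq_intros simp: x2_def)
    show "(v has_real_derivative w' x) (at x)" if "x \<ge> x2" for x
      unfolding v_def[abs_def] using d(2)[of x] that by (auto intro!: derivative_eq_intros simp: x2_def)
    fix \<epsilon> :: real assume eps: "\<epsilon> > 0"
    have e2: "eventually (\<lambda>x. \<bar>Delta2 d l r (\<sigma> x) (w x) - (a11 * u x + a12 * v x)\<bar> \<le> \<epsilon> * norm (u x, v x)) at_top"
      using first_order_error[OF deriv_Delta2_P2 _ l1 l2 eps] Delta2_at_P2 by (simp add: u_def v_def)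
    have e1: "eventually (\<lambda>x. \<bar>Delta1 d l r (\<sigma> x) (w x) - (a21 * u x + a22 * v x)\<bar> \<le> \<epsilon> * norm (u x, v x)) at_top"
      using first_order_error[OF deriv_Delta1_P2 _ l1 l2 eps] Delta1_at_P2 by (simp add: u_def v_def)
    show "eventually (\<lambda>x.
        \<bar>\<bar>Delta (\<sigma> x) (w x)\<bar> * \<sigma>' x - (a11 * u x + a12 * v x)\<bar> \<le> \<epsilon> * norm (u x, v x) \<and>
        \<bar>\<bar>Delta (\<sigma> x) (w x)\<bar> * w' x - (a21 * u x + a22 * v x)\<bar> \<le> \<epsilon> * norm (u x, v x)) at_top"
      using e1 e2 eventually_ge_at_top[of x0]
    proof eventually_elim
      case (elim x)
      then show ?case using eq[of x] by simp
    qed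
  qed auto
qed

lemma connected_einterval: "connected (einterval a b)"
proof -
  have "x \<in> einterval a b" if "u \<in> einterval a b" "v \<in> einterval a b" "u \<le> x" "x \<le> v" for u v x
    using that less_le_trans[of a "ereal u" "ereal x"] le_less_trans[of "ereal x" "ereal v" b]
    by (simp add: einterval_iff)
  then show ?thesis unfolding is_interval_connected_1[symmetric] is_interval_1 by blast
qed

lemma trajectory_cont:
  assumes "trajectory d l r a b \<sigma> w" "x \<in> einterval a b"
  shows "isCont \<sigma> x" "isCont w x" "\<sigma> x > 0" "Delta (\<sigma> x) (w x) \<noteq> 0"
  using assms DERIV_isCont unfolding trajectory_def by blast+

text \<open>
  The intermediate value theorem. As \<open>\<Delta>\<close> is negative near \<open>P\<^sub>6\<close> and equal to \<open>1\<close> at \<open>P\<^sub>4\<close>, its sign is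
  known along the trajectories that start or end there.
\<close>

lemma Delta_sign_constant:
  assumes tr: "trajectory d l r a b \<sigma> w" and xy: "x \<in> einterval a b" "y \<in> einterval a b"
    and x: "Delta (\<sigma> x) (w x) < 0"
  shows "Delta (\<sigma> y) (w y) < 0"
proof (rule ccontr)
  assume "\<not> ?thesis"
  then have y: "0 \<le> Delta (\<sigma> y) (w y)" by simp
  have "continuous_on (einterval a b) (\<lambda>x. Delta (\<sigma> x) (w x))"
    unfolding Delta_def using trajectory_cont(1,2)[OF tr]
    by (intro continuous_intros continuous_at_imp_continuous_on) auto
  moreover have "connected (einterval a b)" by (rule connected_einterval)
  ultimately have "connected ((\<lambda>x. Delta (\<sigma> x) (w x)) ` einterval a b)"
    by (rule connected_continuous_image)
  then have "0 \<in> (\<lambda>x. Delta (\<sigma> x) (w x)) ` einterval a b"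
    using xy x y connectedD_interval[of _ "Delta (\<sigma> x) (w x)" "Delta (\<sigma> y) (w y)" 0] by auto
  then show False using trajectory_cont(4)[OF tr] by auto
qed

lemma connects_P6_P2_subsonic:
  assumes c: "connects_P6_P2 d l r b \<sigma> w" and x: "ereal x < b"
  shows "Delta (\<sigma> x) (w x) < 0"
proof -
  have tr: "trajectory d l r (- \<infinity>) b \<sigma> w" and s: "filterlim \<sigma> at_top at_bot" and w: "(w \<longlongrightarrow> we) at_bot"
    using c by (auto simp: connects_P6_P2_def)
  have "eventually (\<lambda>x. \<sigma> x > 2) at_bot" using s by (simp add: filterlim_at_top_dense)
  moreover have "eventually (\<lambda>x. w x > 0) at_bot" using order_tendstoD(1)[OF w we_pos] .
  moreover have "eventually (\<lambda>x. w x < 1) at_bot" using order_tendstoD(2)[OF w we_lt_1] .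
  moreover have "eventually (\<lambda>z. z < x) at_bot" by (rule eventually_gt_at_bot)
  ultimately have "eventually (\<lambda>z. z < x \<and> Delta (\<sigma> z) (w z) < 0) at_bot"
  proof eventually_elim
    case (elim z)
    then have "(w z - 1)\<^sup>2 < 1\<^sup>2" by (intro power2_strict_mono) auto
    moreover have "1\<^sup>2 < (\<sigma> z)\<^sup>2" using elim by (intro power_strict_mono) auto
    ultimately have "(w z - 1)\<^sup>2 < (\<sigma> z)\<^sup>2" by linarith
    then show ?case using elim by (simp add: Delta_def)
  qed
  then obtain z where z: "z < x" "Delta (\<sigma> z) (w z) < 0"
    by (metis (mono_tags, lifting) eventually_happens trivial_limit_at_bot_linorder)
  then have "ereal z < b" using x by (metis ereal_less(2) less_ereal.simps(1) less_trans)
  then show ?thesis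
    using Delta_sign_constant[OF tr _ _ z(2), of x] x by (simp add: einterval_iff)
qed

lemma connects_P2_P4_supersonic:
  assumes c: "connects_P2_P4 d l r a \<sigma> w" and x: "a < ereal x"
  shows "Delta (\<sigma> x) (w x) > 0"
proof -
  have tr: "trajectory d l r a \<infinity> \<sigma> w" and lim: "((\<lambda>x. (\<sigma> x, w x)) \<longlongrightarrow> (0, 0)) at_top"
    using c by (auto simp: connects_P2_P4_def P4_def)
  have "((\<lambda>x. Delta (\<sigma> x) (w x)) \<longlongrightarrow> Delta 0 0) at_top"
    unfolding Delta_def using tendsto_fst[OF lim] tendsto_snd[OF lim] by (intro tendsto_intros) auto
  then have "eventually (\<lambda>x. Delta (\<sigma> x) (w x) > 0) at_top"
    by (intro order_tendstoD(1)) (auto simp: Delta_def)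
  then have "eventually (\<lambda>z. z > x \<and> Delta (\<sigma> z) (w z) > 0) at_top"
    using eventually_gt_at_top[of x] by eventually_elim auto
  then obtain z where z: "z > x" "Delta (\<sigma> z) (w z) > 0"
    by (metis (mono_tags, lifting) eventually_happens trivial_limit_at_top_linorder)
  have "a < ereal z" using x z(1) by (metis less_ereal.simps(1) less_trans)
  then have "\<not> Delta (\<sigma> x) (w x) < 0"
    using Delta_sign_constant[OF tr, of x z] x z(2) by (auto simp: einterval_iff)
  then show ?thesis using trajectory_cont(4)[OF tr, of x] x by (simp add: einterval_iff)
qed

lemma inner_end_finite:
  assumes c: "connects_P6_P2 d l r b \<sigma> w"
  obtains \<beta> where "b = ereal \<beta>"
proof (cases b)
  case PInf
  have tr: "trajectory d l r (- \<infinity>) \<infinity> \<sigma> w" and lim: "((\<lambda>x. (\<sigma> x, w x)) \<longlongrightarrow> P2 d l r) at_top"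
    using c unfolding connects_P6_P2_def PInf filterlim_at_left_PInf_iff by auto
  obtain \<sigma>' w' where der: "\<And>x. (\<sigma> has_real_derivative \<sigma>' x) (at x)" "\<And>x. (w has_real_derivative w' x) (at x)"
    and eq: "\<And>x. Delta (\<sigma> x) (w x) * w' x = - Delta1 d l r (\<sigma> x) (w x)"
      "\<And>x. Delta (\<sigma> x) (w x) * \<sigma>' x = - Delta2 d l r (\<sigma> x) (w x)"
    using tr unfolding trajectory_def by (simp add: einterval_iff) metis
  have neg: "Delta (\<sigma> x) (w x) < 0" for x using connects_P6_P2_subsonic[OF c] PInf by simp
  have False
  proof (rule no_slow_approach[OF der _ _ _ lim])
    show "Delta (\<sigma> x) (w x) \<noteq> 0" for x using neg[of x] by simp
    show "\<bar>Delta (\<sigma> x) (w x)\<bar> * \<sigma>' x = Delta2 d l r (\<sigma> x) (w x)" for x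
      using neg[of x] eq(2)[of x] by (simp add: abs_of_neg)
    show "\<bar>Delta (\<sigma> x) (w x)\<bar> * w' x = Delta1 d l r (\<sigma> x) (w x)" for x
      using neg[of x] eq(1)[of x] by (simp add: abs_of_neg)
  qed
  then show ?thesis ..
next
  case MInf
  then show ?thesis using c by (simp add: connects_P6_P2_def trajectory_def)
qed (use that in auto)

lemma outer_end_finite:
  assumes c: "connects_P2_P4 d l r a \<sigma> w"
  obtains \<alpha> where "a = ereal \<alpha>"
proof (cases a)
  case MInf
  have tr: "trajectory d l r (- \<infinity>) \<infinity> \<sigma> w" and lim: "((\<lambda>x. (\<sigma> x, w x)) \<longlongrightarrow> P2 d l r) at_bot"
    using c unfolding connects_P2_P4_def MInf filterlim_at_right_MInf_iff by auto
  obtain \<sigma>' w' where der: "\<And>x. (\<sigma> has_real_derivative \<sigma>' x) (at x)" "\<And>x. (w has_real_derivative w' x) (at x)"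
    and eq: "\<And>x. Delta (\<sigma> x) (w x) * w' x = - Delta1 d l r (\<sigma> x) (w x)"
      "\<And>x. Delta (\<sigma> x) (w x) * \<sigma>' x = - Delta2 d l r (\<sigma> x) (w x)"
    using tr unfolding trajectory_def by (simp add: einterval_iff) metis
  have pos: "Delta (\<sigma> x) (w x) > 0" for x using connects_P2_P4_supersonic[OF c] MInf by simp
  have rev: "((\<lambda>x. f (- x)) has_real_derivative - f' (- x)) (at x)"
    if "\<And>x. (f has_real_derivative f' x) (at x)" for f f' :: "real \<Rightarrow> real" and x
    using DERIV_chain2[OF that[of "- x"] DERIV_minus[OF DERIV_ident]] by simp
  have False
  proof (rule no_slow_approach[OF rev[of \<sigma>, OF der(1)] rev[of w, OF der(2)]])
    show "((\<lambda>x. (\<sigma> (- x), w (- x))) \<longlongrightarrow> P2 d l r) at_top"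
      using lim by (simp add: filterlim_at_bot_mirror)
    show "Delta (\<sigma> (- x)) (w (- x)) \<noteq> 0" for x using pos[of "- x"] by simp
    show "\<bar>Delta (\<sigma> (- x)) (w (- x))\<bar> * - \<sigma>' (- x) = Delta2 d l r (\<sigma> (- x)) (w (- x))" for x
      using pos[of "- x"] eq(2)[of "- x"] by simp
    show "\<bar>Delta (\<sigma> (- x)) (w (- x))\<bar> * - w' (- x) = Delta1 d l r (\<sigma> (- x)) (w (- x))" for x
      using pos[of "- x"] eq(1)[of "- x"] by simp
  qed
  then show ?thesis ..
next
  case PInf
  then show ?thesis using c by (simp add: connects_P2_P4_def trajectory_def)
qed (use that in auto)

end

section \<open>The curves from P2 to P4\<close>

lemma DERIV_Delta1:
  assumes "(u has_real_derivative u') (at x)" "(v has_real_derivative v') (at x)"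
  shows "((\<lambda>x. Delta1 d l r (u x) (v x)) has_real_derivative
     (cubic' r (v x) - d * (u x)\<^sup>2) * v' - 2 * d * (v x - w_e d l r) * u x * u') (at x)"
  unfolding Delta1_def cubic'_def
  by (auto intro!: derivative_eq_intros assms simp: algebra_simps power2_eq_square)

context phase_plane
begin

lemma Delta1_cubic: "Delta1 d l r s w = cubic r w - d * (w - we) * s\<^sup>2"
  by (simp add: Delta1_def cubic_def)

lemma Delta2_N2: "Delta2 d l r s w = s / l * (N2 w - l * s\<^sup>2)"
  using l0 by (simp add: Delta2_null2)

lemma continuous_Delta [continuous_intros]:
  assumes "continuous_on A u" "continuous_on A v"
  shows "continuous_on A (\<lambda>x. Delta1 d l r (u x) (v x))" "continuous_on A (\<lambda>x. Delta2 d l r (u x) (v x))"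
    "continuous_on A (\<lambda>x. Delta (u x) (v x))"
  unfolding Delta1_def Delta2_def Delta_def using l0 by (intro continuous_intros assms; simp)+

text \<open>
  The curves start at time \<open>0\<close> on the nullcline \<open>\<Delta>\<^sub>1 = 0\<close>, at \<open>w = q\<close> between
  \<open>w\<^sub>-\<close> and \<open>w_bar\<close>. Backwards in time they are caught between the nullclines \<open>\<Delta>\<^sub>1 = 0\<close> and \<open>\<Delta>\<^sub>2 = 0\<close>
  and run into \<open>P\<^sub>2\<close>; forwards \<open>\<sigma>\<close> decreases exponentially and they run into \<open>P\<^sub>4\<close>.
\<close>

definition "out_region s w \<longleftrightarrow>
  Delta1 d l r s w < 0 \<and> N2 w - l * s\<^sup>2 > 0 \<and> s > 0 \<and> wm < w \<and> w < w_bar"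

definition "start_sigma q = sqrt (cubic r q / (d * (q - we)))"

text \<open>
  To the right of \<open>w\<^sub>-\<close> the elimination identity places the nullcline \<open>\<Delta>\<^sub>1 = 0\<close> below \<open>\<Delta>\<^sub>2 = 0\<close>, which is
  itself below the sonic line, all because \<open>Q < 0\<close>.
\<close>

lemma start_sigma:
  assumes q: "wm < q" "q < w_bar"
  shows "start_sigma q > 0" "Delta1 d l r (start_sigma q) q = 0"
    "N2 q - l * (start_sigma q)\<^sup>2 > 0" "start_sigma q + q < 1"
proof -
  have b: "0 < q" "q < 1" "we < q" using q wm_pos we_lt_wm bar_lt_1 by auto
  have c: "cubic r q > 0" using cubic_pos[OF b(1,2)] by (simp add: cubic_def)
  have dq: "d * (q - we) > 0" using b d2 by simp
  show s: "start_sigma q > 0" using c dq by (simp add: start_sigma_def)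
  have s2: "d * (q - we) * (start_sigma q)\<^sup>2 = cubic r q"
    using c dq by (simp add: start_sigma_def real_sqrt_pow2 less_imp_le divide_pos_pos del: mult_pos_pos) auto
  then show "Delta1 d l r (start_sigma q) q = 0" by (simp add: Delta1_cubic)
  have Qn: "Q q < 0" using q by (intro Q_neg) (auto simp: w_bar_def)
  have "d * (q - we) * (l * (start_sigma q)\<^sup>2 - N2 q) = l * cubic r q - d * (q - we) * N2 q"
    unfolding s2[symmetric] by (simp add: algebra_simps)
  also have "\<dots> = Q q * (l * r - (l + d) * q)" using nullclines_cubic[of q] by (simp add: cubic_def)
  also have "\<dots> < 0" using Qn third_pos[OF q(2)] by (simp add: mult_neg_pos)
  finally have "d * (q - we) * (l * (start_sigma q)\<^sup>2 - N2 q) < 0" .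
  then show N: "N2 q - l * (start_sigma q)\<^sup>2 > 0"
    using dq by (meson diff_gt_0_iff_gt diff_less_0_iff_less mult_less_0_iff not_less_iff_gr_or_eq)
  then have "l * (start_sigma q)\<^sup>2 < l * (1 - q)\<^sup>2" using Qn by (simp add: null2_sonic)
  then have "(start_sigma q)\<^sup>2 < (1 - q)\<^sup>2" using l0 by simp
  then have "start_sigma q < 1 - q" by (rule power2_less_imp_less) (use b in simp)
  then show "start_sigma q + q < 1" by simp
qed

lemma out_region_bounds:
  assumes "out_region s w"
  shows "0 < s" "s < 1 - w" "0 < w" "w < 1" "we < w"
proof -
  have o: "N2 w - l * s\<^sup>2 > 0" "s > 0" "wm < w" "w < w_bar" using assms by (auto simp: out_region_def)
  show "0 < s" by fact
  show w: "0 < w" "w < 1" "we < w" using o wm_pos we_lt_wm bar_lt_1 by auto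
  have "Q w < 0" using o by (intro Q_neg) (auto simp: w_bar_def)
  then have "l * s\<^sup>2 < l * (1 - w)\<^sup>2" using o by (simp add: null2_sonic)
  then have "s\<^sup>2 < (1 - w)\<^sup>2" using l0 by simp
  then show "s < 1 - w" by (rule power2_less_imp_less) (use w in simp)
qed

text \<open>
  As for the inner curve, \<open>a = -\<Delta>\<^sub>1\<close> and \<open>b = N2 w - l \<sigma>\<^sup>2\<close> satisfy a cooperative system,
  now in reversed time.
\<close>

lemma out_region_invariant:
  fixes u v :: "real \<Rightarrow> real"
  assumes t0: "out_region (u t0) (v t0)"
    and cont: "\<And>S. continuous_on S u" "\<And>S. continuous_on S v"
    and u: "\<And>t. out_region (u t) (v t) \<Longrightarrow> (u has_real_derivative Delta2 d l r (u t) (v t)) (at t)"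
    and v: "\<And>t. out_region (u t) (v t) \<Longrightarrow> (v has_real_derivative Delta1 d l r (u t) (v t)) (at t)"
    and t: "t \<ge> t0"
  shows "out_region (u t) (v t)"
proof -
  define a where "a t = - Delta1 d l r (u t) (v t)" for t
  define b where "b t = N2 (v t) - l * (u t)\<^sup>2" for t
  define m where "m t = min (min (a t) (b t)) (min (u t) (min (v t - wm) (w_bar - v t)))" for t
  have m: "m t > 0 \<longleftrightarrow> out_region (u t) (v t)" for t
    by (auto simp: m_def a_def b_def out_region_def)
  have contab: "continuous_on S a" "continuous_on S b" for S
    unfolding a_def b_def by (intro continuous_intros cont)+
  have "m t > 0"
  proof (rule stays_positive[of t0 t m])
    show "continuous_on {t0..t} m" unfolding m_def by (intro continuous_intros contab cont)
    show "m t0 > 0" using t0 m by blast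
    show "t \<in> {t0..t}" using t by simp
  next
    fix c assume c: "t0 < c" and "\<And>x. t0 \<le> x \<Longrightarrow> x < c \<Longrightarrow> m x > 0"
    then have reg: "out_region (u x) (v x)" if "t0 \<le> x" "x < c" for x using that m by blast
    note bd = out_region_bounds[OF reg]
    have ab: "a x > 0" "b x > 0" if "t0 \<le> x" "x < c" for x
      using reg[OF that] by (auto simp: out_region_def a_def b_def)
    have D: "Delta1 d l r (u x) (v x) = - a x" "Delta2 d l r (u x) (v x) = u x / l * b x" for x
      by (auto simp: a_def b_def Delta2_N2)
    have da: "(a has_real_derivative (cubic' r (v x) - d * (u x)\<^sup>2) * a x + 2 * d * (v x - we) * u x * (u x / l * b x)) (at x)"
      if "t0 \<le> x" "x < c" for x
      unfolding a_def[abs_def]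
      by (rule DERIV_cong[OF DERIV_minus[OF DERIV_Delta1[OF u[OF reg[OF that]] v[OF reg[OF that]]]]])
         (simp add: D algebra_simps)
    have db: "(b has_real_derivative - null2' d l r (v x) * a x - 2 * (u x)\<^sup>2 * b x) (at x)"
      if "t0 \<le> x" "x < c" for x
    proof -
      have "(b has_real_derivative null2' d l r (v x) * - a x - l * (2 * u x * (u x / l * b x))) (at x)"
        unfolding b_def[abs_def]
        by (rule derivative_eq_intros u[OF reg[OF that]] v[OF reg[OF that]] refl)+
           (simp add: D b_def[symmetric])
      then show ?thesis
        by (rule DERIV_cong) (use l0 in \<open>simp add: power2_eq_square\<close>)
    qed
    have ac: "a c > 0"
    proof -
      have "a c \<ge> a t0 * exp (- (r + 1 + d) * (c - t0))"
      proof (rule growth_lower[OF _ contab(1)])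
        fix x assume x: "t0 < x" "x < c"
        then have x': "t0 \<le> x" by simp
        show "(a has_real_derivative (cubic' r (v x) - d * (u x)\<^sup>2) * a x + 2 * d * (v x - we) * u x * (u x / l * b x)) (at x)"
          by (rule da[OF x' x(2)])
        have "u x \<le> 1" "u x \<ge> 0" using bd[OF x' x(2)] by auto
        then have "(u x)\<^sup>2 \<le> 1" by (simp add: power_le_one)
        then have "d * (u x)\<^sup>2 \<le> d * 1" using d2 by (intro mult_left_mono) auto
        then have "- (r + 1 + d) \<le> cubic' r (v x) - d * (u x)\<^sup>2"
          using cubic'_bound[of "v x"] bd[OF x' x(2)] by (simp add: abs_le_iff)
        then have "- (r + 1 + d) * a x \<le> (cubic' r (v x) - d * (u x)\<^sup>2) * a x"
          using ab[OF x' x(2)] by (intro mult_right_mono) auto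
        moreover have "2 * d * (v x - we) * u x * (u x / l * b x) \<ge> 0"
          using bd[OF x' x(2)] ab[OF x' x(2)] d2 l0 by (intro mult_nonneg_nonneg) auto
        ultimately show "- (r + 1 + d) * a x \<le> (cubic' r (v x) - d * (u x)\<^sup>2) * a x + 2 * d * (v x - we) * u x * (u x / l * b x)"
          by linarith
      qed (use c in auto)
      moreover have "a t0 > 0" using ab[of t0] c by simp
      ultimately show ?thesis by (meson exp_gt_zero less_le_trans mult_pos_pos)
    qed
    have bc: "b c > 0"
    proof -
      have "b c \<ge> b t0 * exp (- 2 * (c - t0))"
      proof (rule growth_lower[OF _ contab(2)])
        fix x assume x: "t0 < x" "x < c"
        then have x': "t0 \<le> x" by simp
        show "(b has_real_derivative - null2' d l r (v x) * a x - 2 * (u x)\<^sup>2 * b x) (at x)"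
          by (rule db[OF x' x(2)])
        have "u x \<le> 1" "u x \<ge> 0" using bd[OF x' x(2)] by auto
        then have "(u x)\<^sup>2 \<le> 1" by (simp add: power_le_one)
        then have "(u x)\<^sup>2 * b x \<le> 1 * b x" using ab[OF x' x(2)] by (intro mult_right_mono) auto
        moreover have "null2' d l r (v x) * a x \<le> 0"
          using null2'_neg[of "v x"] reg[OF x' x(2)] ab[OF x' x(2)]
          by (intro mult_nonpos_nonneg) (auto simp: out_region_def)
        ultimately show "- 2 * b x \<le> - null2' d l r (v x) * a x - 2 * (u x)\<^sup>2 * b x" by simp
      qed (use c in auto)
      moreover have "b t0 > 0" using ab[of t0] c by simp
      ultimately show ?thesis by (meson exp_gt_zero less_le_trans mult_pos_pos)
    qed
    have uc: "u t0 \<le> u c"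
    proof (rule DERIV_nonneg_imp_increasing_open[OF less_imp_le[OF c]])
      fix x assume "t0 < x" "x < c"
      then show "\<exists>y. (u has_real_derivative y) (at x) \<and> y \<ge> 0"
        using u[OF reg[of x]] ab[of x] bd(1)[of x] l0
        by (intro exI[of _ "Delta2 d l r (u x) (v x)"]) (simp add: D)
    qed (rule cont)
    have vc: "v c \<le> v t0"
    proof (rule DERIV_nonpos_imp_decreasing_open[OF less_imp_le[OF c]])
      fix x assume "t0 < x" "x < c"
      then show "\<exists>y. (v has_real_derivative y) (at x) \<and> y \<le> 0"
        using v[OF reg[of x]] ab[of x] by (intro exI[of _ "Delta1 d l r (u x) (v x)"]) (simp add: D)
    qed (rule cont)
    have "v c \<ge> wm"
    proof (rule tendsto_lowerbound)
      show "(v \<longlongrightarrow> v c) (at_left c)"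
        using cont(2)[of UNIV] by (simp add: continuous_on_eq_continuous_at isCont_def filterlim_at_split)
      show "eventually (\<lambda>x. wm \<le> v x) (at_left c)"
        using reg c by (auto simp: eventually_at_left less_imp_le out_region_def intro!: exI[of _ t0])
    qed auto
    moreover have "v c \<noteq> wm"
    proof
      assume e: "v c = wm"
      have "l * cubic r wm < d * (wm - we) * (l * (u c)\<^sup>2)"
        using ac l0 by (simp add: a_def Delta1_cubic e)
      also have "\<dots> \<le> d * (wm - we) * N2 wm"
        using bc we_lt_wm d2 by (intro mult_left_mono) (auto simp: b_def e)
      also have "\<dots> = l * cubic r wm" using nullclines_cubic[of wm] Q_wm by (simp add: cubic_def)
      finally show False by simp
    qed
    ultimately have "wm < v c" by simp
    then show "m c > 0"
      unfolding m out_region_def using ac bc uc vc reg[of t0] c by (auto simp: a_def b_def out_region_def)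
  qed
  then show ?thesis by (simp add: m)
qed

text \<open>
  In reversed time \<open>\<sigma>\<close> increases and \<open>w\<close> decreases, so both converge.
\<close>

lemma out_region_limit:
  fixes u v :: "real \<Rightarrow> real"
  assumes reg: "\<And>t. t \<ge> t0 \<Longrightarrow> out_region (u t) (v t)"
    and u: "\<And>t. t \<ge> t0 \<Longrightarrow> (u has_real_derivative Delta2 d l r (u t) (v t)) (at t)"
    and v: "\<And>t. t \<ge> t0 \<Longrightarrow> (v has_real_derivative Delta1 d l r (u t) (v t)) (at t)"
  shows "((\<lambda>t. (u t, v t)) \<longlongrightarrow> P2 d l r) at_top"
proof -
  note bd = out_region_bounds[OF reg]
  have mu: "u x \<le> u y" if "t0 \<le> x" "x \<le> y" for x y
  proof (rule DERIV_nonneg_imp_nondecreasing[OF that(2)])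
    fix z assume "x \<le> z" "z \<le> y"
    then show "\<exists>D. (u has_real_derivative D) (at z) \<and> 0 \<le> D"
      using u[of z] reg[of z] that l0
      by (intro exI[of _ "Delta2 d l r (u z) (v z)"]) (auto simp: out_region_def Delta2_N2)
  qed
  have mv: "- v x \<le> - v y" if "t0 \<le> x" "x \<le> y" for x y
  proof -
    have "v y \<le> v x"
    proof (rule DERIV_nonpos_imp_nonincreasing[OF that(2)])
      fix z assume "x \<le> z" "z \<le> y"
      then show "\<exists>D. (v has_real_derivative D) (at z) \<and> D \<le> 0"
        using v[of z] reg[of z] that
        by (intro exI[of _ "Delta1 d l r (u z) (v z)"]) (auto simp: out_region_def)
    qed
    then show ?thesis by simp
  qed
  have ub: "u x \<le> 1" if "t0 \<le> x" for x using bd[OF that] by simp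
  have vb: "- v x \<le> - wm" if "t0 \<le> x" for x using reg[OF that] by (simp add: out_region_def)
  obtain s where s: "(u \<longlongrightarrow> s) at_top" "\<And>x. t0 \<le> x \<Longrightarrow> u x \<le> s"
    using mono_bounded_tendsto_at_top[of t0 u 1, OF mu ub] by blast
  obtain w1 where w1: "((\<lambda>x. - v x) \<longlongrightarrow> w1) at_top" "\<And>x. t0 \<le> x \<Longrightarrow> - v x \<le> w1" "w1 \<le> - wm"
    using mono_bounded_tendsto_at_top[of t0 "\<lambda>x. - v x" "- wm", OF mv vb] by blast
  define w where "w = - w1"
  have w: "(v \<longlongrightarrow> w) at_top" using tendsto_minus[OF w1(1)] by (simp add: w_def)
  have "s > 0" using s(2)[of t0] bd(1)[of t0] by simp
  moreover have "we < w" "w < w_bar"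
    using w1(2)[of t0] w1(3) we_lt_wm reg[of t0] by (auto simp: w_def out_region_def)
  moreover have "Delta2 d l r s w = 0"
    by (rule derivative_limit_zero[OF u s(1)]) (use l0 in \<open>auto simp: Delta2_def intro!: tendsto_intros s(1) w\<close>)
  moreover have "Delta1 d l r s w = 0"
    by (rule derivative_limit_zero[OF v w]) (auto simp: Delta1_def intro!: tendsto_intros s(1) w)
  ultimately have "w = wm" "s = 1 - wm" using equilibrium_is_P2 by blast+
  then show ?thesis unfolding P2_def using s(1) w by (intro tendsto_Pair) auto
qed

text \<open>
  The bound \<open>w > - d\<close> is a barrier: at \<open>w = - d\<close> the cubic term of \<open>- \<Delta>\<^sub>1\<close> dominates, as \<open>\<sigma> < 1\<close>.
\<close>

definition "fwd_region s0 q s w \<longleftrightarrow> 0 < s \<and> s < s0 \<and> w < q \<and> - d < w"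

lemma fwd_region_invariant:
  fixes f g :: "real \<Rightarrow> real"
  assumes q: "wm < q" "q < w_bar"
    and t0: "fwd_region (start_sigma q) q (f t0) (g t0)"
    and cont: "\<And>S. continuous_on S f" "\<And>S. continuous_on S g"
    and der: "\<And>t. \<bar>f t\<bar> \<le> d + 1 \<Longrightarrow> \<bar>g t\<bar> \<le> d + 1 \<Longrightarrow>
       (f has_real_derivative - Delta2 d l r (f t) (g t)) (at t) \<and>
       (g has_real_derivative - Delta1 d l r (f t) (g t)) (at t)"
    and t: "t \<ge> t0"
  shows "fwd_region (start_sigma q) q (f t) (g t)"
proof -
  let ?s = "start_sigma q"
  note st = start_sigma[OF q]
  have q1: "0 < q" "q < 1" "we < q" using q wm_pos we_lt_wm bar_lt_1 by auto
  define m where "m t = min (min (f t) (?s - f t)) (min (q - g t) (g t + d))" for t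
  have m: "m t > 0 \<longleftrightarrow> fwd_region ?s q (f t) (g t)" for t by (auto simp: m_def fwd_region_def)
  have "m t > 0"
  proof (rule stays_positive[of t0 t m])
    show "continuous_on {t0..t} m" unfolding m_def by (intro continuous_intros cont)
    show "m t0 > 0" using t0 m by blast
    show "t \<in> {t0..t}" using t by simp
  next
    fix c assume c: "t0 < c" and "\<And>x. t0 \<le> x \<Longrightarrow> x < c \<Longrightarrow> m x > 0"
    then have reg: "0 < f x" "f x < ?s" "g x < q" "- d < g x" if "t0 \<le> x" "x < c" for x
      using that m by (auto simp: fwd_region_def)
    have df: "(f has_real_derivative - (f x / l * (N2 (g x) - l * (f x)\<^sup>2))) (at x)" if "t0 \<le> x" "x < c" for x
    proof -
      have "\<bar>f x\<bar> \<le> d + 1" "\<bar>g x\<bar> \<le> d + 1" using reg[OF that] st(4) q1 d2 by auto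
      from der[OF this] show ?thesis by (simp add: Delta2_N2)
    qed
    have b: "0 < N2 (g x) - l * (f x)\<^sup>2" if "t0 \<le> x" "x < c" for x
    proof -
      have "(f x)\<^sup>2 \<le> ?s\<^sup>2" using reg[OF that] by (intro power_mono) auto
      then have "l * (f x)\<^sup>2 \<le> l * ?s\<^sup>2" using l0 by simp
      moreover have "N2 q \<le> N2 (g x)" using null2_antimono[of "g x" q] reg[OF that] q by simp
      ultimately show ?thesis using st(3) by linarith
    qed
    have fc: "f c \<le> f t0"
    proof (rule DERIV_nonpos_imp_decreasing_open[OF less_imp_le[OF c]])
      fix x assume "t0 < x" "x < c"
      then show "\<exists>y. (f has_real_derivative y) (at x) \<and> y \<le> 0"
        using df[of x] b[of x] reg(1)[of x] l0
        by (intro exI[of _ "- (f x / l * (N2 (g x) - l * (f x)\<^sup>2))"]) simp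
    qed (rule cont)
    have fpos: "f c > 0"
    proof -
      have "f c \<ge> f t0 * exp (- (N2 (- d) / l) * (c - t0))"
      proof (rule growth_lower[OF _ cont(1)])
        fix x assume x: "t0 < x" "x < c"
        then have x': "t0 \<le> x" by simp
        show "(f has_real_derivative - (f x / l * (N2 (g x) - l * (f x)\<^sup>2))) (at x)"
          by (rule df[OF x' x(2)])
        have "N2 (g x) \<le> N2 (- d)" using null2_antimono[of "- d" "g x"] reg[OF x' x(2)] q by simp
        then have "N2 (g x) - l * (f x)\<^sup>2 \<le> N2 (- d)" using l0 by (smt (verit) mult_nonneg_nonneg zero_le_power2)
        then have "f x / l * (N2 (g x) - l * (f x)\<^sup>2) \<le> f x / l * N2 (- d)"
          using reg[OF x' x(2)] l0 by (intro mult_left_mono) auto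
        then show "- (N2 (- d) / l) * f x \<le> - (f x / l * (N2 (g x) - l * (f x)\<^sup>2))"
          by (simp add: mult.commute)
      qed (use c in auto)
      moreover have "f t0 > 0" using reg[of t0] c by simp
      ultimately show ?thesis by (meson exp_gt_zero less_le_trans mult_pos_pos)
    qed
    have fs: "f c < ?s" using fc reg[of t0] c by simp
    have gl: "(g \<longlongrightarrow> g c) (at_left c)"
      using cont(2)[of UNIV] by (simp add: continuous_on_eq_continuous_at isCont_def filterlim_at_split)
    have left: "eventually (\<lambda>x. - d \<le> g x \<and> g x \<le> q) (at_left c)"
      using reg c by (auto simp: eventually_at_left less_imp_le intro!: exI[of _ t0])
    have gc: "- d \<le> g c" "g c \<le> q"
      using tendsto_lowerbound[OF gl, of "- d"] tendsto_upperbound[OF gl, of q] left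
      by (simp_all add: eventually_conj_iff)
    have dg: "(g has_real_derivative - Delta1 d l r (f c) (g c)) (at c)"
      using der[of c] fpos fs gc st(4) q1 d2 by auto
    have f2: "(f c)\<^sup>2 < ?s\<^sup>2" using fpos fs by (intro power_strict_mono) auto
    \<comment> \<open>at \<open>w = q\<close> the field points down because \<open>\<Delta>\<^sub>1\<close> vanishes at the larger value \<open>start_sigma q\<close>\<close>
    have "g c \<noteq> q"
    proof
      assume e: "g c = q"
      have "d * (q - we) * (f c)\<^sup>2 < d * (q - we) * ?s\<^sup>2" using f2 q1 d2 by simp
      then have "- Delta1 d l r (f c) (g c) < 0" using st(2) by (simp add: Delta1_cubic e)
      from DERIV_neg_dec_left[OF dg this] obtain h where
        h: "h > 0" "\<And>k. k > 0 \<Longrightarrow> k < h \<Longrightarrow> g c < g (c - k)" by blast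
      define k where "k = min (h / 2) (c - t0)"
      have "k > 0" "k < h" "t0 \<le> c - k" "c - k < c" using h(1) c by (auto simp: k_def)
      then show False using h(2)[of k] reg(3)[of "c - k"] e by simp
    qed
    moreover have "g c \<noteq> - d"
    proof
      assume e: "g c = - d"
      have "(f c)\<^sup>2 < 1" using fpos fs st(4) q1 by (simp add: power_less_one_iff)
      then have "d * (d + we) * (f c)\<^sup>2 \<le> d * (d + we) * 1" using d2 we_pos by (intro mult_left_mono) auto
      also have "\<dots> < d * (d + 1) * 1" using we_lt_1 d2 by simp
      also have "\<dots> \<le> d * (d + 1) * (d + r)" using d2 r_gt_1 by (intro mult_left_mono) auto
      finally have "- Delta1 d l r (f c) (g c) > 0"
        by (simp add: Delta1_cubic e cubic_def algebra_simps)
      from DERIV_pos_inc_left[OF dg this] obtain h where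
        h: "h > 0" "\<And>k. k > 0 \<Longrightarrow> k < h \<Longrightarrow> g (c - k) < g c" by blast
      define k where "k = min (h / 2) (c - t0)"
      have "k > 0" "k < h" "t0 \<le> c - k" "c - k < c" using h(1) c by (auto simp: k_def)
      then show False using h(2)[of k] reg(4)[of "c - k"] e by simp
    qed
    ultimately show "m c > 0"
      unfolding m fwd_region_def using fpos fs gc by auto
  qed
  then show ?thesis by (simp add: m)
qed

text \<open>
  Convergence to \<open>P\<^sub>4\<close>: the function \<open>w\<^sup>2 + B \<sigma>\<^sup>2\<close> decays exponentially once \<open>B\<close> is large
  enough for the damping of \<open>\<sigma>\<close> to absorb the forcing \<open>d (w - we) \<sigma>\<^sup>2\<close> of \<open>w\<close>.
\<close>

lemma fwd_region_limit:
  fixes f g :: "real \<Rightarrow> real"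
  assumes q: "wm < q" "q < w_bar"
    and reg: "\<And>t. t \<ge> t0 \<Longrightarrow> fwd_region (start_sigma q) q (f t) (g t)"
    and df: "\<And>t. t \<ge> t0 \<Longrightarrow> (f has_real_derivative - Delta2 d l r (f t) (g t)) (at t)"
    and dg: "\<And>t. t \<ge> t0 \<Longrightarrow> (g has_real_derivative - Delta1 d l r (f t) (g t)) (at t)"
  shows "(f \<longlongrightarrow> 0) at_top" "(g \<longlongrightarrow> 0) at_top"
proof -
  let ?s = "start_sigma q"
  note st = start_sigma[OF q]
  have q1: "0 < q" "q < 1" "we < q" using q wm_pos we_lt_wm bar_lt_1 by auto
  define b0 where "b0 = N2 q - l * ?s\<^sup>2"
  define c0 where "c0 = (1 - q) * (r - q)"
  define C where "C = 2 * d * d * (d + 1)"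
  define B where "B = C * l / b0"
  define \<kappa> where "\<kappa> = min (2 * c0) (b0 / l)"
  have b0: "b0 > 0" using st(3) by (simp add: b0_def)
  have c0: "c0 > 0" using q1 r_gt_1 by (simp add: c0_def)
  have C: "C > 0" using d2 by (simp add: C_def)
  have B: "B > 0" using C l0 b0 by (simp add: B_def)
  have k: "\<kappa> > 0" using c0 b0 l0 by (simp add: \<kappa>_def)
  have Bb: "B * (b0 / l) = C" using b0 l0 by (simp add: B_def)
  define M where "M t = (g t)\<^sup>2 + B * (f t)\<^sup>2" for t
  define M' where "M' t = 2 * g t * (- Delta1 d l r (f t) (g t)) + B * (2 * f t * (- Delta2 d l r (f t) (g t)))" for t
  have dM: "(M has_real_derivative M' t) (at t)" if "t \<ge> t0" for t
    unfolding M_def[abs_def] M'_def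
    by (auto intro!: derivative_eq_intros df[OF that] dg[OF that])
  have M': "M' t \<le> - \<kappa> * M t" if "t \<ge> t0" for t
  proof -
    have R: "0 < f t" "f t < ?s" "g t < q" "- d < g t" using reg[OF that] by (auto simp: fwd_region_def)
    have "c0 \<le> (1 - g t) * (r - g t)"
      unfolding c0_def using R q1 r_gt_1 by (intro mult_mono) auto
    then have "(2 * (g t)\<^sup>2) * c0 \<le> (2 * (g t)\<^sup>2) * ((1 - g t) * (r - g t))"
      by (intro mult_left_mono) auto
    then have 1: "2 * g t * cubic r (g t) \<ge> 2 * c0 * (g t)\<^sup>2"
      by (simp add: cubic_def power2_eq_square algebra_simps)
    have "\<bar>g t\<bar> \<le> d" using R q1 d2 by auto
    moreover have "\<bar>g t - we\<bar> \<le> d + 1" using R q1 d2 we_pos we_lt_1 by auto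
    ultimately have "\<bar>g t\<bar> * \<bar>g t - we\<bar> \<le> d * (d + 1)" using d2 by (intro mult_mono) auto
    then have "g t * (g t - we) \<le> d * (d + 1)" by (metis abs_ge_self abs_mult order_trans)
    then have "(2 * d * (f t)\<^sup>2) * (g t * (g t - we)) \<le> (2 * d * (f t)\<^sup>2) * (d * (d + 1))"
      using d2 by (intro mult_left_mono) auto
    then have 2: "2 * g t * (d * (g t - we) * (f t)\<^sup>2) \<le> C * (f t)\<^sup>2"
      by (simp add: C_def algebra_simps)
    have "(f t)\<^sup>2 \<le> ?s\<^sup>2" using R by (intro power_mono) auto
    then have "l * (f t)\<^sup>2 \<le> l * ?s\<^sup>2" using l0 by simp
    moreover have "N2 q \<le> N2 (g t)" using null2_antimono[of "g t" q] R q by simp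
    ultimately have "b0 \<le> N2 (g t) - l * (f t)\<^sup>2" by (simp add: b0_def)
    then have "(2 * (f t)\<^sup>2 / l) * b0 \<le> (2 * (f t)\<^sup>2 / l) * (N2 (g t) - l * (f t)\<^sup>2)"
      using l0 by (intro mult_left_mono) auto
    also have "\<dots> = 2 * f t * Delta2 d l r (f t) (g t)"
      by (simp add: Delta2_N2 power2_eq_square)
    finally have "B * ((2 * (f t)\<^sup>2 / l) * b0) \<le> B * (2 * f t * Delta2 d l r (f t) (g t))"
      using B by (intro mult_left_mono) auto
    moreover have "B * ((2 * (f t)\<^sup>2 / l) * b0) = 2 * (f t)\<^sup>2 * C" unfolding Bb[symmetric] by simp
    ultimately have 3: "B * (2 * f t * Delta2 d l r (f t) (g t)) \<ge> 2 * (C * (f t)\<^sup>2)" by (simp add: mult_ac)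
    have "M' t = - (2 * g t * cubic r (g t)) + 2 * g t * (d * (g t - we) * (f t)\<^sup>2)
        - B * (2 * f t * Delta2 d l r (f t) (g t))"
      by (simp add: M'_def Delta1_cubic algebra_simps)
    then have "M' t \<le> - (2 * c0 * (g t)\<^sup>2) - C * (f t)\<^sup>2" using 1 2 3 by linarith
    moreover have "\<kappa> * (g t)\<^sup>2 \<le> 2 * c0 * (g t)\<^sup>2" by (intro mult_right_mono) (auto simp: \<kappa>_def)
    moreover have "\<kappa> * (B * (f t)\<^sup>2) \<le> b0 / l * (B * (f t)\<^sup>2)"
      using B by (intro mult_right_mono) (auto simp: \<kappa>_def)
    moreover have "b0 / l * (B * (f t)\<^sup>2) = C * (f t)\<^sup>2" unfolding Bb[symmetric] by simp
    ultimately show ?thesis by (simp add: M_def algebra_simps)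
  qed
  have Mexp: "M t \<le> M t0 * exp (- \<kappa> * (t - t0))" if "t \<ge> t0" for t
  proof (rule growth_upper[OF that, where N' = M'])
    show "continuous_on {t0..t} M"
      using DERIV_isCont[OF dM] by (intro continuous_at_imp_continuous_on) auto
  qed (use dM M' in auto)
  have lim0: "((\<lambda>t. M t0 * exp (- \<kappa> * (t - t0))) \<longlongrightarrow> 0) at_top"
  proof -
    have "filterlim (\<lambda>t. t - t0) at_top at_top"
      unfolding filterlim_at_top
    proof
      fix Z
      show "eventually (\<lambda>t. Z \<le> t - t0) at_top"
        by (rule eventually_at_top_linorderI[of "Z + t0"]) simp
    qed
    then have "filterlim (\<lambda>t. - \<kappa> * (t - t0)) at_bot at_top"
      using k by (intro filterlim_tendsto_neg_mult_at_bot[OF tendsto_const]) auto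
    then have "((\<lambda>t. exp (- \<kappa> * (t - t0))) \<longlongrightarrow> 0) at_top"
      by (rule filterlim_compose[OF exp_at_bot])
    then show ?thesis using tendsto_mult_right_zero by blast
  qed
  have M0: "(M \<longlongrightarrow> 0) at_top"
  proof (rule tendsto_sandwich[OF _ _ tendsto_const lim0])
    show "eventually (\<lambda>t. 0 \<le> M t) at_top" using B by (simp add: M_def)
    show "eventually (\<lambda>t. M t \<le> M t0 * exp (- \<kappa> * (t - t0))) at_top"
      using eventually_ge_at_top[of t0] by eventually_elim (rule Mexp)
  qed
  have lim: "(h \<longlongrightarrow> 0) at_top" if "\<And>t. (h t)\<^sup>2 \<le> D * M t" for h :: "real \<Rightarrow> real" and D
  proof -
    have "((\<lambda>t. sqrt (D * M t)) \<longlongrightarrow> sqrt (D * 0)) at_top" by (intro tendsto_intros M0)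
    then have "((\<lambda>t. sqrt (D * M t)) \<longlongrightarrow> 0) at_top" by simp
    moreover have "\<bar>h t\<bar> \<le> sqrt (D * M t)" for t using that[of t] by (intro real_le_rsqrt) simp
    ultimately show ?thesis by (intro Lim_null_comparison[of h "\<lambda>t. sqrt (D * M t)"]) auto
  qed
  show "(g \<longlongrightarrow> 0) at_top" by (rule lim[of _ 1]) (use B in \<open>simp add: M_def\<close>)
  show "(f \<longlongrightarrow> 0) at_top" by (rule lim[of _ "1 / B"]) (use B in \<open>simp add: M_def field_simps\<close>)
qed

text \<open>
  The orbit through \<open>(start_sigma q, q)\<close> in desingularised time, with the clock \<open>x\<close> as third component.
  The square of half-width \<open>d + 1\<close> contains both the backward and the forward region.
\<close>

definition "outer_flow q f g h \<longleftrightarrow>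
  clipped_solution (d + 1) (\<lambda>z. - Delta2 d l r (fst z) (snd z)) (\<lambda>z. - Delta1 d l r (fst z) (snd z))
    (\<lambda>z. Delta (fst z) (snd z)) 0 f g h \<and> f 0 = start_sigma q \<and> g 0 = q \<and> h 0 = 0"

lemma Ck_on_Deltas:
  "Ck_on k (\<lambda>z. - Delta2 d l r (fst z) (snd z)) UNIV"
  "Ck_on k (\<lambda>z. - Delta1 d l r (fst z) (snd z)) UNIV"
  "Ck_on k (\<lambda>z. Delta (fst z) (snd z)) UNIV"
  unfolding Delta1_def Delta2_def Delta_def using l0 by (intro Ck_intros; simp)+

lemma outer_flow_exists:
  obtains f g h where "outer_flow q f g h"
proof -
  have K: "0 \<le> d + 1" using d2 by simp
  obtain f g h where "clipped_solution (d + 1) (\<lambda>z. - Delta2 d l r (fst z) (snd z)) (\<lambda>z. - Delta1 d l r (fst z) (snd z))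
    (\<lambda>z. Delta (fst z) (snd z)) 0 f g h" "f 0 = start_sigma q" "g 0 = q" "h 0 = 0"
    by (rule clipped_system_exists[OF Ck_on_Deltas K]) (rule that)
  then show ?thesis using that unfolding outer_flow_def by blast
qed

lemma outer_flow_clipped:
  assumes "outer_flow q f g h"
  shows "(f has_real_derivative - Delta2 d l r (clip (d + 1) (f t)) (clip (d + 1) (g t))) (at t)"
    "(g has_real_derivative - Delta1 d l r (clip (d + 1) (f t)) (clip (d + 1) (g t))) (at t)"
    "(h has_real_derivative Delta (clip (d + 1) (f t)) (clip (d + 1) (g t))) (at t)"
    "continuous_on S f" "continuous_on S g" "f 0 = start_sigma q" "g 0 = q" "h 0 = 0"
proof -
  have sol: "clipped_solution (d + 1) (\<lambda>z. - Delta2 d l r (fst z) (snd z)) (\<lambda>z. - Delta1 d l r (fst z) (snd z))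
    (\<lambda>z. Delta (fst z) (snd z)) 0 f g h" using assms by (simp add: outer_flow_def)
  have "(f has_real_derivative - Delta2 d l r (clip (d + 1) (f t)) (clip (d + 1) (g t)) - real 0 / 2 *
      ray_mean 0 (\<lambda>y. - Delta2 d l r (clip (d + 1) (f y)) (clip (d + 1) (g y))) t) (at t)"
    using sol unfolding clipped_solution_def fst_conv snd_conv by blast
  then show "(f has_real_derivative - Delta2 d l r (clip (d + 1) (f t)) (clip (d + 1) (g t))) (at t)" by simp
  show "(g has_real_derivative - Delta1 d l r (clip (d + 1) (f t)) (clip (d + 1) (g t))) (at t)"
    "(h has_real_derivative Delta (clip (d + 1) (f t)) (clip (d + 1) (g t))) (at t)"
    using sol unfolding clipped_solution_def fst_conv snd_conv by blast+
  show "continuous_on S f" "continuous_on S g"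
    using sol continuous_on_subset unfolding clipped_solution_def by blast+
  show "f 0 = start_sigma q" "g 0 = q" "h 0 = 0" using assms by (auto simp: outer_flow_def)
qed

text \<open>
  At time \<open>0\<close> the orbit crosses \<open>\<Delta>\<^sub>1 = 0\<close> transversally, because \<open>\<Delta>\<^sub>2 > 0\<close> there: just before, it is in the
  backward region, just after, in the forward region. The clock tends to infinity because \<open>\<Delta>\<close> tends
  to \<open>1\<close> at \<open>P\<^sub>4\<close>.
\<close>

lemma outer_flow_facts:
  assumes q: "wm < q" "q < w_bar" and fl: "outer_flow q f g h"
  shows "\<And>t. t < 0 \<Longrightarrow> out_region (f t) (g t)"
    and "\<And>t. f t > 0" and "\<And>t. Delta (f t) (g t) > 0"
    and "\<And>t. (f has_real_derivative - Delta2 d l r (f t) (g t)) (at t)"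
    and "\<And>t. (g has_real_derivative - Delta1 d l r (f t) (g t)) (at t)"
    and "\<And>t. (h has_real_derivative Delta (f t) (g t)) (at t)"
    and "((\<lambda>t. (f t, g t)) \<longlongrightarrow> P2 d l r) at_bot" and "((\<lambda>t. (f t, g t)) \<longlongrightarrow> P4) at_top"
    and "filterlim h at_top at_top"
proof -
  let ?s = "start_sigma q"
  note st = start_sigma[OF q]
  note c = outer_flow_clipped[OF fl]
  have q1: "0 < q" "q < 1" "we < q" using q wm_pos we_lt_wm bar_lt_1 by auto
  have der: "(f has_real_derivative - Delta2 d l r (f t) (g t)) (at t) \<and>
       (g has_real_derivative - Delta1 d l r (f t) (g t)) (at t) \<and>
       (h has_real_derivative Delta (f t) (g t)) (at t)"
    if "\<bar>f t\<bar> \<le> d + 1" "\<bar>g t\<bar> \<le> d + 1" for t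
    using c(1,2,3)[of t] clip_id[OF that(1)] clip_id[OF that(2)] by simp
  have b0: "\<bar>f 0\<bar> \<le> d + 1" "\<bar>g 0\<bar> \<le> d + 1" using st q1 d2 c(6,7) by auto
  have D2: "Delta2 d l r ?s q > 0" using st l0 by (simp add: Delta2_N2)
  \<comment> \<open>\<open>\<Delta>\<^sub>1\<close> vanishes at time \<open>0\<close> and increases there\<close>
  have dD: "((\<lambda>t. Delta1 d l r (f t) (g t)) has_real_derivative 2 * d * (q - we) * ?s * Delta2 d l r ?s q) (at 0)"
    by (rule DERIV_cong[OF DERIV_Delta1]) (use der[OF b0] c(6,7) st(2) in auto)
  have pos: "2 * d * (q - we) * ?s * Delta2 d l r ?s q > 0" using q1 d2 st(1) D2 by simp
  obtain e1 where e1: "e1 > 0" "\<And>k. 0 < k \<Longrightarrow> k < e1 \<Longrightarrow> Delta1 d l r (f k) (g k) > 0"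
    using DERIV_pos_inc_right[OF dD pos] c(6,7) st(2) by auto
  obtain e2 where e2: "e2 > 0" "\<And>k. 0 < k \<Longrightarrow> k < e2 \<Longrightarrow> Delta1 d l r (f (- k)) (g (- k)) < 0"
    using DERIV_pos_inc_left[OF dD pos] c(6,7) st(2) by auto
  have "- Delta2 d l r (f 0) (g 0) < 0" using D2 c(6,7) by simp
  then obtain e3 where e3: "e3 > 0" "\<And>k. 0 < k \<Longrightarrow> k < e3 \<Longrightarrow> f k < ?s"
    using DERIV_neg_dec_right[of f "- Delta2 d l r (f 0) (g 0)" 0] der[OF b0] c(6) by auto
  define m where "m t = min (min (N2 (g t) - l * (f t)\<^sup>2) (f t)) (min (g t - wm) (w_bar - g t))" for t
  have "continuous_on UNIV m" unfolding m_def by (intro continuous_intros c(4,5))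
  moreover have "m 0 > 0" using st q c(6,7) by (simp add: m_def)
  ultimately have "eventually (\<lambda>t. m t > 0) (at 0)"
    by (intro order_tendstoD(1)[of m "m 0"]) (auto simp: continuous_on_eq_continuous_at isCont_def)
  then obtain e4 where e4: "e4 > 0" "\<And>t. t \<noteq> 0 \<Longrightarrow> \<bar>t\<bar> < e4 \<Longrightarrow> m t > 0"
    unfolding eventually_at dist_real_def by auto
  define e where "e = min (min e1 e2) (min e3 e4)"
  have e: "e > 0" "e \<le> e1" "e \<le> e2" "e \<le> e3" "e \<le> e4" using e1 e2 e3 e4 by (auto simp: e_def)
  have near: "N2 (g t) - l * (f t)\<^sup>2 > 0" "f t > 0" "g t > wm" "g t < w_bar" if "t \<noteq> 0" "\<bar>t\<bar> < e" for t
    using e4(2)[OF that(1)] that(2) e by (auto simp: m_def)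
  have out0: "out_region (f (- k)) (g (- k))" if "0 < k" "k < e" for k
    using near[of "- k"] e2(2)[of k] that e by (auto simp: out_region_def)
  have rev: "((\<lambda>t. k (- t)) has_real_derivative D) (at t)" if "(k has_real_derivative - D) (at (- t))" for k D t
    using DERIV_chain2[OF that DERIV_minus[OF DERIV_ident]] by simp
  have ob: "\<bar>s\<bar> \<le> d + 1" "\<bar>w\<bar> \<le> d + 1" if "out_region s w" for s w
    using out_region_bounds[OF that] d2 by auto
  have der_rev: "((\<lambda>t. f (- t)) has_real_derivative Delta2 d l r (f (- t)) (g (- t))) (at t)"
    "((\<lambda>t. g (- t)) has_real_derivative Delta1 d l r (f (- t)) (g (- t))) (at t)"
    if "out_region (f (- t)) (g (- t))" for t
    using rev[of f _ t] rev[of g _ t] der[OF ob[OF that]] by auto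
  have contr: "continuous_on S (\<lambda>t. f (- t))" "continuous_on S (\<lambda>t. g (- t))" for S
    by (intro continuous_on_compose2[OF c(4)[of UNIV]] continuous_on_compose2[OF c(5)[of UNIV]] continuous_intros; simp)+
  have out': "out_region (f (- t)) (g (- t))" if "t > 0" for t
  proof -
    define k where "k = min t (e / 2)"
    have k: "0 < k" "k < e" "k \<le> t" using that e(1) by (auto simp: k_def)
    show ?thesis
      using out_region_invariant[of "\<lambda>t. f (- t)" k "\<lambda>t. g (- t)", OF out0[OF k(1,2)] contr der_rev k(3)] .
  qed
  show out: "out_region (f t) (g t)" if "t < 0" for t using out'[of "- t"] that by simp
  have fwd0: "fwd_region ?s q (f k) (g k)" if "0 < k" "k < e" for k
  proof -
    have "g k < g 0"
    proof (rule DERIV_neg_imp_decreasing_open[OF that(1)])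
      fix x assume x: "0 < x" "x < k"
      have nx: "f x > 0" "g x > wm" "g x < w_bar" "f x < ?s"
        using near[of x] e3(2)[of x] x that e by auto
      have "\<bar>f x\<bar> \<le> d + 1" "\<bar>g x\<bar> \<le> d + 1" using nx st(4) q1 d2 bar_lt_1 wm_pos by auto
      from der[OF this] show "\<exists>y. (g has_real_derivative y) (at x) \<and> y < 0"
        using e1(2)[of x] x that e by (intro exI[of _ "- Delta1 d l r (f x) (g x)"]) auto
    qed (rule c(5))
    then show ?thesis
      using near[of k] e3(2)[of k] that e c(7) wm_pos d2 by (auto simp: fwd_region_def)
  qed
  have fwd: "fwd_region ?s q (f t) (g t)" if "t > 0" for t
  proof -
    define k where "k = min t (e / 2)"
    have k: "0 < k" "k < e" "k \<le> t" using that e(1) by (auto simp: k_def)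
    have d': "(f has_real_derivative - Delta2 d l r (f t) (g t)) (at t) \<and>
       (g has_real_derivative - Delta1 d l r (f t) (g t)) (at t)"
      if "\<bar>f t\<bar> \<le> d + 1" "\<bar>g t\<bar> \<le> d + 1" for t using der[OF that] by blast
    show ?thesis
      by (rule fwd_region_invariant[OF q fwd0[OF k(1,2)] c(4,5) d' k(3)])
  qed
  have bnd: "0 < f t" "f t < 1 - g t" "\<bar>f t\<bar> \<le> d + 1" "\<bar>g t\<bar> \<le> d + 1" for t
  proof -
    consider "t < 0" | "t = 0" | "t > 0" by linarith
    then have "0 < f t \<and> f t < 1 - g t \<and> \<bar>f t\<bar> \<le> d + 1 \<and> \<bar>g t\<bar> \<le> d + 1"
    proof cases
      case 1
      then show ?thesis using out_region_bounds[OF out[OF 1]] ob[OF out[OF 1]] by auto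
    next
      case 2
      then show ?thesis using st c(6,7) b0 by auto
    next
      case 3
      then show ?thesis using fwd[OF 3] st(4) q1 d2 by (auto simp: fwd_region_def)
    qed
    then show "0 < f t" "f t < 1 - g t" "\<bar>f t\<bar> \<le> d + 1" "\<bar>g t\<bar> \<le> d + 1" by auto
  qed
  show "f t > 0" for t by (rule bnd)
  show dl: "Delta (f t) (g t) > 0" for t
  proof -
    have "(f t)\<^sup>2 < (1 - g t)\<^sup>2" using bnd[of t] by (intro power_strict_mono) auto
    then show ?thesis by (simp add: Delta_def power2_commute)
  qed
  show df: "(f has_real_derivative - Delta2 d l r (f t) (g t)) (at t)"
    and dg: "(g has_real_derivative - Delta1 d l r (f t) (g t)) (at t)"
    and dh: "(h has_real_derivative Delta (f t) (g t)) (at t)" for t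
    using der[OF bnd(3,4)] by auto
  have "((\<lambda>t. (f (- t), g (- t))) \<longlongrightarrow> P2 d l r) at_top"
    by (rule out_region_limit[of 1]) (use out' der_rev in auto)
  then show "((\<lambda>t. (f t, g t)) \<longlongrightarrow> P2 d l r) at_bot" by (simp add: filterlim_at_bot_mirror)
  have lim: "(f \<longlongrightarrow> 0) at_top" "(g \<longlongrightarrow> 0) at_top"
    using fwd_region_limit[OF q, of 1 f g] fwd df dg by auto
  then show "((\<lambda>t. (f t, g t)) \<longlongrightarrow> P4) at_top" unfolding P4_def by (intro tendsto_Pair)
  have "((\<lambda>t. Delta (f t) (g t)) \<longlongrightarrow> Delta 0 0) at_top"
    unfolding Delta_def by (intro tendsto_intros lim)
  then have "eventually (\<lambda>t. Delta (f t) (g t) > 1 / 2) at_top"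
    by (rule order_tendstoD(1)) (simp add: Delta_def)
  then obtain t1 where t1: "\<And>t. t \<ge> t1 \<Longrightarrow> Delta (f t) (g t) > 1 / 2"
    unfolding eventually_at_top_linorder by blast
  have low: "h t \<ge> h t1 - t1 / 2 + t / 2" if "t \<ge> t1" for t
  proof -
    have "h t1 - t1 / 2 \<le> h t - t / 2"
    proof (rule DERIV_nonneg_imp_nondecreasing[OF that])
      fix x assume "t1 \<le> x" "x \<le> t"
      then show "\<exists>y. ((\<lambda>x. h x - x / 2) has_real_derivative y) (at x) \<and> 0 \<le> y"
        using DERIV_diff[OF dh[of x] DERIV_cdivide[OF DERIV_ident, of 2]] t1[of x]
        by (intro exI[of _ "Delta (f x) (g x) - 1 / 2"]) auto
    qed
    then show ?thesis by simp
  qed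
  show "filterlim h at_top at_top"
    unfolding filterlim_at_top
  proof
    fix Z
    show "eventually (\<lambda>t. Z \<le> h t) at_top"
      using eventually_ge_at_top[of "max t1 (2 * (Z - (h t1 - t1 / 2)))"]
      by eventually_elim (use low in force)
  qed
qed

text \<open>Continuous dependence on the starting point, from the global Lipschitz bound of the clipped field.\<close>

lemma outer_flow_dependence:
  obtains L where "\<And>q q' f g h f' g' h' t. outer_flow q f g h \<Longrightarrow> outer_flow q' f' g' h' \<Longrightarrow>
    norm ((f t, g t, h t) - (f' t, g' t, h' t)) \<le>
      exp (L * \<bar>t\<bar>) * norm ((start_sigma q, q, 0) - (start_sigma q', q', 0 :: real))"
proof -
  define F where "F = clipped_field (d + 1) (\<lambda>z. - Delta2 d l r (fst z) (snd z))
      (\<lambda>z. - Delta1 d l r (fst z) (snd z)) (\<lambda>z. Delta (fst z) (snd z))"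
  have K: "0 \<le> d + 1" using d2 by simp
  obtain L where L: "\<And>z z'. norm (F z - F z') \<le> L * norm (z - z')"
    unfolding F_def by (rule clipped_field_bounds[OF Ck_on_Deltas K]) blast
  have vd: "((\<lambda>t. (f t, g t, h t)) has_vector_derivative F (f t, g t, h t)) (at t)"
    if "outer_flow q f g h" for q f g h t
    using outer_flow_clipped(1-3)[OF that, of t]
    unfolding has_real_derivative_iff_has_vector_derivative F_def clipped_field_def
    by (auto intro!: has_vector_derivative_Pair)
  show ?thesis
  proof (rule that)
    fix q q' f g h f' g' h' t
    assume fl: "outer_flow q f g h" "outer_flow q' f' g' h'"
    define v v' where "v t = (f t, g t, h t)" and "v' t = (f' t, g' t, h' t)" for t
    have dv: "(v has_vector_derivative F (v t)) (at t)" "(v' has_vector_derivative F (v' t)) (at t)" for t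
      using vd[OF fl(1)] vd[OF fl(2)] by (auto simp: v_def[abs_def] v'_def[abs_def])
    have cv: "continuous_on S v" "continuous_on S v'" for S
      using dv has_vector_derivative_continuous by (blast intro: continuous_at_imp_continuous_on)+
    have v0: "v 0 = (start_sigma q, q, 0)" "v' 0 = (start_sigma q', q', 0)"
      using outer_flow_clipped(6-8)[OF fl(1)] outer_flow_clipped(6-8)[OF fl(2)] by (auto simp: v_def v'_def)
    have "norm (v t - v' t) \<le> exp (L * \<bar>t\<bar>) * norm (v 0 - v' 0)"
    proof (cases "t \<ge> 0")
      case True
      then show ?thesis
        using dist_growth(1)[OF True cv dv L] by simp
    next
      case False
      then have "t \<le> 0" by simp
      from dist_growth(2)[OF this cv dv L] False show ?thesis by simp
    qed
    then show "norm ((f t, g t, h t) - (f' t, g' t, h' t)) \<le>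
      exp (L * \<bar>t\<bar>) * norm ((start_sigma q, q, 0) - (start_sigma q', q', 0 :: real))"
      unfolding v0 by (simp add: v_def v'_def)
  qed
qed

text \<open>
  Uniqueness for the autonomous system of the first two components. The clock, which depends on
  the starting point of the quadrature, is replaced by a constant.
\<close>

lemma outer_flow_orbit:
  assumes f1: "outer_flow q1 f1 g1 h1" and f2: "outer_flow q2 f2 g2 h2"
    and q: "wm < q1" "q1 < w_bar" "wm < q2" "q2 < w_bar"
    and meet: "f1 t1 = f2 t2" "g1 t1 = g2 t2"
  shows "f1 (t1 + s) = f2 (t2 + s)" "g1 (t1 + s) = g2 (t2 + s)"
proof -
  define F where "F = clipped_field (d + 1) (\<lambda>z. - Delta2 d l r (fst z) (snd z))
      (\<lambda>z. - Delta1 d l r (fst z) (snd z)) (\<lambda>z. 0)"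
  have K: "0 \<le> d + 1" using d2 by simp
  obtain L where L: "\<And>z z'. norm (F z - F z') \<le> L * norm (z - z')"
    unfolding F_def
    by (rule clipped_field_bounds[OF Ck_on_Deltas(1,2) Ck_on_const[OF open_UNIV] K]) blast
  have vd: "((\<lambda>s. (f (t + s), g (t + s), 0)) has_vector_derivative F (f (t + s), g (t + s), 0)) (at s)"
    if "outer_flow q f g h" for q f g h s t
  proof -
    have sh: "((\<lambda>s. k (t + s)) has_real_derivative D) (at s)" if "(k has_real_derivative D) (at (t + s))" for k D
      using DERIV_chain2[OF that DERIV_add[OF DERIV_const DERIV_ident]] by simp
    show ?thesis
      using sh[OF outer_flow_clipped(1)[OF that]] sh[OF outer_flow_clipped(2)[OF that]]
      unfolding has_real_derivative_iff_has_vector_derivative F_def clipped_field_def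
      by (auto intro!: has_vector_derivative_Pair)
  qed
  define v1 v2 where "v1 s = (f1 (t1 + s), g1 (t1 + s), 0 :: real)" and "v2 s = (f2 (t2 + s), g2 (t2 + s), 0 :: real)" for s
  have dv: "(v1 has_vector_derivative F (v1 s)) (at s)" "(v2 has_vector_derivative F (v2 s)) (at s)" for s
    using vd[OF f1] vd[OF f2] by (auto simp: v1_def[abs_def] v2_def[abs_def])
  have cv: "continuous_on S v1" "continuous_on S v2" for S
    using dv has_vector_derivative_continuous by (blast intro: continuous_at_imp_continuous_on)+
  have v0: "v1 0 - v2 0 = 0" using meet by (simp add: v1_def v2_def)
  have "v1 s = v2 s"
  proof (cases "s \<ge> 0")
    case True
    then show ?thesis using dist_growth(1)[OF True cv dv L] v0 by simp
  next
    case False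
    then have "s \<le> 0" by simp
    from dist_growth(2)[OF this cv dv L] v0 show ?thesis by simp
  qed
  then show "f1 (t1 + s) = f2 (t2 + s)" "g1 (t1 + s) = g2 (t2 + s)" by (auto simp: v1_def v2_def)
qed

text \<open>
  Different starting points give disjoint orbits: an orbit meets the arc \<open>\<Delta>\<^sub>1 = 0\<close> of starting
  points only at time \<open>0\<close>, because \<open>\<Delta>\<^sub>1 < 0\<close> at all earlier times.
\<close>

lemma outer_flow_disjoint:
  assumes f1: "outer_flow q1 f1 g1 h1" and f2: "outer_flow q2 f2 g2 h2"
    and q1: "wm < q1" "q1 < w_bar" and q2: "wm < q2" "q2 < w_bar"
    and meet: "f1 t1 = f2 t2" "g1 t1 = g2 t2"
  shows "q1 = q2"
proof -
  have a: "f1 (t1 - t2) = start_sigma q2" "g1 (t1 - t2) = q2"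
    using outer_flow_orbit[OF f1 f2 q1 q2 meet, of "- t2"] outer_flow_clipped(6,7)[OF f2] by auto
  have b: "f2 (t2 - t1) = start_sigma q1" "g2 (t2 - t1) = q1"
    using outer_flow_orbit[OF f1 f2 q1 q2 meet, of "- t1"] outer_flow_clipped(6,7)[OF f1] by auto
  consider "t1 < t2" | "t2 < t1" | "t1 = t2" by linarith
  then show ?thesis
  proof cases
    case 1
    then have "out_region (f1 (t1 - t2)) (g1 (t1 - t2))" using outer_flow_facts(1)[OF q1 f1] by simp
    then show ?thesis using start_sigma(2)[OF q2] by (simp add: a out_region_def)
  next
    case 2
    then have "out_region (f2 (t2 - t1)) (g2 (t2 - t1))" using outer_flow_facts(1)[OF q2 f2] by simp
    then show ?thesis using start_sigma(2)[OF q1] by (simp add: b out_region_def)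
  next
    case 3
    then show ?thesis using a(2) outer_flow_clipped(7)[OF f1] by simp
  qed
qed

text \<open>
  A homeomorphism of the line onto the interval of admissible starting points.
\<close>

definition "outer_start p = wm + (w_bar - wm) * (1 / 2 + arctan p / pi)"

lemma outer_start: "wm < outer_start p" "outer_start p < w_bar"
proof -
  have "- (1 / 2) < arctan p / pi" "arctan p / pi < 1 / 2"
    using arctan_bounded[of p] pi_gt_zero by (simp_all add: field_simps)
  then have u: "0 < 1 / 2 + arctan p / pi" "1 / 2 + arctan p / pi < 1" by linarith+
  show "wm < outer_start p" using u wm_lt_bar by (simp add: outer_start_def)
  have "(w_bar - wm) * (1 / 2 + arctan p / pi) < (w_bar - wm) * 1"
    using u wm_lt_bar by (intro mult_strict_left_mono) auto
  then show "outer_start p < w_bar" by (simp add: outer_start_def)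
qed

lemma outer_start_inj: "outer_start p = outer_start q \<Longrightarrow> p = q"
  using wm_lt_bar by (simp add: outer_start_def arctan_eq_iff)

lemma continuous_outer_start: "continuous_on A outer_start"
  unfolding outer_start_def by (intro continuous_intros) auto

text \<open>
  The joint continuity in the parameter and \<open>x\<close> is inherited from that of the clocks: they are strictly
  increasing, so the value of an inverse clock at \<open>x\<close> is enclosed by comparing two values of
  the clock with \<open>x\<close>, which is an open condition on the parameter.
\<close>

lemma outer_family:
  obtains a :: "real \<Rightarrow> ereal" and S W :: "real \<Rightarrow> real \<Rightarrow> real" where
    "\<forall>p. connects_P2_P4 d l r (a p) (S p) (W p)"
    "\<forall>p q. p \<noteq> q \<longrightarrow> (\<lambda>x. (S p x, W p x)) ` einterval (a p) \<infinity> \<inter> (\<lambda>x. (S q x, W q x)) ` einterval (a q) \<infinity> = {}"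
    "continuous_on {(p, x). a p < ereal x} (\<lambda>(p, x). (S p x, W p x))"
proof -
  have "\<forall>p. \<exists>F. outer_flow (outer_start p) (fst F) (fst (snd F)) (snd (snd F))"
  proof
    fix p
    obtain f g h where "outer_flow (outer_start p) f g h" by (rule outer_flow_exists)
    then show "\<exists>F. outer_flow (outer_start p) (fst F) (fst (snd F)) (snd (snd F))"
      by (intro exI[of _ "(f, g, h)"]) simp
  qed
  then obtain F where F: "\<And>p. outer_flow (outer_start p) (fst (F p)) (fst (snd (F p))) (snd (snd (F p)))"
    by metis
  define f g h where "f p = fst (F p)" and "g p = fst (snd (F p))" and "h p = snd (snd (F p))" for p
  have fl: "outer_flow (outer_start p) (f p) (g p) (h p)" for p using F by (simp add: f_def g_def h_def)
  note facts = outer_flow_facts[OF outer_start fl]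
  have "\<forall>p. \<exists>c. inverse_clock (h p) (\<lambda>t. Delta (f p t) (g p t)) (fst c) (fst (snd c)) (snd (snd c))"
  proof
    fix p
    obtain a b G where "inverse_clock (h p) (\<lambda>t. Delta (f p t) (g p t)) a b G"
      using inverse_clock_exists[of "h p" "\<lambda>t. Delta (f p t) (g p t)", OF facts(6) facts(3)] by blast
    then show "\<exists>c. inverse_clock (h p) (\<lambda>t. Delta (f p t) (g p t)) (fst c) (fst (snd c)) (snd (snd c))"
      by (intro exI[of _ "(a, b, G)"]) simp
  qed
  then obtain c where c: "\<And>p. inverse_clock (h p) (\<lambda>t. Delta (f p t) (g p t)) (fst (c p)) (fst (snd (c p))) (snd (snd (c p)))"
    by metis
  define a G where "a p = fst (c p)" and "G p = snd (snd (c p))" for p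
  have binf: "fst (snd (c p)) = \<infinity>" for p by (rule inverse_clockD(9)[OF c facts(9)])
  have ic: "inverse_clock (h p) (\<lambda>t. Delta (f p t) (g p t)) (a p) \<infinity> (G p)" for p
    using c[of p] by (simp add: binf a_def G_def)
  note tc = inverse_clockD[OF ic]
  define S W where "S p x = f p (G p x)" and "W p x = g p (G p x)" for p x
  have conn: "connects_P2_P4 d l r (a p) (S p) (W p)" for p
    unfolding connects_P2_P4_def
  proof (intro conjI)
    show "trajectory d l r (a p) \<infinity> (S p) (W p)"
      unfolding trajectory_def
    proof (intro conjI ballI tc(1))
      fix x assume x: "x \<in> einterval (a p) \<infinity>"
      show "S p x > 0" "Delta (S p x) (W p x) \<noteq> 0"
        using facts(2)[of p] facts(3)[of p "G p x"] by (auto simp: S_def W_def)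
      have "(S p has_real_derivative - Delta2 d l r (S p x) (W p x) * (1 / Delta (S p x) (W p x))) (at x)"
        unfolding S_def[abs_def] W_def by (rule DERIV_chain2[OF facts(4) tc(5)[OF x]])
      moreover have "(W p has_real_derivative - Delta1 d l r (S p x) (W p x) * (1 / Delta (S p x) (W p x))) (at x)"
        unfolding S_def W_def[abs_def] by (rule DERIV_chain2[OF facts(5) tc(5)[OF x]])
      ultimately show "\<exists>\<sigma>' w'. (S p has_real_derivative \<sigma>') (at x) \<and> (W p has_real_derivative w') (at x) \<and>
          Delta (S p x) (W p x) * w' = - Delta1 d l r (S p x) (W p x) \<and>
          Delta (S p x) (W p x) * \<sigma>' = - Delta2 d l r (S p x) (W p x)"
        using \<open>Delta (S p x) (W p x) \<noteq> 0\<close> by (intro exI conjI) auto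
    qed
    have "((\<lambda>z. (f p ((G p \<circ> real_of_ereal) z), g p ((G p \<circ> real_of_ereal) z))) \<longlongrightarrow> P2 d l r) (at_right (a p))"
      by (rule filterlim_compose[OF facts(7) tc(7)])
    then show "(((\<lambda>x. (S p x, W p x)) \<circ> real_of_ereal) \<longlongrightarrow> P2 d l r) (at_right (a p))"
      by (simp add: S_def W_def o_def)
    have Gt: "filterlim (G p) at_top at_top"
      using tc(6)[of p] unfolding filterlim_at_left_PInf_iff .
    show "((\<lambda>x. (S p x, W p x)) \<longlongrightarrow> P4) at_top"
      unfolding S_def W_def by (rule filterlim_compose[OF facts(8) Gt])
  qed
  have disj: "(\<lambda>x. (S p x, W p x)) ` einterval (a p) \<infinity> \<inter> (\<lambda>x. (S q x, W q x)) ` einterval (a q) \<infinity> = {}"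
    if "p \<noteq> q" for p q
  proof (rule ccontr)
    assume "\<not> ?thesis"
    then obtain x y where "S p x = S q y" "W p x = W q y" by auto
    then have "outer_start p = outer_start q"
      unfolding S_def W_def using outer_flow_disjoint[OF fl fl outer_start outer_start] by blast
    then show False using that outer_start_inj by blast
  qed
  have mono: "h p s < h p t" if "s < t" for p s t
    by (rule DERIV_pos_imp_increasing[OF that]) (use facts(3,6) in blast)
  obtain L where L: "\<And>p p' t. norm ((f p t, g p t, h p t) - (f p' t, g p' t, h p' t)) \<le>
      exp (L * \<bar>t\<bar>) * norm ((start_sigma (outer_start p), outer_start p, 0) - (start_sigma (outer_start p'), outer_start p', 0 :: real))"
    using outer_flow_dependence fl by metis
  define V where "V p = (start_sigma (outer_start p), outer_start p, 0 :: real)" for p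
  have contV: "continuous_on UNIV V"
  proof -
    have "outer_start p \<noteq> we" for p using outer_start[of p] we_lt_wm by simp
    then show ?thesis
      unfolding V_def start_sigma_def
      by (intro continuous_intros continuous_outer_start) (use d2 in auto)
  qed
  have L0: "norm ((f p t, g p t, h p t) - (f p' t, g p' t, h p' t)) \<le> exp (\<bar>L\<bar> * (\<bar>t0\<bar> + 1)) * norm (V p - V p')"
    if "\<bar>t - t0\<bar> \<le> 1" for p p' t t0
  proof -
    have "L * \<bar>t\<bar> \<le> \<bar>L\<bar> * (\<bar>t0\<bar> + 1)"
      using that by (intro mult_mono) auto
    then show ?thesis
      using L[of p t p'] unfolding V_def[symmetric]
      by (meson exp_le_cancel_iff mult_right_mono norm_ge_zero order_trans)
  qed
  have "continuous_on {(p, x). a p < ereal x} (\<lambda>(p, x). (S p x, W p x))"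
    unfolding continuous_on_sequentially
  proof (intro ballI allI impI)
    fix z zs assume z: "z \<in> {(p, x). a p < ereal x}" and zs: "(\<forall>n. zs n \<in> {(p, x). a p < ereal x}) \<and> zs \<longlonglongrightarrow> z"
    define p0 x0 where "p0 = fst z" and "x0 = snd z"
    define p x where "p n = fst (zs n)" and "x n = snd (zs n)" for n
    have px: "p \<longlonglongrightarrow> p0" "x \<longlonglongrightarrow> x0"
      using zs by (auto simp: p_def[abs_def] x_def[abs_def] p0_def x0_def intro: tendsto_fst tendsto_snd)
    have x0: "x0 \<in> einterval (a p0) \<infinity>" and x: "x n \<in> einterval (a (p n)) \<infinity>" for n
      using z zs by (auto simp: einterval_iff p0_def x0_def p_def x_def split_beta)
    define t0 where "t0 = G p0 x0"
    have ht0: "h p0 t0 = x0" unfolding t0_def by (rule tc(4)[OF x0])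
    have Vp: "(\<lambda>n. norm (V (p n) - V p0)) \<longlonglongrightarrow> 0"
      using continuous_on_tendsto_compose[OF contV px(1)] by (simp add: tendsto_norm_zero_iff LIM_zero_iff)
    have unif: "(\<lambda>n. exp (\<bar>L\<bar> * (\<bar>t0\<bar> + 1)) * norm (V (p n) - V p0)) \<longlonglongrightarrow> 0"
      using tendsto_mult_right_zero[OF Vp] by simp
    have hlim: "(\<lambda>n. h (p n) t) \<longlonglongrightarrow> h p0 t" if "\<bar>t - t0\<bar> \<le> 1" for t
    proof (rule LIM_zero_cancel, rule Lim_null_comparison[OF _ unif], rule always_eventually, rule allI)
      fix n
      have "norm (h (p n) t - h p0 t) \<le> norm ((f (p n) t, g (p n) t, h (p n) t) - (f p0 t, g p0 t, h p0 t))"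
        using norm_snd_le[of "(g (p n) t - g p0 t, h (p n) t - h p0 t)" "f (p n) t - f p0 t"]
          norm_snd_le[of "h (p n) t - h p0 t" "g (p n) t - g p0 t"] by simp
      also note L0[OF that]
      finally show "norm (h (p n) t - h p0 t) \<le> exp (\<bar>L\<bar> * (\<bar>t0\<bar> + 1)) * norm (V (p n) - V p0)" .
    qed
    have Glim: "(\<lambda>n. G (p n) (x n)) \<longlonglongrightarrow> t0"
    proof (rule tendstoI)
      fix e :: real assume e: "e > 0"
      define \<epsilon> where "\<epsilon> = min e 1"
      have eps: "0 < \<epsilon>" "\<epsilon> \<le> e" "\<epsilon> \<le> 1" using e by (auto simp: \<epsilon>_def)
      have "h p0 (t0 - \<epsilon>) < x0" "x0 < h p0 (t0 + \<epsilon>)" using mono[of "t0 - \<epsilon>" t0 p0] mono[of t0 "t0 + \<epsilon>" p0] ht0 eps by auto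
      then obtain m1 m2 where m: "h p0 (t0 - \<epsilon>) < m1" "m1 < x0" "x0 < m2" "m2 < h p0 (t0 + \<epsilon>)"
        using dense by meson
      have "\<forall>\<^sub>F n in sequentially. h (p n) (t0 - \<epsilon>) < m1"
        using order_tendstoD(2)[OF hlim m(1)] eps by simp
      moreover have "\<forall>\<^sub>F n in sequentially. m2 < h (p n) (t0 + \<epsilon>)"
        using order_tendstoD(1)[OF hlim m(4)] eps by simp
      moreover have "\<forall>\<^sub>F n in sequentially. m1 < x n" using order_tendstoD(1)[OF px(2) m(2)] .
      moreover have "\<forall>\<^sub>F n in sequentially. x n < m2" using order_tendstoD(2)[OF px(2) m(3)] .
      ultimately show "\<forall>\<^sub>F n in sequentially. dist (G (p n) (x n)) t0 < e"
      proof eventually_elim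
        case (elim n)
        let ?t = "G (p n) (x n)"
        have ht: "h (p n) ?t = x n" by (rule tc(4)[OF x])
        have "t0 - \<epsilon> < ?t"
          using mono[of ?t "t0 - \<epsilon>" "p n"] ht elim by (cases ?t "t0 - \<epsilon>" rule: linorder_cases) auto
        moreover have "?t < t0 + \<epsilon>"
          using mono[of "t0 + \<epsilon>" ?t "p n"] ht elim by (cases ?t "t0 + \<epsilon>" rule: linorder_cases) auto
        ultimately show ?case using eps by (simp add: dist_real_def abs_less_iff)
      qed
    qed
    have near: "\<forall>\<^sub>F n in sequentially. \<bar>G (p n) (x n) - t0\<bar> \<le> 1"
      using tendstoD[OF Glim zero_less_one] by eventually_elim (simp add: dist_real_def)
    have cf: "isCont (f p0) t0" "isCont (g p0) t0"
      using facts(4)[of p0 t0] facts(5)[of p0 t0] DERIV_isCont by blast+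
    have lim: "(\<lambda>n. k (p n) (G (p n) (x n))) \<longlonglongrightarrow> k p0 t0"
      if k: "isCont (k p0) t0" "\<And>p p' t. \<bar>k p t - k p' t\<bar> \<le> norm ((f p t, g p t, h p t) - (f p' t, g p' t, h p' t))" for k
    proof -
      have "(\<lambda>n. k (p n) (G (p n) (x n)) - k p0 (G (p n) (x n))) \<longlonglongrightarrow> 0"
      proof (rule Lim_null_comparison[OF _ unif])
        show "\<forall>\<^sub>F n in sequentially. norm (k (p n) (G (p n) (x n)) - k p0 (G (p n) (x n)))
            \<le> exp (\<bar>L\<bar> * (\<bar>t0\<bar> + 1)) * norm (V (p n) - V p0)"
          using near
        proof eventually_elim
          case (elim n)
          show ?case unfolding real_norm_def by (rule order_trans[OF k(2) L0[OF elim]])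
        qed
      qed
      from tendsto_add[OF this isCont_tendsto_compose[OF k(1) Glim]] show ?thesis by simp
    qed
    have bf: "\<bar>f p t - f p' t\<bar> \<le> norm ((f p t, g p t, h p t) - (f p' t, g p' t, h p' t))" for p p' t
      using norm_fst_le[of "f p t - f p' t" "(g p t - g p' t, h p t - h p' t)"] by simp
    have bg: "\<bar>g p t - g p' t\<bar> \<le> norm ((f p t, g p t, h p t) - (f p' t, g p' t, h p' t))" for p p' t
      using norm_fst_le[of "g p t - g p' t" "h p t - h p' t"]
        norm_snd_le[of "(g p t - g p' t, h p t - h p' t)" "f p t - f p' t"] by simp
    have "(\<lambda>n. (S (p n) (x n), W (p n) (x n))) \<longlonglongrightarrow> (S p0 x0, W p0 x0)"
      unfolding S_def W_def t0_def[symmetric] by (intro tendsto_Pair lim[OF cf(1) bf] lim[OF cf(2) bg])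
    then show "((\<lambda>(p, x). (S p x, W p x)) \<circ> zs) \<longlonglongrightarrow> (\<lambda>(p, x). (S p x, W p x)) z"
      by (simp add: o_def split_beta p_def x_def p0_def x0_def)
  qed
  then show ?thesis using that conn disj by blast
qed

end

section \<open>Uniqueness of the curve leaving P6\<close>

context phase_plane
begin

text \<open>
  Solutions of the system on \<open>(-\<infinity>, b)\<close> that are allowed to cross the sonic line: this is what an
  arbitrary smooth Euler solution provides.
\<close>

definition weak_solution :: "ereal \<Rightarrow> (real \<Rightarrow> real) \<Rightarrow> (real \<Rightarrow> real) \<Rightarrow> bool" where
  "weak_solution b \<sigma> w \<longleftrightarrow> (\<forall>x. ereal x < b \<longrightarrow> \<sigma> x > 0 \<and>
     (\<exists>\<sigma>' w'. (\<sigma> has_real_derivative \<sigma>') (at x) \<and> (w has_real_derivative w') (at x) \<and>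
        Delta (\<sigma> x) (w x) * w' = - Delta1 d l r (\<sigma> x) (w x) \<and>
        Delta (\<sigma> x) (w x) * \<sigma>' = - Delta2 d l r (\<sigma> x) (w x)))"

lemma trajectory_weak_solution: "trajectory d l r (- \<infinity>) b \<sigma> w \<Longrightarrow> weak_solution b \<sigma> w"
  unfolding trajectory_def weak_solution_def by (auto simp: einterval_iff)

lemma weak_solutionD:
  assumes "weak_solution b \<sigma> w" "ereal x < b" "Delta (\<sigma> x) (w x) \<noteq> 0"
  shows "(\<sigma> has_real_derivative - Delta2 d l r (\<sigma> x) (w x) / Delta (\<sigma> x) (w x)) (at x)"
    "(w has_real_derivative - Delta1 d l r (\<sigma> x) (w x) / Delta (\<sigma> x) (w x)) (at x)"
proof -
  obtain \<sigma>' w' where "(\<sigma> has_real_derivative \<sigma>') (at x)" "(w has_real_derivative w') (at x)"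
    and "Delta (\<sigma> x) (w x) * w' = - Delta1 d l r (\<sigma> x) (w x)"
      "Delta (\<sigma> x) (w x) * \<sigma>' = - Delta2 d l r (\<sigma> x) (w x)"
    using assms(1,2) unfolding weak_solution_def by blast
  then show "(\<sigma> has_real_derivative - Delta2 d l r (\<sigma> x) (w x) / Delta (\<sigma> x) (w x)) (at x)"
    "(w has_real_derivative - Delta1 d l r (\<sigma> x) (w x) / Delta (\<sigma> x) (w x)) (at x)"
    using assms(3) by (metis nonzero_mult_div_cancel_left)+
qed

lemma Delta1_sonic: "Delta1 d l r s w = (1 - w) * Q w + d * (w - we) * Delta s w"
proof -
  have "d * (w - we) = d * w - l * (r - 1)" using d_we by (simp add: right_diff_distrib)
  then show ?thesis
    by (simp add: Delta1_def Delta_def sonic_poly_def power2_eq_square algebra_simps)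
qed

lemma Delta2_sonic: "Delta2 d l r s w = s * (Q w / l + Delta s w)"
  unfolding Delta2_N2 null2_sonic Delta_def using l0 by (simp add: field_simps power2_eq_square)

text \<open>The system in the variables \<open>m = e\<^sup>x \<sigma>\<close> and \<open>w\<close>, which have finite limits at \<open>P\<^sub>6\<close>.\<close>

definition "excess y m w = Q w / (m\<^sup>2 - y * (1 - w)\<^sup>2)"

lemma mass_system:
  assumes ws: "weak_solution b \<sigma> w" and x: "ereal x < b" and D: "Delta (\<sigma> x) (w x) \<noteq> 0"
  defines "m \<equiv> \<lambda>x. exp x * \<sigma> x"
  shows "(m has_real_derivative exp (2 * x) * (m x / l * excess (exp (2 * x)) (m x) (w x))) (at x)"
    "(w has_real_derivative - d * (w x - we) + exp (2 * x) * ((1 - w x) * excess (exp (2 * x)) (m x) (w x))) (at x)"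
proof -
  let ?D = "Delta (\<sigma> x) (w x)"
  have y: "exp (2 * x) = exp x * exp x" by (simp add: exp_add[symmetric])
  have "(m x)\<^sup>2 - exp (2 * x) * (1 - w x)\<^sup>2 = - (exp (2 * x) * ?D)"
    unfolding y m_def Delta_def by (simp add: power2_eq_square algebra_simps)
  then have ex: "exp (2 * x) * excess (exp (2 * x)) (m x) (w x) = - (Q (w x) / ?D)"
    by (simp add: excess_def)
  have "(m has_real_derivative exp x * \<sigma> x + exp x * (- Delta2 d l r (\<sigma> x) (w x) / ?D)) (at x)"
    unfolding m_def by (auto intro!: derivative_eq_intros weak_solutionD[OF ws x D])
  moreover have "exp x * \<sigma> x + exp x * (- Delta2 d l r (\<sigma> x) (w x) / ?D) = m x / l * (- (Q (w x) / ?D))"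
    unfolding Delta2_sonic m_def using D l0 by (simp add: field_simps)
  ultimately show "(m has_real_derivative exp (2 * x) * (m x / l * excess (exp (2 * x)) (m x) (w x))) (at x)"
    unfolding ex[symmetric] by (simp add: mult_ac)
  have "- Delta1 d l r (\<sigma> x) (w x) / ?D = - d * (w x - we) + (1 - w x) * (- (Q (w x) / ?D))"
    unfolding Delta1_sonic using D by (simp add: field_simps)
  then show "(w has_real_derivative - d * (w x - we) + exp (2 * x) * ((1 - w x) * excess (exp (2 * x)) (m x) (w x))) (at x)"
    using weak_solutionD(2)[OF ws x D] unfolding ex[symmetric] by (simp add: mult_ac)
qed

text \<open>
  The limit of \<open>m = e\<^sup>x \<sigma>\<close> exists and is positive: near \<open>P\<^sub>6\<close>, \<open>m\<close> increases, while
  \<open>ln m - C / \<sigma>\<^sup>2\<close> decreases for a suitable \<open>C\<close>, because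
  \<open>(ln m)'\<close> is of order \<open>1 / \<sigma>\<^sup>2\<close> and \<open>1 / \<sigma>\<^sup>2\<close> is at most its own derivative.
\<close>

lemma mass_limit:
  assumes c: "connects_P6_P2 d l r b \<sigma> w"
  obtains c where "c > 0" "((\<lambda>x. exp x * \<sigma> x) \<longlongrightarrow> c) at_bot"
proof -
  have tr: "trajectory d l r (- \<infinity>) b \<sigma> w" and s: "filterlim \<sigma> at_top at_bot" and w: "(w \<longlongrightarrow> we) at_bot"
    using c by (auto simp: connects_P6_P2_def)
  have ws: "weak_solution b \<sigma> w" by (rule trajectory_weak_solution[OF tr])
  define Kq where "Kq = (d - 1) + \<bar>d - 1 + (l - 1) * (r - 1)\<bar> + l * (r - 1)"
  have Kq: "Kq > 0" using d2 l0 r_gt_1 by (simp add: Kq_def add_pos_nonneg add_nonneg_pos)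
  have QK: "Q v \<le> Kq" if "0 < v" "v < 1" for v
  proof -
    define A where "A = d - 1 + (l - 1) * (r - 1)"
    have "(d - 1) * v\<^sup>2 \<le> (d - 1) * 1" using d2 that by (intro mult_left_mono) (auto simp: power_le_one)
    moreover have "\<bar>A * v\<bar> \<le> \<bar>A\<bar> * 1"
      unfolding abs_mult using that by (intro mult_left_mono) auto
    then have "- (A * v) \<le> \<bar>A\<bar>" by simp
    ultimately show ?thesis unfolding sonic_poly_def Kq_def A_def[symmetric] by simp
  qed
  define s0 where "s0 = 2 + 2 * Kq / l"
  have s0: "s0 \<ge> 2" "s0 * l \<ge> 2 * Kq" using Kq l0 by (auto simp: s0_def field_simps)
  have "eventually (\<lambda>x. \<sigma> x > s0) at_bot" using s by (simp add: filterlim_at_top_dense)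
  moreover have "eventually (\<lambda>x. w x > 0) at_bot" by (rule order_tendstoD(1)[OF w we_pos])
  moreover have "eventually (\<lambda>x. w x < wm) at_bot" by (rule order_tendstoD(2)[OF w we_lt_wm])
  moreover have "\<exists>z. ereal z < b" using tr ereal_dense2[of "-\<infinity>" b] by (auto simp: trajectory_def)
  then obtain z where z: "ereal z < b" by blast
  have "eventually (\<lambda>x. x \<le> z) at_bot" by (rule eventually_le_at_bot)
  ultimately have "eventually (\<lambda>x. x \<le> z \<and> \<sigma> x > s0 \<and> 0 < w x \<and> w x < wm) at_bot"
    by eventually_elim auto
  then obtain x0 where x0: "\<And>x. x \<le> x0 \<Longrightarrow> x \<le> z \<and> \<sigma> x > s0 \<and> 0 < w x \<and> w x < wm"
    unfolding eventually_at_bot_linorder by blast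
  have xb: "ereal x < b" if "x \<le> x0" for x using x0[OF that] z le_less_trans[of "ereal x" "ereal z" b] by simp
  note R = x0
  define q where "q x = Q (w x) / (l * - Delta (\<sigma> x) (w x))" for x
  have D: "Delta (\<sigma> x) (w x) < 0" "- Delta (\<sigma> x) (w x) \<ge> (\<sigma> x)\<^sup>2 / 2" "0 \<le> q x" "q x \<le> 1 / 2"
      "q x \<le> 2 * Kq / l * (1 / (\<sigma> x)\<^sup>2)" if "x \<le> x0" for x
  proof -
    have r: "\<sigma> x > s0" "0 < w x" "w x < 1" "w x < wm" using R[OF that] wm_lt_1 by auto
    have "(w x - 1)\<^sup>2 \<le> 1" using r by (intro power2_le_iff_abs_le[THEN iffD2, of 1, simplified]) auto
    moreover have s2: "(\<sigma> x)\<^sup>2 \<ge> 2 * \<sigma> x" "2 * \<sigma> x \<ge> 4" using r s0 by (auto simp: power2_eq_square)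
    ultimately show D2: "- Delta (\<sigma> x) (w x) \<ge> (\<sigma> x)\<^sup>2 / 2" by (simp add: Delta_def)
    have sp: "(\<sigma> x)\<^sup>2 / 2 \<ge> \<sigma> x" "\<sigma> x > 0" using s2 by auto
    then show D1: "Delta (\<sigma> x) (w x) < 0" using D2 by linarith
    have Q0: "0 < Q (w x)" by (rule Q_pos) (rule r)
    then show "0 \<le> q x" unfolding q_def using D1 l0 by (intro divide_nonneg_nonneg mult_nonneg_nonneg) auto
    have "q x \<le> Kq / (l * ((\<sigma> x)\<^sup>2 / 2))"
      unfolding q_def using D2 QK[of "w x"] r Q0 Kq l0 sp by (intro frac_le mult_left_mono mult_pos_pos) auto
    also have "\<dots> = 2 * Kq / l * (1 / (\<sigma> x)\<^sup>2)" by (simp add: field_simps)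
    finally show "q x \<le> 2 * Kq / l * (1 / (\<sigma> x)\<^sup>2)" .
    also have "\<dots> \<le> 1 / 2"
    proof -
      have "4 * Kq \<le> 2 * s0 * l" using s0(2) by linarith
      also have "\<dots> \<le> 2 * \<sigma> x * l" using r l0 by simp
      also have "\<dots> \<le> (\<sigma> x)\<^sup>2 * l" using s2 l0 by simp
      finally show ?thesis using l0 sp by (simp add: field_simps)
    qed
    finally show "q x \<le> 1 / 2" .
  qed
  have ds: "(\<sigma> has_real_derivative \<sigma> x * (q x - 1)) (at x)" if "x \<le> x0" for x
  proof (rule DERIV_cong[OF weak_solutionD(1)[OF ws xb[OF that]]])
    show "Delta (\<sigma> x) (w x) \<noteq> 0" using D(1)[OF that] by simp
    show "- Delta2 d l r (\<sigma> x) (w x) / Delta (\<sigma> x) (w x) = \<sigma> x * (q x - 1)"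
      unfolding Delta2_sonic q_def using D(1)[OF that] l0 by (simp add: field_simps)
  qed
  have sp: "\<sigma> x > 0" if "x \<le> x0" for x using R[OF that] s0 by simp
  define m where "m x = exp x * \<sigma> x" for x
  have dm: "(m has_real_derivative m x * q x) (at x)" if "x \<le> x0" for x
    unfolding m_def[abs_def] by (auto intro!: derivative_eq_intros ds[OF that] simp: algebra_simps)
  have mpos: "m x > 0" if "x \<le> x0" for x using sp[OF that] by (simp add: m_def)
  have mono: "m x \<le> m y" if "x \<le> y" "y \<le> x0" for x y
  proof (rule DERIV_nonneg_imp_nondecreasing[OF that(1)])
    fix u assume "x \<le> u" "u \<le> y"
    then show "\<exists>D. (m has_real_derivative D) (at u) \<and> 0 \<le> D"
      using dm[of u] mpos[of u] D(3)[of u] that by (intro exI[of _ "m u * q u"]) simp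
  qed
  define C where "C = 2 * Kq / l"
  define k where "k = exp (ln (m x0) - C * (1 / (\<sigma> x0)\<^sup>2))"
  have low: "k \<le> m x" if "x \<le> x0" for x
  proof -
    have "ln (m x0) - C * (1 / (\<sigma> x0)\<^sup>2) \<le> ln (m x) - C * (1 / (\<sigma> x)\<^sup>2)"
    proof (rule DERIV_nonpos_imp_nonincreasing[OF that])
      fix u assume u: "x \<le> u" "u \<le> x0"
      have dt: "((\<lambda>u. 1 / (\<sigma> u)\<^sup>2) has_real_derivative - 2 * (q u - 1) * (1 / (\<sigma> u)\<^sup>2)) (at u)"
        using sp[OF u(2)]
        by (auto intro!: derivative_eq_intros ds[OF u(2)] simp: field_simps power2_eq_square)
      have dl: "((\<lambda>u. ln (m u)) has_real_derivative q u) (at u)"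
        using mpos[OF u(2)] by (auto intro!: derivative_eq_intros dm[OF u(2)])
      have "C * (1 / (\<sigma> u)\<^sup>2) \<le> C * (- 2 * (q u - 1) * (1 / (\<sigma> u)\<^sup>2))"
      proof (rule mult_left_mono)
        have "1 * (1 / (\<sigma> u)\<^sup>2) \<le> - 2 * (q u - 1) * (1 / (\<sigma> u)\<^sup>2)"
          using D(4)[OF u(2)] by (intro mult_right_mono) auto
        then show "1 / (\<sigma> u)\<^sup>2 \<le> - 2 * (q u - 1) * (1 / (\<sigma> u)\<^sup>2)" by simp
        show "0 \<le> C" using Kq l0 by (simp add: C_def)
      qed
      then have "q u - C * (- 2 * (q u - 1) * (1 / (\<sigma> u)\<^sup>2)) \<le> 0" using D(5)[OF u(2)] by (simp add: C_def)
      then show "\<exists>D. ((\<lambda>u. ln (m u) - C * (1 / (\<sigma> u)\<^sup>2)) has_real_derivative D) (at u) \<and> D \<le> 0"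
        using DERIV_diff[OF dl DERIV_cmult[OF dt, of C]] by blast
    qed
    also have "\<dots> \<le> ln (m x)" using Kq l0 by (simp add: C_def)
    finally have "k \<le> exp (ln (m x))" unfolding k_def by simp
    then show ?thesis using mpos[OF that] by simp
  qed
  obtain c where c: "(m \<longlongrightarrow> c) at_bot" "k \<le> c"
    using mono_bounded_tendsto_at_bot[of x0 m k, OF mono low] by blast
  have "c > 0" using c(2) by (simp add: k_def less_le_trans[OF exp_gt_zero])
  with c(1) show ?thesis using that by (simp add: m_def[abs_def])
qed

text \<open>
  In the variables \<open>m\<close> and \<open>w\<close> the system is \<open>e\<^sup>2\<^sup>x\<close> times a Lipschitz field plus the damping
  \<open>- d (w - we)\<close>. The damping only decreases the squared distance \<open>N\<close> of two solutions, so that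
  \<open>N' \<le> C e\<^sup>2\<^sup>x N\<close>, with an integrable coefficient at \<open>-\<infinity>\<close>; and \<open>N\<close> tends to \<open>0\<close> there.
\<close>

lemma local_uniqueness_P6:
  assumes ws1: "weak_solution b1 \<sigma>1 w1" and ws2: "weak_solution b2 \<sigma>2 w2"
    and b: "b1 > -\<infinity>" "b2 > -\<infinity>"
    and m1: "((\<lambda>x. exp x * \<sigma>1 x) \<longlongrightarrow> c) at_bot" and m2: "((\<lambda>x. exp x * \<sigma>2 x) \<longlongrightarrow> c) at_bot" and c: "c > 0"
    and l1: "(w1 \<longlongrightarrow> we) at_bot" and l2: "(w2 \<longlongrightarrow> we) at_bot"
  obtains x1 where "ereal x1 < b1" "ereal x1 < b2" "\<And>x. x \<le> x1 \<Longrightarrow> \<sigma>1 x = \<sigma>2 x \<and> w1 x = w2 x"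
proof -
  define S where "S = {z :: real \<times> real \<times> real. (fst (snd z))\<^sup>2 - fst z * (1 - snd (snd z))\<^sup>2 \<noteq> 0}"
  have S: "open S" unfolding S_def by (intro open_Collect_neq continuous_intros)
  have lin: "Ck_on k (\<lambda>z :: real \<times> real \<times> real. fst (snd z)) S" "Ck_on k (\<lambda>z :: real \<times> real \<times> real. snd (snd z)) S" for k
    using S by (auto intro!: Ck_on_linear bounded_linear_fst_comp bounded_linear_snd_comp bounded_linear_snd)
  have CkE: "Ck_on k (\<lambda>z. excess (fst z) (fst (snd z)) (snd (snd z))) S" for k
    unfolding excess_def sonic_poly_def using S lin by (intro Ck_intros) (auto simp: S_def)
  define F where "F z = fst (snd z) / l * excess (fst z) (fst (snd z)) (snd (snd z))" for z
  define G where "G z = (1 - snd (snd z)) * excess (fst z) (fst (snd z)) (snd (snd z))" for z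
  have CkFG: "Ck_on (Suc 0) F S" "Ck_on (Suc 0) G S"
    unfolding F_def G_def using S lin CkE l0 by (intro Ck_intros; auto)+
  have "(0, c, we) \<in> S" using c by (simp add: S_def)
  then obtain \<epsilon> where eps: "\<epsilon> > 0" "cball (0, c, we) \<epsilon> \<subseteq> S" using S open_contains_cball by blast
  obtain LF where LF: "LF \<ge> 0" "\<And>x y. x \<in> cball (0, c, we) \<epsilon> \<Longrightarrow> y \<in> cball (0, c, we) \<epsilon> \<Longrightarrow> \<bar>F x - F y\<bar> \<le> LF * norm (x - y)"
    using Ck_on_1_imp_lipschitz[OF CkFG(1) compact_cball convex_cball eps(2)] by blast
  obtain LG where LG: "LG \<ge> 0" "\<And>x y. x \<in> cball (0, c, we) \<epsilon> \<Longrightarrow> y \<in> cball (0, c, we) \<epsilon> \<Longrightarrow> \<bar>G x - G y\<bar> \<le> LG * norm (x - y)"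
    using Ck_on_1_imp_lipschitz[OF CkFG(2) compact_cball convex_cball eps(2)] by blast
  define y where "y x = exp (2 * x)" for x :: real
  have ylim: "(y \<longlongrightarrow> 0) at_bot"
    unfolding y_def by (intro filterlim_compose[OF exp_at_bot] filterlim_tendsto_pos_mult_at_bot[OF tendsto_const _ filterlim_ident]) auto
  define \<mu>1 \<mu>2 where "\<mu>1 x = exp x * \<sigma>1 x" and "\<mu>2 x = exp x * \<sigma>2 x" for x
  define z1 z2 where "z1 x = (y x, \<mu>1 x, w1 x)" and "z2 x = (y x, \<mu>2 x, w2 x)" for x
  have zl: "(z1 \<longlongrightarrow> (0, c, we)) at_bot" "(z2 \<longlongrightarrow> (0, c, we)) at_bot"
    unfolding z1_def z2_def \<mu>1_def \<mu>2_def by (intro tendsto_Pair ylim m1 m2 l1 l2)+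
  obtain \<beta>1 \<beta>2 where be: "ereal \<beta>1 < b1" "ereal \<beta>2 < b2"
    using b ereal_dense2[of "-\<infinity>" b1] ereal_dense2[of "-\<infinity>" b2] by auto
  have "eventually (\<lambda>x. dist (z1 x) (0, c, we) < \<epsilon>) at_bot" "eventually (\<lambda>x. dist (z2 x) (0, c, we) < \<epsilon>) at_bot"
    using tendstoD[OF zl(1) eps(1)] tendstoD[OF zl(2) eps(1)] by auto
  moreover have "eventually (\<lambda>x. x \<le> min \<beta>1 \<beta>2) at_bot" by (rule eventually_le_at_bot)
  ultimately have "eventually (\<lambda>x. x \<le> min \<beta>1 \<beta>2 \<and> z1 x \<in> cball (0, c, we) \<epsilon> \<and> z2 x \<in> cball (0, c, we) \<epsilon>) at_bot"
    by eventually_elim (auto simp: dist_commute)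
  then obtain x1 where x1: "\<And>x. x \<le> x1 \<Longrightarrow> x \<le> min \<beta>1 \<beta>2 \<and> z1 x \<in> cball (0, c, we) \<epsilon> \<and> z2 x \<in> cball (0, c, we) \<epsilon>"
    unfolding eventually_at_bot_linorder by blast
  have xb: "ereal x < b1" "ereal x < b2" if "x \<le> x1" for x
    using x1[OF that] be le_less_trans[of "ereal x" "ereal \<beta>1" b1] le_less_trans[of "ereal x" "ereal \<beta>2" b2] by auto
  have Dn: "Delta s v \<noteq> 0" if "(y x, exp x * s, v) \<in> S" for x s v
  proof -
    have "exp (2 * x) = exp x * exp x" by (simp add: exp_add[symmetric])
    then have "(exp x * s)\<^sup>2 - y x * (1 - v)\<^sup>2 = - (exp x * exp x * Delta s v)"
      unfolding y_def Delta_def by (simp add: power2_eq_square algebra_simps)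
    then show ?thesis using that by (auto simp: S_def)
  qed
  have d1: "(\<mu>1 has_real_derivative y x * F (z1 x)) (at x)" "(w1 has_real_derivative - d * (w1 x - we) + y x * G (z1 x)) (at x)"
    and d2': "(\<mu>2 has_real_derivative y x * F (z2 x)) (at x)" "(w2 has_real_derivative - d * (w2 x - we) + y x * G (z2 x)) (at x)"
    if "x \<le> x1" for x
  proof -
    have in1: "(y x, exp x * \<sigma>1 x, w1 x) \<in> S" "(y x, exp x * \<sigma>2 x, w2 x) \<in> S"
      using x1[OF that] eps(2) by (auto simp: z1_def z2_def \<mu>1_def \<mu>2_def)
    show "(\<mu>1 has_real_derivative y x * F (z1 x)) (at x)" "(w1 has_real_derivative - d * (w1 x - we) + y x * G (z1 x)) (at x)"
      using mass_system[OF ws1 xb(1)[OF that] Dn[OF in1(1)]]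
      by (simp_all add: F_def G_def z1_def y_def \<mu>1_def[abs_def])
    show "(\<mu>2 has_real_derivative y x * F (z2 x)) (at x)" "(w2 has_real_derivative - d * (w2 x - we) + y x * G (z2 x)) (at x)"
      using mass_system[OF ws2 xb(2)[OF that] Dn[OF in1(2)]]
      by (simp_all add: F_def G_def z2_def y_def \<mu>2_def[abs_def])
  qed
  define C where "C = 2 * (LF + LG)"
  define N where "N x = (\<mu>1 x - \<mu>2 x)\<^sup>2 + (w1 x - w2 x)\<^sup>2" for x
  define N' where "N' x = 2 * (\<mu>1 x - \<mu>2 x) * (y x * (F (z1 x) - F (z2 x)))
      + 2 * (w1 x - w2 x) * (- d * (w1 x - w2 x) + y x * (G (z1 x) - G (z2 x)))" for x
  have dN: "(N has_real_derivative N' x) (at x)" if "x \<le> x1" for x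
    unfolding N_def[abs_def] N'_def
    by (auto intro!: derivative_eq_intros d1[OF that] d2'[OF that] simp: algebra_simps)
  have bN: "N' x \<le> C * y x * N x" if "x \<le> x1" for x
  proof -
    define n where "n = norm (z1 x - z2 x)"
    have n2: "n * n = N x"
      by (simp add: n_def z1_def z2_def N_def norm_Pair power2_eq_square[symmetric])
    have n0: "n \<ge> 0" by (simp add: n_def)
    have a: "\<bar>\<mu>1 x - \<mu>2 x\<bar> \<le> n" "\<bar>w1 x - w2 x\<bar> \<le> n"
      using n2 n0 abs_le_square_iff[of "\<mu>1 x - \<mu>2 x" n] abs_le_square_iff[of "w1 x - w2 x" n]
      by (auto simp: N_def power2_eq_square[symmetric])
    have fg: "\<bar>F (z1 x) - F (z2 x)\<bar> \<le> LF * n" "\<bar>G (z1 x) - G (z2 x)\<bar> \<le> LG * n"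
      unfolding n_def using x1[OF that] LF(2) LG(2) by blast+
    have "(\<mu>1 x - \<mu>2 x) * (F (z1 x) - F (z2 x)) \<le> n * (LF * n)"
      by (rule order_trans[OF abs_ge_self]) (unfold abs_mult, intro mult_mono a fg n0 abs_ge_zero)
    moreover have "(w1 x - w2 x) * (G (z1 x) - G (z2 x)) \<le> n * (LG * n)"
      by (rule order_trans[OF abs_ge_self]) (unfold abs_mult, intro mult_mono a fg n0 abs_ge_zero)
    ultimately have "2 * y x * ((\<mu>1 x - \<mu>2 x) * (F (z1 x) - F (z2 x)) + (w1 x - w2 x) * (G (z1 x) - G (z2 x)))
        \<le> 2 * y x * (n * (LF * n) + n * (LG * n))"
      by (intro mult_left_mono add_mono) (auto simp: y_def)
    also have "\<dots> = C * y x * (n * n)" by (simp add: C_def algebra_simps)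
    finally have "2 * y x * ((\<mu>1 x - \<mu>2 x) * (F (z1 x) - F (z2 x)) + (w1 x - w2 x) * (G (z1 x) - G (z2 x))) \<le> C * y x * N x"
      unfolding n2 .
    moreover have "d * (w1 x - w2 x)\<^sup>2 \<ge> 0" using d2 by simp
    moreover have "N' x = 2 * y x * ((\<mu>1 x - \<mu>2 x) * (F (z1 x) - F (z2 x)) + (w1 x - w2 x) * (G (z1 x) - G (z2 x)))
        - 2 * (d * (w1 x - w2 x)\<^sup>2)"
      by (simp add: N'_def power2_eq_square algebra_simps)
    ultimately show ?thesis by linarith
  qed
  \<comment> \<open>\<open>N exp (- C y / 2)\<close> decreases and tends to \<open>0\<close> at \<open>-\<infinity>\<close>\<close>
  have N0: "N x \<le> 0" if x: "x \<le> x1" for x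
  proof -
    have dec: "N x * exp (- (C / 2) * y x) \<le> N z * exp (- (C / 2) * y z)" if "z \<le> x" for z
    proof (rule DERIV_nonpos_imp_nonincreasing[OF that])
      fix u assume u: "z \<le> u" "u \<le> x"
      then have ux: "u \<le> x1" using x by simp
      have "((\<lambda>u. N u * exp (- (C / 2) * y u)) has_real_derivative (N' u - C * y u * N u) * exp (- (C / 2) * y u)) (at u)"
        unfolding y_def by (auto intro!: derivative_eq_intros dN[OF ux] simp: y_def algebra_simps)
      moreover have "(N' u - C * y u * N u) * exp (- (C / 2) * y u) \<le> 0"
        using bN[OF ux] by (intro mult_nonpos_nonneg) auto
      ultimately show "\<exists>D. ((\<lambda>u. N u * exp (- (C / 2) * y u)) has_real_derivative D) (at u) \<and> D \<le> 0" by blast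
    qed
    have "((\<lambda>z. N z * exp (- (C / 2) * y z)) \<longlongrightarrow> ((c - c)\<^sup>2 + (we - we)\<^sup>2) * exp (- (C / 2) * 0)) at_bot"
      unfolding N_def \<mu>1_def \<mu>2_def by (intro tendsto_intros m1 m2 l1 l2 ylim)
    then have "N x * exp (- (C / 2) * y x) \<le> ((c - c)\<^sup>2 + (we - we)\<^sup>2) * exp (- (C / 2) * 0)"
      by (rule tendsto_lowerbound[OF _ eventually_mono[OF eventually_le_at_bot dec]]) auto
    then show ?thesis by (simp add: mult_le_0_iff not_le[symmetric])
  qed
  show ?thesis
  proof (rule that[of x1])
    show "ereal x1 < b1" "ereal x1 < b2" using xb[of x1] by auto
    fix x assume "x \<le> x1"
    from N0[OF this] have "(\<mu>1 x - \<mu>2 x)\<^sup>2 = 0 \<and> (w1 x - w2 x)\<^sup>2 = 0"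
      unfolding N_def using zero_le_power2[of "\<mu>1 x - \<mu>2 x"] zero_le_power2[of "w1 x - w2 x"] by linarith
    then show "\<sigma>1 x = \<sigma>2 x \<and> w1 x = w2 x" by (simp add: \<mu>1_def \<mu>2_def)
  qed
qed

text \<open>
  Away from the sonic line the field is locally Lipschitz. Only the first solution is known to avoid that
  line; the second one does so as long as it agrees with the first.
\<close>

lemma continuation_uniqueness:
  assumes ws1: "weak_solution b1 \<sigma>1 w1" and ws2: "weak_solution b2 \<sigma>2 w2"
    and D1: "\<And>x. ereal x < b1 \<Longrightarrow> Delta (\<sigma>1 x) (w1 x) \<noteq> 0"
    and agree: "\<sigma>1 x1 = \<sigma>2 x1 \<and> w1 x1 = w2 x1"
    and x: "ereal x < b1" "ereal x < b2" "x1 \<le> x"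
  shows "\<sigma>1 x = \<sigma>2 x \<and> w1 x = w2 x"
proof -
  define v1 v2 where "v1 t = (\<sigma>1 t, w1 t)" and "v2 t = (\<sigma>2 t, w2 t)" for t
  have tb: "ereal t < b1" "ereal t < b2" if "t \<le> x" for t
    using x that le_less_trans[of "ereal t" "ereal x"] by auto
  have cont: "isCont v1 t" "isCont v2 t" if "ereal t < b1" "ereal t < b2" for t
  proof -
    have "isCont \<sigma>1 t" "isCont w1 t" "isCont \<sigma>2 t" "isCont w2 t"
      using ws1 ws2 that DERIV_isCont unfolding weak_solution_def by blast+
    then show "isCont v1 t" "isCont v2 t"
      unfolding v1_def v2_def isCont_def by (auto intro!: tendsto_Pair)
  qed
  have contS: "continuous_on {x1..x} v1" "continuous_on {x1..x} v2"
    using cont tb by (auto intro!: continuous_at_imp_continuous_on)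
  define S where "S = {z :: real \<times> real. Delta (fst z) (snd z) \<noteq> 0}"
  have S: "open S" unfolding S_def Delta_def by (intro open_Collect_neq continuous_intros)
  define F where "F z = - Delta2 d l r (fst z) (snd z) / Delta (fst z) (snd z)" for z
  define G where "G z = - Delta1 d l r (fst z) (snd z) / Delta (fst z) (snd z)" for z
  have CkD: "Ck_on k (\<lambda>z. - Delta2 d l r (fst z) (snd z)) S" "Ck_on k (\<lambda>z. - Delta1 d l r (fst z) (snd z)) S"
    "Ck_on k (\<lambda>z. Delta (fst z) (snd z)) S" for k
    by (rule Ck_on_subset[OF _ subset_UNIV], rule Ck_on_Deltas)+
  have "Ck_on (Suc 0) F S"
    unfolding F_def by (rule Ck_on_divide[OF S CkD(1) CkD(3)]; simp add: S_def)
  moreover have "Ck_on (Suc 0) G S"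
    unfolding G_def by (rule Ck_on_divide[OF S CkD(2) CkD(3)]; simp add: S_def)
  ultimately have CkFG: "Ck_on (Suc 0) F S" "Ck_on (Suc 0) G S" by auto
  define E where "E = {t \<in> {x1..x}. v1 t = v2 t}"
  have "closedin (top_of_set {x1..x}) ({x1..x} \<inter> (\<lambda>t. v1 t - v2 t) -` {0})"
    by (intro continuous_closedin_preimage continuous_intros contS; simp)
  moreover have "{x1..x} \<inter> (\<lambda>t. v1 t - v2 t) -` {0} = E" by (auto simp: E_def)
  ultimately have cl: "closedin (top_of_set {x1..x}) E" by simp
  have op: "openin (top_of_set {x1..x}) E"
    unfolding openin_euclidean_subtopology_iff
  proof (intro conjI ballI)
    show "E \<subseteq> {x1..x}" by (auto simp: E_def)
    fix c assume "c \<in> E"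
    then have c: "x1 \<le> c" "c \<le> x" "v1 c = v2 c" by (auto simp: E_def)
    have "v1 c \<in> S" using D1[OF tb(1)[OF c(2)]] by (simp add: S_def v1_def)
    then obtain \<epsilon> where eps: "\<epsilon> > 0" "cball (v1 c) \<epsilon> \<subseteq> S" using S open_contains_cball by blast
    obtain LF where LF: "LF \<ge> 0" "\<And>x y. x \<in> cball (v1 c) \<epsilon> \<Longrightarrow> y \<in> cball (v1 c) \<epsilon> \<Longrightarrow> \<bar>F x - F y\<bar> \<le> LF * norm (x - y)"
      using Ck_on_1_imp_lipschitz[OF CkFG(1) compact_cball convex_cball eps(2)] by blast
    obtain LG where LG: "LG \<ge> 0" "\<And>x y. x \<in> cball (v1 c) \<epsilon> \<Longrightarrow> y \<in> cball (v1 c) \<epsilon> \<Longrightarrow> \<bar>G x - G y\<bar> \<le> LG * norm (x - y)"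
      using Ck_on_1_imp_lipschitz[OF CkFG(2) compact_cball convex_cball eps(2)] by blast
    obtain \<delta>1 where de1: "\<delta>1 > 0" "\<And>t. dist t c < \<delta>1 \<Longrightarrow> dist (v1 t) (v1 c) < \<epsilon>"
      using cont(1)[OF tb[OF c(2)]] eps(1) unfolding continuous_at_eps_delta by blast
    obtain \<delta>2 where de2: "\<delta>2 > 0" "\<And>t. dist t c < \<delta>2 \<Longrightarrow> dist (v2 t) (v1 c) < \<epsilon>"
      using cont(2)[OF tb[OF c(2)]] eps(1) unfolding continuous_at_eps_delta c(3) by blast
    have inb: "v1 t \<in> cball (v1 c) \<epsilon>" "v2 t \<in> cball (v1 c) \<epsilon>" if "dist t c < min \<delta>1 \<delta>2" for t
      using de1(2)[of t] de2(2)[of t] that by (auto simp: dist_commute)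
    have der: "(v1 has_vector_derivative (F (v1 t), G (v1 t))) (at t)" "(v2 has_vector_derivative (F (v2 t), G (v2 t))) (at t)"
      if "dist t c < min \<delta>1 \<delta>2" "t \<le> x" for t
    proof -
      have n: "Delta (\<sigma>1 t) (w1 t) \<noteq> 0" "Delta (\<sigma>2 t) (w2 t) \<noteq> 0"
        using inb[OF that(1)] eps(2) by (auto simp: v1_def v2_def S_def)
      show "(v1 has_vector_derivative (F (v1 t), G (v1 t))) (at t)"
        using weak_solutionD[OF ws1 tb(1)[OF that(2)] n(1)]
        unfolding v1_def[abs_def] F_def G_def has_real_derivative_iff_has_vector_derivative
        by (auto intro!: has_vector_derivative_Pair)
      show "(v2 has_vector_derivative (F (v2 t), G (v2 t))) (at t)"
        using weak_solutionD[OF ws2 tb(2)[OF that(2)] n(2)]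
        unfolding v2_def[abs_def] F_def G_def has_real_derivative_iff_has_vector_derivative
        by (auto intro!: has_vector_derivative_Pair)
    qed
    have lip: "norm ((F (v1 t), G (v1 t)) - (F (v2 t), G (v2 t))) \<le> (LF + LG) * norm (v1 t - v2 t)"
      if "dist t c < min \<delta>1 \<delta>2" for t
    proof -
      have "norm ((F (v1 t), G (v1 t)) - (F (v2 t), G (v2 t))) \<le> \<bar>F (v1 t) - F (v2 t)\<bar> + \<bar>G (v1 t) - G (v2 t)\<bar>"
        using norm_Pair_le[of "F (v1 t) - F (v2 t)" "G (v1 t) - G (v2 t)"] by simp
      also have "\<dots> \<le> LF * norm (v1 t - v2 t) + LG * norm (v1 t - v2 t)"
        by (intro add_mono LF(2) LG(2) inb that)
      finally show ?thesis by (simp add: algebra_simps)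
    qed
    have "t \<in> E" if t: "t \<in> {x1..x}" "dist t c < min \<delta>1 \<delta>2" for t
    proof -
      define p q where "p = min t c" and "q = max t c"
      have pq: "p \<le> q" "x1 \<le> p" "q \<le> x" using t c by (auto simp: p_def q_def)
      have near: "dist u c < min \<delta>1 \<delta>2" if "p < u" "u < q" for u
        using that t(2) by (auto simp: p_def q_def dist_real_def min_def max_def split: if_splits)
      have cs: "continuous_on {p..q} v1" "continuous_on {p..q} v2"
        using contS pq by (auto elim!: continuous_on_subset)
      have "norm (v1 q - v2 q) \<le> exp ((LF + LG) * (q - p)) * norm (v1 p - v2 p)"
        "norm (v1 p - v2 p) \<le> exp ((LF + LG) * (q - p)) * norm (v1 q - v2 q)"
        using dist_growth[OF pq(1) cs, of "\<lambda>t. (F (v1 t), G (v1 t))" "\<lambda>t. (F (v2 t), G (v2 t))" "LF + LG"]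
          der[OF near] lip[OF near] pq(3) by auto
      then have "v1 t = v2 t" using c(3) by (auto simp: p_def q_def min_def max_def split: if_splits)
      then show ?thesis using t(1) by (simp add: E_def)
    qed
    then show "\<exists>e>0. \<forall>x'\<in>{x1..x}. dist x' c < e \<longrightarrow> x' \<in> E"
      using de1(1) de2(1) by (intro exI[of _ "min \<delta>1 \<delta>2"]) auto
  qed
  have "connected {x1..x}" by simp
  then have "E = {} \<or> E = {x1..x}" using cl op unfolding connected_clopen by blast
  moreover have "x1 \<in> E" using agree x(3) by (simp add: E_def v1_def v2_def)
  ultimately have "x \<in> E" using x(3) by auto
  then show ?thesis by (simp add: E_def v1_def v2_def)
qed

text \<open>Local uniqueness at \<open>P\<^sub>6\<close>, continued along the first trajectory, which is subsonic.\<close>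

lemma inner_agree:
  assumes c1: "connects_P6_P2 d l r b1 \<sigma>1 w1" and ws2: "weak_solution b2 \<sigma>2 w2" and b2: "b2 > -\<infinity>"
    and m1: "((\<lambda>x. exp x * \<sigma>1 x) \<longlongrightarrow> c) at_bot" and m2: "((\<lambda>x. exp x * \<sigma>2 x) \<longlongrightarrow> c) at_bot" and c: "c > 0"
    and l2: "(w2 \<longlongrightarrow> we) at_bot" and x: "ereal x < b1" "ereal x < b2"
  shows "\<sigma>1 x = \<sigma>2 x \<and> w1 x = w2 x"
proof -
  have tr: "trajectory d l r (- \<infinity>) b1 \<sigma>1 w1" and l1: "(w1 \<longlongrightarrow> we) at_bot"
    using c1 by (auto simp: connects_P6_P2_def)
  have b1: "b1 > -\<infinity>" using tr by (simp add: trajectory_def)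
  note ws1 = trajectory_weak_solution[OF tr]
  obtain x1 where x1: "ereal x1 < b1" "ereal x1 < b2" "\<And>x. x \<le> x1 \<Longrightarrow> \<sigma>1 x = \<sigma>2 x \<and> w1 x = w2 x"
    by (rule local_uniqueness_P6[OF ws1 ws2 b1 b2 m1 m2 c l1 l2], rule that)
  show ?thesis
  proof (cases "x \<le> x1")
    case False
    have D: "Delta (\<sigma>1 x) (w1 x) \<noteq> 0" if "ereal x < b1" for x
      using connects_P6_P2_subsonic[OF c1 that] by simp
    show ?thesis
      by (rule continuation_uniqueness[OF ws1 ws2 D x1(3)[OF order_refl] x]) (use False in auto)
  qed (rule x1(3))
qed

lemma filterlim_shift_at_bot: "filterlim (\<lambda>x :: real. x + t) at_bot at_bot"
  unfolding filterlim_at_bot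
proof
  fix Z
  show "eventually (\<lambda>x. x + t \<le> Z) at_bot"
    using eventually_le_at_bot[of "Z - t"] by eventually_elim simp
qed

lemma exp_shift_limit:
  assumes "((\<lambda>x. exp x * \<sigma> x) \<longlongrightarrow> c) at_bot"
  shows "((\<lambda>x. exp x * \<sigma> (x + t)) \<longlongrightarrow> exp (- t) * c) (at_bot :: real filter)"
proof -
  from tendsto_mult[OF tendsto_const[of "exp (- t)"] filterlim_compose[OF assms filterlim_shift_at_bot]]
  have "((\<lambda>x. exp (- t) * (exp (x + t) * \<sigma> (x + t))) \<longlongrightarrow> exp (- t) * c) at_bot" .
  moreover have "exp (- t) * (exp (x + t) * \<sigma> (x + t)) = exp x * \<sigma> (x + t)" for x
    by (simp add: mult.assoc[symmetric] exp_add[symmetric])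
  ultimately show ?thesis by simp
qed

lemma weak_solution_shift:
  assumes "weak_solution (ereal b) \<sigma> w"
  shows "weak_solution (ereal (b - t)) (\<lambda>x. \<sigma> (x + t)) (\<lambda>x. w (x + t))"
  unfolding weak_solution_def
proof (intro allI impI)
  fix x assume "ereal x < ereal (b - t)"
  then have "ereal (x + t) < ereal b" by simp
  then obtain s v where "\<sigma> (x + t) > 0" "(\<sigma> has_real_derivative s) (at (x + t))" "(w has_real_derivative v) (at (x + t))"
    "Delta (\<sigma> (x + t)) (w (x + t)) * v = - Delta1 d l r (\<sigma> (x + t)) (w (x + t))"
    "Delta (\<sigma> (x + t)) (w (x + t)) * s = - Delta2 d l r (\<sigma> (x + t)) (w (x + t))"
    using assms unfolding weak_solution_def by blast
  then show "\<sigma> (x + t) > 0 \<and> (\<exists>\<sigma>' w'. ((\<lambda>x. \<sigma> (x + t)) has_real_derivative \<sigma>') (at x) \<and>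
      ((\<lambda>x. w (x + t)) has_real_derivative w') (at x) \<and>
      Delta (\<sigma> (x + t)) (w (x + t)) * w' = - Delta1 d l r (\<sigma> (x + t)) (w (x + t)) \<and>
      Delta (\<sigma> (x + t)) (w (x + t)) * \<sigma>' = - Delta2 d l r (\<sigma> (x + t)) (w (x + t)))"
    using DERIV_shift by blast
qed

text \<open>
  If the second solution existed beyond the end of the first, it would pass through \<open>P\<^sub>2\<close>, which is sonic.
\<close>

lemma inner_end_le:
  assumes c1: "connects_P6_P2 d l r (ereal b1) \<sigma>1 w1" and ws2: "weak_solution (ereal b2) \<sigma>2 w2"
    and D2: "\<And>x. x < b2 \<Longrightarrow> Delta (\<sigma>2 x) (w2 x) \<noteq> 0"
    and ag: "\<And>x. x < b1 \<Longrightarrow> x < b2 \<Longrightarrow> \<sigma>1 x = \<sigma>2 x \<and> w1 x = w2 x"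
  shows "b2 \<le> b1"
proof (rule ccontr)
  assume "\<not> b2 \<le> b1"
  then have lt: "b1 < b2" by simp
  have "isCont \<sigma>2 b1" "isCont w2 b1"
    using ws2 lt DERIV_isCont unfolding weak_solution_def by (metis less_ereal.simps(1))+
  then have "((\<lambda>x. (\<sigma>2 x, w2 x)) \<longlongrightarrow> (\<sigma>2 b1, w2 b1)) (at_left b1)"
    by (intro tendsto_Pair) (auto simp: isCont_def filterlim_at_split)
  moreover have "((\<lambda>x. (\<sigma>2 x, w2 x)) \<longlongrightarrow> P2 d l r) (at_left b1)"
  proof (rule Lim_transform_eventually)
    show "((\<lambda>x. (\<sigma>1 x, w1 x)) \<longlongrightarrow> P2 d l r) (at_left b1)"
      using c1 unfolding connects_P6_P2_def ereal_tendsto_simps1 by blast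
    show "eventually (\<lambda>x. (\<sigma>1 x, w1 x) = (\<sigma>2 x, w2 x)) (at_left b1)"
    proof -
      have "eventually (\<lambda>x. x < b1) (at_left b1)" by (simp add: eventually_at_filter)
      then show ?thesis by eventually_elim (use ag lt in auto)
    qed
  qed
  ultimately have "(\<sigma>2 b1, w2 b1) = P2 d l r" by (rule tendsto_unique[rotated]) simp
  then have "Delta (\<sigma>2 b1) (w2 b1) = 0" by (auto simp: P2_def Delta_def power2_commute)
  then show False using D2[OF lt] by simp
qed

text \<open>
  A translation of \<open>x\<close> by \<open>t\<close> multiplies the limit of \<open>e\<^sup>x \<sigma>\<close> by \<open>exp (- t)\<close>, so any two limits can be
  matched.
\<close>

lemma inner_unique:
  assumes c1: "connects_P6_P2 d l r b1 \<sigma>1 w1" and c2: "connects_P6_P2 d l r b2 \<sigma>2 w2"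
  obtains t where "b2 = b1 + ereal t" "\<And>x. ereal x < b1 \<Longrightarrow> \<sigma>2 (x + t) = \<sigma>1 x \<and> w2 (x + t) = w1 x"
proof -
  obtain k1 k2 where k: "k1 > 0" "((\<lambda>x. exp x * \<sigma>1 x) \<longlongrightarrow> k1) at_bot" "k2 > 0" "((\<lambda>x. exp x * \<sigma>2 x) \<longlongrightarrow> k2) at_bot"
    using mass_limit[OF c1] mass_limit[OF c2] by metis
  obtain \<beta>1 where be1: "b1 = ereal \<beta>1" by (rule inner_end_finite[OF c1])
  obtain \<beta>2 where be2: "b2 = ereal \<beta>2" by (rule inner_end_finite[OF c2])
  define t where "t = ln (k2 / k1)"
  have et: "exp (- t) * k2 = k1" using k by (simp add: t_def exp_minus)
  have ws1: "weak_solution (ereal \<beta>1) \<sigma>1 w1" and ws2: "weak_solution (ereal \<beta>2) \<sigma>2 w2"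
    using trajectory_weak_solution c1 c2 unfolding connects_P6_P2_def be1 be2 by blast+
  have l2: "(w2 \<longlongrightarrow> we) at_bot" using c2 by (simp add: connects_P6_P2_def)
  note ws2' = weak_solution_shift[OF ws2, of t]
  have ag: "\<sigma>1 x = \<sigma>2 (x + t) \<and> w1 x = w2 (x + t)" if "x < \<beta>1" "x < \<beta>2 - t" for x
    by (rule inner_agree[OF c1 ws2' _ k(2) exp_shift_limit[OF k(4), of t, unfolded et] k(1) filterlim_compose[OF l2 filterlim_shift_at_bot]])
       (use that be1 in auto)
  have "\<beta>2 - t \<le> \<beta>1"
  proof (rule inner_end_le[OF c1[unfolded be1] ws2' _ ag])
    show "Delta (\<sigma>2 (x + t)) (w2 (x + t)) \<noteq> 0" if "x < \<beta>2 - t" for x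
      using connects_P6_P2_subsonic[OF c2, of "x + t"] that be2 by simp
  qed
  moreover have "\<beta>1 - - t \<le> \<beta>2"
  proof (rule inner_end_le[OF c2[unfolded be2] weak_solution_shift[OF ws1, of "- t"]])
    show "Delta (\<sigma>1 (x + - t)) (w1 (x + - t)) \<noteq> 0" if "x < \<beta>1 - - t" for x
      using connects_P6_P2_subsonic[OF c1, of "x + - t"] that be1 by simp
    show "\<sigma>2 x = \<sigma>1 (x + - t) \<and> w2 x = w1 (x + - t)" if "x < \<beta>2" "x < \<beta>1 - - t" for x
      using ag[of "x - t"] that by simp
  qed
  ultimately have e: "\<beta>2 = \<beta>1 + t" by simp
  show ?thesis
  proof (rule that[of t])
    show "b2 = b1 + ereal t" by (simp add: be1 be2 e)
    show "\<sigma>2 (x + t) = \<sigma>1 x \<and> w2 (x + t) = w1 x" if "ereal x < b1" for x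
      using ag[of x] that be1 e by simp
  qed
qed

end

section \<open>Radial Euler flows\<close>

lemma frechet_derivative_eqI: "(f has_derivative f') (at x) \<Longrightarrow> frechet_derivative f (at x) = f'"
  using frechet_derivative_at by metis

lemma DERIV_compose_inner_self:
  fixes Z :: "'a::real_inner"
  assumes "(f has_real_derivative f') (at (Z \<bullet> Z))"
  shows "((\<lambda>Y. f (Y \<bullet> Y)) has_derivative (\<lambda>h. 2 * f' * (Z \<bullet> h))) (at Z)"
proof -
  have "((\<lambda>Y. Y \<bullet> Y) has_derivative (\<lambda>h. Z \<bullet> h + h \<bullet> Z)) (at Z)"
    by (auto intro!: derivative_eq_intros)
  from has_derivative_compose[OF this assms[unfolded has_field_derivative_def]]
  show ?thesis by (rule has_derivative_eq_rhs) (simp add: inner_commute algebra_simps)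
qed

lemma sum_inner_axis: "(\<Sum>i\<in>UNIV. (Z :: real^'n) $ i * Z $ i) = Z \<bullet> Z"
  by (simp add: inner_vec_def)

text \<open>
  For \<open>\<rho> = ((l/2) T)\<^sup>l\<^sup>/\<^sup>2\<close> the enthalpy \<open>\<rho>\<^sup>\<gamma>\<^sup>-\<^sup>1\<close> is \<open>(l/2) T\<close>, and the Euler equations become two
  scalar equations in \<open>y = \<bar>Z\<bar>\<^sup>2\<close>. They are linear in the derivatives \<open>T'\<close> and \<open>w'\<close> with respect to \<open>y\<close>, and
  the determinant is a multiple of \<open>\<Delta>\<close>. The momentum equation is a vector equation proportional to
  \<open>Z\<close>, hence empty at the origin.
\<close>

definition "mass_eq d l r y T T' w w' \<longleftrightarrow> - d * (w - w_e d l r) + l * y * (1 - w) * T' / T - 2 * y * w' = 0"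
definition "momentum_eq l r y T' w w' \<longleftrightarrow> w * (w - r) + 2 * y * w' * (w - 1) + l * T' = (0 :: real)"

lemma radial_euler_iff:
  fixes \<rho> :: "real^'n \<Rightarrow> real" and u :: "real^'n \<Rightarrow> real^'n"
  assumes l0: "l > 0" and S: "open S" "Z \<in> S"
    and \<rho>: "\<And>Y. Y \<in> S \<Longrightarrow> \<rho> Y = (l / 2 * T (Y \<bullet> Y)) powr (l / 2)"
    and u: "\<And>Y. Y \<in> S \<Longrightarrow> u Y = - (om (Y \<bullet> Y) *\<^sub>R Y)"
    and Tpos: "\<And>Y. Y \<in> S \<Longrightarrow> T (Y \<bullet> Y) > 0"
    and T: "(T has_real_derivative T') (at (Z \<bullet> Z))" and om: "(om has_real_derivative om') (at (Z \<bullet> Z))"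
  defines "y \<equiv> Z \<bullet> Z" and "d \<equiv> real CARD('n)"
  shows "(l * (r - 1) * \<rho> Z + Z \<bullet> grad \<rho> Z + diverg (\<lambda>Y. \<rho> Y *\<^sub>R u Y) Z = 0)
      \<longleftrightarrow> mass_eq d l r y (T y) T' (om y) om'"
    and "((r - 1) *\<^sub>R u Z + frechet_derivative u (at Z) Z + frechet_derivative u (at Z) (u Z)
       + grad (\<lambda>Y. \<rho> Y powr (gam l - 1)) Z = 0)
      \<longleftrightarrow> Z = 0 \<or> momentum_eq l r y T' (om y) om'"
proof -
  define \<phi> where "\<phi> t = (l / 2 * T t) powr (l / 2)" for t
  define \<phi>' where "\<phi>' = l / 2 * \<phi> y * T' / T y"
  have Ty: "T y > 0" using Tpos[OF S(2)] by (simp add: y_def)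
  have \<phi>pos: "\<phi> y > 0" using Ty l0 by (simp add: \<phi>_def)
  have d\<phi>: "(\<phi> has_real_derivative \<phi>') (at y)"
  proof -
    have "(\<phi> has_real_derivative (l / 2) * (l / 2 * T y) powr (l / 2 - 1) * (l / 2 * T')) (at y)"
      unfolding \<phi>_def[abs_def] using Ty l0 T
      by (auto intro!: derivative_eq_intros simp: y_def)
    moreover have "(l / 2) * (l / 2 * T y) powr (l / 2 - 1) * (l / 2 * T') = \<phi>'"
    proof -
      have e: "(l / 2 * T y) powr (l / 2 - 1) = (l / 2 * T y) powr (l / 2) / (l / 2 * T y)"
        using Ty l0 by (simp add: powr_diff)
      have "(l / 2) * (A / (l / 2 * T y)) * (l / 2 * T') = l / 2 * A * T' / T y" for A
        using Ty l0 by (simp add: field_simps)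
      then show ?thesis unfolding \<phi>'_def \<phi>_def e .
    qed
    ultimately show ?thesis by simp
  qed
  have d\<rho>: "(\<rho> has_derivative (\<lambda>h. 2 * \<phi>' * (Z \<bullet> h))) (at Z)"
    by (rule has_derivative_transform_within_open[OF DERIV_compose_inner_self[OF d\<phi>[unfolded y_def]] S])
       (simp add: \<rho> \<phi>_def)
  have dom: "((\<lambda>Y. om (Y \<bullet> Y)) has_derivative (\<lambda>h. 2 * om' * (Z \<bullet> h))) (at Z)"
    by (rule DERIV_compose_inner_self[OF om])
  define Du where "Du h = - (om y *\<^sub>R h + (2 * om' * (Z \<bullet> h)) *\<^sub>R Z)" for h
  have du: "(u has_derivative Du) (at Z)"
  proof (rule has_derivative_transform_within_open[OF _ S])
    show "((\<lambda>Y. - (om (Y \<bullet> Y) *\<^sub>R Y)) has_derivative Du) (at Z)"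
      unfolding Du_def[abs_def] y_def
      by (intro has_derivative_minus has_derivative_scaleR[OF dom has_derivative_ident])
  qed (simp add: u)
  have dru: "((\<lambda>Y. \<rho> Y *\<^sub>R u Y) has_derivative (\<lambda>h. \<rho> Z *\<^sub>R Du h + (2 * \<phi>' * (Z \<bullet> h)) *\<^sub>R u Z)) (at Z)"
    by (rule has_derivative_scaleR[OF d\<rho> du])
  have \<rho>Z: "\<rho> Z = \<phi> y" and uZ: "u Z = - (om y *\<^sub>R Z)" using \<rho> u S(2) by (auto simp: \<phi>_def y_def)
  have ent: "((\<lambda>Y. \<rho> Y powr (gam l - 1)) has_derivative (\<lambda>h. 2 * (l / 2 * T') * (Z \<bullet> h))) (at Z)"
  proof (rule has_derivative_transform_within_open[OF _ S])
    show "((\<lambda>Y. l / 2 * T (Y \<bullet> Y)) has_derivative (\<lambda>h. 2 * (l / 2 * T') * (Z \<bullet> h))) (at Z)"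
      by (rule DERIV_compose_inner_self[of "\<lambda>t. l / 2 * T t", OF DERIV_cmult[OF T]])
    show "l / 2 * T (Y \<bullet> Y) = \<rho> Y powr (gam l - 1)" if "Y \<in> S" for Y
      using \<rho>[OF that] Tpos[OF that] l0 by (simp add: gam_def powr_powr)
  qed
  have grad\<rho>: "grad \<rho> Z = (2 * \<phi>') *\<^sub>R Z"
    by (simp add: grad_def frechet_derivative_eqI[OF d\<rho>] inner_axis vec_eq_iff)
  have gradE: "grad (\<lambda>Y. \<rho> Y powr (gam l - 1)) Z = (l * T') *\<^sub>R Z"
    by (simp add: grad_def frechet_derivative_eqI[OF ent] inner_axis vec_eq_iff)
  have "diverg (\<lambda>Y. \<rho> Y *\<^sub>R u Y) Z = (\<Sum>i\<in>UNIV. (\<rho> Z *\<^sub>R Du (axis i 1) + (2 * \<phi>' * (Z \<bullet> axis i 1)) *\<^sub>R u Z) $ i)"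
    by (simp add: diverg_def frechet_derivative_eqI[OF dru])
  also have "\<dots> = (\<Sum>i\<in>(UNIV :: 'n set). - (\<phi> y * om y) - (2 * (\<phi> y * om' + \<phi>' * om y)) * (Z $ i * Z $ i))"
  proof (rule sum.cong[OF refl])
    fix i :: 'n
    have ax: "axis i (1 :: real) $ i = 1" by (simp add: axis_def)
    show "(\<rho> Z *\<^sub>R Du (axis i 1) + (2 * \<phi>' * (Z \<bullet> axis i 1)) *\<^sub>R u Z) $ i
        = - (\<phi> y * om y) - (2 * (\<phi> y * om' + \<phi>' * om y)) * (Z $ i * Z $ i)"
      by (simp add: \<rho>Z uZ Du_def inner_axis ax algebra_simps)
  qed
  also have "\<dots> = - (d * (\<phi> y * om y)) - 2 * (\<phi> y * om' + \<phi>' * om y) * y"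
    by (simp add: sum_subtractf sum_distrib_left[symmetric] sum_inner_axis y_def d_def sum_negf)
  finally have div: "diverg (\<lambda>Y. \<rho> Y *\<^sub>R u Y) Z = - (d * (\<phi> y * om y)) - 2 * (\<phi> y * om' + \<phi>' * om y) * y" .
  have "d \<noteq> 0" by (simp add: d_def)
  then have "d * w_e d l r = l * (r - 1)" by (simp add: w_e_def)
  then have dwe: "d * (om y - w_e d l r) = d * om y - l * (r - 1)" by (simp only: right_diff_distrib)
  have "l * (r - 1) * \<rho> Z + Z \<bullet> grad \<rho> Z + diverg (\<lambda>Y. \<rho> Y *\<^sub>R u Y) Z
      = \<phi> y * (- (d * (om y - w_e d l r)) + l * y * (1 - om y) * T' / T y - 2 * y * om')"
    unfolding grad\<rho> div \<rho>Z dwe \<phi>'_def using Ty by (simp add: y_def[symmetric] field_simps)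
  then show "(l * (r - 1) * \<rho> Z + Z \<bullet> grad \<rho> Z + diverg (\<lambda>Y. \<rho> Y *\<^sub>R u Y) Z = 0)
      \<longleftrightarrow> mass_eq d l r y (T y) T' (om y) om'"
    using \<phi>pos by (simp add: mass_eq_def)
  have "(r - 1) *\<^sub>R u Z + frechet_derivative u (at Z) Z + frechet_derivative u (at Z) (u Z)
       + grad (\<lambda>Y. \<rho> Y powr (gam l - 1)) Z
     = (om y * (om y - r) + 2 * y * om' * (om y - 1) + l * T') *\<^sub>R Z"
    unfolding gradE frechet_derivative_eqI[OF du] uZ Du_def
    by (simp add: y_def[symmetric] vec_eq_iff algebra_simps)
  then show "((r - 1) *\<^sub>R u Z + frechet_derivative u (at Z) Z + frechet_derivative u (at Z) (u Z)
       + grad (\<lambda>Y. \<rho> Y powr (gam l - 1)) Z = 0)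
      \<longleftrightarrow> Z = 0 \<or> momentum_eq l r y T' (om y) om'"
    by (auto simp: momentum_eq_def)
qed

context phase_plane
begin

text \<open>
  Here \<open>T = y \<sigma>\<^sup>2\<close> and \<open>y = e\<^sup>2\<^sup>x\<close>, so that the derivatives with respect to \<open>y\<close> are \<open>\<sigma>\<^sup>2 + \<sigma> \<sigma>'\<close> and
  \<open>w' / (2 y)\<close>. The system follows by Cramer's rule, and conversely when the determinant, a multiple of
  \<open>\<Delta>\<close>, does not vanish.
\<close>

lemma scalar_eqs_imp_system:
  assumes y: "y > 0" and s: "s > 0"
    and "mass_eq d l r y (y * s\<^sup>2) (s\<^sup>2 + s * s') w (w' / (2 * y))"
    and "momentum_eq l r y (s\<^sup>2 + s * s') w (w' / (2 * y))"
  shows "Delta s w * w' = - Delta1 d l r s w" "Delta s w * s' = - Delta2 d l r s w"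
proof -
  define V X where "V = w' + d * (w - we)" and "X = s + s'"
  have e1: "s * V = l * (1 - w) * X"
  proof -
    have "l * y * (1 - w) * (s\<^sup>2 + s * s') / (y * s\<^sup>2) = l * (1 - w) * X / s"
      using y s by (simp add: X_def field_simps power2_eq_square)
    moreover have "2 * y * (w' / (2 * y)) = w'" using y by simp
    ultimately have "V = l * (1 - w) * X / s"
      using assms(3) unfolding mass_eq_def V_def by simp
    then show ?thesis using s by simp
  qed
  have Qe: "w * (w - r) = - Q w + d * (w - we) * (w - 1)"
  proof -
    have "d * (w - we) = d * w - l * (r - 1)" using d_we by (simp add: right_diff_distrib)
    then show ?thesis by (simp add: sonic_poly_def power2_eq_square algebra_simps)
  qed
  have "w * (w - r) + w' * (w - 1) + l * (s * X) = 0"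
    using assms(4) y unfolding momentum_eq_def X_def by (simp add: power2_eq_square algebra_simps)
  then have e2: "l * s * X = Q w + (1 - w) * V" unfolding Qe V_def by (simp add: algebra_simps)
  have "s * (s * V) = (1 - w) * (l * s * X)" unfolding e1 by simp
  then have "Delta s w * V = - ((1 - w) * Q w)"
    unfolding e2 Delta_def by (simp add: power2_eq_square algebra_simps)
  then show "Delta s w * w' = - Delta1 d l r s w" unfolding Delta1_sonic V_def by (simp add: algebra_simps)
  have "s * (l * s * X) = s * Q w + (1 - w) * (s * V)" unfolding e2 by (simp add: algebra_simps)
  then have "l * (Delta s w * X) = - (s * Q w)"
    unfolding e1 Delta_def by (simp add: power2_eq_square algebra_simps)
  then have "Delta s w * X = - (s * Q w / l)" using l0 by (simp add: field_simps)
  then show "Delta s w * s' = - Delta2 d l r s w" unfolding Delta2_sonic X_def by (simp add: algebra_simps)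
qed

lemma system_imp_scalar_eqs:
  assumes y: "y > 0" and s: "s > 0" and D: "Delta s w \<noteq> 0"
    and w': "Delta s w * w' = - Delta1 d l r s w" and s': "Delta s w * s' = - Delta2 d l r s w"
  shows "mass_eq d l r y (y * s\<^sup>2) (s\<^sup>2 + s * s') w (w' / (2 * y))"
    "momentum_eq l r y (s\<^sup>2 + s * s') w (w' / (2 * y))"
proof -
  let ?D = "Delta s w"
  define k where "k = Q w / ?D"
  have W: "w' = - (1 - w) * k - d * (w - we)" using w' D unfolding Delta1_sonic k_def by (simp add: field_simps)
  have S: "s' = - s * k / l - s" using s' D l0 unfolding Delta2_sonic k_def by (simp add: field_simps)
  have X: "s\<^sup>2 + s * s' = - (s\<^sup>2 * k / l)" unfolding S using l0 by (simp add: field_simps power2_eq_square)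
  have m1: "l * y * (1 - w) * (- (s\<^sup>2 * k / l)) / (y * s\<^sup>2) = - ((1 - w) * k)"
    using y s l0 by (simp add: field_simps)
  have m2: "2 * y * (w' / (2 * y)) = w'" using y by simp
  show "mass_eq d l r y (y * s\<^sup>2) (s\<^sup>2 + s * s') w (w' / (2 * y))"
    unfolding mass_eq_def X m1 m2 by (simp add: W algebra_simps)
  have Qe: "w * (w - r) = - Q w + d * (w - we) * (w - 1)"
  proof -
    have "d * (w - we) = d * w - l * (r - 1)" using d_we by (simp add: right_diff_distrib)
    then show ?thesis by (simp add: sonic_poly_def power2_eq_square algebra_simps)
  qed
  have kD: "k * ?D = Q w" using D by (simp add: k_def)
  have "w * (w - r) + w' * (w - 1) + l * (- (s\<^sup>2 * k / l)) = - Q w + k * ?D"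
    unfolding Qe W Delta_def using l0 by (simp add: power2_eq_square algebra_simps)
  then have "w * (w - r) + w' * (w - 1) + l * (- (s\<^sup>2 * k / l)) = 0" by (simp add: kD)
  moreover have "2 * y * (w' / (2 * y)) = w'" using y by simp
  ultimately show "momentum_eq l r y (s\<^sup>2 + s * s') w (w' / (2 * y))"
    unfolding momentum_eq_def X by simp
qed

text \<open>Since \<open>\<bar>Z\<bar>\<^sup>2\<close> is smooth in \<open>Z\<close>, also at the origin, smoothness of the profiles in \<open>y\<close> is enough.\<close>

lemma profile_euler:
  fixes S :: "(real^'n) set"
  assumes dn: "d = real CARD('n)" and S: "open S" and J: "open J" "\<And>Z. Z \<in> S \<Longrightarrow> Z \<bullet> Z \<in> J"
    and CT: "\<And>k. Ck_on k T J" and Com: "\<And>k. Ck_on k om J" and Tpos: "\<And>y. y \<in> J \<Longrightarrow> T y > 0"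
    and eqs: "\<And>Z. Z \<in> S \<Longrightarrow> \<exists>T' om'. (T has_real_derivative T') (at (Z \<bullet> Z)) \<and>
       (om has_real_derivative om') (at (Z \<bullet> Z)) \<and>
       mass_eq d l r (Z \<bullet> Z) (T (Z \<bullet> Z)) T' (om (Z \<bullet> Z)) om' \<and> momentum_eq l r (Z \<bullet> Z) T' (om (Z \<bullet> Z)) om'"
    and \<rho>: "\<And>Z. Z \<in> S \<Longrightarrow> \<rho> Z = (l / 2 * T (Z \<bullet> Z)) powr (l / 2)"
    and u: "\<And>Z. Z \<in> S \<Longrightarrow> u Z = - (om (Z \<bullet> Z) *\<^sub>R Z)"
  shows "smooth_radial_euler_on l r S \<rho> u"
  unfolding smooth_radial_euler_on_def
proof (intro conjI)
  have n2: "Z \<bullet> Z = (norm Z)\<^sup>2" for Z :: "real^'n" by (simp add: power2_norm_eq_inner)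
  show "spherically_symmetric_on S \<rho> u"
    unfolding spherically_symmetric_on_def
    by (rule exI[of _ "\<lambda>s. (l / 2 * T (s\<^sup>2)) powr (l / 2)"], rule exI[of _ "\<lambda>s. - om (s\<^sup>2)"])
       (auto simp: \<rho> u n2)
  have "Ck_on k (\<lambda>Z :: real^'n. (l / 2 * T (Z \<bullet> Z)) powr (l / 2)) S" for k
  proof (rule Ck_on_compose[OF S _ Ck_on_inner_self[OF S], where U = J])
    show "Ck_on k (\<lambda>y. (l / 2 * T y) powr (l / 2)) J"
      by (rule Ck_on_compose[OF J(1) _ Ck_on_mult[OF J(1) Ck_on_const[OF J(1)] CT] Ck_on_powr])
         (use Tpos l0 in auto)
  qed (use J(2) in auto)
  then show "Cinf_on \<rho> S"
    unfolding Cinf_on_def using Ck_on_cong[OF S] \<rho> by (metis (no_types, lifting))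
  have "Ck_on k (\<lambda>Z :: real^'n. (- om (Z \<bullet> Z)) *\<^sub>R Z) S" for k
  proof (rule Ck_on_scaleR[OF S _ Ck_on_linear[OF S bounded_linear_ident]])
    show "Ck_on k (\<lambda>Z :: real^'n. - om (Z \<bullet> Z)) S"
      by (rule Ck_on_minus[OF S Ck_on_compose[OF S _ Ck_on_inner_self[OF S] Com]]) (use J(2) in auto)
  qed
  then have "Ck_on k u S" for k by (rule Ck_on_cong[OF S, rotated]) (simp add: u)
  then show "Cinf_on u S" by (simp add: Cinf_on_def)
  show "euler_solution_on l r S \<rho> u"
    unfolding euler_solution_on_def
  proof
    fix Z assume Z: "Z \<in> S"
    obtain T' om' where e: "(T has_real_derivative T') (at (Z \<bullet> Z))" "(om has_real_derivative om') (at (Z \<bullet> Z))"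
      "mass_eq d l r (Z \<bullet> Z) (T (Z \<bullet> Z)) T' (om (Z \<bullet> Z)) om'" "momentum_eq l r (Z \<bullet> Z) T' (om (Z \<bullet> Z)) om'"
      using eqs[OF Z] by blast
    have TS: "T (Y \<bullet> Y) > 0" if "Y \<in> S" for Y using Tpos J(2) that by blast
    note iff = radial_euler_iff[where r = r, OF l0 S Z \<rho> u TS e(1,2)]
    show "\<rho> Z > 0 \<and> l * (r - 1) * \<rho> Z + Z \<bullet> grad \<rho> Z + diverg (\<lambda>Y. \<rho> Y *\<^sub>R u Y) Z = 0 \<and>
     (r - 1) *\<^sub>R u Z + frechet_derivative u (at Z) Z + frechet_derivative u (at Z) (u Z)
       + grad (\<lambda>Y. \<rho> Y powr (gam l - 1)) Z = 0"
      using iff e(3,4) \<rho>[OF Z] TS[OF Z] l0 by (simp add: dn)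
  qed
qed

text \<open>Along a trajectory the right-hand sides are rational, so smoothness bootstraps.\<close>

lemma trajectory_smooth:
  assumes tr: "trajectory d l r a b \<sigma> w"
  shows "Ck_on k \<sigma> (einterval a b)" "Ck_on k w (einterval a b)"
proof -
  let ?I = "einterval a b"
  have I: "open ?I" by simp
  have D: "Delta (\<sigma> x) (w x) \<noteq> 0" if "x \<in> ?I" for x using trajectory_cont(4)[OF tr that] .
  have der: "(\<sigma> has_real_derivative - Delta2 d l r (\<sigma> x) (w x) / Delta (\<sigma> x) (w x)) (at x)"
    "(w has_real_derivative - Delta1 d l r (\<sigma> x) (w x) / Delta (\<sigma> x) (w x)) (at x)" if x: "x \<in> ?I" for x
  proof -
    obtain \<sigma>' w' where "(\<sigma> has_real_derivative \<sigma>') (at x)" "(w has_real_derivative w') (at x)"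
      and "Delta (\<sigma> x) (w x) * w' = - Delta1 d l r (\<sigma> x) (w x)"
        "Delta (\<sigma> x) (w x) * \<sigma>' = - Delta2 d l r (\<sigma> x) (w x)"
      using tr x unfolding trajectory_def by blast
    then show "(\<sigma> has_real_derivative - Delta2 d l r (\<sigma> x) (w x) / Delta (\<sigma> x) (w x)) (at x)"
      "(w has_real_derivative - Delta1 d l r (\<sigma> x) (w x) / Delta (\<sigma> x) (w x)) (at x)"
      using D[OF x] by (metis nonzero_mult_div_cancel_left)+
  qed
  have "Ck_on k \<sigma> ?I \<and> Ck_on k w ?I"
  proof (induction k)
    case 0
    then show ?case using trajectory_cont(1,2)[OF tr] by (auto intro: continuous_at_imp_continuous_on)
  next
    case (Suc k)
    then have c: "Ck_on k \<sigma> ?I" "Ck_on k w ?I" by auto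
    have cD: "Ck_on k (\<lambda>x. Delta (\<sigma> x) (w x)) ?I"
      unfolding Delta_def by (intro Ck_intros c I)
    have c1: "Ck_on k (\<lambda>x. - Delta1 d l r (\<sigma> x) (w x)) ?I"
      unfolding Delta1_def by (intro Ck_intros c I)
    have c2: "Ck_on k (\<lambda>x. - Delta2 d l r (\<sigma> x) (w x)) ?I"
      unfolding Delta2_def using l0 by (intro Ck_intros c I) auto
    show ?case
      using Ck_on_realI[OF I der(1) Ck_on_divide[OF I c2 cD D]] Ck_on_realI[OF I der(2) Ck_on_divide[OF I c1 cD D]]
      by blast
  qed
  then show "Ck_on k \<sigma> (einterval a b)" "Ck_on k w (einterval a b)" by auto
qed

lemma trajectory_scalar_eqs:
  assumes tr: "trajectory d l r a b \<sigma> w" and x: "x \<in> einterval a b"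
    and T: "eventually (\<lambda>y. T y = y * (\<sigma> (ln y / 2))\<^sup>2) (nhds (exp (2 * x)))"
    and om: "eventually (\<lambda>y. om y = w (ln y / 2)) (nhds (exp (2 * x)))"
  shows "\<exists>T' om'. (T has_real_derivative T') (at (exp (2 * x))) \<and> (om has_real_derivative om') (at (exp (2 * x))) \<and>
    mass_eq d l r (exp (2 * x)) (T (exp (2 * x))) T' (om (exp (2 * x))) om' \<and>
    momentum_eq l r (exp (2 * x)) T' (om (exp (2 * x))) om'"
proof -
  let ?y = "exp (2 * x)"
  obtain s' w' where d: "(\<sigma> has_real_derivative s') (at x)" "(w has_real_derivative w') (at x)"
    and e: "Delta (\<sigma> x) (w x) * w' = - Delta1 d l r (\<sigma> x) (w x)"
      "Delta (\<sigma> x) (w x) * s' = - Delta2 d l r (\<sigma> x) (w x)" and sp: "\<sigma> x > 0" "Delta (\<sigma> x) (w x) \<noteq> 0"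
    using tr x unfolding trajectory_def by blast
  have xl: "ln ?y / 2 = x" by simp
  have dl: "((\<lambda>y. ln y / 2) has_real_derivative 1 / (2 * ?y)) (at ?y)"
    by (auto intro!: derivative_eq_intros simp: field_simps)
  have ds: "((\<lambda>y. \<sigma> (ln y / 2)) has_real_derivative s' * (1 / (2 * ?y))) (at ?y)"
    by (rule DERIV_chain2[OF _ dl]) (simp add: d)
  have dw: "((\<lambda>y. w (ln y / 2)) has_real_derivative w' / (2 * ?y)) (at ?y)"
    using DERIV_chain2[OF _ dl, of w w'] d(2) by simp
  have "((\<lambda>y. y * (\<sigma> (ln y / 2))\<^sup>2) has_real_derivative 1 * (\<sigma> x)\<^sup>2 + ?y * (2 * \<sigma> x * (s' * (1 / (2 * ?y))))) (at ?y)"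
    using DERIV_mult[OF DERIV_ident DERIV_power[OF ds, of 2]] by (simp add: algebra_simps)
  then have dT: "((\<lambda>y. y * (\<sigma> (ln y / 2))\<^sup>2) has_real_derivative (\<sigma> x)\<^sup>2 + \<sigma> x * s') (at ?y)"
    by (rule DERIV_cong) simp
  have "(T has_real_derivative (\<sigma> x)\<^sup>2 + \<sigma> x * s') (at ?y)"
    using dT T DERIV_cong_ev[of ?y ?y T "\<lambda>y. y * (\<sigma> (ln y / 2))\<^sup>2"] by simp
  moreover have "(om has_real_derivative w' / (2 * ?y)) (at ?y)"
    using dw om DERIV_cong_ev[of ?y ?y om "\<lambda>y. w (ln y / 2)"] by simp
  moreover have "T ?y = ?y * (\<sigma> x)\<^sup>2" "om ?y = w x"
    using eventually_nhds_x_imp_x[OF T] eventually_nhds_x_imp_x[OF om] by auto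
  ultimately show ?thesis
    using system_imp_scalar_eqs[OF _ sp e, of ?y] by (intro exI[of _ "(\<sigma> x)\<^sup>2 + \<sigma> x * s'"] exI[of _ "w' / (2 * ?y)"]) simp
qed

lemma emden_from_profile:
  fixes S :: "(real^'n) set"
  assumes \<rho>: "\<And>Z. Z \<in> S \<Longrightarrow> \<rho> Z = (l / 2 * T (Z \<bullet> Z)) powr (l / 2)"
    and u: "\<And>Z. Z \<in> S \<Longrightarrow> u Z = - (om (Z \<bullet> Z) *\<^sub>R Z)"
    and T: "\<And>Z. Z \<in> S \<Longrightarrow> Z \<noteq> 0 \<and> T (Z \<bullet> Z) = (Z \<bullet> Z) * (\<sigma> (ln (norm Z)))\<^sup>2 \<and> om (Z \<bullet> Z) = w (ln (norm Z)) \<and> \<sigma> (ln (norm Z)) > 0"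
  shows "emden_on l S \<rho> u \<sigma> w"
  unfolding emden_on_def
proof
  fix Z assume Z: "Z \<in> S"
  let ?s = "\<sigma> (ln (norm Z))"
  have t: "T (Z \<bullet> Z) = (norm Z * ?s)\<^sup>2" using T[OF Z] by (simp add: power2_norm_eq_inner[symmetric] power_mult_distrib)
  have p: "norm Z * ?s > 0" using T[OF Z] by simp
  have "\<rho> Z powr ((gam l - 1) / 2) = (l / 2 * (norm Z * ?s)\<^sup>2) powr (1 / 2)"
    using l0 p by (simp add: \<rho>[OF Z] t gam_def powr_powr)
  also have "\<dots> = sqrt (l / 2 * (norm Z * ?s)\<^sup>2)" using l0 p by (simp add: powr_half_sqrt)
  also have "\<dots> = sqrt (l / 2) * (norm Z * ?s)" using p by (simp only: real_sqrt_mult real_sqrt_abs abs_of_pos)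
  finally show "\<rho> Z powr ((gam l - 1) / 2) = sqrt (l / 2) * norm Z * ?s \<and> u Z = - (w (ln (norm Z)) *\<^sub>R Z)"
    using u[OF Z] T[OF Z] by simp
qed

text \<open>
  Conversely a smooth radial Euler flow on a ball solves the system, and the smoothness at the origin
  forces the asymptotics of \<open>P\<^sub>6\<close>: the velocity gradient at the origin is a multiple of the identity,
  and the continuity equation there determines the multiple to be \<open>- we\<close>.
\<close>

lemma euler_to_weak:
  fixes \<rho> :: "real^'n \<Rightarrow> real" and u :: "real^'n \<Rightarrow> real^'n"
  assumes dn: "d = real CARD('n)" and R: "R > 0" and sm: "smooth_radial_euler_on l r (ball 0 R) \<rho> u"
  obtains \<sigma> w c where "weak_solution (ereal (ln R)) \<sigma> w" "c > 0" "((\<lambda>x. exp x * \<sigma> x) \<longlongrightarrow> c) at_bot"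
    "(w \<longlongrightarrow> we) at_bot" "emden_on l (ball 0 R - {0}) \<rho> u \<sigma> w"
proof -
  obtain f g where fg: "\<And>Z. Z \<in> ball 0 R \<Longrightarrow> \<rho> Z = f (norm Z)" "\<And>Z. Z \<in> ball 0 R \<Longrightarrow> u Z = g (norm Z) *\<^sub>R Z"
    using sm unfolding smooth_radial_euler_on_def spherically_symmetric_on_def by blast
  have "Ck_on (Suc 0) \<rho> (ball 0 R)" "Ck_on (Suc 0) u (ball 0 R)"
    using sm unfolding smooth_radial_euler_on_def Cinf_on_def by blast+
  then have diff: "\<rho> differentiable (at Z)" "u differentiable (at Z)" if "Z \<in> ball 0 R" for Z
    using that by auto
  have eu: "\<rho> Z > 0" "l * (r - 1) * \<rho> Z + Z \<bullet> grad \<rho> Z + diverg (\<lambda>Y. \<rho> Y *\<^sub>R u Y) Z = 0"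
    "(r - 1) *\<^sub>R u Z + frechet_derivative u (at Z) Z + frechet_derivative u (at Z) (u Z)
       + grad (\<lambda>Y. \<rho> Y powr (gam l - 1)) Z = 0" if "Z \<in> ball 0 R" for Z
    using sm that unfolding smooth_radial_euler_on_def euler_solution_on_def by blast+
  define i0 :: 'n where "i0 = undefined"
  define e :: "real^'n" where "e = axis i0 1"
  have e: "norm e = 1" "e \<bullet> e = 1" by (simp_all add: e_def inner_axis_axis)
  define S where "S = ball (0 :: real^'n) R - {0}"
  have S: "open S" unfolding S_def by (rule open_delete[OF open_ball])
  define T where "T y = 2 / l * \<rho> (sqrt y *\<^sub>R e) powr (2 / l)" for y
  define om where "om y = - (u (sqrt y *\<^sub>R e) \<bullet> e) / sqrt y" for y
  have ray: "sqrt y *\<^sub>R e \<in> ball 0 R" if "0 < y" "y < R\<^sup>2" for y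
    using that e R real_less_lsqrt[of R y] by simp
  have SZ: "0 < Z \<bullet> Z" "Z \<bullet> Z < R\<^sup>2" "sqrt (Z \<bullet> Z) = norm Z" "norm Z *\<^sub>R e \<in> ball 0 R" "Z \<in> ball 0 R" "Z \<noteq> 0"
    if "Z \<in> S" for Z
  proof -
    show Z: "Z \<in> ball 0 R" "Z \<noteq> 0" using that by (auto simp: S_def)
    show "sqrt (Z \<bullet> Z) = norm Z" by (simp add: norm_eq_sqrt_inner)
    show "0 < Z \<bullet> Z" using Z by simp
    show "Z \<bullet> Z < R\<^sup>2" unfolding power2_norm_eq_inner[symmetric] using Z by (intro power_strict_mono) auto
    show "norm Z *\<^sub>R e \<in> ball 0 R" using Z e by simp
  qed
  have \<rho>S: "\<rho> Z = (l / 2 * T (Z \<bullet> Z)) powr (l / 2)" if Z: "Z \<in> S" for Z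
  proof -
    have "\<rho> (norm Z *\<^sub>R e) = \<rho> Z" using fg(1)[OF SZ(4)[OF Z]] fg(1)[OF SZ(5)[OF Z]] e by simp
    then have "l / 2 * T (Z \<bullet> Z) = \<rho> Z powr (2 / l)" using SZ(3)[OF Z] l0 by (simp add: T_def)
    then show ?thesis using eu(1)[OF SZ(5)[OF Z]] l0 by (simp add: powr_powr)
  qed
  have uS: "u Z = - (om (Z \<bullet> Z) *\<^sub>R Z)" if Z: "Z \<in> S" for Z
  proof -
    have "om (Z \<bullet> Z) = - g (norm Z)"
      unfolding om_def SZ(3)[OF Z] using fg(2)[OF SZ(4)[OF Z]] e SZ(6)[OF Z] by simp
    then show ?thesis using fg(2)[OF SZ(5)[OF Z]] by simp
  qed
  have Tpos: "T y > 0" if "0 < y" "y < R\<^sup>2" for y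
    using eu(1)[OF ray[OF that]] l0 by (simp add: T_def)
  have dsq: "(\<lambda>y. sqrt y *\<^sub>R e) differentiable (at y)" if "0 < y" for y
  proof -
    have "sqrt differentiable (at y)" using DERIV_real_sqrt[OF that] real_differentiable_def by blast
    then show ?thesis by simp
  qed
  have dT: "\<exists>T'. (T has_real_derivative T') (at y)" if y: "0 < y" "y < R\<^sup>2" for y
  proof -
    obtain D where D: "((\<lambda>y. \<rho> (sqrt y *\<^sub>R e)) has_real_derivative D) (at y)"
      using differentiable_compose[OF diff(1)[OF ray[OF y]] dsq[OF y(1)]] real_differentiable_def by blast
    have "((\<lambda>y. \<rho> (sqrt y *\<^sub>R e) powr (2 / l)) has_real_derivative
        (2 / l) * \<rho> (sqrt y *\<^sub>R e) powr (2 / l - 1) * D) (at y)"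
      using eu(1)[OF ray[OF y]] by (auto intro!: derivative_eq_intros D)
    from DERIV_cmult[OF this, of "2 / l"] show ?thesis unfolding T_def[abs_def] by blast
  qed
  have dom: "\<exists>om'. (om has_real_derivative om') (at y)" if y: "0 < y" "y < R\<^sup>2" for y
  proof -
    have "(\<lambda>y. u (sqrt y *\<^sub>R e) \<bullet> e) differentiable (at y)"
      using differentiable_compose[OF diff(2)[OF ray[OF y]] dsq[OF y(1)]] by (intro differentiable_inner) auto
    then obtain D where D: "((\<lambda>y. u (sqrt y *\<^sub>R e) \<bullet> e) has_real_derivative D) (at y)"
      using real_differentiable_def by blast
    have "sqrt y \<noteq> 0" using y by simp
    from DERIV_divide[OF DERIV_minus[OF D] DERIV_real_sqrt[OF y(1)] this] show ?thesis
      unfolding om_def[abs_def] by blast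
  qed
  have scal: "mass_eq d l r y (T y) T' (om y) om' \<and> momentum_eq l r y T' (om y) om'"
    if y: "0 < y" "y < R\<^sup>2" and d': "(T has_real_derivative T') (at y)" "(om has_real_derivative om') (at y)" for y T' om'
  proof -
    define Z where "Z = sqrt y *\<^sub>R e"
    have Z: "Z \<in> S" "Z \<bullet> Z = y" "Z \<noteq> 0" using ray[OF y] y e by (auto simp: S_def Z_def)
    have TS: "T (Y \<bullet> Y) > 0" if "Y \<in> S" for Y using Tpos SZ(1,2)[OF that] by blast
    have "(T has_real_derivative T') (at (Z \<bullet> Z))" "(om has_real_derivative om') (at (Z \<bullet> Z))"
      using d' Z(2) by auto
    note iff = radial_euler_iff[where r = r, OF l0 S Z(1) \<rho>S uS TS this]
    show ?thesis using iff eu(2,3)[OF SZ(5)[OF Z(1)]] Z(3) unfolding Z(2) dn by blast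
  qed
  define \<sigma> where "\<sigma> x = sqrt (T (exp (2 * x))) * exp (- x)" for x
  define w where "w x = om (exp (2 * x))" for x
  have yx: "0 < exp (2 * x)" "exp (2 * x) < R\<^sup>2" if "x < ln R" for x
  proof -
    have "exp (2 * x) < exp (2 * ln R)" using that by simp
    also have "\<dots> = R\<^sup>2" using R by (simp add: exp_double)
    finally show "exp (2 * x) < R\<^sup>2" .
  qed simp
  have ex2: "exp (- x) * exp (- x) * exp (2 * x) = 1" for x :: real
    by (simp add: exp_add[symmetric])
  have \<sigma>2: "exp (2 * x) * (\<sigma> x)\<^sup>2 = T (exp (2 * x))" "\<sigma> x > 0" if "x < ln R" for x
  proof -
    have "exp (2 * x) * (\<sigma> x)\<^sup>2 = T (exp (2 * x)) * (exp (- x) * exp (- x) * exp (2 * x))"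
      using Tpos[OF yx[OF that]] by (simp add: \<sigma>_def power_mult_distrib power2_eq_square mult_ac)
    then show "exp (2 * x) * (\<sigma> x)\<^sup>2 = T (exp (2 * x))" by (simp only: ex2 mult_1_right)
    show "\<sigma> x > 0" using Tpos[OF yx[OF that]] by (simp add: \<sigma>_def)
  qed
  have ws: "weak_solution (ereal (ln R)) \<sigma> w"
    unfolding weak_solution_def
  proof (intro allI impI)
    fix x assume "ereal x < ereal (ln R)"
    then have x: "x < ln R" by simp
    let ?y = "exp (2 * x)"
    note y = yx[OF x]
    obtain T' om' where d': "(T has_real_derivative T') (at ?y)" "(om has_real_derivative om') (at ?y)"
      using dT[OF y] dom[OF y] by blast
    have dy: "((\<lambda>x. exp (2 * x)) has_real_derivative 2 * ?y) (at x)"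
      by (auto intro!: derivative_eq_intros)
    define s' where "s' = inverse (sqrt (T ?y)) / 2 * (T' * (2 * ?y)) * exp (- x) - \<sigma> x"
    have ds: "(\<sigma> has_real_derivative s') (at x)"
    proof -
      have "((\<lambda>x. sqrt (T (exp (2 * x)))) has_real_derivative inverse (sqrt (T ?y)) / 2 * (T' * (2 * ?y))) (at x)"
        by (rule DERIV_chain2[OF DERIV_real_sqrt[OF Tpos[OF y]] DERIV_chain2[OF d'(1) dy]])
      moreover have "((\<lambda>x. exp (- x)) has_real_derivative - exp (- x)) (at x)"
        by (auto intro!: derivative_eq_intros)
      ultimately have "((\<lambda>x. sqrt (T (exp (2 * x))) * exp (- x)) has_real_derivative
          inverse (sqrt (T ?y)) / 2 * (T' * (2 * ?y)) * exp (- x) + - exp (- x) * sqrt (T ?y)) (at x)"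
        by (rule DERIV_mult)
      then show ?thesis unfolding \<sigma>_def[abs_def]
        by (rule DERIV_cong) (simp add: s'_def \<sigma>_def)
    qed
    have dw: "(w has_real_derivative om' * (2 * ?y)) (at x)"
      unfolding w_def[abs_def] by (rule DERIV_chain2[OF d'(2) dy])
    have ss: "(\<sigma> x)\<^sup>2 + \<sigma> x * s' = T'"
    proof -
      have "sqrt (T ?y) * inverse (sqrt (T ?y)) = 1" using Tpos[OF y] by simp
      moreover have "(\<sigma> x)\<^sup>2 + \<sigma> x * s' = (sqrt (T ?y) * inverse (sqrt (T ?y))) * (exp (- x) * exp (- x) * ?y) * T'"
        by (simp add: s'_def \<sigma>_def power2_eq_square algebra_simps)
      ultimately show ?thesis by (simp only: ex2 mult_1_left)
    qed
    have "mass_eq d l r ?y (?y * (\<sigma> x)\<^sup>2) ((\<sigma> x)\<^sup>2 + \<sigma> x * s') (w x) (om' * (2 * ?y) / (2 * ?y))"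
      "momentum_eq l r ?y ((\<sigma> x)\<^sup>2 + \<sigma> x * s') (w x) (om' * (2 * ?y) / (2 * ?y))"
      using scal[OF y d'] unfolding ss \<sigma>2(1)[OF x] w_def by auto
    from scalar_eqs_imp_system[OF y(1) \<sigma>2(2)[OF x] this]
    show "\<sigma> x > 0 \<and> (\<exists>\<sigma>' w'. (\<sigma> has_real_derivative \<sigma>') (at x) \<and> (w has_real_derivative w') (at x) \<and>
        Delta (\<sigma> x) (w x) * w' = - Delta1 d l r (\<sigma> x) (w x) \<and>
        Delta (\<sigma> x) (w x) * \<sigma>' = - Delta2 d l r (\<sigma> x) (w x))"
      using ds dw \<sigma>2(2)[OF x] by blast
  qed
  have 0: "0 \<in> ball (0 :: real^'n) R" using R by simp
  have e0: "((\<lambda>x. exp x *\<^sub>R e) \<longlongrightarrow> 0) at_bot"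
    using tendsto_scaleR[OF exp_at_bot tendsto_const[of e]] by simp
  have sqe: "sqrt (exp (2 * x)) = exp x" for x :: real by (simp add: exp_double)
  define c where "c = sqrt (2 / l * \<rho> 0 powr (2 / l))"
  have cpos: "c > 0" using eu(1)[OF 0] l0 by (simp add: c_def)
  have "isCont \<rho> 0" using diff(1)[OF 0] differentiable_imp_continuous_within by blast
  from isCont_tendsto_compose[OF this e0] have "((\<lambda>x. \<rho> (exp x *\<^sub>R e)) \<longlongrightarrow> \<rho> 0) at_bot" .
  then have "((\<lambda>x. sqrt (2 / l * \<rho> (exp x *\<^sub>R e) powr (2 / l))) \<longlongrightarrow> c) at_bot"
    unfolding c_def using eu(1)[OF 0] by (intro tendsto_intros) auto
  moreover have "sqrt (2 / l * \<rho> (exp x *\<^sub>R e) powr (2 / l)) = exp x * \<sigma> x" for x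
    unfolding \<sigma>_def T_def sqe by (simp add: exp_minus)
  ultimately have climit: "((\<lambda>x. exp x * \<sigma> x) \<longlongrightarrow> c) at_bot" by simp
  \<comment> \<open>the velocity gradient at the origin\<close>
  have u0: "u 0 = 0" using fg(2)[OF 0] by simp
  define Du where "Du = frechet_derivative u (at 0)"
  have Du: "(u has_derivative Du) (at 0)" using diff(2)[OF 0] frechet_derivative_works Du_def by blast
  have rl: "((\<lambda>x. (u (exp x *\<^sub>R a) \<bullet> a) / exp x) \<longlongrightarrow> Du a \<bullet> a) at_bot" for a
  proof -
    have lin: "((\<lambda>t :: real. t *\<^sub>R a) has_derivative (\<lambda>h. h *\<^sub>R a)) (at 0)"
      by (auto intro!: derivative_eq_intros)
    have "((\<lambda>t. u (t *\<^sub>R a)) has_derivative (\<lambda>h. Du (h *\<^sub>R a))) (at 0)"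
      by (rule has_derivative_compose[OF lin]) (use Du in simp)
    from has_derivative_inner_left[OF this, of a]
    have "((\<lambda>t. u (t *\<^sub>R a) \<bullet> a) has_real_derivative Du a \<bullet> a) (at 0)"
      unfolding has_field_derivative_def
      by (rule has_derivative_eq_rhs) (simp add: linear_scale[OF has_derivative_linear[OF Du]] fun_eq_iff)
    then have "(\<lambda>h. (u (h *\<^sub>R a) \<bullet> a) / h) \<midarrow>0\<rightarrow> Du a \<bullet> a"
      by (simp add: DERIV_def u0)
    then show ?thesis
      by (rule filterlim_compose) (auto simp: filterlim_at intro: exp_at_bot)
  qed
  have same: "Du (axis j 1) \<bullet> axis j 1 = Du e \<bullet> e" for j :: 'n
  proof (rule tendsto_unique[OF _ rl[of "axis j 1"]])
    have "eventually (\<lambda>x. x < ln R) at_bot" by (rule eventually_gt_at_bot)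
    then show "((\<lambda>x. (u (exp x *\<^sub>R axis j 1) \<bullet> axis j 1) / exp x) \<longlongrightarrow> Du e \<bullet> e) at_bot"
    proof (rule Lim_transform_eventually[OF rl[of e] eventually_mono])
      fix x assume "x < ln R"
      then have "exp x < R" using R by (metis exp_less_cancel_iff exp_ln)
      then have "exp x *\<^sub>R a \<in> ball 0 R" if "norm a = 1" for a :: "real^'n" using that by simp
      then show "(u (exp x *\<^sub>R e) \<bullet> e) / exp x = (u (exp x *\<^sub>R axis j 1) \<bullet> axis j 1) / exp x"
        using fg(2) e by (simp add: inner_axis_axis)
    qed
  qed simp
  have "diverg (\<lambda>Y. \<rho> Y *\<^sub>R u Y) 0 = \<rho> 0 * (d * (Du e \<bullet> e))"
  proof -
    have "(\<rho> has_derivative frechet_derivative \<rho> (at 0)) (at 0)" using diff(1)[OF 0] frechet_derivative_works by blast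
    from frechet_derivative_eqI[OF has_derivative_scaleR[OF this Du]]
    have "diverg (\<lambda>Y. \<rho> Y *\<^sub>R u Y) 0 = (\<Sum>i\<in>UNIV. \<rho> 0 * (Du (axis i 1) $ i))"
      by (simp add: diverg_def u0)
    also have "\<dots> = (\<Sum>i\<in>(UNIV :: 'n set). \<rho> 0 * (Du e \<bullet> e))"
      using same by (simp add: inner_axis)
    finally show ?thesis by (simp add: dn)
  qed
  then have "\<rho> 0 * (l * (r - 1) + d * (Du e \<bullet> e)) = 0"
    using eu(2)[OF 0] by (simp add: algebra_simps)
  then have "d * (Du e \<bullet> e) = d * - we" using eu(1)[OF 0] d_we by simp
  then have k: "Du e \<bullet> e = - we" using mult_left_cancel[of d "Du e \<bullet> e" "- we"] d2 by simp
  have weq: "w = (\<lambda>x. - ((u (exp x *\<^sub>R e) \<bullet> e) / exp x))" by (rule ext) (simp add: w_def om_def sqe)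
  have wl: "(w \<longlongrightarrow> we) at_bot" unfolding weq using tendsto_minus[OF rl[of e]] k by simp
  have "emden_on l S \<rho> u \<sigma> w"
  proof (rule emden_from_profile[where T = T and om = om, OF \<rho>S uS])
    fix Z assume Z: "Z \<in> S"
    have x: "ln (norm Z) < ln R" using SZ(5,6)[OF Z] R by simp
    have "exp (2 * ln (norm Z)) = Z \<bullet> Z" using SZ(6)[OF Z] by (simp add: exp_double power2_norm_eq_inner)
    then show "Z \<noteq> 0 \<and> T (Z \<bullet> Z) = (Z \<bullet> Z) * (\<sigma> (ln (norm Z)))\<^sup>2 \<and> om (Z \<bullet> Z) = w (ln (norm Z)) \<and> \<sigma> (ln (norm Z)) > 0"
      using \<sigma>2[OF x] SZ(6)[OF Z] by (simp add: w_def)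
  qed
  with ws cpos climit wl show ?thesis using that unfolding S_def by blast
qed

text \<open>
  By uniqueness every trajectory from \<open>P\<^sub>6\<close> to \<open>P\<^sub>2\<close> is a translate of the one constructed above, and a
  translation of \<open>x\<close> multiplies \<open>y\<close> by a constant.
\<close>

lemma inner_profile:
  assumes n: "d = real n" and c: "connects_P6_P2 d l r b \<sigma> w"
  obtains T om :: "real \<Rightarrow> real" and J :: "real set" where
    "open J" "0 \<in> J" "\<And>k. Ck_on k T J" "\<And>k. Ck_on k om J" "\<And>Y. Y \<in> J \<Longrightarrow> T Y > 0" "om 0 = we"
    "\<And>x. ereal x < b \<Longrightarrow> exp (2 * x) \<in> J \<and> T (exp (2 * x)) = exp (2 * x) * (\<sigma> x)\<^sup>2 \<and> om (exp (2 * x)) = w x"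
proof -
  obtain b0 \<sigma>0 w0 T0 om0 J0 where
    c0: "connects_P6_P2 d l r b0 \<sigma>0 w0" and J0: "open J0" "0 \<in> J0"
    and CkT: "\<And>k. Ck_on k T0 J0" and Cko: "\<And>k. Ck_on k om0 J0"
    and Tp: "\<And>Y. Y \<in> J0 \<Longrightarrow> T0 Y > 0" and T00: "T0 0 = 1" and om0: "om0 0 = we"
    and ph: "\<And>x. ereal x < b0 \<Longrightarrow> exp (2 * x) \<in> J0 \<and> T0 (exp (2 * x)) = exp (2 * x) * (\<sigma>0 x)\<^sup>2 \<and> om0 (exp (2 * x)) = w0 x"
    and neg: "\<And>x. ereal x < b0 \<Longrightarrow> Delta (\<sigma>0 x) (w0 x) < 0"
    by (rule inner_trajectory[OF n], rule that)
  obtain t where t: "b = b0 + ereal t" "\<And>x. ereal x < b0 \<Longrightarrow> \<sigma> (x + t) = \<sigma>0 x \<and> w (x + t) = w0 x"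
    by (rule inner_unique[OF c0 c], rule that)
  obtain \<beta>0 where be: "b0 = ereal \<beta>0" by (rule inner_end_finite[OF c0])
  define k where "k = exp (- 2 * t)"
  have k: "k > 0" by (simp add: k_def)
  define J where "J = (\<lambda>Y. k * Y) -` J0"
  have J: "open J" unfolding J_def by (rule open_vimage[OF J0(1)]) (intro continuous_intros)
  have Cks: "Ck_on m (\<lambda>Y. k * Y) J" for m
    by (intro Ck_on_mult Ck_on_const Ck_on_linear bounded_linear_ident J)
  define T where "T Y = T0 (k * Y) / k" for Y
  define om where "om Y = om0 (k * Y)" for Y
  show ?thesis
  proof (rule that[OF J])
    show "0 \<in> J" using J0(2) by (simp add: J_def)
    have CT0: "Ck_on m (\<lambda>Y. T0 (k * Y)) J" for m
      by (rule Ck_on_compose[OF J _ Cks CkT]) (auto simp: J_def)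
    show "Ck_on m T J" for m
      unfolding T_def using k by (intro Ck_on_divide Ck_on_const CT0 J) auto
    show "Ck_on m om J" for m
      unfolding om_def by (rule Ck_on_compose[OF J _ Cks Cko]) (auto simp: J_def)
    show "T Y > 0" if "Y \<in> J" for Y using Tp[of "k * Y"] that k by (simp add: T_def J_def)
    show "om 0 = we" by (simp add: om_def om0)
    fix x assume "ereal x < b"
    then have x: "ereal (x - t) < b0" by (simp add: t(1) be)
    have "k * exp (2 * x) = exp (2 * (x - t))" by (simp add: k_def exp_add[symmetric] algebra_simps)
    then show "exp (2 * x) \<in> J \<and> T (exp (2 * x)) = exp (2 * x) * (\<sigma> x)\<^sup>2 \<and> om (exp (2 * x)) = w x"
      using ph[OF x] t(2)[OF x] k by (simp add: T_def om_def J_def field_simps)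
  qed
qed

text \<open>
  At \<open>y = 0\<close> the mass equation reduces to \<open>om 0 = we\<close>, and the momentum equation is the limit of the
  equations at positive \<open>y\<close>.
\<close>

lemma inner_profile_eqs:
  assumes c: "connects_P6_P2 d l r (ereal \<beta>) \<sigma> w"
    and J: "open J" "0 \<in> J" and CT: "\<And>k. Ck_on k T J" and Co: "\<And>k. Ck_on k om J" and om0: "om 0 = we"
    and ph: "\<And>x. x < \<beta> \<Longrightarrow> exp (2 * x) \<in> J \<and> T (exp (2 * x)) = exp (2 * x) * (\<sigma> x)\<^sup>2 \<and> om (exp (2 * x)) = w x"
    and y: "0 \<le> y" "y < exp (2 * \<beta>)"
  shows "\<exists>T' om'. (T has_real_derivative T') (at y) \<and> (om has_real_derivative om') (at y) \<and>
    mass_eq d l r y (T y) T' (om y) om' \<and> momentum_eq l r y T' (om y) om'"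
proof -
  have tr: "trajectory d l r (- \<infinity>) (ereal \<beta>) \<sigma> w" using c by (simp add: connects_P6_P2_def)
  have pos: "\<exists>T' om'. (T has_real_derivative T') (at y) \<and> (om has_real_derivative om') (at y) \<and>
    mass_eq d l r y (T y) T' (om y) om' \<and> momentum_eq l r y T' (om y) om'" if y: "0 < y" "y < exp (2 * \<beta>)" for y
  proof -
    define x where "x = ln y / 2"
    have yx: "exp (2 * x) = y" using y by (simp add: x_def)
    have lt: "ln v / 2 < \<beta>" "exp (2 * (ln v / 2)) = v" if "0 < v" "v < exp (2 * \<beta>)" for v
    proof -
      have "ln v < ln (exp (2 * \<beta>))" using that by (subst ln_less_cancel_iff) auto
      then show "ln v / 2 < \<beta>" by simp
      show "exp (2 * (ln v / 2)) = v" using that by simp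
    qed
    have ev: "eventually (\<lambda>v. v \<in> {0<..<exp (2 * \<beta>)}) (nhds y)"
      using y by (intro eventually_nhds_in_open) auto
    have "eventually (\<lambda>v. T v = v * (\<sigma> (ln v / 2))\<^sup>2) (nhds (exp (2 * x)))"
      unfolding yx using ev by eventually_elim (use ph[OF lt(1)] lt(2) in auto)
    moreover have "eventually (\<lambda>v. om v = w (ln v / 2)) (nhds (exp (2 * x)))"
      unfolding yx using ev by eventually_elim (use ph[OF lt(1)] lt(2) in auto)
    moreover have "x \<in> einterval (- \<infinity>) (ereal \<beta>)" using lt(1)[OF y] by (simp add: einterval_iff x_def)
    ultimately show ?thesis using trajectory_scalar_eqs[OF tr, of x T om] unfolding yx by blast
  qed
  show ?thesis
  proof (cases "y = 0")
    case False
    then show ?thesis using pos[of y] y by simp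
  next
    case True
    define T' where "T' v = frechet_derivative T (at v) 1" for v
    define om' where "om' v = frechet_derivative om (at v) 1" for v
    have real: "(k has_real_derivative frechet_derivative k (at v) 1) (at v)"
      if "\<And>m. Ck_on m k J" "v \<in> J" for k v
    proof -
      have der: "(k has_derivative frechet_derivative k (at v)) (at v)" by (rule Ck_on_SucD[OF that])
      have "frechet_derivative k (at v) h = frechet_derivative k (at v) 1 * h" for h
        using linear_scale[OF has_derivative_linear[OF der], of h 1] by (simp add: mult.commute)
      then have "frechet_derivative k (at v) = (*) (frechet_derivative k (at v) 1)" by (rule ext)
      with der show ?thesis unfolding has_field_derivative_def by metis
    qed
    have dT: "(T has_real_derivative T' v) (at v)" and do: "(om has_real_derivative om' v) (at v)" if "v \<in> J" for v
      unfolding T'_def om'_def using real[OF CT that] real[OF Co that] by auto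
    have CkT': "Ck_on 0 T' J" "Ck_on 0 om' J"
      using Ck_on_real_deriv[OF J(1) dT CT[of "Suc 0"]] Ck_on_real_deriv[OF J(1) do Co[of "Suc 0"]] by auto
    define \<mu> where "\<mu> v = om v * (om v - r) + 2 * v * om' v * (om v - 1) + l * T' v" for v
    have "continuous_on J \<mu>"
      unfolding \<mu>_def using CkT' Ck_on_imp_continuous[OF Co[of 0]] by (intro continuous_intros) auto
    then have "isCont \<mu> 0" using J by (simp add: continuous_on_eq_continuous_at)
    then have "(\<mu> \<longlongrightarrow> \<mu> 0) (at_right 0)" by (simp add: isCont_def filterlim_at_split)
    moreover have "(\<mu> \<longlongrightarrow> 0) (at_right 0)"
    proof (rule Lim_transform_eventually[OF tendsto_const])
      have "eventually (\<lambda>v. v \<in> {0<..<exp (2 * \<beta>)}) (at_right 0)"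
        by (rule eventually_at_right_real) simp
      then show "eventually (\<lambda>v. 0 = \<mu> v) (at_right 0)"
      proof eventually_elim
        case (elim v)
        then have v: "0 < v" "v < exp (2 * \<beta>)" by auto
        obtain t o' where to: "(T has_real_derivative t) (at v)" "(om has_real_derivative o') (at v)"
          "momentum_eq l r v t (om v) o'" using pos[OF v] by blast
        have "v = exp (2 * (ln v / 2))" "ln v / 2 < \<beta>"
          using v ln_less_cancel_iff[of v "exp (2 * \<beta>)"] by auto
        then have "v \<in> J" using ph by metis
        then have "t = T' v" "o' = om' v" using DERIV_unique to dT do by blast+
        then show ?case using to(3) by (simp add: momentum_eq_def \<mu>_def)
      qed
    qed
    ultimately have "\<mu> 0 = 0" using tendsto_unique[of "at_right (0 :: real)"] by fastforce
    then have "momentum_eq l r 0 (T' 0) (om 0) (om' 0)" by (simp add: \<mu>_def momentum_eq_def)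
    moreover have "mass_eq d l r 0 (T 0) (T' 0) (om 0) (om' 0)" by (simp add: mass_eq_def om0)
    ultimately show ?thesis using True dT[OF J(2)] do[OF J(2)] by blast
  qed
qed

lemma inner_flow:
  assumes dn: "d = real CARD('n)" and c: "connects_P6_P2 d l r (ereal \<beta>) \<sigma> w"
  obtains T om :: "real \<Rightarrow> real" and J :: "real set" where
    "open J" "\<And>y. 0 \<le> y \<Longrightarrow> y < exp (2 * \<beta>) \<Longrightarrow> y \<in> J" "\<And>k. Ck_on k T J" "\<And>k. Ck_on k om J" "\<And>y. y \<in> J \<Longrightarrow> T y > 0"
    "\<And>x. x < \<beta> \<Longrightarrow> T (exp (2 * x)) = exp (2 * x) * (\<sigma> x)\<^sup>2 \<and> om (exp (2 * x)) = w x"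
    "\<And>(\<rho> :: real^'n \<Rightarrow> real) u. (\<And>Z. Z \<in> ball 0 (exp \<beta>) \<Longrightarrow> \<rho> Z = (l / 2 * T (Z \<bullet> Z)) powr (l / 2)) \<Longrightarrow>
       (\<And>Z. Z \<in> ball 0 (exp \<beta>) \<Longrightarrow> u Z = - (om (Z \<bullet> Z) *\<^sub>R Z)) \<Longrightarrow>
       smooth_radial_euler_on l r (ball 0 (exp \<beta>)) \<rho> u \<and> emden_on l (ball 0 (exp \<beta>) - {0}) \<rho> u \<sigma> w"
proof -
  obtain T om :: "real \<Rightarrow> real" and J :: "real set" where
    J: "open J" "0 \<in> J" and CT: "\<And>k. Ck_on k T J" and Co: "\<And>k. Ck_on k om J" and Tp: "\<And>Y. Y \<in> J \<Longrightarrow> T Y > 0"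
    and om0: "om 0 = we"
    and ph': "\<And>x. ereal x < ereal \<beta> \<Longrightarrow> exp (2 * x) \<in> J \<and> T (exp (2 * x)) = exp (2 * x) * (\<sigma> x)\<^sup>2 \<and> om (exp (2 * x)) = w x"
    by (rule inner_profile[OF dn c], rule that)
  have ph: "exp (2 * x) \<in> J \<and> T (exp (2 * x)) = exp (2 * x) * (\<sigma> x)\<^sup>2 \<and> om (exp (2 * x)) = w x" if "x < \<beta>" for x
    using ph' that by simp
  have sp: "\<sigma> x > 0" if "x < \<beta>" for x
    using c that unfolding connects_P6_P2_def trajectory_def by (simp add: einterval_iff)
  have yJ: "y \<in> J" if "0 \<le> y" "y < exp (2 * \<beta>)" for y
  proof (cases "y = 0")
    case False
    then have "0 < y" using that by simp
    then have "ln y < ln (exp (2 * \<beta>))" using that by (subst ln_less_cancel_iff) auto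
    then have "ln y / 2 < \<beta>" by simp
    from ph[OF this] \<open>0 < y\<close> show ?thesis by simp
  qed (use J in simp)
  have e2: "exp (2 * \<beta>) = (exp \<beta>)\<^sup>2" by (simp add: exp_double)
  have Zb: "Z \<bullet> Z < exp (2 * \<beta>)" if "Z \<in> ball 0 (exp \<beta>)" for Z :: "real^'n"
    unfolding e2 power2_norm_eq_inner[symmetric] using that by (intro power_strict_mono) auto
  show ?thesis
  proof (rule that[OF J(1) yJ CT Co Tp])
    show "T (exp (2 * x)) = exp (2 * x) * (\<sigma> x)\<^sup>2 \<and> om (exp (2 * x)) = w x" if "x < \<beta>" for x
      using ph[OF that] by blast
    fix \<rho> :: "real^'n \<Rightarrow> real" and u :: "real^'n \<Rightarrow> real^'n"
    assume \<rho>: "\<And>Z. Z \<in> ball 0 (exp \<beta>) \<Longrightarrow> \<rho> Z = (l / 2 * T (Z \<bullet> Z)) powr (l / 2)"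
      and u: "\<And>Z. Z \<in> ball 0 (exp \<beta>) \<Longrightarrow> u Z = - (om (Z \<bullet> Z) *\<^sub>R Z)"
    have "smooth_radial_euler_on l r (ball 0 (exp \<beta>)) \<rho> u"
    proof (rule profile_euler[where T = T and om = om, OF dn open_ball J(1) _ CT Co Tp _ \<rho> u])
      show "Z \<bullet> Z \<in> J" if "Z \<in> ball 0 (exp \<beta>)" for Z :: "real^'n" by (rule yJ[OF inner_ge_zero Zb[OF that]])
      show "\<exists>T' om'. (T has_real_derivative T') (at (Z \<bullet> Z)) \<and> (om has_real_derivative om') (at (Z \<bullet> Z)) \<and>
         mass_eq d l r (Z \<bullet> Z) (T (Z \<bullet> Z)) T' (om (Z \<bullet> Z)) om' \<and> momentum_eq l r (Z \<bullet> Z) T' (om (Z \<bullet> Z)) om'"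
        if "Z \<in> ball 0 (exp \<beta>)" for Z :: "real^'n"
        by (rule inner_profile_eqs[OF c J CT Co om0 ph inner_ge_zero Zb[OF that]])
    qed auto
    moreover have "emden_on l (ball 0 (exp \<beta>) - {0}) \<rho> u \<sigma> w"
    proof (rule emden_from_profile[where T = T and om = om])
      fix Z :: "real^'n" assume Z: "Z \<in> ball 0 (exp \<beta>) - {0}"
      then have "ln (norm Z) < ln (exp \<beta>)" by (subst ln_less_cancel_iff) auto
      then have x: "ln (norm Z) < \<beta>" by simp
      have "exp (2 * ln (norm Z)) = Z \<bullet> Z" using Z by (simp add: exp_double power2_norm_eq_inner)
      then show "Z \<noteq> 0 \<and> T (Z \<bullet> Z) = (Z \<bullet> Z) * (\<sigma> (ln (norm Z)))\<^sup>2 \<and> om (Z \<bullet> Z) = w (ln (norm Z)) \<and> \<sigma> (ln (norm Z)) > 0"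
        using ph[OF x] sp[OF x] Z by simp
    qed (use \<rho> u in auto)
    ultimately show "smooth_radial_euler_on l r (ball 0 (exp \<beta>)) \<rho> u \<and> emden_on l (ball 0 (exp \<beta>) - {0}) \<rho> u \<sigma> w" ..
  qed auto
qed

lemma outer_flow_euler:
  fixes \<rho> :: "real^'n \<Rightarrow> real" and u :: "real^'n \<Rightarrow> real^'n"
  assumes dn: "d = real CARD('n)" and tr: "trajectory d l r (ereal \<alpha>) \<infinity> \<sigma> w"
    and \<rho>: "\<And>Z. norm Z > exp \<alpha> \<Longrightarrow> \<rho> Z = (l / 2 * (norm Z * \<sigma> (ln (norm Z)))\<^sup>2) powr (l / 2)"
    and u: "\<And>Z. norm Z > exp \<alpha> \<Longrightarrow> u Z = - (w (ln (norm Z)) *\<^sub>R Z)"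
  shows "smooth_radial_euler_on l r {Z. norm Z > exp \<alpha>} \<rho> u" "emden_on l {Z. norm Z > exp \<alpha>} \<rho> u \<sigma> w"
proof -
  let ?S = "{Z :: real^'n. norm Z > exp \<alpha>}"
  define J where "J = {exp (2 * \<alpha>)<..}"
  have J: "open J" by (simp add: J_def)
  have S: "open ?S" by (intro open_Collect_less continuous_intros)
  define T where "T y = y * (\<sigma> (ln y / 2))\<^sup>2" for y
  define om where "om y = w (ln y / 2)" for y
  have e2: "exp (2 * \<alpha>) = (exp \<alpha>)\<^sup>2" by (simp add: exp_double)
  have Jl: "y > 0" "ln y / 2 \<in> einterval (ereal \<alpha>) \<infinity>" if "y \<in> J" for y
  proof -
    show y: "y > 0" using that less_trans[OF exp_gt_zero, of "2 * \<alpha>" y] by (simp add: J_def)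
    have "ln (exp (2 * \<alpha>)) < ln y" using that y by (subst ln_less_cancel_iff) (auto simp: J_def)
    then show "ln y / 2 \<in> einterval (ereal \<alpha>) \<infinity>" by (simp add: einterval_iff)
  qed
  have Ckl: "Ck_on k (\<lambda>y. ln y / 2) J" for k
    using Jl(1) by (intro Ck_on_divide Ck_on_const J Ck_on_subset[OF Ck_on_ln]) auto
  have Cks: "Ck_on k (\<lambda>y. \<sigma> (ln y / 2)) J" and Com: "Ck_on k om J" for k
    unfolding om_def using Jl(2)
    by (auto intro!: Ck_on_compose[OF J _ Ckl trajectory_smooth(1)[OF tr]] Ck_on_compose[OF J _ Ckl trajectory_smooth(2)[OF tr]])
  have CT: "Ck_on k T J" for k
    unfolding T_def by (intro Ck_on_mult Ck_on_power Ck_on_linear bounded_linear_ident Cks J)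
  have sp: "\<sigma> x > 0" if "x \<in> einterval (ereal \<alpha>) \<infinity>" for x
    using trajectory_cont(3)[OF tr that] .
  have Tp: "T y > 0" if "y \<in> J" for y
    unfolding T_def using Jl(1)[OF that] sp[OF Jl(2)[OF that]] by (intro mult_pos_pos zero_less_power)
  have Z: "Z \<bullet> Z \<in> J" "ln (Z \<bullet> Z) / 2 = ln (norm Z)" "Z \<noteq> 0" "Z \<bullet> Z = (norm Z)\<^sup>2" if "Z \<in> ?S" for Z :: "real^'n"
  proof -
    have "norm Z > 0" using that less_trans[OF exp_gt_zero, of \<alpha> "norm Z"] by simp
    then show "Z \<noteq> 0" by simp
    show q: "Z \<bullet> Z = (norm Z)\<^sup>2" by (simp add: power2_norm_eq_inner)
    show "Z \<bullet> Z \<in> J" unfolding J_def q e2 using that by (auto intro!: power_strict_mono)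
    show "ln (Z \<bullet> Z) / 2 = ln (norm Z)" unfolding q using \<open>norm Z > 0\<close> by (simp add: ln_realpow)
  qed
  have \<rho>': "\<rho> Z = (l / 2 * T (Z \<bullet> Z)) powr (l / 2)" and u': "u Z = - (om (Z \<bullet> Z) *\<^sub>R Z)" if "Z \<in> ?S" for Z
    unfolding T_def om_def Z(2)[OF that] using that \<rho> u by (auto simp: power_mult_distrib power2_norm_eq_inner)
  show "smooth_radial_euler_on l r ?S \<rho> u"
  proof (rule profile_euler[where T = T and om = om, OF dn S J Z(1) CT Com Tp _ \<rho>' u'])
    fix Y :: "real^'n" assume Y: "Y \<in> ?S"
    define x where "x = ln (norm Y)"
    have x: "exp (2 * x) = Y \<bullet> Y" "x \<in> einterval (ereal \<alpha>) \<infinity>"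
      using Z[OF Y] Jl(2)[OF Z(1)[OF Y]] by (auto simp: x_def exp_double)
    show "\<exists>T' om'. (T has_real_derivative T') (at (Y \<bullet> Y)) \<and> (om has_real_derivative om') (at (Y \<bullet> Y)) \<and>
       mass_eq d l r (Y \<bullet> Y) (T (Y \<bullet> Y)) T' (om (Y \<bullet> Y)) om' \<and> momentum_eq l r (Y \<bullet> Y) T' (om (Y \<bullet> Y)) om'"
      using trajectory_scalar_eqs[OF tr x(2), of T om] unfolding x(1) by (simp add: T_def om_def)
  qed
  show "emden_on l ?S \<rho> u \<sigma> w"
  proof (rule emden_from_profile[where T = T and om = om, OF \<rho>' u'])
    fix Y :: "real^'n" assume Y: "Y \<in> ?S"
    show "Y \<noteq> 0 \<and> T (Y \<bullet> Y) = (Y \<bullet> Y) * (\<sigma> (ln (norm Y)))\<^sup>2 \<and> om (Y \<bullet> Y) = w (ln (norm Y)) \<and> \<sigma> (ln (norm Y)) > 0"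
      using Z[OF Y] sp[OF Jl(2)[OF Z(1)[OF Y]]] by (simp add: T_def om_def)
  qed
qed

section \<open>Scaling and gluing of Euler flows\<close>

lemma trajectory_shift:
  assumes "trajectory d l r (ereal \<alpha>) \<infinity> \<sigma> w"
  shows "trajectory d l r (ereal (\<alpha> - t)) \<infinity> (\<lambda>x. \<sigma> (x + t)) (\<lambda>x. w (x + t))"
  unfolding trajectory_def
proof (intro conjI ballI)
  fix x assume "x \<in> einterval (ereal (\<alpha> - t)) \<infinity>"
  then have x: "x + t \<in> einterval (ereal \<alpha>) \<infinity>" by (auto simp: einterval_iff)
  show "\<sigma> (x + t) > 0" "Delta (\<sigma> (x + t)) (w (x + t)) \<noteq> 0" using trajectory_cont[OF assms x] by auto
  obtain s v where "(\<sigma> has_real_derivative s) (at (x + t))" "(w has_real_derivative v) (at (x + t))"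
    "Delta (\<sigma> (x + t)) (w (x + t)) * v = - Delta1 d l r (\<sigma> (x + t)) (w (x + t))"
    "Delta (\<sigma> (x + t)) (w (x + t)) * s = - Delta2 d l r (\<sigma> (x + t)) (w (x + t))"
    using assms x unfolding trajectory_def by blast
  then show "\<exists>\<sigma>' w'. ((\<lambda>x. \<sigma> (x + t)) has_real_derivative \<sigma>') (at x) \<and>
      ((\<lambda>x. w (x + t)) has_real_derivative w') (at x) \<and>
      Delta (\<sigma> (x + t)) (w (x + t)) * w' = - Delta1 d l r (\<sigma> (x + t)) (w (x + t)) \<and>
      Delta (\<sigma> (x + t)) (w (x + t)) * \<sigma>' = - Delta2 d l r (\<sigma> (x + t)) (w (x + t))"
    using DERIV_shift by blast
qed simp

text \<open>
  The Emden transform determines a flow off the origin, where a translation of \<open>x\<close> acts as a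
  scaling; the value at the origin follows by continuity.
\<close>

lemma emden_scaling:
  fixes \<rho> \<rho>' :: "real^'n \<Rightarrow> real"
  assumes lam: "lam > 0" and M: "M > 0" "M \<le> R" "lam * M \<le> Z2"
    and s1: "smooth_radial_euler_on l r (ball 0 Z2) \<rho> u" and e1: "emden_on l (ball 0 Z2 - {0}) \<rho> u \<sigma> w"
    and s2: "smooth_radial_euler_on l r (ball 0 R) \<rho>' u'" and e2: "emden_on l (ball 0 R - {0}) \<rho>' u' \<sigma>' w'"
    and shift: "\<And>x. x < ln M \<Longrightarrow> \<sigma>' x = \<sigma> (x + ln lam) \<and> w' x = w (x + ln lam)"
    and Z: "Z \<in> ball 0 M"
  shows "\<rho>' Z = scale_density l lam \<rho> Z \<and> u' Z = scale_velocity lam u Z"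
proof -
  have inb: "lam *\<^sub>R Z \<in> ball 0 Z2" "Z \<in> ball 0 R" if "Z \<in> ball 0 M" for Z :: "real^'n"
  proof -
    have "lam * norm Z < lam * M" using that lam by simp
    then have "lam * norm Z < Z2" using M(3) by linarith
    then show "lam *\<^sub>R Z \<in> ball 0 Z2" using lam by simp
    show "Z \<in> ball 0 R" using that M by simp
  qed
  have pos: "\<rho> Z > 0" if "Z \<in> ball 0 Z2" for Z
    using s1 that unfolding smooth_radial_euler_on_def euler_solution_on_def by blast
  have pos': "\<rho>' Z > 0" if "Z \<in> ball 0 R" for Z
    using s2 that unfolding smooth_radial_euler_on_def euler_solution_on_def by blast
  have off0: "\<rho>' Z = scale_density l lam \<rho> Z \<and> u' Z = scale_velocity lam u Z" if Z: "Z \<in> ball 0 M" "Z \<noteq> 0" for Z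
  proof -
    have g: "(gam l - 1) / 2 = 1 / l" using l0 by (simp add: gam_def)
    have ln': "ln (norm (lam *\<^sub>R Z)) = ln (norm Z) + ln lam" using lam Z by (simp add: ln_mult)
    have x: "ln (norm Z) < ln M" using Z M by (subst ln_less_cancel_iff) auto
    have a: "\<rho>' Z powr (1 / l) = sqrt (l / 2) * norm Z * \<sigma>' (ln (norm Z))" "u' Z = - (w' (ln (norm Z)) *\<^sub>R Z)"
      using e2 inb(2)[OF Z(1)] Z(2) unfolding emden_on_def g by auto
    have b: "\<rho> (lam *\<^sub>R Z) powr (1 / l) = sqrt (l / 2) * (lam * norm Z) * \<sigma> (ln (norm Z) + ln lam)"
      "u (lam *\<^sub>R Z) = - (w (ln (norm Z) + ln lam) *\<^sub>R (lam *\<^sub>R Z))"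
      using e1 inb(1)[OF Z(1)] Z(2) lam unfolding emden_on_def g ln'[symmetric] by auto
    have "\<rho>' Z powr (1 / l) = \<rho> (lam *\<^sub>R Z) powr (1 / l) / lam"
      unfolding a(1) b(1) using shift[OF x] lam by simp
    then have "(\<rho>' Z powr (1 / l)) powr l = (\<rho> (lam *\<^sub>R Z) powr (1 / l) / lam) powr l" by simp
    then have "\<rho>' Z = \<rho> (lam *\<^sub>R Z) / lam powr l"
      using l0 lam pos[OF inb(1)[OF Z(1)]] pos'[OF inb(2)[OF Z(1)]] by (simp add: powr_powr powr_divide)
    then have "\<rho>' Z = scale_density l lam \<rho> Z" by (simp add: scale_density_def powr_minus_divide)
    moreover have "u' Z = scale_velocity lam u Z"
      unfolding scale_velocity_def a(2) b(2) using shift[OF x] lam by simp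
    ultimately show ?thesis ..
  qed
  show ?thesis
  proof (cases "Z = 0")
    case True
    have zero: "v 0 = 0" if "smooth_radial_euler_on l r (ball 0 K) q v" "K > 0" for K and q :: "real^'n \<Rightarrow> real" and v :: "real^'n \<Rightarrow> real^'n"
      using that unfolding smooth_radial_euler_on_def spherically_symmetric_on_def by force
    have cont: "isCont q 0" if "smooth_radial_euler_on l r (ball 0 K) q v" "K > 0" for K and q :: "real^'n \<Rightarrow> real" and v :: "real^'n \<Rightarrow> real^'n"
    proof -
      have "Ck_on 0 q (ball 0 K)" using that(1) unfolding smooth_radial_euler_on_def Cinf_on_def by blast
      then show ?thesis using that(2) by (simp add: continuous_on_eq_continuous_at)
    qed
    have R0: "R > 0" and Z20: "Z2 > 0" using M lam by (auto intro: less_le_trans mult_pos_pos)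
    have "((\<lambda>Y :: real^'n. lam *\<^sub>R Y) \<longlongrightarrow> lam *\<^sub>R 0) (at 0)" by (intro tendsto_intros)
    then have l0': "((\<lambda>Y :: real^'n. lam *\<^sub>R Y) \<longlongrightarrow> 0) (at 0)" by simp
    have "((\<lambda>Y. lam powr (- l) * \<rho> (lam *\<^sub>R Y)) \<longlongrightarrow> lam powr (- l) * \<rho> 0) (at 0)"
      by (intro tendsto_intros isCont_tendsto_compose[OF cont[OF s1 Z20] l0'])
    moreover have "eventually (\<lambda>Y. lam powr (- l) * \<rho> (lam *\<^sub>R Y) = \<rho>' Y) (at 0)"
    proof -
      have "eventually (\<lambda>Y. Y \<in> ball 0 M) (at (0 :: real^'n))"
        using M by (intro eventually_at_in_open') auto
      moreover have "eventually (\<lambda>Y :: real^'n. Y \<noteq> 0) (at 0)" by (simp add: eventually_at_filter)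
      ultimately show ?thesis by eventually_elim (use off0 in \<open>simp add: scale_density_def\<close>)
    qed
    ultimately have "(\<rho>' \<longlongrightarrow> lam powr (- l) * \<rho> 0) (at 0)" by (rule Lim_transform_eventually)
    moreover have "(\<rho>' \<longlongrightarrow> \<rho>' 0) (at 0)" using cont[OF s2 R0] by (simp add: isCont_def)
    ultimately have "\<rho>' 0 = lam powr (- l) * \<rho> 0" by (meson at_neq_bot tendsto_unique)
    then show ?thesis
      using True zero[OF s1 Z20] zero[OF s2 R0] by (simp add: scale_density_def scale_velocity_def)
  qed (use off0 Z in blast)
qed

lemma isCont_glue:
  fixes f g :: "real \<Rightarrow> real"
  assumes f: "\<And>s. 0 \<le> s \<Longrightarrow> s < z \<Longrightarrow> isCont f s" and g: "\<And>s. z < s \<Longrightarrow> isCont g s"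
    and fl: "(f \<longlongrightarrow> L) (at_left z)" and gr: "(g \<longlongrightarrow> L) (at_right z)" and s: "0 \<le> s"
  shows "isCont (\<lambda>s. if s < z then f s else if s = z then L else g s) s"
proof -
  let ?h = "\<lambda>s. if s < z then f s else if s = z then L else g s"
  consider "s < z" | "s > z" | "s = z" by linarith
  then show ?thesis
  proof cases
    case 1
    have "eventually (\<lambda>v. v \<in> {..<z}) (nhds s)" using 1 by (intro eventually_nhds_in_open) auto
    then have "eventually (\<lambda>v. f v = ?h v) (nhds s)" by eventually_elim auto
    then show ?thesis using isCont_cong f[OF s 1] by fastforce
  next
    case 2
    have "eventually (\<lambda>v. v \<in> {z<..}) (nhds s)" using 2 by (intro eventually_nhds_in_open) auto
    then have "eventually (\<lambda>v. g v = ?h v) (nhds s)" by eventually_elim auto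
    then show ?thesis using isCont_cong g[OF 2] by fastforce
  next
    case 3
    have "(?h \<longlongrightarrow> L) (at_left z)"
      by (rule Lim_transform_eventually[OF fl]) (simp add: eventually_at_filter)
    moreover have "(?h \<longlongrightarrow> L) (at_right z)"
      by (rule Lim_transform_eventually[OF gr]) (simp add: eventually_at_filter)
    ultimately show ?thesis unfolding 3 by (simp add: isCont_def filterlim_at_split)
  qed
qed

lemma ln_at_left: "filterlim ln (at_left (\<beta>::real)) (at_left (exp \<beta>))"
  unfolding filterlim_at
proof (intro conjI)
  have "isCont ln (exp \<beta>)" by (rule DERIV_isCont[OF DERIV_ln]) simp
  then show "(ln \<longlongrightarrow> \<beta>) (at_left (exp \<beta>))" by (simp add: isCont_def filterlim_at_split)
  have "eventually (\<lambda>s. s \<in> {0<..<exp \<beta>}) (at_left (exp \<beta>))" by (rule eventually_at_left_real) simp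
  then show "eventually (\<lambda>s. ln s \<in> {..<\<beta>} \<and> ln s \<noteq> \<beta>) (at_left (exp \<beta>))"
  proof eventually_elim
    case (elim s)
    then have "ln s < ln (exp \<beta>)" by (subst ln_less_cancel_iff) auto
    then show ?case by simp
  qed
qed

lemma ln_at_right: "filterlim ln (at_right (\<beta>::real)) (at_right (exp \<beta>))"
  unfolding filterlim_at
proof (intro conjI)
  have "isCont ln (exp \<beta>)" by (rule DERIV_isCont[OF DERIV_ln]) simp
  then show "(ln \<longlongrightarrow> \<beta>) (at_right (exp \<beta>))" by (simp add: isCont_def filterlim_at_split)
  have "eventually (\<lambda>s. exp \<beta> < s) (at_right (exp \<beta>))" by (simp add: eventually_at_filter)
  then show "eventually (\<lambda>s. ln s \<in> {\<beta><..} \<and> ln s \<noteq> \<beta>) (at_right (exp \<beta>))"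
  proof eventually_elim
    case (elim s)
    then have "ln (exp \<beta>) < ln s" using less_trans[OF exp_gt_zero elim] by (subst ln_less_cancel_iff) auto
    then show ?case by simp
  qed
qed

end

section \<open>The inner and outer solutions and their connection\<close>

theorem lemma1p1:
  fixes d :: nat and l r :: real
  assumes dim: "CARD('n::finite) = d" and d2: "d \<ge> 2" and l0: "l > 0"
    and range: "(l < real d \<and> 1 < r \<and> r < r_star d l) \<or>
                (l > real d \<and> r_star d l < r \<and> r < r_plus d l)"
  shows
    \<comment> \<open>(1) solutions near the origin\<close>
    "(\<exists>b \<sigma> w. connects_P6_P2 d l r b \<sigma> w) \<and>
     (\<forall>b \<sigma> w b' \<sigma>' w'. connects_P6_P2 d l r b \<sigma> w \<and> connects_P6_P2 d l r b' \<sigma>' w' \<longrightarrow>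
        (\<exists>x0. b' = b + ereal x0 \<and>
           (\<forall>x\<in>einterval (-\<infinity>) b. \<sigma>' (x + x0) = \<sigma> x \<and> w' (x + x0) = w x))) \<and>
     (\<forall>b \<sigma> w. connects_P6_P2 d l r b \<sigma> w \<longrightarrow>
        (\<exists>Z2 (\<rho> :: real^'n \<Rightarrow> real) u. Z2 > 0 \<and> b = ereal (ln Z2) \<and>
           smooth_radial_euler_on l r (ball 0 Z2) \<rho> u \<and>
           emden_on l (ball 0 Z2 - {0}) \<rho> u \<sigma> w \<and>
           (\<forall>R \<rho>' u'. R > 0 \<and> smooth_radial_euler_on l r (ball 0 R) \<rho>' u' \<longrightarrow>
              (\<exists>lam>0. \<forall>Z\<in>ball 0 (min R (Z2 / lam)).
                 \<rho>' Z = scale_density l lam \<rho> Z \<and> u' Z = scale_velocity lam u Z)) \<and>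
           (\<forall>R \<rho>' u'. inner_solution l r R \<rho>' u' \<longrightarrow>
              (\<exists>lam>0. R = Z2 / lam \<and> (\<forall>Z\<in>ball 0 R.
                 \<rho>' Z = scale_density l lam \<rho> Z \<and> u' Z = scale_velocity lam u Z))))) \<and>
     \<comment> \<open>(2) solutions near infinity\<close>
     (\<exists>(a :: real \<Rightarrow> ereal) (S :: real \<Rightarrow> real \<Rightarrow> real) (W :: real \<Rightarrow> real \<Rightarrow> real).
        (\<forall>p. connects_P2_P4 d l r (a p) (S p) (W p)) \<and>
        (\<forall>p q. p \<noteq> q \<longrightarrow>
           (\<lambda>x. (S p x, W p x)) ` einterval (a p) \<infinity> \<inter>
           (\<lambda>x. (S q x, W q x)) ` einterval (a q) \<infinity> = {}) \<and>
        continuous_on {(p, x). a p < ereal x} (\<lambda>(p, x). (S p x, W p x))) \<and>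
     (\<forall>a \<sigma> w. connects_P2_P4 d l r a \<sigma> w \<longrightarrow>
        (\<exists>Z2 (\<rho> :: real^'n \<Rightarrow> real) u. Z2 > 0 \<and> a = ereal (ln Z2) \<and>
           smooth_radial_euler_on l r {Z. norm Z > Z2} \<rho> u \<and>
           emden_on l {Z. norm Z > Z2} \<rho> u \<sigma> w)) \<and>
     \<comment> \<open>(3) connection at P2, after a translation matching the two end points\<close>
     (\<forall>b \<sigma>1 w1 a \<sigma>2 w2. connects_P6_P2 d l r b \<sigma>1 w1 \<and> connects_P2_P4 d l r a \<sigma>2 w2 \<longrightarrow>
        (\<exists>Z2 Z2'. Z2 > 0 \<and> Z2' > 0 \<and> b = ereal (ln Z2) \<and> a = ereal (ln Z2') \<and>
           (\<exists>(\<rho> :: real^'n \<Rightarrow> real) u.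
              continuous_on UNIV \<rho> \<and> continuous_on UNIV u \<and>
              spherically_symmetric_on UNIV \<rho> u \<and>
              smooth_radial_euler_on l r (ball 0 Z2) \<rho> u \<and>
              emden_on l (ball 0 Z2 - {0}) \<rho> u \<sigma>1 w1 \<and>
              smooth_radial_euler_on l r {Z. norm Z > Z2} \<rho> u \<and>
              emden_on l {Z. norm Z > Z2} \<rho> u
                (\<lambda>x. \<sigma>2 (x + (ln Z2' - ln Z2))) (\<lambda>x. w2 (x + (ln Z2' - ln Z2))))))"
proof -
  interpret phase_plane "real d" l r
    by unfold_locales (use d2 l0 range in auto)
  have dn: "real d = real CARD('n)" using dim by simp
  have exists: "\<exists>b \<sigma> w. connects_P6_P2 d l r b \<sigma> w"
  proof -
    obtain b \<sigma> w where "connects_P6_P2 d l r b \<sigma> w"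
      by (rule inner_trajectory[OF refl]) blast
    then show ?thesis by blast
  qed
  have unique: "\<exists>x0. b' = b + ereal x0 \<and> (\<forall>x\<in>einterval (-\<infinity>) b. \<sigma>' (x + x0) = \<sigma> x \<and> w' (x + x0) = w x)"
    if c: "connects_P6_P2 d l r b \<sigma> w" "connects_P6_P2 d l r b' \<sigma>' w'" for b \<sigma> w b' \<sigma>' w'
  proof -
    obtain t where "b' = b + ereal t" "\<And>x. ereal x < b \<Longrightarrow> \<sigma>' (x + t) = \<sigma> x \<and> w' (x + t) = w x"
      by (rule inner_unique[OF c], rule that)
    then show ?thesis by (intro exI[of _ t]) (auto simp: einterval_iff)
  qed
  have inner: "\<exists>Z2 (\<rho> :: real^'n \<Rightarrow> real) u. Z2 > 0 \<and> b = ereal (ln Z2) \<and>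
           smooth_radial_euler_on l r (ball 0 Z2) \<rho> u \<and>
           emden_on l (ball 0 Z2 - {0}) \<rho> u \<sigma> w \<and>
           (\<forall>R \<rho>' u'. R > 0 \<and> smooth_radial_euler_on l r (ball 0 R) \<rho>' u' \<longrightarrow>
              (\<exists>lam>0. \<forall>Z\<in>ball 0 (min R (Z2 / lam)).
                 \<rho>' Z = scale_density l lam \<rho> Z \<and> u' Z = scale_velocity lam u Z)) \<and>
           (\<forall>R \<rho>' u'. inner_solution l r R \<rho>' u' \<longrightarrow>
              (\<exists>lam>0. R = Z2 / lam \<and> (\<forall>Z\<in>ball 0 R.
                 \<rho>' Z = scale_density l lam \<rho> Z \<and> u' Z = scale_velocity lam u Z)))"
    if c: "connects_P6_P2 d l r b \<sigma> w" for b \<sigma> w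
  proof -
    obtain \<beta> where be: "b = ereal \<beta>" by (rule inner_end_finite[OF c])
    note c' = c[unfolded be]
    obtain T om :: "real \<Rightarrow> real" and J :: "real set" where
      flow: "\<And>(\<rho> :: real^'n \<Rightarrow> real) u. (\<And>Z. Z \<in> ball 0 (exp \<beta>) \<Longrightarrow> \<rho> Z = (l / 2 * T (Z \<bullet> Z)) powr (l / 2)) \<Longrightarrow>
       (\<And>Z. Z \<in> ball 0 (exp \<beta>) \<Longrightarrow> u Z = - (om (Z \<bullet> Z) *\<^sub>R Z)) \<Longrightarrow>
       smooth_radial_euler_on l r (ball 0 (exp \<beta>)) \<rho> u \<and> emden_on l (ball 0 (exp \<beta>) - {0}) \<rho> u \<sigma> w"
      by (rule inner_flow[OF dn c']) blast
    define \<rho> where "\<rho> Z = (l / 2 * T (Z \<bullet> Z)) powr (l / 2)" for Z :: "real^'n"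
    define u where "u Z = - (om (Z \<bullet> Z) *\<^sub>R Z)" for Z :: "real^'n"
    have sm: "smooth_radial_euler_on l r (ball 0 (exp \<beta>)) \<rho> u"
      and em: "emden_on l (ball 0 (exp \<beta>) - {0}) \<rho> u \<sigma> w"
      using flow[of \<rho> u] by (auto simp: \<rho>_def u_def)
    \<comment> \<open>the Emden transform of a smooth flow near the origin solves the system, whence local uniqueness\<close>
    have loc: "\<exists>lam>0. \<forall>Z\<in>ball 0 (min R (exp \<beta> / lam)).
                 \<rho>' Z = scale_density l lam \<rho> Z \<and> u' Z = scale_velocity lam u Z"
      if R: "R > 0" and sm': "smooth_radial_euler_on l r (ball 0 R) \<rho>' u'" for R and \<rho>' :: "real^'n \<Rightarrow> real" and u'
    proof -
      obtain \<sigma>' w' c2 where ws: "weak_solution (ereal (ln R)) \<sigma>' w'" and c2: "c2 > 0"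
        and l2: "((\<lambda>x. exp x * \<sigma>' x) \<longlongrightarrow> c2) at_bot" and w2: "(w' \<longlongrightarrow> we) at_bot"
        and em': "emden_on l (ball 0 R - {0}) \<rho>' u' \<sigma>' w'"
        by (rule euler_to_weak[OF dn R sm'], rule that)
      obtain c1 where c1: "c1 > 0" "((\<lambda>x. exp x * \<sigma> x) \<longlongrightarrow> c1) at_bot" by (rule mass_limit[OF c])
      \<comment> \<open>the scaling that matches the central densities\<close>
      define lam where "lam = c1 / c2"
      have lam: "lam > 0" "exp (- (- ln lam)) * c2 = c1" using c1 c2 by (auto simp: lam_def)
      have agree: "\<sigma> x = \<sigma>' (x + - ln lam) \<and> w x = w' (x + - ln lam)" if "x < \<beta>" "x < ln R + ln lam" for x
        by (rule inner_agree[OF c weak_solution_shift[OF ws, of "- ln lam"] _ c1(2)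
              exp_shift_limit[OF l2, of "- ln lam", unfolded lam(2)] c1(1) filterlim_compose[OF w2 filterlim_shift_at_bot]])
           (use that be in auto)
      define M where "M = min R (exp \<beta> / lam)"
      have M: "M > 0" "M \<le> R" "lam * M \<le> exp \<beta>" using R lam by (auto simp: M_def field_simps min_def)
      have lnM: "ln M \<le> ln R" "ln M + ln lam \<le> \<beta>"
      proof -
        show "ln M \<le> ln R" using M R by simp
        have "ln (lam * M) \<le> ln (exp \<beta>)" using M lam by (subst ln_le_cancel_iff) auto
        then show "ln M + ln lam \<le> \<beta>" using M lam by (simp add: ln_mult)
      qed
      have "\<sigma>' x = \<sigma> (x + ln lam) \<and> w' x = w (x + ln lam)" if "x < ln M" for x
        using agree[of "x + ln lam"] that lnM by simp
      then show ?thesis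
        using emden_scaling[OF lam(1) M sm em sm' em'] lam(1) unfolding M_def by blast
    qed
    \<comment> \<open>for a flow that reaches \<open>P\<^sub>2\<close> uniqueness of the trajectory also matches the end points\<close>
    have glob: "\<exists>lam>0. R = exp \<beta> / lam \<and> (\<forall>Z\<in>ball 0 R.
                 \<rho>' Z = scale_density l lam \<rho> Z \<and> u' Z = scale_velocity lam u Z)"
      if sol: "inner_solution l r R \<rho>' u'" for R and \<rho>' :: "real^'n \<Rightarrow> real" and u'
    proof -
      obtain \<sigma>' w' where R: "R > 0" and sm': "smooth_radial_euler_on l r (ball 0 R) \<rho>' u'"
        and cc: "connects_P6_P2 d l r (ereal (ln R)) \<sigma>' w'" and em': "emden_on l (ball 0 R - {0}) \<rho>' u' \<sigma>' w'"
        using sol unfolding inner_solution_def dn by blast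
      obtain t where t: "b = ereal (ln R) + ereal t" "\<And>x. ereal x < ereal (ln R) \<Longrightarrow> \<sigma> (x + t) = \<sigma>' x \<and> w (x + t) = w' x"
        by (rule inner_unique[OF cc c], rule that)
      have bt: "exp \<beta> = R * exp t" using t(1) R be by (simp add: exp_add)
      have "\<rho>' Z = scale_density l (exp t) \<rho> Z \<and> u' Z = scale_velocity (exp t) u Z" if Z: "Z \<in> ball 0 R" for Z
        by (rule emden_scaling[OF exp_gt_zero R order_refl _ sm em sm' em' _ Z]) (use bt t(2) in auto)
      then show ?thesis using bt by (intro exI[of _ "exp t"]) auto
    qed
    show ?thesis
      using sm em loc glob be by (intro exI[of _ "exp \<beta>"] exI[of _ \<rho>] exI[of _ u]) auto
  qed
  have family: "\<exists>(a :: real \<Rightarrow> ereal) (S :: real \<Rightarrow> real \<Rightarrow> real) (W :: real \<Rightarrow> real \<Rightarrow> real).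
        (\<forall>p. connects_P2_P4 d l r (a p) (S p) (W p)) \<and>
        (\<forall>p q. p \<noteq> q \<longrightarrow>
           (\<lambda>x. (S p x, W p x)) ` einterval (a p) \<infinity> \<inter>
           (\<lambda>x. (S q x, W q x)) ` einterval (a q) \<infinity> = {}) \<and>
        continuous_on {(p, x). a p < ereal x} (\<lambda>(p, x). (S p x, W p x))"
    by (rule outer_family) blast
  have outer: "\<exists>Z2 (\<rho> :: real^'n \<Rightarrow> real) u. Z2 > 0 \<and> a = ereal (ln Z2) \<and>
           smooth_radial_euler_on l r {Z. norm Z > Z2} \<rho> u \<and> emden_on l {Z. norm Z > Z2} \<rho> u \<sigma> w"
    if c: "connects_P2_P4 d l r a \<sigma> w" for a \<sigma> w
  proof -
    obtain \<alpha> where al: "a = ereal \<alpha>" by (rule outer_end_finite[OF c])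
    have tr: "trajectory d l r (ereal \<alpha>) \<infinity> \<sigma> w" using c al by (simp add: connects_P2_P4_def)
    define \<rho> where "\<rho> Z = (l / 2 * (norm Z * \<sigma> (ln (norm Z)))\<^sup>2) powr (l / 2)" for Z :: "real^'n"
    define u where "u Z = - (w (ln (norm Z)) *\<^sub>R Z)" for Z :: "real^'n"
    show ?thesis
      using outer_flow_euler[OF dn tr, of \<rho> u] al
      by (intro exI[of _ "exp \<alpha>"] exI[of _ \<rho>] exI[of _ u]) (auto simp: \<rho>_def u_def)
  qed
  have glue: "\<exists>Z2 Z2'. Z2 > 0 \<and> Z2' > 0 \<and> b = ereal (ln Z2) \<and> a = ereal (ln Z2') \<and>
           (\<exists>(\<rho> :: real^'n \<Rightarrow> real) u.
              continuous_on UNIV \<rho> \<and> continuous_on UNIV u \<and>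
              spherically_symmetric_on UNIV \<rho> u \<and>
              smooth_radial_euler_on l r (ball 0 Z2) \<rho> u \<and>
              emden_on l (ball 0 Z2 - {0}) \<rho> u \<sigma>1 w1 \<and>
              smooth_radial_euler_on l r {Z. norm Z > Z2} \<rho> u \<and>
              emden_on l {Z. norm Z > Z2} \<rho> u
                (\<lambda>x. \<sigma>2 (x + (ln Z2' - ln Z2))) (\<lambda>x. w2 (x + (ln Z2' - ln Z2))))"
    if c1: "connects_P6_P2 d l r b \<sigma>1 w1" and c2: "connects_P2_P4 d l r a \<sigma>2 w2" for b \<sigma>1 w1 a \<sigma>2 w2
  proof -
    obtain \<beta> where be: "b = ereal \<beta>" by (rule inner_end_finite[OF c1])
    obtain \<alpha> where al: "a = ereal \<alpha>" by (rule outer_end_finite[OF c2])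
    obtain T om :: "real \<Rightarrow> real" and J :: "real set" where
      J: "open J" "\<And>y. 0 \<le> y \<Longrightarrow> y < exp (2 * \<beta>) \<Longrightarrow> y \<in> J" and CT: "\<And>k. Ck_on k T J" and Co: "\<And>k. Ck_on k om J"
      and Tp: "\<And>y. y \<in> J \<Longrightarrow> T y > 0"
      and ph: "\<And>x. x < \<beta> \<Longrightarrow> T (exp (2 * x)) = exp (2 * x) * (\<sigma>1 x)\<^sup>2 \<and> om (exp (2 * x)) = w1 x"
      and flow: "\<And>(\<rho> :: real^'n \<Rightarrow> real) u. (\<And>Z. Z \<in> ball 0 (exp \<beta>) \<Longrightarrow> \<rho> Z = (l / 2 * T (Z \<bullet> Z)) powr (l / 2)) \<Longrightarrow>
       (\<And>Z. Z \<in> ball 0 (exp \<beta>) \<Longrightarrow> u Z = - (om (Z \<bullet> Z) *\<^sub>R Z)) \<Longrightarrow>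
       smooth_radial_euler_on l r (ball 0 (exp \<beta>)) \<rho> u \<and> emden_on l (ball 0 (exp \<beta>) - {0}) \<rho> u \<sigma>1 w1"
    proof (rule inner_flow[OF dn c1[unfolded be]], goal_cases)
      case (1 T om J)
      from 1(2-) show thesis by (rule that[of J T om])
    qed
    \<comment> \<open>the translation that moves the start of the outer trajectory to the end of the inner one\<close>
    define t where "t = \<alpha> - \<beta>"
    define \<sigma>o wo where "\<sigma>o x = \<sigma>2 (x + t)" and "wo x = w2 (x + t)" for x
    have tr2: "trajectory d l r (ereal \<alpha>) \<infinity> \<sigma>2 w2" using c2 al by (simp add: connects_P2_P4_def)
    have tro: "trajectory d l r (ereal \<beta>) \<infinity> \<sigma>o wo"
      using trajectory_shift[OF tr2, of t] by (simp add: t_def \<sigma>o_def[abs_def] wo_def[abs_def])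
    have lim1: "(\<sigma>1 \<longlongrightarrow> 1 - wm) (at_left \<beta>)" "(w1 \<longlongrightarrow> wm) (at_left \<beta>)"
    proof -
      have "((\<lambda>x. (\<sigma>1 x, w1 x)) \<longlongrightarrow> P2 d l r) (at_left \<beta>)"
        using c1 unfolding connects_P6_P2_def be ereal_tendsto_simps1 by blast
      from tendsto_fst[OF this] tendsto_snd[OF this]
      show "(\<sigma>1 \<longlongrightarrow> 1 - wm) (at_left \<beta>)" "(w1 \<longlongrightarrow> wm) (at_left \<beta>)" by (auto simp: P2_def)
    qed
    have lim2: "(\<sigma>o \<longlongrightarrow> 1 - wm) (at_right \<beta>)" "(wo \<longlongrightarrow> wm) (at_right \<beta>)"
    proof -
      have "((\<lambda>x. (\<sigma>2 x, w2 x)) \<longlongrightarrow> P2 d l r) (at_right \<alpha>)"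
        using c2 unfolding connects_P2_P4_def al ereal_tendsto_simps1 by blast
      moreover have "filterlim (\<lambda>x. x + t) (at_right \<alpha>) (at_right \<beta>)"
        unfolding filterlim_at
      proof
        have "((\<lambda>x. x + t) \<longlongrightarrow> \<beta> + t) (at_right \<beta>)" by (intro tendsto_intros)
        then show "((\<lambda>x. x + t) \<longlongrightarrow> \<alpha>) (at_right \<beta>)" by (simp add: t_def)
        show "eventually (\<lambda>x. x + t \<in> {\<alpha><..} \<and> x + t \<noteq> \<alpha>) (at_right \<beta>)"
          by (auto simp: eventually_at_filter t_def)
      qed
      ultimately have "((\<lambda>x. (\<sigma>2 (x + t), w2 (x + t))) \<longlongrightarrow> P2 d l r) (at_right \<beta>)" by (rule filterlim_compose)
      from tendsto_fst[OF this] tendsto_snd[OF this]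
      show "(\<sigma>o \<longlongrightarrow> 1 - wm) (at_right \<beta>)" "(wo \<longlongrightarrow> wm) (at_right \<beta>)"
        by (auto simp: P2_def \<sigma>o_def[abs_def] wo_def[abs_def])
    qed
    define z where "z = exp \<beta>"
    have z: "z > 0" by (simp add: z_def)
    have sqJ: "s\<^sup>2 \<in> J" if "0 \<le> s" "s < z" for s
    proof (rule J(2))
      have "s\<^sup>2 < z\<^sup>2" using that by (intro power_strict_mono) auto
      then show "s\<^sup>2 < exp (2 * \<beta>)" by (simp add: z_def exp_double)
    qed simp
    have lns: "ln s < \<beta>" "exp (2 * ln s) = s\<^sup>2" if "0 < s" "s < z" for s
    proof -
      have "ln s < ln z" using that by (subst ln_less_cancel_iff) auto
      then show "ln s < \<beta>" by (simp add: z_def)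
      show "exp (2 * ln s) = s\<^sup>2" using that by (simp add: exp_double)
    qed
    have lns2: "ln s \<in> einterval (ereal \<beta>) \<infinity>" if "z < s" for s
    proof -
      have "ln z < ln s" using that z by (subst ln_less_cancel_iff) auto
      then show ?thesis by (simp add: z_def einterval_iff)
    qed
    \<comment> \<open>\<open>\<bar>Z\<bar>\<^sup>2 \<sigma>\<^sup>2\<close> and \<open>w\<close> as functions of \<open>\<bar>Z\<bar>\<close>, with their common limits at \<open>Z\<^sub>2\<close>\<close>
    define Tg where "Tg s = (if s < z then T (s\<^sup>2) else if s = z then (z * (1 - wm))\<^sup>2 else (s * \<sigma>o (ln s))\<^sup>2)" for s
    define og where "og s = (if s < z then om (s\<^sup>2) else if s = z then wm else wo (ln s))" for s
    have ev: "eventually (\<lambda>s. s \<in> {0<..<z}) (at_left z)" using z by (rule eventually_at_left_real)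
    have idl: "((\<lambda>s. s) \<longlongrightarrow> z) (at_left z)" "((\<lambda>s. s) \<longlongrightarrow> z) (at_right z)" by (intro tendsto_ident_at)+
    have contT: "isCont Tg s" if "0 \<le> s" for s
      unfolding Tg_def
    proof (rule isCont_glue[OF _ _ _ _ that])
      show "isCont (\<lambda>s. T (s\<^sup>2)) s" if "0 \<le> s" "s < z" for s
      proof -
        have "isCont T (s\<^sup>2)"
          using Ck_on_imp_continuous[OF CT[of 0]] J(1) sqJ[OF that] by (simp add: continuous_on_eq_continuous_at)
        moreover have "isCont (\<lambda>s. s\<^sup>2) s" by (intro continuous_intros)
        ultimately show ?thesis by (rule isCont_o2[where f = "\<lambda>s. s\<^sup>2" and g = T, rotated])
      qed
      show "isCont (\<lambda>s. (s * \<sigma>o (ln s))\<^sup>2) s" if "z < s" for s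
      proof -
        have "isCont \<sigma>o (ln s)" by (rule trajectory_cont(1)[OF tro lns2[OF that]])
        moreover have "isCont ln s" using that z by (intro DERIV_isCont[OF DERIV_ln]) auto
        ultimately have "isCont (\<lambda>s. \<sigma>o (ln s)) s" by (rule isCont_o2[rotated])
        then show ?thesis by (intro continuous_intros)
      qed
      have "((\<lambda>s. (s * \<sigma>1 (ln s))\<^sup>2) \<longlongrightarrow> (z * (1 - wm))\<^sup>2) (at_left z)"
        by (intro tendsto_intros idl filterlim_compose[OF lim1(1) ln_at_left, folded z_def])
      moreover have "eventually (\<lambda>s. (s * \<sigma>1 (ln s))\<^sup>2 = T (s\<^sup>2)) (at_left z)"
        using ev by eventually_elim (use ph lns in \<open>force simp: power_mult_distrib\<close>)
      ultimately show "((\<lambda>s. T (s\<^sup>2)) \<longlongrightarrow> (z * (1 - wm))\<^sup>2) (at_left z)" by (rule Lim_transform_eventually)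
      show "((\<lambda>s. (s * \<sigma>o (ln s))\<^sup>2) \<longlongrightarrow> (z * (1 - wm))\<^sup>2) (at_right z)"
        by (intro tendsto_intros idl filterlim_compose[OF lim2(1) ln_at_right, folded z_def])
    qed
    have conto: "isCont og s" if "0 \<le> s" for s
      unfolding og_def
    proof (rule isCont_glue[OF _ _ _ _ that])
      show "isCont (\<lambda>s. om (s\<^sup>2)) s" if "0 \<le> s" "s < z" for s
      proof -
        have "isCont om (s\<^sup>2)"
          using Ck_on_imp_continuous[OF Co[of 0]] J(1) sqJ[OF that] by (simp add: continuous_on_eq_continuous_at)
        moreover have "isCont (\<lambda>s. s\<^sup>2) s" by (intro continuous_intros)
        ultimately show ?thesis by (rule isCont_o2[where f = "\<lambda>s. s\<^sup>2" and g = om, rotated])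
      qed
      show "isCont (\<lambda>s. wo (ln s)) s" if "z < s" for s
      proof -
        have "isCont wo (ln s)" by (rule trajectory_cont(2)[OF tro lns2[OF that]])
        moreover have "isCont ln s" using that z by (intro DERIV_isCont[OF DERIV_ln]) auto
        ultimately show ?thesis by (rule isCont_o2[rotated])
      qed
      have "((\<lambda>s. w1 (ln s)) \<longlongrightarrow> wm) (at_left z)"
        by (rule filterlim_compose[OF lim1(2) ln_at_left, folded z_def])
      moreover have "eventually (\<lambda>s. w1 (ln s) = om (s\<^sup>2)) (at_left z)"
        using ev by eventually_elim (use ph lns in force)
      ultimately show "((\<lambda>s. om (s\<^sup>2)) \<longlongrightarrow> wm) (at_left z)" by (rule Lim_transform_eventually)
      show "((\<lambda>s. wo (ln s)) \<longlongrightarrow> wm) (at_right z)"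
        by (rule filterlim_compose[OF lim2(2) ln_at_right, folded z_def])
    qed
    have Tgp: "Tg s > 0" if "0 \<le> s" for s
    proof -
      consider "s < z" | "s = z" | "z < s" by linarith
      then show ?thesis
      proof cases
        case 1
        then show ?thesis using Tp[OF sqJ[OF that 1]] by (simp add: Tg_def)
      next
        case 2
        then show ?thesis using z wm_lt_1 by (simp add: Tg_def)
      next
        case 3
        then have "\<sigma>o (ln s) > 0" "s > 0" using trajectory_cont(3)[OF tro lns2[OF 3]] z by auto
        then show ?thesis using 3 by (simp add: Tg_def)
      qed
    qed
    define \<rho> where "\<rho> Z = (l / 2 * Tg (norm Z)) powr (l / 2)" for Z :: "real^'n"
    define u where "u Z = - (og (norm Z) *\<^sub>R Z)" for Z :: "real^'n"
    have cn: "isCont (\<lambda>Z :: real^'n. k (norm Z)) Z" if "\<And>s. 0 \<le> s \<Longrightarrow> isCont k s" for k :: "real \<Rightarrow> real" and Z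
      by (rule isCont_o2[OF _ that]) (auto intro!: continuous_intros)
    have "isCont \<rho> Z" for Z
      unfolding \<rho>_def using Tgp[of "norm Z"] l0 by (intro continuous_intros cn contT) auto
    then have c\<rho>: "continuous_on UNIV \<rho>" by (simp add: continuous_on_eq_continuous_at)
    have "isCont u Z" for Z unfolding u_def by (intro continuous_intros cn conto)
    then have cu: "continuous_on UNIV u" by (simp add: continuous_on_eq_continuous_at)
    have sym: "spherically_symmetric_on UNIV \<rho> u"
      unfolding spherically_symmetric_on_def \<rho>_def u_def
      by (rule exI[of _ "\<lambda>s. (l / 2 * Tg s) powr (l / 2)"], rule exI[of _ "\<lambda>s. - og s"]) simp
    have in1: "smooth_radial_euler_on l r (ball 0 (exp \<beta>)) \<rho> u \<and> emden_on l (ball 0 (exp \<beta>) - {0}) \<rho> u \<sigma>1 w1"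
      by (rule flow) (auto simp: \<rho>_def u_def Tg_def og_def z_def power2_norm_eq_inner)
    have out1: "smooth_radial_euler_on l r {Z. norm Z > exp \<beta>} \<rho> u" "emden_on l {Z. norm Z > exp \<beta>} \<rho> u \<sigma>o wo"
      by (rule outer_flow_euler[OF dn tro]; simp add: \<rho>_def u_def Tg_def og_def z_def)+
    show ?thesis
      using c\<rho> cu sym in1 out1 be al
      by (intro exI[of _ "exp \<beta>"] exI[of _ "exp \<alpha>"] conjI exI[of _ \<rho>] exI[of _ u])
         (auto simp: \<sigma>o_def[abs_def] wo_def[abs_def] t_def)
  qed
  show ?thesis
  proof (intro conjI allI impI, goal_cases)
    case 1
    show ?case by (rule exists)
  next
    case (2 b \<sigma> w b' \<sigma>' w')
    then show ?case by (elim conjE) (rule unique[of b \<sigma> w b' \<sigma>' w'])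
  next
    case (3 b \<sigma> w)
    then show ?case by (rule inner[of b \<sigma> w])
  next
    case 4
    show ?case by (rule family)
  next
    case (5 a \<sigma> w)
    then show ?case by (rule outer[of a \<sigma> w])
  next
    case (6 b \<sigma>1 w1 a \<sigma>2 w2)
    then show ?case by (elim conjE) (rule glue[of b \<sigma>1 w1 a \<sigma>2 w2])
  qed
qed

end
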